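(* (1) The space $\mathbf H^c_\Omega$ is a two-sided ideal of $\mathbf H^{\widehat I}_\Omega$. Moreover there is a split short exact sequence of algebras preserving the $\widehat I$-grading $$0\to\mathbf H^c_\Omega\to\mathbf H^{\widehat I}_\Omega\xrightarrow{\ j^*\ }\mathbf H^\heartsuit_\Omega\to0 .$$ (2) $\mathbf H_{\widehat\Omega}$ is a split subquotient of $\mathbf H_\Omega$, isomorphic to $\mathbf H^{\widehat I}_\Omega/\mathbf H^c_\Omega$.
   Context: GRAPHS. $(\mathbf I,\Omega)$ is a finite oriented graph without loops, each arrow $h\in\Omega$ going from $h'$ to $h''\ne h'$. An admissible automorphism $a$ consists of bijections of $\mathbf I$ and of $\Omega$ compatible with $h\mapsto h',h''$, such that no arrow joins two vertices of one $a$-orbit. $I=\mathbf I/a$ is the set of orbits. Fix orbits $i_+,i_-\in I$ such that $\#i_+=\#i_-=\#\{h\in\Omega:h',h''\in i_+\cup i_-\}$ and each of these arrows starts in $i_+$ (and ends in $i_-$). Put $i_0=i_++i_-$, $\widehat I=(I\setminus\{i_+,i_-\})\cup\{i_0\}$. For $\nu\in\mathbb N[I]$ write $\nu_{\mathbf i}=\nu_i$ for $\mathbf i\in i$; $\mathbb N[\widehat I]=\{\nu\in\mathbb N[I]:\nu_{i_+}=\nu_{i_-}\}$. The edge contraction $(\widehat{\mathbf I},\widehat\Omega,\widehat a)$ has vertex set $\widehat{\mathbf I}=\mathbf I\setminus i_-$ and arrow set $\widehat\Omega$ consisting of: the $h\in\Omega$ with $h',h''\notin i_-$; symbols $h_2h_1$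 (from $h_1'$ to $h_2''$) with $h_1$ going from $i_+$ to $i_-$ and $h_2'=h_1''$; symbols $\bar h_1h_2$ (from $h_2'$ to $h_1'$) with $h_1$ going from $i_+$ to $i_-$, $h_2''=h_1''$, $h_2'\notin i_+$; $\widehat a$ is induced by $a$. $\widehat{\mathbf I}/\widehat a$ is identified with $\widehat I$ by $i\mapsto i$ ($i\neq i_+$), $i_+\mapsto i_0$; so $\nu\in\mathbb N[\widehat I]$ is a dimension vector on $\widehat{\mathbf I}$ with value $\nu_{i_+}$ on $i_+$. HALL ALGEBRAS. Let $q$ be a power of a prime $p$, $\mathbf k=\overline{\mathbb F}_p$; fix $q^{1/2}\in\mathbb C$. For $\nu\in\mathbb N[I]$ let $V_{\mathbf i}=\mathbf k^{\nu_{\mathbf i}}$, $\mathbf E_{\nu,\Omega}=\bigoplus_{h\in\Omega}\mathrm{Hom}(V_{h'},V_{h''})$, $\mathbf G_\nu=\prod_{\mathbf i}\mathrm{GL}(V_{\mathbf i})$ acting by conjugation, and $\mathbf F$ the composition of the entrywise $q$-power map with the permutation induced by $a$ ($\mathbf F(x)_{a(h)}=x_h^{(q)}$, $\mathbf F(g)_{a(\mathbf i)}=g_{\mathbf i}^{(q)}$); superscript $\mathbf F$ means fixed points. $\mathbf H_{\nu,\Omega}$ is the space of $\mathbb Q(q^{1/2})$-valued $\mathbf G_\nu^{\mathbf F}$-invariant functions on $\mathbf E^{\mathbf F}_{\nu,\Omega}$; $\mathbf H_\Omega=\bigoplus_{\nu\in\mathbb N[I]}\mathbf H_{\nu,\Omega}$.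 For a map $\phi$ of finite sets, $\phi^*f=f\phi$, $\phi_!(f)(y)=\sum_{x\in\phi^{-1}(y)}f(x)$. For $\nu=\tau+\omega$ write $V=T\oplus W$ (coordinate decomposition with dimension vectors $\tau,\omega$), $S_W=\{x\in\mathbf E_{\nu,\Omega}:x\text{ leaves }W\text{ stable}\}$, $x^W,x^T$ the elements induced on $W$ and $V/W=T$, $Q\subset\mathbf G_\nu$ the stabilizer of $W$, $U$ its unipotent radical, $\mathbf E'=\mathbf G_\nu\times_US_W$, $\mathbf E''=\mathbf G_\nu\times_QS_W$; $p_1:\mathbf E'\to\mathbf E_{\tau,\Omega}\times\mathbf E_{\omega,\Omega}$, $[g,x]\mapsto(x^T,x^W)$, $p_2:\mathbf E'\to\mathbf E''$ the projection, $p_3:\mathbf E''\to\mathbf E_{\nu,\Omega}$, $[g,x]\mapsto g.x$. $\mathbf H_\Omega$ is an associative algebra with product given, on $\mathbf F$-fixed points, by $$\mathrm{Ind}^\nu_{\tau,\omega}=(q^{1/2})^{-m_\Omega(\tau,\omega)}\tfrac{1}{\#(\mathbf G_\tau^{\mathbf F}\times\mathbf G_\omega^{\mathbf F})}(p_3)_!(p_2)_!(p_1)^*,\quad m_\Omega(\tau,\omega)=\sum_{\mathbf i}\tau_{\mathbf i}\omega_{\mathbf i}+\sum_{h\in\Omega}\tau_{h'}\omega_{h''}.$$ $\mathbf H_{\widehat\Omega}$ is the same algebra for $(\widehat{\mathbf I},\widehat\Omega,\widehat a)$. For $\nu\in\mathbb N[\widehat I]$ let $\mathbf E^\heartsuit_{\nu,\Omega}\subset\mathbf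 E_{\nu,\Omega}$ be the set of $x$ with $x_h$ invertible for each arrow $h$ from $i_+$ to $i_-$, and $\mathbf E^{c,\mathbf F}_{\nu,\Omega}$ the complement of $\mathbf E^{\heartsuit,\mathbf F}_{\nu,\Omega}$ in $\mathbf E^{\mathbf F}_{\nu,\Omega}$. $\mathbf H^\heartsuit_{\nu,\Omega}$ and $\mathbf H^c_{\nu,\Omega}$ are the spaces of $\mathbb Q(q^{1/2})$-valued $\mathbf G_\nu^{\mathbf F}$-invariant functions on $\mathbf E^{\heartsuit,\mathbf F}_{\nu,\Omega}$ and $\mathbf E^{c,\mathbf F}_{\nu,\Omega}$; functions on the latter are viewed in $\mathbf H_{\nu,\Omega}$ via extension by zero. Put $\mathbf H^\heartsuit_\Omega=\bigoplus_{\nu\in\mathbb N[\widehat I]}\mathbf H^\heartsuit_{\nu,\Omega}$ (an algebra under the same formula for the product, with all spaces replaced by their open parts where the $x_h$, $h$ from $i_+$ to $i_-$, are invertible), $\mathbf H^c_\Omega=\bigoplus_{\nu\in\mathbb N[\widehat I]}\mathbf H^c_{\nu,\Omega}$, and $\mathbf H^{\widehat I}_\Omega=\bigoplus_{\nu\in\mathbb N[\widehat I]}\mathbf H_{\nu,\Omega}$, a subalgebra of $\mathbf H_\Omega$. $j^*$ is restriction of functions from $\mathbf E^{\mathbf F}_{\nu,\Omega}$ to $\mathbf E^{\heartsuit,\mathbf F}_{\nu,\Omega}$. "Split" means that the quotient homomorphism admits a section that is an algebra homomorphism (for $j^*$: extension by zero $j_!$). A subquotient of an algebra is a quotient, by a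 two-sided ideal, of a subalgebra. *)

theory Defs
  imports
    "HOL-Algebra.Algebraic_Closure_Type"
    "HOL-Algebra.Generated_Fields"
    "HOL-Algebra.QuotRing"
    "HOL-Algebra.Subrings"
    "HOL-Combinatorics.Orbits"
    "HOL-Library.Cardinality"
    "Graph_Theory.Digraph"
    "Jordan_Normal_Form.Matrix"
begin

section \<open>Associative algebras\<close>

text \<open>The library locale \<open>algebra\<close> is restricted to commutative algebras.\<close>

locale assoc_algebra = module R M + ring M for R and M (structure) +
  assumes smult_mult_left:
      "\<lbrakk> a \<in> carrier R; x \<in> carrier M; y \<in> carrier M \<rbrakk> \<Longrightarrow>
        (a \<odot>\<^bsub>M\<^esub> x) \<otimes>\<^bsub>M\<^esub> y = a \<odot>\<^bsub>M\<^esub> (x \<otimes>\<^bsub>M\<^esub> y)"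
    and smult_mult_right:
      "\<lbrakk> a \<in> carrier R; x \<in> carrier M; y \<in> carrier M \<rbrakk> \<Longrightarrow>
        x \<otimes>\<^bsub>M\<^esub> (a \<odot>\<^bsub>M\<^esub> y) = a \<odot>\<^bsub>M\<^esub> (x \<otimes>\<^bsub>M\<^esub> y)"

definition smult_stable :: "('c, 'm) ring_scheme \<Rightarrow> ('c, 'a) module \<Rightarrow> 'a set \<Rightarrow> bool" where
  "smult_stable K A S \<longleftrightarrow> (\<forall>c\<in>carrier K. \<forall>x\<in>S. c \<odot>\<^bsub>A\<^esub> x \<in> S)"

definition subalgebra_of :: "('c, 'm) ring_scheme \<Rightarrow> 'a set \<Rightarrow> ('c, 'a) module \<Rightarrow> bool" where
  "subalgebra_of K S A \<longleftrightarrow> assoc_algebra K A \<and> subring S A \<and> smult_stable K A S"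

definition algebra_ideal :: "('c, 'm) ring_scheme \<Rightarrow> 'a set \<Rightarrow> ('c, 'a) module \<Rightarrow> bool" where
  "algebra_ideal K J A \<longleftrightarrow> assoc_algebra K A \<and> ideal J A \<and> smult_stable K A J"

definition algebra_hom ::
  "('c, 'm) ring_scheme \<Rightarrow> ('c, 'a) module \<Rightarrow> ('c, 'b) module \<Rightarrow> ('a \<Rightarrow> 'b) set" where
  "algebra_hom K A B =
    {\<phi> \<in> Ring.ring_hom A B. \<forall>c\<in>carrier K. \<forall>x\<in>carrier A. \<phi> (c \<odot>\<^bsub>A\<^esub> x) = c \<odot>\<^bsub>B\<^esub> \<phi> x}"

definition algebra_iso ::
  "('c, 'm) ring_scheme \<Rightarrow> ('c, 'a) module \<Rightarrow> ('c, 'b) module \<Rightarrow> ('a \<Rightarrow> 'b) set" where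
  "algebra_iso K A B = {\<phi> \<in> algebra_hom K A B. bij_betw \<phi> (carrier A) (carrier B)}"

definition quotient_algebra :: "('c, 'a) module \<Rightarrow> 'a set \<Rightarrow> ('c, 'a set) module" where
  "quotient_algebra A J =
    ring.extend (A Quot J) (module.fields (\<lambda>c Y. \<Union>x\<in>Y. J +>\<^bsub>A\<^esub> (c \<odot>\<^bsub>A\<^esub> x)))"

section \<open>Oriented graphs with an admissible automorphism\<close>

text \<open>An arrow \<open>h\<close> goes from \<open>h' = tail \<Gamma> h\<close> to \<open>h'' = head \<Gamma> h\<close>.\<close>

record ('v, 'h) aut_digraph = "('v, 'h) pre_digraph" +
  vaut :: "'v \<Rightarrow> 'v"
  aaut :: "'h \<Rightarrow> 'h"

definition admissible :: "('v, 'h) aut_digraph \<Rightarrow> bool" where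
  "admissible \<Gamma> \<longleftrightarrow>
    fin_digraph (pre_digraph.truncate \<Gamma>) \<and> loopfree_digraph (pre_digraph.truncate \<Gamma>) \<and>
    bij_betw (vaut \<Gamma>) (verts \<Gamma>) (verts \<Gamma>) \<and> bij_betw (aaut \<Gamma>) (arcs \<Gamma>) (arcs \<Gamma>) \<and>
    (\<forall>h\<in>arcs \<Gamma>. tail \<Gamma> (aaut \<Gamma> h) = vaut \<Gamma> (tail \<Gamma> h) \<and>
                 head \<Gamma> (aaut \<Gamma> h) = vaut \<Gamma> (head \<Gamma> h)) \<and>
    (\<forall>h\<in>arcs \<Gamma>. orbit (vaut \<Gamma>) (tail \<Gamma> h) \<noteq> orbit (vaut \<Gamma>) (head \<Gamma> h))"

definition vorbits :: "('v, 'h) aut_digraph \<Rightarrow> 'v set set" where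
  "vorbits \<Gamma> = orbit (vaut \<Gamma>) ` verts \<Gamma>"

text \<open>The monoid \<open>\<nat>[I]\<close>, \<open>I\<close> the set of orbits, as functions vanishing off \<open>I\<close>.\<close>

definition dim_vectors :: "('v, 'h) aut_digraph \<Rightarrow> ('v set \<Rightarrow> nat) set" where
  "dim_vectors \<Gamma> = {\<nu>. \<forall>i. i \<notin> vorbits \<Gamma> \<longrightarrow> \<nu> i = 0}"

definition vdim :: "('v, 'h) aut_digraph \<Rightarrow> ('v set \<Rightarrow> nat) \<Rightarrow> 'v \<Rightarrow> nat" where
  "vdim \<Gamma> \<nu> v = \<nu> (orbit (vaut \<Gamma>) v)"

section \<open>Representation spaces\<close>

definition rep_space :: "('v, 'h) aut_digraph \<Rightarrow> ('v set \<Rightarrow> nat) \<Rightarrow> ('h \<Rightarrow> 'k::field mat) set" where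
  "rep_space \<Gamma> \<nu> = (\<Pi>\<^sub>E h\<in>arcs \<Gamma>. carrier_mat (vdim \<Gamma> \<nu> (head \<Gamma> h)) (vdim \<Gamma> \<nu> (tail \<Gamma> h)))"

abbreviation mat_alg :: "nat \<Rightarrow> 'k::field mat ring" where
  "mat_alg n \<equiv> ring_mat TYPE('k) n ()"

definition gauge :: "('v, 'h) aut_digraph \<Rightarrow> ('v set \<Rightarrow> nat) \<Rightarrow> ('v \<Rightarrow> 'k::field mat) set" where
  "gauge \<Gamma> \<nu> = (\<Pi>\<^sub>E v\<in>verts \<Gamma>. Units (mat_alg (vdim \<Gamma> \<nu> v)))"

definition gauge_mult ::
  "('v, 'h) aut_digraph \<Rightarrow> ('v \<Rightarrow> 'k::field mat) \<Rightarrow> ('v \<Rightarrow> 'k mat) \<Rightarrow> 'v \<Rightarrow> 'k mat" where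
  "gauge_mult \<Gamma> g g' = (\<lambda>v\<in>verts \<Gamma>. g v * g' v)"

definition gauge_inv ::
  "('v, 'h) aut_digraph \<Rightarrow> ('v set \<Rightarrow> nat) \<Rightarrow> ('v \<Rightarrow> 'k::field mat) \<Rightarrow> 'v \<Rightarrow> 'k mat" where
  "gauge_inv \<Gamma> \<nu> g = (\<lambda>v\<in>verts \<Gamma>. inv\<^bsub>mat_alg (vdim \<Gamma> \<nu> v)\<^esub> (g v))"

definition gauge_act ::
  "('v, 'h) aut_digraph \<Rightarrow> ('v set \<Rightarrow> nat) \<Rightarrow> ('v \<Rightarrow> 'k::field mat) \<Rightarrow> ('h \<Rightarrow> 'k mat) \<Rightarrow> 'h \<Rightarrow> 'k mat" where
  "gauge_act \<Gamma> \<nu> g x =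
    (\<lambda>h\<in>arcs \<Gamma>. g (head \<Gamma> h) * x h * gauge_inv \<Gamma> \<nu> g (tail \<Gamma> h))"

definition frob_rep ::
  "('v, 'h) aut_digraph \<Rightarrow> nat \<Rightarrow> ('h \<Rightarrow> 'k::field mat) \<Rightarrow> 'h \<Rightarrow> 'k mat" where
  "frob_rep \<Gamma> q x =
    (\<lambda>h\<in>arcs \<Gamma>. map_mat (\<lambda>z. z ^ q) (x (inv_into (arcs \<Gamma>) (aaut \<Gamma>) h)))"

definition frob_gauge ::
  "('v, 'h) aut_digraph \<Rightarrow> nat \<Rightarrow> ('v \<Rightarrow> 'k::field mat) \<Rightarrow> 'v \<Rightarrow> 'k mat" where
  "frob_gauge \<Gamma> q g =
    (\<lambda>v\<in>verts \<Gamma>. map_mat (\<lambda>z. z ^ q) (g (inv_into (verts \<Gamma>) (vaut \<Gamma>) v)))"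

definition fixed_pts :: "('a \<Rightarrow> 'a) \<Rightarrow> 'a set \<Rightarrow> 'a set" where
  "fixed_pts F Y = {x \<in> Y. F x = x}"

section \<open>The induction diagram\<close>

text \<open>
  In \<open>V = T \<oplus> W\<close>, at the vertex \<open>v\<close> the first \<open>\<tau>\<close> coordinates span \<open>T\<close> and the last \<open>\<omega>\<close>
  coordinates span \<open>W\<close>. Throughout, \<open>Y \<nu>\<close> is a subset of \<open>rep_space \<Gamma> \<nu>\<close>
  (the whole space, or its open part).
\<close>

definition dplus :: "('i \<Rightarrow> nat) \<Rightarrow> ('i \<Rightarrow> nat) \<Rightarrow> 'i \<Rightarrow> nat" where
  "dplus \<tau> \<omega> = (\<lambda>i. \<tau> i + \<omega> i)"

definition subsp_W ::
  "('v, 'h) aut_digraph \<Rightarrow> ('v set \<Rightarrow> nat) \<Rightarrow> ('v set \<Rightarrow> nat) \<Rightarrow> 'v \<Rightarrow> 'k::field vec set" where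
  "subsp_W \<Gamma> \<tau> \<omega> v =
    {w \<in> carrier_vec (vdim \<Gamma> \<tau> v + vdim \<Gamma> \<omega> v). \<forall>j<vdim \<Gamma> \<tau> v. w $ j = 0}"

definition stab_rep ::
  "('v, 'h) aut_digraph \<Rightarrow> (('v set \<Rightarrow> nat) \<Rightarrow> ('h \<Rightarrow> 'k::field mat) set) \<Rightarrow>
    ('v set \<Rightarrow> nat) \<Rightarrow> ('v set \<Rightarrow> nat) \<Rightarrow> ('h \<Rightarrow> 'k mat) set" where
  "stab_rep \<Gamma> Y \<tau> \<omega> = {x \<in> Y (dplus \<tau> \<omega>).
    \<forall>h\<in>arcs \<Gamma>. \<forall>w\<in>subsp_W \<Gamma> \<tau> \<omega> (tail \<Gamma> h). x h *\<^sub>v w \<in> subsp_W \<Gamma> \<tau> \<omega> (head \<Gamma> h)}"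

definition induced_T ::
  "('v, 'h) aut_digraph \<Rightarrow> ('v set \<Rightarrow> nat) \<Rightarrow> ('h \<Rightarrow> 'k::field mat) \<Rightarrow> 'h \<Rightarrow> 'k mat" where
  "induced_T \<Gamma> \<tau> x = (\<lambda>h\<in>arcs \<Gamma>.
    mat (vdim \<Gamma> \<tau> (head \<Gamma> h)) (vdim \<Gamma> \<tau> (tail \<Gamma> h)) (\<lambda>(i, j). x h $$ (i, j)))"

definition induced_W ::
  "('v, 'h) aut_digraph \<Rightarrow> ('v set \<Rightarrow> nat) \<Rightarrow> ('v set \<Rightarrow> nat) \<Rightarrow>
    ('h \<Rightarrow> 'k::field mat) \<Rightarrow> 'h \<Rightarrow> 'k mat" where
  "induced_W \<Gamma> \<tau> \<omega> x = (\<lambda>h\<in>arcs \<Gamma>.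
    mat (vdim \<Gamma> \<omega> (head \<Gamma> h)) (vdim \<Gamma> \<omega> (tail \<Gamma> h))
      (\<lambda>(i, j). x h $$ (vdim \<Gamma> \<tau> (head \<Gamma> h) + i, vdim \<Gamma> \<tau> (tail \<Gamma> h) + j)))"

definition parab ::
  "('v, 'h) aut_digraph \<Rightarrow> ('v set \<Rightarrow> nat) \<Rightarrow> ('v set \<Rightarrow> nat) \<Rightarrow> ('v \<Rightarrow> 'k::field mat) set" where
  "parab \<Gamma> \<tau> \<omega> = {g \<in> gauge \<Gamma> (dplus \<tau> \<omega>).
    \<forall>v\<in>verts \<Gamma>. (\<lambda>w. g v *\<^sub>v w) ` subsp_W \<Gamma> \<tau> \<omega> v = subsp_W \<Gamma> \<tau> \<omega> v}"

text \<open>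
  The unipotent radical of \<open>parab\<close> is the subgroup of the elements which induce the identity
  on \<open>W\<close> and on \<open>V/W\<close>.
\<close>

definition unip_rad ::
  "('v, 'h) aut_digraph \<Rightarrow> ('v set \<Rightarrow> nat) \<Rightarrow> ('v set \<Rightarrow> nat) \<Rightarrow> ('v \<Rightarrow> 'k::field mat) set" where
  "unip_rad \<Gamma> \<tau> \<omega> = {g \<in> parab \<Gamma> \<tau> \<omega>. \<forall>v\<in>verts \<Gamma>.
    (\<forall>w\<in>subsp_W \<Gamma> \<tau> \<omega> v. g v *\<^sub>v w = w) \<and>
    (\<forall>u\<in>carrier_vec (vdim \<Gamma> \<tau> v + vdim \<Gamma> \<omega> v). g v *\<^sub>v u - u \<in> subsp_W \<Gamma> \<tau> \<omega> v)}"

text \<open>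
  For a subgroup \<open>P\<close> of \<open>parab\<close>, \<open>G \<times>\<^sub>P S\<^sub>W\<close> is the set of orbits of \<open>P\<close> in \<open>G \<times> S\<^sub>W\<close>
  under \<open>b \<cdot> (g, x) = (g b\<^sup>-\<^sup>1, b.x)\<close>.
\<close>

definition twist_rel ::
  "('v, 'h) aut_digraph \<Rightarrow> (('v set \<Rightarrow> nat) \<Rightarrow> ('h \<Rightarrow> 'k::field mat) set) \<Rightarrow>
    ('v set \<Rightarrow> nat) \<Rightarrow> ('v set \<Rightarrow> nat) \<Rightarrow> ('v \<Rightarrow> 'k mat) set \<Rightarrow>
    (('v \<Rightarrow> 'k mat) \<times> ('h \<Rightarrow> 'k mat)) rel" where
  "twist_rel \<Gamma> Y \<tau> \<omega> P =
    {((g, x), (gauge_mult \<Gamma> g (gauge_inv \<Gamma> (dplus \<tau> \<omega>) b), gauge_act \<Gamma> (dplus \<tau> \<omega>) b x)) | g x b.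
      g \<in> gauge \<Gamma> (dplus \<tau> \<omega>) \<and> x \<in> stab_rep \<Gamma> Y \<tau> \<omega> \<and> b \<in> P}"

definition E1 ::
  "('v, 'h) aut_digraph \<Rightarrow> (('v set \<Rightarrow> nat) \<Rightarrow> ('h \<Rightarrow> 'k::field mat) set) \<Rightarrow>
    ('v set \<Rightarrow> nat) \<Rightarrow> ('v set \<Rightarrow> nat) \<Rightarrow> (('v \<Rightarrow> 'k mat) \<times> ('h \<Rightarrow> 'k mat)) set set" where
  "E1 \<Gamma> Y \<tau> \<omega> = (gauge \<Gamma> (dplus \<tau> \<omega>) \<times> stab_rep \<Gamma> Y \<tau> \<omega>)
     // twist_rel \<Gamma> Y \<tau> \<omega> (unip_rad \<Gamma> \<tau> \<omega>)"

definition E2 ::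
  "('v, 'h) aut_digraph \<Rightarrow> (('v set \<Rightarrow> nat) \<Rightarrow> ('h \<Rightarrow> 'k::field mat) set) \<Rightarrow>
    ('v set \<Rightarrow> nat) \<Rightarrow> ('v set \<Rightarrow> nat) \<Rightarrow> (('v \<Rightarrow> 'k mat) \<times> ('h \<Rightarrow> 'k mat)) set set" where
  "E2 \<Gamma> Y \<tau> \<omega> = (gauge \<Gamma> (dplus \<tau> \<omega>) \<times> stab_rep \<Gamma> Y \<tau> \<omega>)
     // twist_rel \<Gamma> Y \<tau> \<omega> (parab \<Gamma> \<tau> \<omega>)"

definition frob_class ::
  "('v, 'h) aut_digraph \<Rightarrow> nat \<Rightarrow> (('v \<Rightarrow> 'k::field mat) \<times> ('h \<Rightarrow> 'k mat)) set \<Rightarrow>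
    (('v \<Rightarrow> 'k mat) \<times> ('h \<Rightarrow> 'k mat)) set" where
  "frob_class \<Gamma> q c = map_prod (frob_gauge \<Gamma> q) (frob_rep \<Gamma> q) ` c"

definition p1 ::
  "('v, 'h) aut_digraph \<Rightarrow> ('v set \<Rightarrow> nat) \<Rightarrow> ('v set \<Rightarrow> nat) \<Rightarrow>
    (('v \<Rightarrow> 'k::field mat) \<times> ('h \<Rightarrow> 'k mat)) set \<Rightarrow> ('h \<Rightarrow> 'k mat) \<times> ('h \<Rightarrow> 'k mat)" where
  "p1 \<Gamma> \<tau> \<omega> c = the_elem ((\<lambda>(g, x). (induced_T \<Gamma> \<tau> x, induced_W \<Gamma> \<tau> \<omega> x)) ` c)"

definition p2 ::
  "('v, 'h) aut_digraph \<Rightarrow> (('v set \<Rightarrow> nat) \<Rightarrow> ('h \<Rightarrow> 'k::field mat) set) \<Rightarrow>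
    ('v set \<Rightarrow> nat) \<Rightarrow> ('v set \<Rightarrow> nat) \<Rightarrow>
    (('v \<Rightarrow> 'k mat) \<times> ('h \<Rightarrow> 'k mat)) set \<Rightarrow> (('v \<Rightarrow> 'k mat) \<times> ('h \<Rightarrow> 'k mat)) set" where
  "p2 \<Gamma> Y \<tau> \<omega> c = twist_rel \<Gamma> Y \<tau> \<omega> (parab \<Gamma> \<tau> \<omega>) `` c"

definition p3 ::
  "('v, 'h) aut_digraph \<Rightarrow> ('v set \<Rightarrow> nat) \<Rightarrow> ('v set \<Rightarrow> nat) \<Rightarrow>
    (('v \<Rightarrow> 'k::field mat) \<times> ('h \<Rightarrow> 'k mat)) set \<Rightarrow> 'h \<Rightarrow> 'k mat" where
  "p3 \<Gamma> \<tau> \<omega> c = the_elem ((\<lambda>(g, x). gauge_act \<Gamma> (dplus \<tau> \<omega>) g x) ` c)"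

definition pushforward :: "'a set \<Rightarrow> ('a \<Rightarrow> 'b) \<Rightarrow> ('a \<Rightarrow> complex) \<Rightarrow> 'b \<Rightarrow> complex" where
  "pushforward A \<phi> f y = (\<Sum>x | x \<in> A \<and> \<phi> x = y. f x)"

definition m_form ::
  "('v, 'h) aut_digraph \<Rightarrow> ('v set \<Rightarrow> nat) \<Rightarrow> ('v set \<Rightarrow> nat) \<Rightarrow> nat" where
  "m_form \<Gamma> \<tau> \<omega> = (\<Sum>v\<in>verts \<Gamma>. vdim \<Gamma> \<tau> v * vdim \<Gamma> \<omega> v)
     + (\<Sum>h\<in>arcs \<Gamma>. vdim \<Gamma> \<tau> (tail \<Gamma> h) * vdim \<Gamma> \<omega> (head \<Gamma> h))"

definition gauge_F ::
  "('v, 'h) aut_digraph \<Rightarrow> nat \<Rightarrow> ('v set \<Rightarrow> nat) \<Rightarrow> ('v \<Rightarrow> 'k::field mat) set" where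
  "gauge_F \<Gamma> q \<nu> = fixed_pts (frob_gauge \<Gamma> q) (gauge \<Gamma> \<nu>)"

text \<open>Here \<open>s\<close> is the chosen square root of \<open>q\<close>.\<close>

definition Ind ::
  "('v, 'h) aut_digraph \<Rightarrow> nat \<Rightarrow> complex \<Rightarrow> (('v set \<Rightarrow> nat) \<Rightarrow> ('h \<Rightarrow> 'k::field mat) set) \<Rightarrow>
    ('v set \<Rightarrow> nat) \<Rightarrow> ('v set \<Rightarrow> nat) \<Rightarrow>
    (('h \<Rightarrow> 'k mat) \<Rightarrow> complex) \<Rightarrow> (('h \<Rightarrow> 'k mat) \<Rightarrow> complex) \<Rightarrow> ('h \<Rightarrow> 'k mat) \<Rightarrow> complex" where
  "Ind \<Gamma> q s Y \<tau> \<omega> f f' y =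
    inverse s ^ m_form \<Gamma> \<tau> \<omega> *
    (1 / of_nat (card ((gauge_F \<Gamma> q \<tau> :: ('v \<Rightarrow> 'k mat) set) \<times>
                       (gauge_F \<Gamma> q \<omega> :: ('v \<Rightarrow> 'k mat) set)))) *
    pushforward (fixed_pts (frob_class \<Gamma> q) (E2 \<Gamma> Y \<tau> \<omega>)) (p3 \<Gamma> \<tau> \<omega>)
      (pushforward (fixed_pts (frob_class \<Gamma> q) (E1 \<Gamma> Y \<tau> \<omega>)) (p2 \<Gamma> Y \<tau> \<omega>)
        ((\<lambda>(xT, xW). f xT * f' xW) \<circ> p1 \<Gamma> \<tau> \<omega>)) y"

section \<open>Hall algebras\<close>

text \<open>The field \<open>\<rat>(s)\<close>, as a subfield of the complex numbers.\<close>

definition coeff_field :: "complex \<Rightarrow> complex ring" where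
  "coeff_field s =
    (ring_of_type_algebra :: complex ring)\<lparr>carrier := generate_field ring_of_type_algebra {s}\<rparr>"

type_synonym ('v, 'h, 'k) hall_elt = "('v set \<Rightarrow> nat) \<Rightarrow> ('h \<Rightarrow> 'k mat) \<Rightarrow> complex"

definition inv_funs ::
  "('v, 'h) aut_digraph \<Rightarrow> nat \<Rightarrow> complex \<Rightarrow> (('v set \<Rightarrow> nat) \<Rightarrow> ('h \<Rightarrow> 'k::field mat) set) \<Rightarrow>
    ('v set \<Rightarrow> nat) \<Rightarrow> (('h \<Rightarrow> 'k mat) \<Rightarrow> complex) set" where
  "inv_funs \<Gamma> q s Y \<nu> =
    {f \<in> fixed_pts (frob_rep \<Gamma> q) (Y \<nu>) \<rightarrow>\<^sub>E carrier (coeff_field s).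
      \<forall>g\<in>gauge_F \<Gamma> q \<nu>. \<forall>x\<in>fixed_pts (frob_rep \<Gamma> q) (Y \<nu>). f (gauge_act \<Gamma> \<nu> g x) = f x}"

text \<open>The direct sum over \<open>\<nu> \<in> D\<close> of the spaces of invariant functions on \<open>(Y \<nu>)\<^sup>F\<close>.\<close>

definition hall_space ::
  "('v, 'h) aut_digraph \<Rightarrow> nat \<Rightarrow> complex \<Rightarrow> ('v set \<Rightarrow> nat) set \<Rightarrow>
    (('v set \<Rightarrow> nat) \<Rightarrow> ('h \<Rightarrow> 'k::field mat) set) \<Rightarrow> ('v, 'h, 'k) hall_elt set" where
  "hall_space \<Gamma> q s D Y =
    {f \<in> (\<Pi>\<^sub>E \<nu>\<in>D. inv_funs \<Gamma> q s Y \<nu>).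
      finite {\<nu> \<in> D. \<exists>x\<in>fixed_pts (frob_rep \<Gamma> q) (Y \<nu>). f \<nu> x \<noteq> 0}}"

definition hall_tab ::
  "('v, 'h) aut_digraph \<Rightarrow> nat \<Rightarrow> ('v set \<Rightarrow> nat) set \<Rightarrow>
    (('v set \<Rightarrow> nat) \<Rightarrow> ('h \<Rightarrow> 'k::field mat) set) \<Rightarrow> ('v, 'h, 'k) hall_elt \<Rightarrow> ('v, 'h, 'k) hall_elt" where
  "hall_tab \<Gamma> q D Y f = (\<lambda>\<nu>\<in>D. restrict (f \<nu>) (fixed_pts (frob_rep \<Gamma> q) (Y \<nu>)))"

definition hall_algebra ::
  "('v, 'h) aut_digraph \<Rightarrow> nat \<Rightarrow> complex \<Rightarrow> ('v set \<Rightarrow> nat) set \<Rightarrow>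
    (('v set \<Rightarrow> nat) \<Rightarrow> ('h \<Rightarrow> 'k::field mat) set) \<Rightarrow> (complex, ('v, 'h, 'k) hall_elt) module" where
  "hall_algebra \<Gamma> q s D Y = \<lparr>
    partial_object.carrier = hall_space \<Gamma> q s D Y,
    monoid.mult = (\<lambda>f f'. hall_tab \<Gamma> q D Y
      (\<lambda>\<nu> x. \<Sum>(\<tau>, \<omega>) | \<tau> \<in> D \<and> \<omega> \<in> D \<and> dplus \<tau> \<omega> = \<nu>. Ind \<Gamma> q s Y \<tau> \<omega> (f \<tau>) (f' \<omega>) x)),
    monoid.one = hall_tab \<Gamma> q D Y (\<lambda>\<nu> x. if \<nu> = (\<lambda>i. 0) then 1 else 0),
    ring.zero = hall_tab \<Gamma> q D Y (\<lambda>\<nu> x. 0),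
    ring.add = (\<lambda>f f'. hall_tab \<Gamma> q D Y (\<lambda>\<nu> x. f \<nu> x + f' \<nu> x)),
    module.smult = (\<lambda>c f. hall_tab \<Gamma> q D Y (\<lambda>\<nu> x. c * f \<nu> x))\<rparr>"

text \<open>Extension by zero, from functions on \<open>Y \<nu>\<close> (\<open>\<nu> \<in> D\<close>) to functions on \<open>Y' \<nu>\<close> (\<open>\<nu> \<in> D'\<close>).\<close>

definition extend_zero ::
  "('v, 'h) aut_digraph \<Rightarrow> nat \<Rightarrow>
    ('v set \<Rightarrow> nat) set \<Rightarrow> (('v set \<Rightarrow> nat) \<Rightarrow> ('h \<Rightarrow> 'k::field mat) set) \<Rightarrow>
    ('v set \<Rightarrow> nat) set \<Rightarrow> (('v set \<Rightarrow> nat) \<Rightarrow> ('h \<Rightarrow> 'k mat) set) \<Rightarrow>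
    ('v, 'h, 'k) hall_elt \<Rightarrow> ('v, 'h, 'k) hall_elt" where
  "extend_zero \<Gamma> q D Y D' Y' f =
    hall_tab \<Gamma> q D' Y' (\<lambda>\<nu> x. if \<nu> \<in> D \<and> x \<in> fixed_pts (frob_rep \<Gamma> q) (Y \<nu>) then f \<nu> x else 0)"

definition hall :: "('v, 'h) aut_digraph \<Rightarrow> nat \<Rightarrow> complex \<Rightarrow>
    (complex, ('v, 'h, 'k::field) hall_elt) module" where
  "hall \<Gamma> q s = hall_algebra \<Gamma> q s (dim_vectors \<Gamma>) (rep_space \<Gamma>)"

definition homogeneous :: "('c, ('d \<Rightarrow> 'b)) module \<Rightarrow> 'd \<Rightarrow> ('d \<Rightarrow> 'b) set" where
  "homogeneous A \<nu> = {f \<in> carrier A. \<forall>\<mu>. \<mu> \<noteq> \<nu> \<longrightarrow> f \<mu> = \<zero>\<^bsub>A\<^esub> \<mu>}"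

definition graded_map ::
  "'d set \<Rightarrow> ('c, ('d \<Rightarrow> 'b)) module \<Rightarrow> ('c, ('d \<Rightarrow> 'b)) module \<Rightarrow>
    (('d \<Rightarrow> 'b) \<Rightarrow> ('d \<Rightarrow> 'b)) \<Rightarrow> bool" where
  "graded_map D A B \<phi> \<longleftrightarrow> (\<forall>\<nu>\<in>D. \<phi> ` homogeneous A \<nu> \<subseteq> homogeneous B \<nu>)"

section \<open>Edge contraction\<close>

definition contractible :: "('v, 'h) aut_digraph \<Rightarrow> 'v set \<Rightarrow> 'v set \<Rightarrow> bool" where
  "contractible \<Gamma> ip im \<longleftrightarrow> ip \<in> vorbits \<Gamma> \<and> im \<in> vorbits \<Gamma> \<and> card ip = card im \<and>
    card im = card {h \<in> arcs \<Gamma>. tail \<Gamma> h \<in> ip \<union> im \<and> head \<Gamma> h \<in> ip \<union> im} \<and>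
    (\<forall>h\<in>arcs \<Gamma>. tail \<Gamma> h \<in> ip \<union> im \<and> head \<Gamma> h \<in> ip \<union> im \<longrightarrow> tail \<Gamma> h \<in> ip \<and> head \<Gamma> h \<in> im)"

definition bridges :: "('v, 'h) aut_digraph \<Rightarrow> 'v set \<Rightarrow> 'v set \<Rightarrow> 'h set" where
  "bridges \<Gamma> ip im = {h \<in> arcs \<Gamma>. tail \<Gamma> h \<in> ip \<and> head \<Gamma> h \<in> im}"

text \<open>\<open>Comp h2 h1\<close> is the symbol \<open>h\<^sub>2h\<^sub>1\<close>, and \<open>CompBar h1 h2\<close> the symbol with \<open>h\<^sub>1\<close> reversed.\<close>

datatype 'h contr_arc = Old 'h | Comp 'h 'h | CompBar 'h 'h

definition contraction ::
  "('v, 'h) aut_digraph \<Rightarrow> 'v set \<Rightarrow> 'v set \<Rightarrow> ('v, 'h contr_arc) aut_digraph" where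
  "contraction \<Gamma> ip im = \<lparr>
    verts = verts \<Gamma> - im,
    arcs = {Old h | h. h \<in> arcs \<Gamma> \<and> tail \<Gamma> h \<notin> im \<and> head \<Gamma> h \<notin> im}
         \<union> {Comp h2 h1 | h1 h2. h1 \<in> bridges \<Gamma> ip im \<and> h2 \<in> arcs \<Gamma> \<and> tail \<Gamma> h2 = head \<Gamma> h1}
         \<union> {CompBar h1 h2 | h1 h2. h1 \<in> bridges \<Gamma> ip im \<and> h2 \<in> arcs \<Gamma> \<and>
              head \<Gamma> h2 = head \<Gamma> h1 \<and> tail \<Gamma> h2 \<notin> ip},
    tail = (\<lambda>e. case e of Old h \<Rightarrow> tail \<Gamma> h | Comp h2 h1 \<Rightarrow> tail \<Gamma> h1 | CompBar h1 h2 \<Rightarrow> tail \<Gamma> h2),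
    head = (\<lambda>e. case e of Old h \<Rightarrow> head \<Gamma> h | Comp h2 h1 \<Rightarrow> head \<Gamma> h2 | CompBar h1 h2 \<Rightarrow> tail \<Gamma> h1),
    vaut = vaut \<Gamma>,
    aaut = map_contr_arc (aaut \<Gamma>)\<rparr>"

text \<open>
  The orbits on \<open>contraction \<Gamma> ip im\<close> are the orbits on \<open>\<Gamma>\<close> other than \<open>im\<close>, so forgetting the value at
  \<open>im\<close> identifies this set with \<open>dim_vectors (contraction \<Gamma> ip im)\<close>.
\<close>

definition dim_vectors_hat ::
  "('v, 'h) aut_digraph \<Rightarrow> 'v set \<Rightarrow> 'v set \<Rightarrow> ('v set \<Rightarrow> nat) set" where
  "dim_vectors_hat \<Gamma> ip im = {\<nu> \<in> dim_vectors \<Gamma>. \<nu> ip = \<nu> im}"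

definition rep_heart ::
  "('v, 'h) aut_digraph \<Rightarrow> 'v set \<Rightarrow> 'v set \<Rightarrow> ('v set \<Rightarrow> nat) \<Rightarrow> ('h \<Rightarrow> 'k::field mat) set" where
  "rep_heart \<Gamma> ip im \<nu> = {x \<in> rep_space \<Gamma> \<nu>. \<forall>h\<in>bridges \<Gamma> ip im. invertible_mat (x h)}"

definition rep_compl ::
  "('v, 'h) aut_digraph \<Rightarrow> 'v set \<Rightarrow> 'v set \<Rightarrow> ('v set \<Rightarrow> nat) \<Rightarrow> ('h \<Rightarrow> 'k::field mat) set" where
  "rep_compl \<Gamma> ip im \<nu> = rep_space \<Gamma> \<nu> - rep_heart \<Gamma> ip im \<nu>"

definition hall_sub :: "('v, 'h) aut_digraph \<Rightarrow> 'v set \<Rightarrow> 'v set \<Rightarrow> nat \<Rightarrow> complex \<Rightarrow>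
    (complex, ('v, 'h, 'k::field) hall_elt) module" where
  "hall_sub \<Gamma> ip im q s = (hall \<Gamma> q s)\<lparr>carrier :=
    extend_zero \<Gamma> q (dim_vectors_hat \<Gamma> ip im) (rep_space \<Gamma>) (dim_vectors \<Gamma>) (rep_space \<Gamma>)
      ` hall_space \<Gamma> q s (dim_vectors_hat \<Gamma> ip im) (rep_space \<Gamma>)\<rparr>"

definition hall_compl :: "('v, 'h) aut_digraph \<Rightarrow> 'v set \<Rightarrow> 'v set \<Rightarrow> nat \<Rightarrow> complex \<Rightarrow>
    ('v, 'h, 'k::field) hall_elt set" where
  "hall_compl \<Gamma> ip im q s =
    extend_zero \<Gamma> q (dim_vectors_hat \<Gamma> ip im) (rep_compl \<Gamma> ip im) (dim_vectors \<Gamma>) (rep_space \<Gamma>)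
      ` hall_space \<Gamma> q s (dim_vectors_hat \<Gamma> ip im) (rep_compl \<Gamma> ip im)"

definition hall_heart :: "('v, 'h) aut_digraph \<Rightarrow> 'v set \<Rightarrow> 'v set \<Rightarrow> nat \<Rightarrow> complex \<Rightarrow>
    (complex, ('v, 'h, 'k::field) hall_elt) module" where
  "hall_heart \<Gamma> ip im q s =
    hall_algebra \<Gamma> q s (dim_vectors_hat \<Gamma> ip im) (rep_heart \<Gamma> ip im)"

definition j_restrict :: "('v, 'h) aut_digraph \<Rightarrow> 'v set \<Rightarrow> 'v set \<Rightarrow> nat \<Rightarrow>
    ('v, 'h, 'k::field) hall_elt \<Rightarrow> ('v, 'h, 'k) hall_elt" where
  "j_restrict \<Gamma> ip im q f = hall_tab \<Gamma> q (dim_vectors_hat \<Gamma> ip im) (rep_heart \<Gamma> ip im) f"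

definition j_extend :: "('v, 'h) aut_digraph \<Rightarrow> 'v set \<Rightarrow> 'v set \<Rightarrow> nat \<Rightarrow>
    ('v, 'h, 'k::field) hall_elt \<Rightarrow> ('v, 'h, 'k) hall_elt" where
  "j_extend \<Gamma> ip im q =
    extend_zero \<Gamma> q (dim_vectors_hat \<Gamma> ip im) (rep_heart \<Gamma> ip im) (dim_vectors \<Gamma>) (rep_space \<Gamma>)"

end

theory Submission
  imports Defs "Jordan_Normal_Form.Determinant"
begin

text \<open>
  Everything takes place on finite sets, the Frobenius-fixed points of representation spaces and of
  general linear groups, and the proof is a count.

  The induction product is defined by push and pull along \<open>E1 = G \<times>\<^sub>U S\<close> and \<open>E2 = G \<times>\<^sub>Q S\<close>. By Lang's
  theorem for the unipotent radical \<open>U\<close> (\<open>lang_U\<close>, a system of Artin-Schreier equations) each fixed point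
  of \<open>E1\<close> is the class of a pair of fixed points. So the product of \<open>f\<close> and \<open>f'\<close> at \<open>y\<close> is, up to a constant,
  the sum of \<open>f ((g y)\<^sup>T) f' ((g y)\<^sup>W)\<close> over the fixed points \<open>g\<close> of the gauge group for which \<open>g y\<close>
  stabilises \<open>W\<close> (\<open>Ind_formula\<close>). About the fixed points of \<open>E2\<close> only the finiteness of the fibres
  of \<open>p3\<close> matters; it holds because a subspace stable under a power of Frobenius is spanned by its fixed
  vectors (\<open>stable_subspace_spanned\<close>). Associativity follows from the formula: once the inner sums are
  absorbed (\<open>orb_sum_conv_left\<close>), both bracketings sum over the \<open>g\<close> that make \<open>g y\<close> block triangular
  with three blocks (\<open>ind_assoc\<close>).

  A block triangular matrix is invertible if and only if its diagonal blocks are. So a representation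
  which stabilises \<open>W\<close> lies in the open part if and only if both induced ones do (\<open>heart_blocks\<close>).
  Hence a product with a factor that vanishes on the open part vanishes there (\<open>Hc_ideal\<close>), a product of
  two functions supported on the open part is supported there, and on the open part the product involves
  only values on open parts: restriction and extension by zero are both homomorphisms (\<open>jr_hom\<close>,
  \<open>je_hom\<close>).

  On the open part the arrows from \<open>ip\<close> to \<open>im\<close>, the bridges, identify the space at each vertex of \<open>im\<close>
  with the space at a vertex of \<open>ip\<close>, and this turns a representation \<open>x\<close> into a representation
  \<open>contr_rep \<nu> x\<close> of the contracted graph. The general linear groups at \<open>im\<close> act simply transitively on the
  invertible bridges, so orbits correspond to orbits (\<open>conj_lift\<close>, \<open>contr_rep_sect\<close>). Moreover \<open>x\<close> stabilises
  \<open>W\<close> if and only if its bridges are block triangular and \<open>contr_rep \<nu> x\<close> stabilises \<open>W\<close> (\<open>contr_S_iff\<close>).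
  Thus the sum over the gauge group of the graph is that for the contraction times the number of
  fixed points of a parabolic subgroup at \<open>im\<close> (\<open>orb_sum_contr\<close>). The normalising constant changes by the
  same factor (\<open>card_Q_contr\<close>), except for the power of \<open>s\<close>: the forms \<open>m_form\<close> of the two graphs differ by
  \<open>2 N \<tau> \<omega>\<close>, with \<open>N\<close> the number of elements of \<open>ip\<close> and \<open>\<tau>\<close>, \<open>\<omega>\<close> the dimensions at \<open>ip\<close>. This is the
  polarisation of \<open>N \<nu>\<^sup>2\<close>, so pulling functions back along the contraction and multiplying
  them by \<open>s\<close> to the power \<open>- N \<nu>\<^sup>2\<close> is multiplicative (\<open>ind_contr\<close>). This isomorphism \<open>pull\<close> between the
  Hall algebra of the contraction and the algebra of the open part, together with restriction and
  extension by zero, gives the quotient map and its section (\<open>quotient_iso\<close>).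
\<close>

section \<open>Block lower triangular matrices\<close>

text \<open>
  Let \<open>W\<close> be spanned by the last coordinate vectors of \<open>V = T \<oplus> W\<close>. A matrix maps \<open>W\<close> to \<open>W\<close> if and only if
  it is block lower triangular; then \<open>blk_T\<close> and \<open>blk_W\<close> are the maps which it induces on \<open>V / W\<close> and on \<open>W\<close>.
\<close>

definition blk_lower :: "nat \<Rightarrow> nat \<Rightarrow> 'a::zero mat \<Rightarrow> bool" where
  "blk_lower r c A \<longleftrightarrow> (\<forall>i<r. \<forall>j. c \<le> j \<longrightarrow> j < dim_col A \<longrightarrow> A $$ (i, j) = 0)"

definition blk_T :: "nat \<Rightarrow> nat \<Rightarrow> 'a mat \<Rightarrow> 'a mat" where
  "blk_T r c A = mat r c (\<lambda>(i, j). A $$ (i, j))"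

definition blk_L :: "nat \<Rightarrow> nat \<Rightarrow> nat \<Rightarrow> 'a mat \<Rightarrow> 'a mat" where
  "blk_L r k c A = mat k c (\<lambda>(i, j). A $$ (r + i, j))"

definition blk_W :: "nat \<Rightarrow> nat \<Rightarrow> nat \<Rightarrow> nat \<Rightarrow> 'a mat \<Rightarrow> 'a mat" where
  "blk_W r c k l A = mat k l (\<lambda>(i, j). A $$ (r + i, c + j))"

lemma blk_carrier [simp]:
  "blk_T r c A \<in> carrier_mat r c" "blk_L r k c A \<in> carrier_mat k c"
  "blk_W r c k l A \<in> carrier_mat k l"
  by (simp_all add: blk_T_def blk_L_def blk_W_def)

lemma blk_dims [simp]:
  "dim_row (blk_T r c A) = r" "dim_col (blk_T r c A) = c"
  "dim_row (blk_L r k c A) = k" "dim_col (blk_L r k c A) = c"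
  "dim_row (blk_W r c k l A) = k" "dim_col (blk_W r c k l A) = l"
  by (simp_all add: blk_T_def blk_L_def blk_W_def)

lemma blk_index [simp]:
  "i < r \<Longrightarrow> j < c \<Longrightarrow> blk_T r c A $$ (i, j) = A $$ (i, j)"
  "i < k \<Longrightarrow> j < c \<Longrightarrow> blk_L r k c A $$ (i, j) = A $$ (r + i, j)"
  "i < k \<Longrightarrow> j < l \<Longrightarrow> blk_W r c k l A $$ (i, j) = A $$ (r + i, c + j)"
  by (simp_all add: blk_T_def blk_L_def blk_W_def)

abbreviation lower_mat :: "'a::zero mat \<Rightarrow> 'a mat \<Rightarrow> 'a mat \<Rightarrow> 'a mat" where
  "lower_mat A L B \<equiv> four_block_mat A (0\<^sub>m (dim_row A) (dim_col B)) L B"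

lemma blk_lower_decomp:
  assumes "A \<in> carrier_mat (r + k) (c + l)" "blk_lower r c A"
  shows "A = lower_mat (blk_T r c A) (blk_L r k c A) (blk_W r c k l A)"
  using assms by (intro eq_matI) (auto simp: blk_lower_def)

lemma blk_of_lower_mat:
  assumes "A \<in> carrier_mat r c" "L \<in> carrier_mat k c" "B \<in> carrier_mat k l"
  shows "blk_lower r c (lower_mat A L B)"
    "blk_T r c (lower_mat A L B) = A"
    "blk_L r k c (lower_mat A L B) = L"
    "blk_W r c k l (lower_mat A L B) = B"
  using assms by (auto simp: blk_lower_def intro!: eq_matI)

lemma lower_mat_mult:
  fixes A :: "'a::comm_ring_1 mat"
  assumes "A \<in> carrier_mat r m" "L \<in> carrier_mat k m" "B \<in> carrier_mat k n"
    and "A' \<in> carrier_mat m c" "L' \<in> carrier_mat n c" "B' \<in> carrier_mat n l"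
  shows "lower_mat A L B * lower_mat A' L' B' = lower_mat (A * A') (L * A' + B * L') (B * B')"
  by (subst mult_four_block_mat) (use assms in \<open>auto intro!: cong_four_block_mat eq_matI\<close>)

lemma blk_mult:
  fixes A :: "'a::comm_ring_1 mat"
  assumes A: "A \<in> carrier_mat (r + k) (m + n)" "blk_lower r m A"
    and B: "B \<in> carrier_mat (m + n) (c + l)" "blk_lower m c B"
  shows "blk_lower r c (A * B)"
    "blk_T r c (A * B) = blk_T r m A * blk_T m c B"
    "blk_W r c k l (A * B) = blk_W r m k n A * blk_W m c n l B"
proof -
  have *: "A * B = lower_mat (blk_T r m A * blk_T m c B)
      (blk_L r k m A * blk_T m c B + blk_W r m k n A * blk_L m n c B)
      (blk_W r m k n A * blk_W m c n l B)"
    by (subst blk_lower_decomp[OF A], subst blk_lower_decomp[OF B], subst lower_mat_mult) auto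
  show "blk_lower r c (A * B)"
    "blk_T r c (A * B) = blk_T r m A * blk_T m c B"
    "blk_W r c k l (A * B) = blk_W r m k n A * blk_W m c n l B"
    unfolding * by (rule blk_of_lower_mat; auto intro!: mult_carrier_mat add_carrier_mat)+
qed

lemma det_blk_lower:
  fixes A :: "'a::idom mat"
  assumes "A \<in> carrier_mat (r + k) (r + k)" "blk_lower r r A"
  shows "det A = det (blk_T r r A) * det (blk_W r r k k A)"
  by (subst blk_lower_decomp[OF assms], subst det_four_block_mat_upper_right_zero) auto

lemma blk_one [simp]:
  "blk_lower r r (1\<^sub>m (r + k))" "blk_T r r (1\<^sub>m (r + k)) = 1\<^sub>m r"
  "blk_W r r k k (1\<^sub>m (r + k)) = 1\<^sub>m k"
  by (auto simp: blk_lower_def intro!: eq_matI)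

lemma blk_map_mat:
  assumes "\<theta> 0 = 0" "A \<in> carrier_mat (r + k) (c + l)"
  shows "blk_lower r c A \<Longrightarrow> blk_lower r c (map_mat \<theta> A)"
    "blk_T r c (map_mat \<theta> A) = map_mat \<theta> (blk_T r c A)"
    "blk_L r k c (map_mat \<theta> A) = map_mat \<theta> (blk_L r k c A)"
    "blk_W r c k l (map_mat \<theta> A) = map_mat \<theta> (blk_W r c k l A)"
  using assms by (auto simp: blk_lower_def intro!: eq_matI)

text \<open>
  A flag of two subspaces can be cut at either subspace first, which is what makes the product
  associative.
\<close>

lemma blk_nested:
  "blk_T a a' (blk_T (a + b) (a' + b') A) = blk_T a a' A"
  "blk_W a a' b b' (blk_T (a + b) (a' + b') A) = blk_T b b' (blk_W a a' (b + c) (b' + c') A)"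
  "blk_W (a + b) (a' + b') c c' A = blk_W b b' c c' (blk_W a a' (b + c) (b' + c') A)"
  by (auto intro!: eq_matI simp: add.assoc)

lemma blk_lower_nested:
  assumes "A \<in> carrier_mat (a + b + c) (a' + b' + c')"
  shows "blk_lower (a + b) (a' + b') A \<and> blk_lower a a' (blk_T (a + b) (a' + b') A) \<longleftrightarrow>
         blk_lower a a' A \<and> blk_lower b b' (blk_W a a' (b + c) (b' + c') A)"
    (is "?P \<longleftrightarrow> ?Q")
proof
  assume P: ?P
  have "A $$ (i, j) = 0" if "i < a" "a' \<le> j" "j < a' + b' + c'" for i j
    using P that assms by (cases "j < a' + b'") (auto simp: blk_lower_def)
  moreover have "A $$ (a + i, a' + j) = 0" if "i < b" "b' \<le> j" "j < b' + c'" for i j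
    using P that assms by (auto simp: blk_lower_def)
  ultimately show ?Q using assms by (auto simp: blk_lower_def)
next
  assume Q: ?Q
  have "A $$ (i, j) = 0" if that: "i < a + b" "a' + b' \<le> j" "j < a' + b' + c'" for i j
  proof (cases "i < a")
    case True
    then show ?thesis using Q that assms by (auto simp: blk_lower_def)
  next
    case False
    have ij: "i = a + (i - a)" "j = a' + (j - a')" using False that by auto
    have lt: "i - a < b" "b' \<le> j - a'" "j - a' < b' + c'" using that False by auto
    then have "blk_W a a' (b + c) (b' + c') A $$ (i - a, j - a') = 0"
      using Q unfolding blk_lower_def by (metis blk_dims(6))
    then show ?thesis using ij lt by simp
  qed
  moreover have "A $$ (i, j) = 0" if "i < a" "a' \<le> j" "j < a' + b'" for i j
    using Q that assms by (auto simp: blk_lower_def)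
  ultimately show ?P using assms by (auto simp: blk_lower_def)
qed

subsection \<open>Invertible matrices\<close>

lemma Units_mat_alg:
  "Units (mat_alg n) = {A \<in> carrier_mat n n. det A \<noteq> (0 :: 'k::field)}"
  using unit_imp_det_non_zero[of _ n "()"] det_non_zero_imp_unit[of _ n "()"]
  by (auto simp: Units_def ring_mat_def)

lemma inv_mat_alg:
  fixes A :: "'k::field mat"
  assumes "A \<in> carrier_mat n n" "det A \<noteq> 0"
  shows "inv\<^bsub>mat_alg n\<^esub> A \<in> carrier_mat n n" "inv\<^bsub>mat_alg n\<^esub> A * A = 1\<^sub>m n"
    "A * inv\<^bsub>mat_alg n\<^esub> A = 1\<^sub>m n" "det (inv\<^bsub>mat_alg n\<^esub> A) \<noteq> 0"
proof -
  interpret M: ring "mat_alg n :: 'k mat ring" by (rule ring_mat)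
  have U: "A \<in> Units (mat_alg n)" using assms by (simp add: Units_mat_alg)
  show "inv\<^bsub>mat_alg n\<^esub> A \<in> carrier_mat n n" "inv\<^bsub>mat_alg n\<^esub> A * A = 1\<^sub>m n"
    "A * inv\<^bsub>mat_alg n\<^esub> A = 1\<^sub>m n" "det (inv\<^bsub>mat_alg n\<^esub> A) \<noteq> 0"
    using M.Units_inv_Units[OF U] M.Units_l_inv[OF U] M.Units_r_inv[OF U]
    unfolding Units_mat_alg by (simp_all add: ring_mat_simps)
qed

lemma inv_mat_alg_eqI:
  fixes A :: "'k::field mat"
  assumes A: "A \<in> carrier_mat n n" and B: "B \<in> carrier_mat n n" and AB: "A * B = 1\<^sub>m n"
  shows "inv\<^bsub>mat_alg n\<^esub> A = B"
proof -
  have "det A * det B = 1" using det_mult[OF A B] AB by simp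
  then have "det A \<noteq> 0" by auto
  note i = inv_mat_alg[OF A this]
  have "inv\<^bsub>mat_alg n\<^esub> A = inv\<^bsub>mat_alg n\<^esub> A * (A * B)" using AB i by simp
  also have "\<dots> = B" using i A B by (simp add: assoc_mult_mat[symmetric, of _ n n _ n _ n])
  finally show ?thesis .
qed

lemma mat_cancel:
  fixes A :: "'k::field mat"
  assumes "A \<in> carrier_mat n n" "det A \<noteq> 0" "B \<in> carrier_mat n l"
  shows "inv\<^bsub>mat_alg n\<^esub> A * (A * B) = B" "A * (inv\<^bsub>mat_alg n\<^esub> A * B) = B"
proof -
  note i = inv_mat_alg[OF assms(1,2)]
  show "inv\<^bsub>mat_alg n\<^esub> A * (A * B) = B"
    using i assms by (simp add: assoc_mult_mat[symmetric, of _ n n _ n _ l])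
  show "A * (inv\<^bsub>mat_alg n\<^esub> A * B) = B"
    using i assms by (simp add: assoc_mult_mat[symmetric, of _ n n _ n _ l])
qed

lemma mat_assoc4:
  fixes a b c d :: "'k::field mat"
  assumes a: "a \<in> carrier_mat n1 n2" and b: "b \<in> carrier_mat n2 n3" and c: "c \<in> carrier_mat n3 n4"
    and d: "d \<in> carrier_mat n4 n5"
  shows "a * b * c * d = a * (b * (c * d))" "a * (b * c) * d = a * (b * (c * d))"
proof -
  show 2: "a * (b * c) * d = a * (b * (c * d))"
    using assoc_mult_mat[OF a mult_carrier_mat[OF b c] d] assoc_mult_mat[OF b c d] by simp
  then show "a * b * c * d = a * (b * (c * d))" using assoc_mult_mat[OF a b c] by simp
qed

lemma mat_cancel_right:
  fixes M :: "'k::field mat"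
  assumes c: "c \<in> carrier_mat n n" "det c \<noteq> 0" and M: "M \<in> carrier_mat m n"
  shows "M * c * inv\<^bsub>mat_alg n\<^esub> c = M" "M * inv\<^bsub>mat_alg n\<^esub> c * c = M"
  using assoc_mult_mat[OF M c(1) inv_mat_alg(1)[OF c]] assoc_mult_mat[OF M inv_mat_alg(1)[OF c] c(1)]
    inv_mat_alg(2,3)[OF c] M by auto

lemma inv_mat_alg_mult:
  fixes A :: "'k::field mat"
  assumes A: "A \<in> carrier_mat n n" "det A \<noteq> 0" and B: "B \<in> carrier_mat n n" "det B \<noteq> 0"
  shows "inv\<^bsub>mat_alg n\<^esub> (A * B) = inv\<^bsub>mat_alg n\<^esub> B * inv\<^bsub>mat_alg n\<^esub> A"
proof (rule inv_mat_alg_eqI)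
  note i = inv_mat_alg[OF A] inv_mat_alg[OF B]
  have "A * B * (inv\<^bsub>mat_alg n\<^esub> B * inv\<^bsub>mat_alg n\<^esub> A) =
      A * (B * (inv\<^bsub>mat_alg n\<^esub> B * inv\<^bsub>mat_alg n\<^esub> A))"
    using i A B by (intro assoc_mult_mat) auto
  also have "\<dots> = 1\<^sub>m n" by (simp add: mat_cancel[OF B i(1)] i)
  finally show "A * B * (inv\<^bsub>mat_alg n\<^esub> B * inv\<^bsub>mat_alg n\<^esub> A) = 1\<^sub>m n" .
qed (use inv_mat_alg[OF A] inv_mat_alg[OF B] A B in auto)

lemma inv_mat_alg_one [simp]: "inv\<^bsub>mat_alg n\<^esub> (1\<^sub>m n :: 'k::field mat) = 1\<^sub>m n"
  by (rule inv_mat_alg_eqI) auto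

text \<open>
  An invertible matrix which maps the coordinate subspace \<open>W\<close> into itself maps it onto itself,
  so its inverse is block lower triangular as well; the blocks are inverted separately.
\<close>

lemma blk_inv:
  fixes A :: "'k::field mat"
  assumes A: "A \<in> carrier_mat (r + k) (r + k)" "det A \<noteq> 0" "blk_lower r r A"
  shows "blk_lower r r (inv\<^bsub>mat_alg (r + k)\<^esub> A)"
    "blk_T r r (inv\<^bsub>mat_alg (r + k)\<^esub> A) = inv\<^bsub>mat_alg r\<^esub> (blk_T r r A)"
    "blk_W r r k k (inv\<^bsub>mat_alg (r + k)\<^esub> A) = inv\<^bsub>mat_alg k\<^esub> (blk_W r r k k A)"
proof -
  let ?T = "blk_T r r A" and ?W = "blk_W r r k k A" and ?L = "blk_L r k r A"
  let ?T' = "inv\<^bsub>mat_alg r\<^esub> ?T" and ?W' = "inv\<^bsub>mat_alg k\<^esub> ?W"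
  have d: "det ?T \<noteq> 0" "det ?W \<noteq> 0" using det_blk_lower[OF A(1,3)] A(2) by auto
  note iT = inv_mat_alg[OF blk_carrier(1) d(1)] and iW = inv_mat_alg[OF blk_carrier(3) d(2)]
  let ?B = "lower_mat ?T' (- (?W' * (?L * ?T'))) ?W'"
  have c: "- (?W' * (?L * ?T')) \<in> carrier_mat k r" using iT iW by auto
  have "A * ?B = lower_mat (?T * ?T') (?L * ?T' + ?W * (- (?W' * (?L * ?T')))) (?W * ?W')"
    by (subst blk_lower_decomp[OF A(1,3)], subst lower_mat_mult) (use iT iW c in auto)
  also have "?W * (- (?W' * (?L * ?T'))) = - (?W * (?W' * (?L * ?T')))"
    using iT iW by (intro uminus_mult_right_mat) auto
  also have "?W * (?W' * (?L * ?T')) = ?L * ?T'"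
    by (rule mat_cancel(2)) (use d iT iW in auto)
  also have "?L * ?T' + - (?L * ?T') = 0\<^sub>m k r"
    using iT by (intro eq_matI) auto
  finally have AB: "A * ?B = 1\<^sub>m (r + k)" using iT iW by (simp add: four_block_one_mat)
  have i: "inv\<^bsub>mat_alg (r + k)\<^esub> A = ?B"
    by (rule inv_mat_alg_eqI[OF A(1) _ AB]) (use iT iW in auto)
  show "blk_lower r r (inv\<^bsub>mat_alg (r + k)\<^esub> A)"
    "blk_T r r (inv\<^bsub>mat_alg (r + k)\<^esub> A) = ?T'"
    "blk_W r r k k (inv\<^bsub>mat_alg (r + k)\<^esub> A) = ?W'"
    unfolding i by (rule blk_of_lower_mat; use iT iW c in simp)+
qed

lemma (in field_hom) map_mat_inv:
  assumes A: "A \<in> carrier_mat n n" "det A \<noteq> 0"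
  shows "map_mat hom (inv\<^bsub>mat_alg n\<^esub> A) = inv\<^bsub>mat_alg n\<^esub> (map_mat hom A)"
proof (rule inv_mat_alg_eqI[symmetric])
  note i = inv_mat_alg[OF A]
  show "map_mat hom A * map_mat hom (inv\<^bsub>mat_alg n\<^esub> A) = 1\<^sub>m n"
    using mat_hom_mult[OF A(1) i(1)] i(3) mat_hom_one by simp
qed (use A inv_mat_alg[OF A] in auto)

lemma conj_mult_mat:
  fixes A :: "'k::field mat"
  assumes "A \<in> carrier_mat n n" "A' \<in> carrier_mat n n" "x \<in> carrier_mat n m"
    and "B \<in> carrier_mat m m" "B' \<in> carrier_mat m m"
  shows "A * A' * x * (B' * B) = A * (A' * x * B') * B"
proof -
  have "A * A' * x * (B' * B) = A * (A' * x) * (B' * B)"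
    using assms by (simp add: assoc_mult_mat[of _ n n _ n _ m])
  also have "\<dots> = A * ((A' * x) * (B' * B))"
    using assms by (intro assoc_mult_mat) auto
  also have "(A' * x) * (B' * B) = A' * x * B' * B"
    using assms by (intro assoc_mult_mat[symmetric]) auto
  also have "A * (A' * x * B' * B) = A * (A' * x * B') * B"
    using assms by (intro assoc_mult_mat[symmetric]) auto
  finally show ?thesis .
qed

text \<open>
  The two kinds of arrows of the contraction that involve a bridge, \<open>x y\<close> and \<open>y\<inverse> x\<close>, do not see the
  change of basis \<open>c\<close> at the vertex where \<open>x\<close> meets the bridge \<open>y\<close>.
\<close>

lemma comp_conj:
  fixes l :: "'k::field mat"
  assumes l: "l \<in> carrier_mat m m" and x: "x \<in> carrier_mat m n" and c: "c \<in> carrier_mat n n" "det c \<noteq> 0"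
    and y: "y \<in> carrier_mat n n" and r: "r \<in> carrier_mat n n"
  shows "(l * x * inv\<^bsub>mat_alg n\<^esub> c) * (c * y * r) = l * (x * y) * r"
proof -
  note i = inv_mat_alg(1)[OF c]
  have yr: "y * r \<in> carrier_mat n n" and lx: "l * x \<in> carrier_mat m n" using y r l x by auto
  have cyr: "c * (y * r) \<in> carrier_mat n n" using c yr by auto
  have "(l * x * inv\<^bsub>mat_alg n\<^esub> c) * (c * y * r) = (l * x * inv\<^bsub>mat_alg n\<^esub> c) * (c * (y * r))"
    using assoc_mult_mat[OF c(1) y r] by simp
  also have "\<dots> = l * x * (inv\<^bsub>mat_alg n\<^esub> c * (c * (y * r)))" by (rule assoc_mult_mat[OF lx i cyr])
  also have "inv\<^bsub>mat_alg n\<^esub> c * (c * (y * r)) = y * r" by (rule mat_cancel(1)[OF c yr])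
  also have "l * x * (y * r) = l * (x * (y * r))" by (rule assoc_mult_mat[OF l x yr])
  also have "\<dots> = l * (x * y) * r" by (rule mat_assoc4(2)[OF l x y r, symmetric])
  finally show ?thesis .
qed

lemma bar_conj:
  fixes c :: "'k::field mat"
  assumes c: "c \<in> carrier_mat n n" "det c \<noteq> 0" and y: "y \<in> carrier_mat n n" "det y \<noteq> 0"
    and t: "t \<in> carrier_mat n n" "det t \<noteq> 0" and x: "x \<in> carrier_mat n m" and r: "r \<in> carrier_mat m m"
  shows "inv\<^bsub>mat_alg n\<^esub> (c * y * inv\<^bsub>mat_alg n\<^esub> t) * (c * x * r) = t * (inv\<^bsub>mat_alg n\<^esub> y * x) * r"
proof -
  let ?I = "\<lambda>M. inv\<^bsub>mat_alg n\<^esub> M"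
  note ic = inv_mat_alg[OF c] and iy = inv_mat_alg[OF y] and it = inv_mat_alg[OF t]
  have d1: "det (c * y) \<noteq> 0" using det_mult[OF c(1) y(1)] c y by simp
  have iI: "?I (?I t) = t" by (rule inv_mat_alg_eqI[OF it(1) t(1) it(2)])
  have xr: "x * r \<in> carrier_mat n m" using x r by auto
  have cxr: "c * (x * r) \<in> carrier_mat n m" using c xr by auto
  have "?I (c * y * ?I t) = t * (?I y * ?I c)"
    using inv_mat_alg_mult[OF mult_carrier_mat[OF c(1) y(1)] d1 it(1,4)]
      inv_mat_alg_mult[OF c y] iI by simp
  then have "?I (c * y * ?I t) * (c * x * r) = t * (?I y * ?I c) * (c * (x * r))"
    using assoc_mult_mat[OF c(1) x r] by simp
  also have "\<dots> = t * (?I y * (?I c * (c * (x * r))))" by (rule mat_assoc4(2)[OF t(1) iy(1) ic(1) cxr])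
  also have "?I c * (c * (x * r)) = x * r" by (rule mat_cancel(1)[OF c xr])
  also have "t * (?I y * (x * r)) = t * (?I y * x) * r" by (rule mat_assoc4(2)[OF t(1) iy(1) x r, symmetric])
  finally show ?thesis .
qed

text \<open>
  The inverse of an invertible block lower triangular matrix is block lower triangular again.
\<close>

lemma blk_lower_mult_right_iff:
  fixes M :: "'k::field mat"
  assumes M: "M \<in> carrier_mat (r + k) (n + m)" and B: "B \<in> carrier_mat (n + m) (n + m)" "det B \<noteq> 0" "blk_lower n n B"
  shows "blk_lower r n (M * B) \<longleftrightarrow> blk_lower r n M"
proof
  assume l: "blk_lower r n (M * B)"
  have "M * B * inv\<^bsub>mat_alg (n + m)\<^esub> B = M" by (rule mat_cancel_right(1)[OF B(1,2) M])
  moreover have "blk_lower r n (M * B * inv\<^bsub>mat_alg (n + m)\<^esub> B)"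
    by (rule blk_mult(1)[OF mult_carrier_mat[OF M B(1)] l inv_mat_alg(1)[OF B(1,2)] blk_inv(1)[OF B]])
  ultimately show "blk_lower r n M" by simp
qed (rule blk_mult(1)[OF M _ B(1,3)])

lemma blk_lower_mult_left_iff:
  fixes M :: "'k::field mat"
  assumes M: "M \<in> carrier_mat (n + m) (c + l)" and B: "B \<in> carrier_mat (n + m) (n + m)" "det B \<noteq> 0" "blk_lower n n B"
  shows "blk_lower n c (inv\<^bsub>mat_alg (n + m)\<^esub> B * M) \<longleftrightarrow> blk_lower n c M"
proof
  assume b: "blk_lower n c (inv\<^bsub>mat_alg (n + m)\<^esub> B * M)"
  have "B * (inv\<^bsub>mat_alg (n + m)\<^esub> B * M) = M" by (rule mat_cancel(2)[OF B(1,2) M])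
  moreover have "blk_lower n c (B * (inv\<^bsub>mat_alg (n + m)\<^esub> B * M))"
    by (rule blk_mult(1)[OF B(1,3) mult_carrier_mat[OF inv_mat_alg(1)[OF B(1,2)] M] b])
  ultimately show "blk_lower n c M" by simp
qed (rule blk_mult(1)[OF inv_mat_alg(1)[OF B(1,2)] blk_inv(1)[OF B] M])

subsection \<open>Stabilisers of the coordinate subspace\<close>

abbreviation coordW :: "nat \<Rightarrow> nat \<Rightarrow> 'k::zero vec set" where
  "coordW c l \<equiv> {w \<in> carrier_vec (c + l). \<forall>j<c. w $ j = 0}"

lemma mat_mult_unit_vec:
  assumes "A \<in> carrier_mat n m" "j < m" "i < n"
  shows "(A *\<^sub>v unit_vec m j) $ i = (A $$ (i, j) :: 'k::semiring_1)"
  using assms by (auto simp: scalar_prod_right_unit[of _ m])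

lemma coordW_stable_iff:
  fixes A :: "'k::comm_ring_1 mat"
  assumes A: "A \<in> carrier_mat (r + k) (c + l)"
  shows "(\<forall>w\<in>coordW c l. A *\<^sub>v w \<in> coordW r k) \<longleftrightarrow> blk_lower r c A"
proof
  assume s: "\<forall>w\<in>coordW c l. A *\<^sub>v w \<in> coordW r k"
  show "blk_lower r c A" unfolding blk_lower_def
  proof safe
    fix i j assume ij: "i < r" "c \<le> j" "j < dim_col A"
    have "unit_vec (c + l) j \<in> coordW c l" using ij A by (auto simp: unit_vec_def)
    then have "A *\<^sub>v unit_vec (c + l) j \<in> coordW r k" using s by blast
    then have "(A *\<^sub>v unit_vec (c + l) j) $ i = 0" using ij by blast
    then show "A $$ (i, j) = 0" using mat_mult_unit_vec[OF A, of j i] ij A by auto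
  qed
next
  assume b: "blk_lower r c A"
  show "\<forall>w\<in>coordW c l. A *\<^sub>v w \<in> coordW r k"
  proof safe
    fix w :: "'k vec" assume w: "w \<in> carrier_vec (c + l)" "\<forall>j<c. w $ j = 0"
    show "A *\<^sub>v w \<in> carrier_vec (r + k)" using A w by auto
    fix i assume i: "i < r"
    have "row A i $ j * w $ j = 0" if "j < c + l" for j
      using that b w i A by (cases "j < c") (auto simp: blk_lower_def)
    then show "(A *\<^sub>v w) $ i = 0" using A w i by (auto simp: scalar_prod_def intro!: sum.neutral)
  qed
qed

lemma coordW_image_iff:
  fixes A :: "'k::field mat"
  assumes A: "A \<in> carrier_mat (r + k) (r + k)" "det A \<noteq> 0"
  shows "(\<lambda>w. A *\<^sub>v w) ` coordW r k = coordW r k \<longleftrightarrow> blk_lower r r A"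
proof
  assume "(\<lambda>w. A *\<^sub>v w) ` coordW r k = coordW r k"
  then show "blk_lower r r A" using coordW_stable_iff[OF A(1)] by blast
next
  assume b: "blk_lower r r A"
  note i = inv_mat_alg[OF A]
  have 1: "\<forall>w\<in>coordW r k. A *\<^sub>v w \<in> coordW r k" using coordW_stable_iff[OF A(1)] b by blast
  have 2: "\<forall>w\<in>coordW r k. inv\<^bsub>mat_alg (r + k)\<^esub> A *\<^sub>v w \<in> coordW r k"
    using coordW_stable_iff[OF i(1), of] blk_inv(1)[OF A b] by blast
  have "A *\<^sub>v (inv\<^bsub>mat_alg (r + k)\<^esub> A *\<^sub>v w) = w" if "w \<in> coordW r k" for w
    using that i A by (simp add: assoc_mult_mat_vec[symmetric])
  then show "(\<lambda>w. A *\<^sub>v w) ` coordW r k = coordW r k"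
    using 1 2 by (auto simp: image_iff) (metis (no_types, lifting) mem_Collect_eq)
qed

lemma mat_mult_zero_vec:
  "A \<in> carrier_mat n m \<Longrightarrow> A *\<^sub>v 0\<^sub>v m = (0\<^sub>v n :: 'k::semiring_1 vec)"
  by (intro eq_vecI) auto

lemma unipotent_iff:
  fixes A :: "'k::comm_ring_1 mat"
  assumes A: "A \<in> carrier_mat (r + k) (r + k)" "blk_lower r r A"
  shows "(\<forall>w\<in>coordW r k. A *\<^sub>v w = w) \<and> (\<forall>u\<in>carrier_vec (r + k). A *\<^sub>v u - u \<in> coordW r k)
    \<longleftrightarrow> blk_T r r A = 1\<^sub>m r \<and> blk_W r r k k A = 1\<^sub>m k"
proof (intro iffI conjI ballI)
  assume s: "(\<forall>w\<in>coordW r k. A *\<^sub>v w = w) \<and> (\<forall>u\<in>carrier_vec (r + k). A *\<^sub>v u - u \<in> coordW r k)"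
  show "blk_T r r A = 1\<^sub>m r"
  proof (rule eq_matI)
    fix i j assume ij: "i < dim_row (1\<^sub>m r :: 'k mat)" "j < dim_col (1\<^sub>m r :: 'k mat)"
    have "(A *\<^sub>v unit_vec (r + k) j - unit_vec (r + k) j) $ i = 0" using s ij by auto
    then show "blk_T r r A $$ (i, j) = 1\<^sub>m r $$ (i, j)"
      using mat_mult_unit_vec[OF A(1), of j i] ij A(1) by (auto split: if_splits)
  qed auto
  show "blk_W r r k k A = 1\<^sub>m k"
  proof (rule eq_matI)
    fix i j assume ij: "i < dim_row (1\<^sub>m k :: 'k mat)" "j < dim_col (1\<^sub>m k :: 'k mat)"
    have "unit_vec (r + k) (r + j) \<in> coordW r k" using ij by (auto simp: unit_vec_def)
    then have "A *\<^sub>v unit_vec (r + k) (r + j) = unit_vec (r + k) (r + j)" using s by blast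
    then show "blk_W r r k k A $$ (i, j) = 1\<^sub>m k $$ (i, j)"
      using mat_mult_unit_vec[OF A(1), of "r + j" "r + i"] ij A(1) by (auto split: if_splits)
  qed auto
next
  assume s: "blk_T r r A = 1\<^sub>m r \<and> blk_W r r k k A = 1\<^sub>m k"
  have eq: "A *\<^sub>v u = vec_first u r @\<^sub>v (blk_L r k r A *\<^sub>v vec_first u r + vec_last u k)"
    if u: "u \<in> carrier_vec (r + k)" for u
  proof -
    have "A *\<^sub>v u = lower_mat (1\<^sub>m r) (blk_L r k r A) (1\<^sub>m k) *\<^sub>v (vec_first u r @\<^sub>v vec_last u k)"
      using blk_lower_decomp[OF A] s u by (simp add: vec_first_last_append)
    also have "\<dots> = (1\<^sub>m r *\<^sub>v vec_first u r + 0\<^sub>m r k *\<^sub>v vec_last u k) @\<^sub>v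
       (blk_L r k r A *\<^sub>v vec_first u r + 1\<^sub>m k *\<^sub>v vec_last u k)"
      by (subst four_block_mat_mult_vec[of _ r r _ k _ k]) auto
    finally show ?thesis by auto
  qed
  {
    fix w :: "'k vec" assume w: "w \<in> coordW r k"
    then have z: "vec_first w r = 0\<^sub>v r" by (auto simp: vec_first_def intro!: eq_vecI)
    have c: "w \<in> carrier_vec (r + k)" using w by simp
    have "A *\<^sub>v w = vec_first w r @\<^sub>v vec_last w k"
      unfolding eq[OF c] z using left_zero_vec[of "vec_last w k" k] by (simp add: mat_mult_zero_vec[OF blk_carrier(2)])
    then show "A *\<^sub>v w = w" using c by (simp add: vec_first_last_append)
  next
    fix u :: "'k vec" assume u: "u \<in> carrier_vec (r + k)"
    have "A *\<^sub>v u - u \<in> carrier_vec (r + k)" using A(1) u by auto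
    moreover have "(A *\<^sub>v u - u) $ i = 0" if "i < r" for i
      unfolding eq[OF u] using u that by (auto simp: vec_first_def)
    ultimately show "A *\<^sub>v u - u \<in> coordW r k" by blast
  }
qed

section \<open>Frobenius fixed points of families of matrices\<close>

lemma self_in_orbit_of_bij_betw:
  assumes "finite A" "bij_betw a A A" "v \<in> A"
  shows "v \<in> orbit a v"
proof -
  define a' where "a' = (\<lambda>x. if x \<in> A then a x else x)"
  have bb: "bij_betw a' A A" using assms(2) by (rule bij_betw_cong[THEN iffD1, rotated]) (simp add: a'_def)
  have "a' permutes A" by (rule bij_imp_permutes[OF bb]) (simp add: a'_def)
  then have "permutation a'" using assms(1) permutation_permutes by blast
  then have "v \<in> orbit a' v" by (rule permutation_self_in_orbit)
  moreover have "orbit a v = orbit a' v"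
    by (rule orbit_cong0[of v A]) (use assms bij_betwE in \<open>auto simp: a'_def\<close>)
  ultimately show ?thesis by simp
qed

lemma orbit_of_bij_betw:
  assumes "finite A" "bij_betw a A A" "v \<in> A"
  shows "orbit a (a v) = orbit a v" "orbit a v \<subseteq> A"
proof -
  have in_A: "a x \<in> A" if "x \<in> A" for x using that assms(2) bij_betwE by blast
  have "v \<in> orbit a (a v)"
    by (rule orbit_swap[OF self_in_orbit_of_bij_betw[OF assms] orbit.base])
  then show "orbit a (a v) = orbit a v"
    using orbit_trans[of _ a "a v" v] orbit_trans[of _ a v "a v"] orbit.base[of a v] by blast
  show "orbit a v \<subseteq> A"
  proof
    fix x assume "x \<in> orbit a v"
    then show "x \<in> A" by induction (use assms(3) in_A in auto)
  qed
qed

lemma returns_of_bij_betw: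
  assumes "finite A" "bij_betw a A A" "v \<in> A"
  shows "\<exists>n>0. (a ^^ n) v = v"
  using self_in_orbit_of_bij_betw[OF assms] by (auto simp: orbit_altdef)

locale frobenius =
  fixes p e q :: nat and K :: "'k::alg_closed_field itself"
  assumes p: "prime p" and char: "CHAR('k) = p" and e: "e \<ge> 1" and q: "q = p ^ e"
begin

lemma q_gt_1: "q > 1"
  using p e unfolding q by (metis less_eq_Suc_le One_nat_def one_less_power prime_gt_1_nat)

lemma fr_add: "(x + y) ^ q = (x ^ q + y ^ q :: 'k)"
  using freshmans_dream'[where ?'a = 'k, of q e x y] p char q by simp

lemma fr_pow_Suc: "x ^ (q ^ Suc n) = ((x ^ (q ^ n)) ^ q :: 'k)"
  by (metis power_Suc2 power_mult)

lemma fr_add_pow: "(x + y) ^ (q ^ n) = (x ^ (q ^ n) + y ^ (q ^ n) :: 'k)"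
  by (induction n) (simp_all add: fr_pow_Suc fr_add del: power_Suc)

lemma fr_hom: "field_hom (\<lambda>z :: 'k. z ^ q)"
proof
  show "(1::'k) ^ q = 1" by simp
  show "(0::'k) ^ q = 0" using q_gt_1 by simp
qed (auto simp: fr_add power_mult_distrib)

lemma fr_inj: "x ^ q = y ^ q \<Longrightarrow> x = (y :: 'k)"
proof -
  assume "x ^ q = y ^ q"
  then have "(x - y) ^ q + y ^ q = 0 + y ^ q" using fr_add[of "x - y" y] by simp
  then show ?thesis by simp
qed

text \<open>
  The polynomial has positive degree. With \<open>b = 0\<close> it yields \<open>N\<close>-th roots, with \<open>b = 1\<close> solutions of
  Artin-Schreier equations.
\<close>

lemma root_exists:
  assumes "N > 1"
  shows "\<exists>x :: 'k. x ^ N + c = b * x"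
proof -
  let ?P = "monom 1 N + [:c:] - monom b 1"
  have "coeff ?P N = 1" using assms by (auto simp: coeff_pCons split: nat.splits)
  then have "degree ?P \<ge> N" by (intro le_degree) simp
  then have "degree ?P > 0" using assms by simp
  then obtain x where "poly ?P x = 0" using alg_closed_imp_poly_has_root by blast
  then show ?thesis by (auto simp: poly_monom algebra_simps)
qed

lemma finite_fixed:
  assumes "n > 0"
  shows "finite {x :: 'k. x ^ (q ^ n) = x}"
proof -
  have N: "q ^ n > 1" using q_gt_1 assms one_less_power by blast
  let ?P = "monom 1 (q ^ n) - monom 1 1 :: 'k poly"
  have "coeff ?P (q ^ n) = 1" using N by auto
  then have "?P \<noteq> 0" by (metis coeff_0 zero_neq_one)
  then have "finite {x. poly ?P x = 0}" by (rule poly_roots_finite)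
  then show ?thesis by (simp add: poly_monom)
qed

definition fr_root :: "'k \<Rightarrow> 'k" where
  "fr_root y = (SOME x. x ^ q = y)"

lemma fr_root [simp]: "fr_root y ^ q = y" "fr_root (y ^ q) = y"
proof -
  show *: "fr_root y ^ q = y" for y :: 'k
    unfolding fr_root_def using root_exists[OF q_gt_1, of "- y" 0]
    by (intro someI_ex[where P = "\<lambda>x. x ^ q = y"]) auto
  show "fr_root (y ^ q) = y" by (rule fr_inj) (rule *)
qed

lemma fr_root_hom: "field_hom fr_root"
proof
  show "fr_root 1 = 1" "fr_root 0 = 0" by (rule fr_inj, use q_gt_1 in simp)+
  show "fr_root (x + y) = fr_root x + fr_root y" "fr_root (x * y) = fr_root x * fr_root y" for x y
    by (rule fr_inj, simp add: fr_add power_mult_distrib)+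
qed

text \<open>
  Lang's theorem for the additive group, in the form needed for a Frobenius map which also permutes
  the coordinates: running once around an \<open>a\<close>-orbit of length \<open>n\<close> turns the equation into
  \<open>t = t ^ (q ^ n) + c\<close>, which has a root.
\<close>

lemma twisted_artin_schreier:
  fixes \<beta> :: "'x \<Rightarrow> 'k"
  assumes A: "finite A" "bij_betw a A A"
  shows "\<exists>z. \<forall>v\<in>A. z (a v) = z v ^ q + \<beta> (a v)"
proof -
  \<comment> \<open>\<open>r v\<close> is a base point of the orbit of \<open>v\<close>, \<open>w u t k\<close> the value which the equation forces at the \<open>k\<close>-th
    point after \<open>u\<close> if \<open>t\<close> is the value at \<open>u\<close>, \<open>n u\<close> the length of the orbit of \<open>u\<close>, and \<open>k v\<close> the position of \<open>v\<close>.\<close>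
  define r where "r v = (SOME u. u \<in> orbit a v)" for v
  define w where "w u t = rec_nat t (\<lambda>k y. y ^ q + \<beta> ((a ^^ Suc k) u))" for u t
  have w: "w u t 0 = t" "w u t (Suc k) = w u t k ^ q + \<beta> (a ((a ^^ k) u))" for u t k
    by (simp_all add: w_def)
  have w_add: "w u t k = t ^ (q ^ k) + w u 0 k" for u t k
    by (induction k) (simp_all add: w fr_add fr_pow_Suc del: power_Suc)
  define n where "n u = (LEAST n. n > 0 \<and> (a ^^ n) u = u)" for u
  have n: "n u > 0 \<and> (a ^^ n u) u = u" if "u \<in> A" for u
    unfolding n_def by (rule LeastI_ex) (use returns_of_bij_betw[OF A that] in blast)
  \<comment> \<open>The value at the base point has to be reproduced after one round.\<close>
  have "\<exists>t. w u t (n u) = t" if "u \<in> A" for u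
  proof -
    have "q ^ n u > 1" using n[OF that] q_gt_1 one_less_power by blast
    from root_exists[OF this, of "w u 0 (n u)" 1] show ?thesis by (metis mult_1 w_add)
  qed
  then obtain t where t: "\<And>u. u \<in> A \<Longrightarrow> w u (t u) (n u) = t u" by metis
  define k where "k v = (LEAST k. (a ^^ k) (r v) = v)" for v
  have aA: "a v \<in> A" if "v \<in> A" for v using that A bij_betwE by blast
  have inj: "x = y" if "a x = a y" "x \<in> A" "y \<in> A" for x y
    using that A by (meson bij_betw_imp_inj_on inj_on_def)
  have rA: "r v \<in> A" and k: "(a ^^ k v) (r v) = v" and r_step: "r (a v) = r v" if v: "v \<in> A" for v
  proof -
    have "r v \<in> orbit a v" unfolding r_def
      by (rule someI[where P = "\<lambda>u. u \<in> orbit a v"]) (rule self_in_orbit_of_bij_betw[OF A v])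
    moreover then show rA: "r v \<in> A" using orbit_of_bij_betw(2)[OF A v] by blast
    ultimately have "v \<in> orbit a (r v)"
      using orbit_swap[OF self_in_orbit_of_bij_betw[OF A v]] by blast
    then have "\<exists>k. (a ^^ k) (r v) = v" by (auto simp: orbit_altdef intro: sym)
    then show "(a ^^ k v) (r v) = v" unfolding k_def by (rule LeastI_ex)
    show "r (a v) = r v" unfolding r_def orbit_of_bij_betw(1)[OF A v] ..
  qed
  have iter: "(a ^^ m) u \<in> A" if "u \<in> A" for u m by (induction m) (use that aA in auto)
  have pred: "k v \<le> m" if v: "v \<in> A" and m: "(a ^^ Suc m) (r v) = a v" for v m
  proof -
    have "(a ^^ m) (r v) = v" using inj[OF _ iter[OF rA[OF v]] v] m by simp
    then show ?thesis unfolding k_def by (rule Least_le)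
  qed
  define z where "z v = w (r v) (t (r v)) (k v)" for v
  have "z (a v) = z v ^ q + \<beta> (a v)" if v: "v \<in> A" for v
  proof -
    have step: "w (r v) (t (r v)) (Suc (k v)) = z v ^ q + \<beta> (a v)"
      using k[OF v] by (simp add: w z_def)
    show ?thesis
    proof (cases "a v = r v")
      case True
      have k0: "k (a v) = 0" unfolding k_def r_step[OF v] using True by (intro Least_eq_0) simp
      have "n (r v) \<le> Suc (k v)"
        unfolding n_def by (rule Least_le) (use k[OF v] True in simp)
      moreover have "Suc (k v) \<le> n (r v)"
      proof -
        obtain m where m: "n (r v) = Suc m" using n[OF rA[OF v]] by (metis gr0_conv_Suc)
        have "k v \<le> m" by (rule pred[OF v]) (use n[OF rA[OF v]] m True in simp)
        then show ?thesis using m by simp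
      qed
      ultimately have "Suc (k v) = n (r v)" by simp
      then have "w (r v) (t (r v)) (Suc (k v)) = t (r v)" using t[OF rA[OF v]] by simp
      then show ?thesis using step k0 by (simp add: z_def r_step[OF v] w)
    next
      case False
      have 1: "k (a v) \<le> Suc (k v)" unfolding k_def[of "a v"] r_step[OF v]
        by (rule Least_le) (use k[OF v] in simp)
      have ka: "(a ^^ k (a v)) (r v) = a v" using k[OF aA[OF v]] r_step[OF v] by simp
      then have "k (a v) \<noteq> 0" using False by (metis funpow_0)
      then obtain m where m: "k (a v) = Suc m" using not0_implies_Suc by blast
      then have "k v \<le> m" using pred[OF v] ka by metis
      then have "k (a v) = Suc (k v)" using 1 m by simp
      then show ?thesis using step by (simp add: z_def r_step[OF v])
    qed
  qed
  then show ?thesis by blast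
qed

abbreviation fr :: "'k mat \<Rightarrow> 'k mat" where
  "fr \<equiv> map_mat (\<lambda>z. z ^ q)"

lemma fr_mult: "M \<in> carrier_mat a b \<Longrightarrow> N \<in> carrier_mat b c \<Longrightarrow> fr (M * N) = fr M * fr N"
proof -
  interpret fr: field_hom "\<lambda>z :: 'k. z ^ q" by (rule fr_hom)
  show "M \<in> carrier_mat a b \<Longrightarrow> N \<in> carrier_mat b c \<Longrightarrow> fr (M * N) = fr M * fr N" by (rule fr.mat_hom_mult)
qed

lemma fr_inv: "M \<in> carrier_mat n n \<Longrightarrow> det M \<noteq> 0 \<Longrightarrow> fr (inv\<^bsub>mat_alg n\<^esub> M) = inv\<^bsub>mat_alg n\<^esub> (fr M)"
  by (rule field_hom.map_mat_inv[OF fr_hom])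

text \<open>
  The Frobenius-fixed points of a product of spaces of matrices, when Frobenius also permutes the factors
  by \<open>a\<close>.
\<close>

definition mfam :: "'x set \<Rightarrow> ('x \<Rightarrow> 'x) \<Rightarrow> ('x \<Rightarrow> nat) \<Rightarrow> ('x \<Rightarrow> nat) \<Rightarrow> ('x \<Rightarrow> 'k mat) set" where
  "mfam A a r c =
    {M \<in> (\<Pi>\<^sub>E v\<in>A. carrier_mat (r v) (c v)). \<forall>v\<in>A. M (a v) = fr (M v)}"

lemma finite_mats:
  assumes "finite S"
  shows "finite {M \<in> carrier_mat r c. \<forall>i<r. \<forall>j<c. M $$ (i, j) \<in> S}"
proof (rule finite_subset)
  show "finite (mat r c ` (({..<r} \<times> {..<c}) \<rightarrow>\<^sub>E S))"
    by (intro finite_imageI finite_PiE) (use assms in auto)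
  show "{M \<in> carrier_mat r c. \<forall>i<r. \<forall>j<c. M $$ (i, j) \<in> S}
      \<subseteq> mat r c ` (({..<r} \<times> {..<c}) \<rightarrow>\<^sub>E S)"
  proof
    fix M assume "M \<in> {M \<in> carrier_mat r c. \<forall>i<r. \<forall>j<c. M $$ (i, j) \<in> S}"
    then show "M \<in> mat r c ` (({..<r} \<times> {..<c}) \<rightarrow>\<^sub>E S)"
      by (intro image_eqI[of _ _ "\<lambda>ij\<in>{..<r} \<times> {..<c}. M $$ ij"]) (auto intro!: eq_matI)
  qed
qed

text \<open>
  After one round of the \<open>a\<close>-orbit of \<open>v\<close>, of length \<open>n\<close>, the entries of \<open>M v\<close> are found to be roots of
  \<open>x ^ (q ^ n) = x\<close>.
\<close>

lemma finite_mfam: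
  assumes A: "finite A" "bij_betw a A A"
  shows "finite (mfam A a r c)"
proof -
  have aA: "a v \<in> A" if "v \<in> A" for v using that A bij_betwE by blast
  obtain n where n: "\<And>v. v \<in> A \<Longrightarrow> n v > 0 \<and> (a ^^ n v) v = v"
    using returns_of_bij_betw[OF A] by metis
  let ?S = "\<lambda>v. {M \<in> carrier_mat (r v) (c v). \<forall>i<r v. \<forall>j<c v. M $$ (i, j) \<in> {x :: 'k. x ^ (q ^ n v) = x}}"
  have "mfam A a r c \<subseteq> (\<Pi>\<^sub>E v\<in>A. ?S v)"
  proof
    fix M assume M: "M \<in> mfam A a r c"
    have it: "(a ^^ m) v \<in> A \<and> M ((a ^^ m) v) = map_mat (\<lambda>z. z ^ (q ^ m)) (M v)"
      if "v \<in> A" for v m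
    proof (induction m)
      case 0
      show ?case using that by (auto intro!: eq_matI)
    next
      case (Suc m)
      then have "M ((a ^^ Suc m) v) = fr (M ((a ^^ m) v))" using M by (simp add: mfam_def)
      then show ?case using Suc aA by (auto intro!: eq_matI simp: fr_pow_Suc simp del: power_Suc)
    qed
    have "M v \<in> ?S v" if v: "v \<in> A" for v
    proof -
      have c: "M v \<in> carrier_mat (r v) (c v)" using M v by (auto simp: mfam_def)
      have eq: "M v = map_mat (\<lambda>z. z ^ (q ^ n v)) (M v)" using it[OF v, of "n v"] n[OF v] by simp
      have "M v $$ (i, j) ^ (q ^ n v) = M v $$ (i, j)" if "i < r v" "j < c v" for i j
        using arg_cong[OF eq, of "\<lambda>B. B $$ (i, j)"] c that by simp
      then show ?thesis using c by auto
    qed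
    then show "M \<in> (\<Pi>\<^sub>E v\<in>A. ?S v)" using M by (auto simp: mfam_def PiE_iff)
  qed
  moreover have "finite (?S v)" if "v \<in> A" for v
    using finite_mats[OF finite_fixed[of "n v"], of "r v" "c v"] n[OF that] by simp
  then have "finite (\<Pi>\<^sub>E v\<in>A. ?S v)" by (rule finite_PiE[OF A(1)])
  ultimately show ?thesis by (rule finite_subset)
qed

lemma frob_fixed_iff:
  assumes a: "bij_betw a A A" and M: "M \<in> extensional A"
  shows "(\<lambda>v\<in>A. fr (M (inv_into A a v))) = M \<longleftrightarrow> (\<forall>v\<in>A. M (a v) = fr (M v))"
proof
  assume e: "(\<lambda>v\<in>A. fr (M (inv_into A a v))) = M"
  show "\<forall>v\<in>A. M (a v) = fr (M v)"
  proof
    fix v assume v: "v \<in> A"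
    then have "a v \<in> A" using a bij_betwE by blast
    then have "M (a v) = fr (M (inv_into A a (a v)))" using fun_cong[OF e, of "a v"] by simp
    then show "M (a v) = fr (M v)" using v a by (simp add: bij_betw_inv_into_left)
  qed
next
  assume f: "\<forall>v\<in>A. M (a v) = fr (M v)"
  show "(\<lambda>v\<in>A. fr (M (inv_into A a v))) = M"
  proof (rule extensionalityI[of _ A])
    fix v assume v: "v \<in> A"
    then have "inv_into A a v \<in> A" using a by (metis bij_betw_imp_surj_on inv_into_into)
    then show "(\<lambda>v\<in>A. fr (M (inv_into A a v))) v = M v"
      using f[rule_format, of "inv_into A a v"] v a by (simp add: bij_betw_inv_into_right)
  qed (use M in auto)
qed

end

section \<open>Gauge groups and their action\<close>

locale hall_data = frobenius p e q K
  for p e q :: nat and K :: "'k::alg_closed_field itself" +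
  fixes \<Gamma> :: "('v, 'h) aut_digraph"
  assumes admissible: "admissible \<Gamma>"
begin

abbreviation dm :: "('v set \<Rightarrow> nat) \<Rightarrow> 'v \<Rightarrow> nat" where "dm \<equiv> vdim \<Gamma>"
abbreviation V :: "'v set" where "V \<equiv> verts \<Gamma>"
abbreviation A :: "'h set" where "A \<equiv> arcs \<Gamma>"

lemma fin_V [simp, intro]: "finite V" and fin_A [simp, intro]: "finite A"
proof -
  interpret fin_digraph "pre_digraph.truncate \<Gamma>" using admissible by (simp add: admissible_def)
  show "finite V" "finite A" using finite_verts finite_arcs by (simp_all add: pre_digraph.defs)
qed

lemma tail_in [simp, intro]: "h \<in> A \<Longrightarrow> tail \<Gamma> h \<in> V"
  and head_in [simp, intro]: "h \<in> A \<Longrightarrow> head \<Gamma> h \<in> V"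
proof -
  interpret fin_digraph "pre_digraph.truncate \<Gamma>" using admissible by (simp add: admissible_def)
  show "h \<in> A \<Longrightarrow> tail \<Gamma> h \<in> V" "h \<in> A \<Longrightarrow> head \<Gamma> h \<in> V"
    using tail_in_verts[of h] head_in_verts[of h] by (simp_all add: pre_digraph.defs)
qed

lemma vaut_bij: "bij_betw (vaut \<Gamma>) V V" and aaut_bij: "bij_betw (aaut \<Gamma>) A A"
  and tail_aaut [simp]: "h \<in> A \<Longrightarrow> tail \<Gamma> (aaut \<Gamma> h) = vaut \<Gamma> (tail \<Gamma> h)"
  and head_aaut [simp]: "h \<in> A \<Longrightarrow> head \<Gamma> (aaut \<Gamma> h) = vaut \<Gamma> (head \<Gamma> h)"
  and orbit_tail_head: "h \<in> A \<Longrightarrow> orbit (vaut \<Gamma>) (tail \<Gamma> h) \<noteq> orbit (vaut \<Gamma>) (head \<Gamma> h)"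
  using admissible by (auto simp: admissible_def)

lemma vaut_in [simp, intro]: "v \<in> V \<Longrightarrow> vaut \<Gamma> v \<in> V"
  using vaut_bij bij_betwE by blast

lemma aaut_in [simp, intro]: "h \<in> A \<Longrightarrow> aaut \<Gamma> h \<in> A"
  using aaut_bij bij_betwE by blast

abbreviation vinv :: "'v \<Rightarrow> 'v" where "vinv \<equiv> inv_into V (vaut \<Gamma>)"
abbreviation ainv :: "'h \<Rightarrow> 'h" where "ainv \<equiv> inv_into A (aaut \<Gamma>)"

lemma vinv [simp]: "v \<in> V \<Longrightarrow> vinv v \<in> V" "v \<in> V \<Longrightarrow> vaut \<Gamma> (vinv v) = v"
  "v \<in> V \<Longrightarrow> vinv (vaut \<Gamma> v) = v"
  using vaut_bij by (auto simp: bij_betw_inv_into_left bij_betw_inv_into_right bij_betw_def inv_into_into)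

lemma ainv [simp]: "h \<in> A \<Longrightarrow> ainv h \<in> A" "h \<in> A \<Longrightarrow> aaut \<Gamma> (ainv h) = h"
  "h \<in> A \<Longrightarrow> ainv (aaut \<Gamma> h) = h"
  using aaut_bij by (auto simp: bij_betw_inv_into_left bij_betw_inv_into_right bij_betw_def inv_into_into)

lemma ends_ainv [simp]:
  assumes "h \<in> A"
  shows "tail \<Gamma> (ainv h) = vinv (tail \<Gamma> h)" "head \<Gamma> (ainv h) = vinv (head \<Gamma> h)"
  using tail_aaut[of "ainv h"] head_aaut[of "ainv h"] assms by (metis ainv(1,2) tail_in head_in vinv(3))+

lemma dm_vaut [simp]: "v \<in> V \<Longrightarrow> dm \<nu> (vaut \<Gamma> v) = dm \<nu> v"
  by (simp add: vdim_def orbit_of_bij_betw(1)[OF fin_V vaut_bij])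

lemma dm_vinv [simp]: "v \<in> V \<Longrightarrow> dm \<nu> (vinv v) = dm \<nu> v"
  using dm_vaut[of "vinv v" \<nu>] by simp

lemma dm_dplus [simp]: "dm (dplus \<tau> \<omega>) v = dm \<tau> v + dm \<omega> v"
  by (simp add: vdim_def dplus_def)

abbreviation G :: "('v set \<Rightarrow> nat) \<Rightarrow> ('v \<Rightarrow> 'k mat) set" where "G \<equiv> gauge \<Gamma>"
abbreviation E :: "('v set \<Rightarrow> nat) \<Rightarrow> ('h \<Rightarrow> 'k mat) set" where "E \<equiv> rep_space \<Gamma>"
abbreviation gm :: "('v \<Rightarrow> 'k mat) \<Rightarrow> ('v \<Rightarrow> 'k mat) \<Rightarrow> 'v \<Rightarrow> 'k mat" where "gm \<equiv> gauge_mult \<Gamma>"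
abbreviation gi :: "('v set \<Rightarrow> nat) \<Rightarrow> ('v \<Rightarrow> 'k mat) \<Rightarrow> 'v \<Rightarrow> 'k mat" where "gi \<equiv> gauge_inv \<Gamma>"
abbreviation act :: "('v set \<Rightarrow> nat) \<Rightarrow> ('v \<Rightarrow> 'k mat) \<Rightarrow> ('h \<Rightarrow> 'k mat) \<Rightarrow> 'h \<Rightarrow> 'k mat"
  where "act \<equiv> gauge_act \<Gamma>"
abbreviation FG :: "('v \<Rightarrow> 'k mat) \<Rightarrow> 'v \<Rightarrow> 'k mat" where "FG \<equiv> frob_gauge \<Gamma> q"
abbreviation FE :: "('h \<Rightarrow> 'k mat) \<Rightarrow> 'h \<Rightarrow> 'k mat" where "FE \<equiv> frob_rep \<Gamma> q"

lemma gauge_iff: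
  "g \<in> G \<nu> \<longleftrightarrow> g \<in> extensional V \<and> (\<forall>v\<in>V. g v \<in> carrier_mat (dm \<nu> v) (dm \<nu> v) \<and> det (g v) \<noteq> 0)"
  by (auto simp: gauge_def Units_mat_alg PiE_iff)

lemma gaugeD:
  assumes "g \<in> G \<nu>"
  shows "v \<in> V \<Longrightarrow> g v \<in> carrier_mat (dm \<nu> v) (dm \<nu> v)" "v \<in> V \<Longrightarrow> det (g v) \<noteq> 0"
    "g \<in> extensional V"
  using assms by (auto simp: gauge_iff)

lemma repD:
  assumes "x \<in> E \<nu>"
  shows "h \<in> A \<Longrightarrow> x h \<in> carrier_mat (dm \<nu> (head \<Gamma> h)) (dm \<nu> (tail \<Gamma> h))" "x \<in> extensional A"
  using assms by (auto simp: rep_space_def PiE_iff)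

definition gunit :: "('v set \<Rightarrow> nat) \<Rightarrow> 'v \<Rightarrow> 'k mat" where
  "gunit \<nu> = (\<lambda>v\<in>V. 1\<^sub>m (dm \<nu> v))"

lemma gunit_in [simp]: "gunit \<nu> \<in> G \<nu>" by (simp add: gunit_def gauge_iff)

lemma gm_in [simp]: "g \<in> G \<nu> \<Longrightarrow> g' \<in> G \<nu> \<Longrightarrow> gm g g' \<in> G \<nu>"
  by (auto simp: gauge_iff gauge_mult_def det_mult)

lemma gi_at:
  assumes "g \<in> G \<nu>" "v \<in> V"
  shows "gi \<nu> g v \<in> carrier_mat (dm \<nu> v) (dm \<nu> v)" "gi \<nu> g v * g v = 1\<^sub>m (dm \<nu> v)"
    "g v * gi \<nu> g v = 1\<^sub>m (dm \<nu> v)" "det (gi \<nu> g v) \<noteq> 0"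
  using inv_mat_alg[OF gaugeD(1,2)[OF assms]] assms(2) by (simp_all add: gauge_inv_def)

lemma gi_in [simp]: "g \<in> G \<nu> \<Longrightarrow> gi \<nu> g \<in> G \<nu>"
  using gi_at[of g \<nu>] unfolding gauge_iff[of "gi \<nu> g"] by (simp add: gauge_inv_def)

lemma act_in [simp]:
  assumes "g \<in> G \<nu>" "x \<in> E \<nu>"
  shows "act \<nu> g x \<in> E \<nu>"
  using gaugeD(1)[OF assms(1)] gi_at(1)[OF assms(1)] repD(1)[OF assms(2)] unfolding rep_space_def
  by (auto simp: gauge_act_def intro!: mult_carrier_mat)

lemma gm_assoc: "g \<in> G \<nu> \<Longrightarrow> g' \<in> G \<nu> \<Longrightarrow> g'' \<in> G \<nu> \<Longrightarrow> gm (gm g g') g'' = gm g (gm g' g'')"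
  unfolding gauge_mult_def
  by (intro restrict_ext) (auto dest!: gaugeD(1) simp: assoc_mult_mat)

lemma gm_one [simp]:
  assumes "g \<in> G \<nu>"
  shows "gm (gunit \<nu>) g = g" "gm g (gunit \<nu>) = g"
  using gaugeD(3)[OF assms] left_mult_one_mat[OF gaugeD(1)[OF assms]] right_mult_one_mat[OF gaugeD(1)[OF assms]]
  by (auto simp: gauge_mult_def gunit_def fun_eq_iff extensional_def)

lemma gi_cancel [simp]:
  assumes "g \<in> G \<nu>"
  shows "gm (gi \<nu> g) g = gunit \<nu>" "gm g (gi \<nu> g) = gunit \<nu>"
  using gi_at[OF assms] by (auto simp: gauge_mult_def gunit_def intro!: restrict_ext)

lemma gm_cancel [simp]:
  assumes "g \<in> G \<nu>" "g' \<in> G \<nu>"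
  shows "gm (gi \<nu> g) (gm g g') = g'" "gm g (gm (gi \<nu> g) g') = g'"
    "gm (gm g' g) (gi \<nu> g) = g'" "gm (gm g' (gi \<nu> g)) g = g'"
proof -
  note a = gm_assoc[of _ \<nu>]
  show "gm (gi \<nu> g) (gm g g') = g'" using a[of "gi \<nu> g" g g'] assms by simp
  show "gm g (gm (gi \<nu> g) g') = g'" using a[of g "gi \<nu> g" g'] assms by simp
  show "gm (gm g' g) (gi \<nu> g) = g'" using a[of g' g "gi \<nu> g"] assms by simp
  show "gm (gm g' (gi \<nu> g)) g = g'" using a[of g' "gi \<nu> g" g] assms by simp
qed

lemma gi_unique:
  assumes "g \<in> G \<nu>" "g' \<in> G \<nu>" "gm g g' = gunit \<nu>"
  shows "gi \<nu> g = g'"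
  using gm_cancel(1)[OF assms(1,2)] assms by simp

lemma gi_gm:
  assumes "g \<in> G \<nu>" "g' \<in> G \<nu>"
  shows "gi \<nu> (gm g g') = gm (gi \<nu> g') (gi \<nu> g)"
proof (rule gi_unique)
  have "gm (gm g g') (gm (gi \<nu> g') (gi \<nu> g)) = gm g (gm g' (gm (gi \<nu> g') (gi \<nu> g)))"
    using assms by (intro gm_assoc) auto
  then show "gm (gm g g') (gm (gi \<nu> g') (gi \<nu> g)) = gunit \<nu>" using assms by simp
qed (use assms in auto)

lemma gi_gi [simp]: "g \<in> G \<nu> \<Longrightarrow> gi \<nu> (gi \<nu> g) = g"
  by (rule gi_unique) auto

lemma gi_one [simp]: "gi \<nu> (gunit \<nu>) = gunit \<nu>"
  by (rule gi_unique) auto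

lemma act_gm:
  assumes "g \<in> G \<nu>" "g' \<in> G \<nu>" "x \<in> E \<nu>"
  shows "act \<nu> (gm g g') x = act \<nu> g (act \<nu> g' x)"
  unfolding gauge_act_def
proof (rule restrict_ext)
  fix h assume h: "h \<in> A"
  have "gi \<nu> (gm g g') (tail \<Gamma> h) = gi \<nu> g' (tail \<Gamma> h) * gi \<nu> g (tail \<Gamma> h)"
    using h by (subst gi_gm[OF assms(1,2)]) (simp add: gauge_mult_def)
  moreover have "gm g g' (head \<Gamma> h) = g (head \<Gamma> h) * g' (head \<Gamma> h)"
    using h by (simp add: gauge_mult_def)
  ultimately show "gm g g' (head \<Gamma> h) * x h * gi \<nu> (gm g g') (tail \<Gamma> h) =
      g (head \<Gamma> h) * (\<lambda>h\<in>A. g' (head \<Gamma> h) * x h * gi \<nu> g' (tail \<Gamma> h)) h * gi \<nu> g (tail \<Gamma> h)"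
    using h assms gaugeD(1)[OF gi_in[OF assms(1)], of "tail \<Gamma> h"] gaugeD(1)[OF gi_in[OF assms(2)], of "tail \<Gamma> h"]
    by (simp add: conj_mult_mat[OF gaugeD(1)[OF assms(1)] gaugeD(1)[OF assms(2)] repD(1)[OF assms(3)]])
qed

lemma act_one [simp]: "x \<in> E \<nu> \<Longrightarrow> act \<nu> (gunit \<nu>) x = x"
  using repD(2)[of x \<nu>] left_mult_one_mat[OF repD(1)[of x \<nu>]] right_mult_one_mat[OF repD(1)[of x \<nu>]]
  unfolding gauge_act_def gi_one by (auto simp: gunit_def fun_eq_iff extensional_def)

lemma act_cancel [simp]:
  assumes "g \<in> G \<nu>" "x \<in> E \<nu>"
  shows "act \<nu> (gi \<nu> g) (act \<nu> g x) = x" "act \<nu> g (act \<nu> (gi \<nu> g) x) = x"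
  using assms by (simp_all flip: act_gm)

subsection \<open>The Frobenius map\<close>

lemma frob_gauge_iff:
  "g \<in> G \<nu> \<Longrightarrow> FG g = g \<longleftrightarrow> (\<forall>v\<in>V. g (vaut \<Gamma> v) = fr (g v))"
  unfolding frob_gauge_def by (rule frob_fixed_iff[OF vaut_bij]) (auto simp: gauge_iff)

lemma frob_rep_iff:
  "x \<in> E \<nu> \<Longrightarrow> FE x = x \<longleftrightarrow> (\<forall>h\<in>A. x (aaut \<Gamma> h) = fr (x h))"
  unfolding frob_rep_def by (rule frob_fixed_iff[OF aaut_bij]) (auto dest: repD)

interpretation fr: field_hom "\<lambda>z :: 'k. z ^ q" by (rule fr_hom)

lemma gauge_at:
  assumes "g \<in> G \<nu>" "v \<in> V"
  shows "g (vinv v) \<in> carrier_mat (dm \<nu> v) (dm \<nu> v)" "g (vaut \<Gamma> v) \<in> carrier_mat (dm \<nu> v) (dm \<nu> v)"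
  using gaugeD(1)[OF assms(1), of "vinv v"] gaugeD(1)[OF assms(1), of "vaut \<Gamma> v"] assms(2) by simp_all

lemma FG_in [simp]: "g \<in> G \<nu> \<Longrightarrow> FG g \<in> G \<nu>"
  using gauge_at(1)[of g \<nu>] gaugeD(2)[of g \<nu>, OF _ vinv(1)] unfolding gauge_iff[of "FG g"]
  by (auto simp: frob_gauge_def fr.hom_det)

lemma FG_gm:
  assumes "g \<in> G \<nu>" "g' \<in> G \<nu>"
  shows "FG (gm g g') = gm (FG g) (FG g')"
  using fr.mat_hom_mult[OF gauge_at(1)[OF assms(1)] gauge_at(1)[OF assms(2)]]
  by (auto simp: frob_gauge_def gauge_mult_def intro!: restrict_ext)

lemma FG_one [simp]: "FG (gunit \<nu>) = gunit \<nu>"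
  unfolding frob_gauge_def gunit_def by (intro restrict_ext) (auto simp: fr.mat_hom_one)

lemma FG_gi:
  assumes "g \<in> G \<nu>"
  shows "FG (gi \<nu> g) = gi \<nu> (FG g)"
proof (rule gi_unique[symmetric])
  show "gm (FG g) (FG (gi \<nu> g)) = gunit \<nu>"
    by (subst FG_gm[symmetric, of _ \<nu>]) (use assms in auto)
  show "FG g \<in> G \<nu>" "FG (gi \<nu> g) \<in> G \<nu>" using assms by (metis FG_in gi_in)+
qed

lemma FE_act:
  assumes "g \<in> G \<nu>" "x \<in> E \<nu>"
  shows "FE (act \<nu> g x) = act \<nu> (FG g) (FE x)"
proof -
  have "FE (act \<nu> g x) h = act \<nu> (FG g) (FE x) h" for h
  proof (cases "h \<in> A")
    case True
    let ?k = "ainv h"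
    have k: "?k \<in> A" using True by simp
    note c = gaugeD(1)[OF assms(1) head_in[OF k]] repD(1)[OF assms(2) k] gaugeD(1)[OF gi_in[OF assms(1)] tail_in[OF k]]
    have "fr (g (head \<Gamma> ?k) * x ?k * gi \<nu> g (tail \<Gamma> ?k)) =
        fr (g (head \<Gamma> ?k)) * fr (x ?k) * fr (gi \<nu> g (tail \<Gamma> ?k))"
      using fr.mat_hom_mult[OF mult_carrier_mat[OF c(1,2)] c(3)] fr.mat_hom_mult[OF c(1,2)] by simp
    moreover have "fr (gi \<nu> g (tail \<Gamma> ?k)) = gi \<nu> (FG g) (tail \<Gamma> h)"
      unfolding FG_gi[OF assms(1), symmetric] using True by (simp add: frob_gauge_def)
    ultimately show ?thesis using True k by (simp add: frob_rep_def gauge_act_def frob_gauge_def)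
  qed (simp add: frob_rep_def gauge_act_def)
  then show ?thesis by blast
qed

abbreviation GF :: "('v set \<Rightarrow> nat) \<Rightarrow> ('v \<Rightarrow> 'k mat) set" where "GF \<equiv> gauge_F \<Gamma> q"
definition EF :: "('v set \<Rightarrow> nat) \<Rightarrow> ('h \<Rightarrow> 'k mat) set" where "EF \<nu> = fixed_pts FE (E \<nu>)"

lemma GF_iff: "g \<in> GF \<nu> \<longleftrightarrow> g \<in> G \<nu> \<and> FG g = g" by (simp add: gauge_F_def fixed_pts_def)
lemma EF_iff: "x \<in> EF \<nu> \<longleftrightarrow> x \<in> E \<nu> \<and> FE x = x" by (simp add: EF_def fixed_pts_def)

lemma GF_iff_mfam: "g \<in> GF \<nu> \<longleftrightarrow> g \<in> mfam V (vaut \<Gamma>) (dm \<nu>) (dm \<nu>) \<and> (\<forall>v\<in>V. det (g v) \<noteq> 0)"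
proof -
  have "g \<in> GF \<nu> \<longleftrightarrow> g \<in> G \<nu> \<and> (\<forall>v\<in>V. g (vaut \<Gamma> v) = fr (g v))"
    using frob_gauge_iff by (auto simp: GF_iff)
  then show ?thesis by (auto simp: gauge_iff mfam_def PiE_iff)
qed

lemma EF_eq_mfam: "EF \<nu> = mfam A (aaut \<Gamma>) (\<lambda>h. dm \<nu> (head \<Gamma> h)) (\<lambda>h. dm \<nu> (tail \<Gamma> h))"
proof -
  have "x \<in> EF \<nu> \<longleftrightarrow> x \<in> E \<nu> \<and> (\<forall>h\<in>A. x (aaut \<Gamma> h) = fr (x h))" for x
    using frob_rep_iff by (auto simp: EF_iff)
  then show ?thesis by (auto simp: rep_space_def mfam_def)
qed

lemma finite_GF [simp]: "finite (GF \<nu>)"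
  by (rule finite_subset[OF _ finite_mfam[OF fin_V vaut_bij]]) (use GF_iff_mfam in blast)

lemma finite_EF [simp]: "finite (EF \<nu>)"
  unfolding EF_eq_mfam by (rule finite_mfam[OF fin_A aaut_bij])

lemma GF_closed [simp]:
  "gunit \<nu> \<in> GF \<nu>" "g \<in> GF \<nu> \<Longrightarrow> g' \<in> GF \<nu> \<Longrightarrow> gm g g' \<in> GF \<nu>" "g \<in> GF \<nu> \<Longrightarrow> gi \<nu> g \<in> GF \<nu>"
  by (auto simp: GF_iff FG_gm FG_gi)

lemma act_EF [simp]: "g \<in> GF \<nu> \<Longrightarrow> x \<in> EF \<nu> \<Longrightarrow> act \<nu> g x \<in> EF \<nu>"
  by (auto simp: GF_iff EF_iff FE_act)

lemma GF_G: "g \<in> GF \<nu> \<Longrightarrow> g \<in> G \<nu>" by (simp add: GF_iff)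
lemma EF_E: "x \<in> EF \<nu> \<Longrightarrow> x \<in> E \<nu>" by (simp add: EF_iff)

definition FG_root :: "('v \<Rightarrow> 'k mat) \<Rightarrow> 'v \<Rightarrow> 'k mat" where
  "FG_root g = (\<lambda>v\<in>V. map_mat fr_root (g (vaut \<Gamma> v)))"

interpretation fr_root: field_hom fr_root by (rule fr_root_hom)

lemma FG_root_in [simp]: "g \<in> G \<nu> \<Longrightarrow> FG_root g \<in> G \<nu>"
  using gauge_at(2)[of g \<nu>] gaugeD(2)[of g \<nu>, OF _ vaut_in] fr_root.hom_0_iff unfolding gauge_iff[of "FG_root g"]
  by (auto simp: FG_root_def fr_root.hom_det)

lemma FG_FG_root: "g \<in> G \<nu> \<Longrightarrow> FG (FG_root g) = g"
  using gaugeD(3)[of g \<nu>]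
  by (auto simp: frob_gauge_def FG_root_def fun_eq_iff extensional_def intro!: eq_matI)

section \<open>The parabolic subgroup and the stable representations\<close>

definition gT :: "('v set \<Rightarrow> nat) \<Rightarrow> ('v \<Rightarrow> 'k mat) \<Rightarrow> 'v \<Rightarrow> 'k mat" where
  "gT \<tau> g = (\<lambda>v\<in>V. blk_T (dm \<tau> v) (dm \<tau> v) (g v))"

definition gW :: "('v set \<Rightarrow> nat) \<Rightarrow> ('v set \<Rightarrow> nat) \<Rightarrow> ('v \<Rightarrow> 'k mat) \<Rightarrow> 'v \<Rightarrow> 'k mat" where
  "gW \<tau> \<omega> g = (\<lambda>v\<in>V. blk_W (dm \<tau> v) (dm \<tau> v) (dm \<omega> v) (dm \<omega> v) (g v))"

abbreviation iT :: "('v set \<Rightarrow> nat) \<Rightarrow> ('h \<Rightarrow> 'k mat) \<Rightarrow> 'h \<Rightarrow> 'k mat" where "iT \<equiv> induced_T \<Gamma>"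
abbreviation iW :: "('v set \<Rightarrow> nat) \<Rightarrow> ('v set \<Rightarrow> nat) \<Rightarrow> ('h \<Rightarrow> 'k mat) \<Rightarrow> 'h \<Rightarrow> 'k mat"
  where "iW \<equiv> induced_W \<Gamma>"
abbreviation Q :: "('v set \<Rightarrow> nat) \<Rightarrow> ('v set \<Rightarrow> nat) \<Rightarrow> ('v \<Rightarrow> 'k mat) set" where "Q \<equiv> parab \<Gamma>"
abbreviation U :: "('v set \<Rightarrow> nat) \<Rightarrow> ('v set \<Rightarrow> nat) \<Rightarrow> ('v \<Rightarrow> 'k mat) set" where "U \<equiv> unip_rad \<Gamma>"

lemma iT_eq: "iT \<tau> x = (\<lambda>h\<in>A. blk_T (dm \<tau> (head \<Gamma> h)) (dm \<tau> (tail \<Gamma> h)) (x h))"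
  by (simp add: induced_T_def blk_T_def)

lemma iW_eq: "iW \<tau> \<omega> x =
    (\<lambda>h\<in>A. blk_W (dm \<tau> (head \<Gamma> h)) (dm \<tau> (tail \<Gamma> h)) (dm \<omega> (head \<Gamma> h)) (dm \<omega> (tail \<Gamma> h)) (x h))"
  by (simp add: induced_W_def blk_W_def)

lemma parab_iff: "g \<in> Q \<tau> \<omega> \<longleftrightarrow> g \<in> G (dplus \<tau> \<omega>) \<and> (\<forall>v\<in>V. blk_lower (dm \<tau> v) (dm \<tau> v) (g v))"
proof -
  have "(\<lambda>w. g v *\<^sub>v w) ` subsp_W \<Gamma> \<tau> \<omega> v = subsp_W \<Gamma> \<tau> \<omega> v \<longleftrightarrow> blk_lower (dm \<tau> v) (dm \<tau> v) (g v)"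
    if "g \<in> G (dplus \<tau> \<omega>)" "v \<in> V" for v
    unfolding subsp_W_def by (rule coordW_image_iff) (use gaugeD[OF that(1)] that(2) in auto)
  then show ?thesis by (auto simp: parab_def)
qed

lemma unip_iff: "g \<in> U \<tau> \<omega> \<longleftrightarrow> g \<in> Q \<tau> \<omega> \<and> gT \<tau> g = gunit \<tau> \<and> gW \<tau> \<omega> g = gunit \<omega>"
proof -
  have "gT \<tau> g = gunit \<tau> \<and> gW \<tau> \<omega> g = gunit \<omega> \<longleftrightarrow> (\<forall>v\<in>V. blk_T (dm \<tau> v) (dm \<tau> v) (g v) = 1\<^sub>m (dm \<tau> v)
      \<and> blk_W (dm \<tau> v) (dm \<tau> v) (dm \<omega> v) (dm \<omega> v) (g v) = 1\<^sub>m (dm \<omega> v))"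
    by (auto simp: gT_def gW_def gunit_def fun_eq_iff restrict_def split: if_splits)
  moreover have "(\<forall>w\<in>subsp_W \<Gamma> \<tau> \<omega> v. g v *\<^sub>v w = w) \<and>
      (\<forall>u\<in>carrier_vec (dm \<tau> v + dm \<omega> v). g v *\<^sub>v u - u \<in> subsp_W \<Gamma> \<tau> \<omega> v) \<longleftrightarrow>
      blk_T (dm \<tau> v) (dm \<tau> v) (g v) = 1\<^sub>m (dm \<tau> v) \<and>
      blk_W (dm \<tau> v) (dm \<tau> v) (dm \<omega> v) (dm \<omega> v) (g v) = 1\<^sub>m (dm \<omega> v)"
    if "g \<in> Q \<tau> \<omega>" "v \<in> V" for v
    unfolding subsp_W_def by (rule unipotent_iff) (use that gaugeD(1)[of g "dplus \<tau> \<omega>" v] in \<open>auto simp: parab_iff\<close>)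
  ultimately show ?thesis unfolding unip_rad_def by blast
qed

definition S :: "('v set \<Rightarrow> nat) \<Rightarrow> ('v set \<Rightarrow> nat) \<Rightarrow> ('h \<Rightarrow> 'k mat) set" where
  "S \<tau> \<omega> = {x \<in> E (dplus \<tau> \<omega>). \<forall>h\<in>A. blk_lower (dm \<tau> (head \<Gamma> h)) (dm \<tau> (tail \<Gamma> h)) (x h)}"

lemma stab_rep_eq:
  assumes "Y (dplus \<tau> \<omega>) \<subseteq> E (dplus \<tau> \<omega>)"
  shows "stab_rep \<Gamma> Y \<tau> \<omega> = S \<tau> \<omega> \<inter> Y (dplus \<tau> \<omega>)"
proof -
  have "(\<forall>w\<in>subsp_W \<Gamma> \<tau> \<omega> (tail \<Gamma> h). x h *\<^sub>v w \<in> subsp_W \<Gamma> \<tau> \<omega> (head \<Gamma> h)) \<longleftrightarrow>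
      blk_lower (dm \<tau> (head \<Gamma> h)) (dm \<tau> (tail \<Gamma> h)) (x h)" if "x \<in> E (dplus \<tau> \<omega>)" "h \<in> A" for x h
    unfolding subsp_W_def by (rule coordW_stable_iff) (use repD(1)[OF that] in simp)
  then show ?thesis using assms unfolding stab_rep_def S_def by blast
qed

lemma Q_G: "g \<in> Q \<tau> \<omega> \<Longrightarrow> g \<in> G (dplus \<tau> \<omega>)" by (simp add: parab_iff)
lemma U_Q: "g \<in> U \<tau> \<omega> \<Longrightarrow> g \<in> Q \<tau> \<omega>" by (simp add: unip_iff)
lemma S_E: "x \<in> S \<tau> \<omega> \<Longrightarrow> x \<in> E (dplus \<tau> \<omega>)" by (simp add: S_def)

lemma QD:
  assumes "g \<in> Q \<tau> \<omega>" "v \<in> V"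
  shows "g v \<in> carrier_mat (dm \<tau> v + dm \<omega> v) (dm \<tau> v + dm \<omega> v)" "det (g v) \<noteq> 0"
    "blk_lower (dm \<tau> v) (dm \<tau> v) (g v)"
  using assms gaugeD(1,2)[of g "dplus \<tau> \<omega>" v] by (auto simp: parab_iff)

lemma SD:
  assumes "x \<in> S \<tau> \<omega>" "h \<in> A"
  shows "x h \<in> carrier_mat (dm \<tau> (head \<Gamma> h) + dm \<omega> (head \<Gamma> h)) (dm \<tau> (tail \<Gamma> h) + dm \<omega> (tail \<Gamma> h))"
    "blk_lower (dm \<tau> (head \<Gamma> h)) (dm \<tau> (tail \<Gamma> h)) (x h)"
  using assms repD(1)[of x "dplus \<tau> \<omega>" h] by (auto simp: S_def)

lemma gT_in [simp]: "g \<in> Q \<tau> \<omega> \<Longrightarrow> gT \<tau> g \<in> G \<tau>"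
  and gW_in [simp]: "g \<in> Q \<tau> \<omega> \<Longrightarrow> gW \<tau> \<omega> g \<in> G \<omega>"
proof -
  have "det (blk_T (dm \<tau> v) (dm \<tau> v) (g v)) \<noteq> 0 \<and>
      det (blk_W (dm \<tau> v) (dm \<tau> v) (dm \<omega> v) (dm \<omega> v) (g v)) \<noteq> 0"
    if "v \<in> V" "g \<in> Q \<tau> \<omega>" for v using det_blk_lower[OF QD(1,3)[OF that(2,1)]] QD(2)[OF that(2,1)] by auto
  then show "g \<in> Q \<tau> \<omega> \<Longrightarrow> gT \<tau> g \<in> G \<tau>" "g \<in> Q \<tau> \<omega> \<Longrightarrow> gW \<tau> \<omega> g \<in> G \<omega>"
    by (auto simp: gauge_iff gT_def gW_def)
qed

lemma iT_in [simp]: "iT \<tau> x \<in> E \<tau>" and iW_in [simp]: "iW \<tau> \<omega> x \<in> E \<omega>"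
  by (auto simp: iT_eq iW_eq rep_space_def)

lemma Q_one [simp]: "gunit (dplus \<tau> \<omega>) \<in> Q \<tau> \<omega>"
  unfolding parab_iff by (intro conjI gunit_in) (auto simp: gunit_def)

lemma Q_gm [simp]:
  assumes "g \<in> Q \<tau> \<omega>" "g' \<in> Q \<tau> \<omega>"
  shows "gm g g' \<in> Q \<tau> \<omega>" "gT \<tau> (gm g g') = gm (gT \<tau> g) (gT \<tau> g')"
    "gW \<tau> \<omega> (gm g g') = gm (gW \<tau> \<omega> g) (gW \<tau> \<omega> g')"
proof -
  have b: "blk_lower (dm \<tau> v) (dm \<tau> v) (g v * g' v)"
    "blk_T (dm \<tau> v) (dm \<tau> v) (g v * g' v) = blk_T (dm \<tau> v) (dm \<tau> v) (g v) * blk_T (dm \<tau> v) (dm \<tau> v) (g' v)"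
    "blk_W (dm \<tau> v) (dm \<tau> v) (dm \<omega> v) (dm \<omega> v) (g v * g' v) =
      blk_W (dm \<tau> v) (dm \<tau> v) (dm \<omega> v) (dm \<omega> v) (g v) * blk_W (dm \<tau> v) (dm \<tau> v) (dm \<omega> v) (dm \<omega> v) (g' v)"
    if v: "v \<in> V" for v
    using blk_mult[OF QD(1,3)[OF assms(1) v] QD(1,3)[OF assms(2) v]] by auto
  show "gm g g' \<in> Q \<tau> \<omega>" unfolding parab_iff
    using gm_in[OF Q_G[OF assms(1)] Q_G[OF assms(2)]] b(1) by (auto simp: gauge_mult_def)
  show "gT \<tau> (gm g g') = gm (gT \<tau> g) (gT \<tau> g')" "gW \<tau> \<omega> (gm g g') = gm (gW \<tau> \<omega> g) (gW \<tau> \<omega> g')"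
    using b(2,3) by (auto simp: gT_def gW_def gauge_mult_def intro!: restrict_ext)
qed

lemma Q_gi [simp]:
  assumes "g \<in> Q \<tau> \<omega>"
  shows "gi (dplus \<tau> \<omega>) g \<in> Q \<tau> \<omega>" "gT \<tau> (gi (dplus \<tau> \<omega>) g) = gi \<tau> (gT \<tau> g)"
    "gW \<tau> \<omega> (gi (dplus \<tau> \<omega>) g) = gi \<omega> (gW \<tau> \<omega> g)"
proof -
  note b = blk_inv[OF QD[OF assms]]
  show "gi (dplus \<tau> \<omega>) g \<in> Q \<tau> \<omega>" unfolding parab_iff
    using gi_in[OF Q_G[OF assms]] b(1) by (auto simp: gauge_inv_def)
  show "gT \<tau> (gi (dplus \<tau> \<omega>) g) = gi \<tau> (gT \<tau> g)" "gW \<tau> \<omega> (gi (dplus \<tau> \<omega>) g) = gi \<omega> (gW \<tau> \<omega> g)"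
    using b(2,3) by (auto simp: gT_def gW_def gauge_inv_def intro!: restrict_ext)
qed

lemma gT_one [simp]: "gT \<tau> (gunit (dplus \<tau> \<omega>)) = gunit \<tau>"
  and gW_one [simp]: "gW \<tau> \<omega> (gunit (dplus \<tau> \<omega>)) = gunit \<omega>"
  by (auto simp: gT_def gW_def gunit_def intro!: restrict_ext)

lemma U_closed [simp]:
  "gunit (dplus \<tau> \<omega>) \<in> U \<tau> \<omega>" "g \<in> U \<tau> \<omega> \<Longrightarrow> g' \<in> U \<tau> \<omega> \<Longrightarrow> gm g g' \<in> U \<tau> \<omega>"
  "g \<in> U \<tau> \<omega> \<Longrightarrow> gi (dplus \<tau> \<omega>) g \<in> U \<tau> \<omega>"
  by (auto simp: unip_iff)

lemma S_act:
  assumes g: "g \<in> Q \<tau> \<omega>" and x: "x \<in> S \<tau> \<omega>"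
  shows "act (dplus \<tau> \<omega>) g x \<in> S \<tau> \<omega>"
    "iT \<tau> (act (dplus \<tau> \<omega>) g x) = act \<tau> (gT \<tau> g) (iT \<tau> x)"
    "iW \<tau> \<omega> (act (dplus \<tau> \<omega>) g x) = act \<omega> (gW \<tau> \<omega> g) (iW \<tau> \<omega> x)"
proof -
  let ?g' = "gi (dplus \<tau> \<omega>) g"
  note g' = Q_gi[OF g]
  have b: "blk_lower (dm \<tau> (head \<Gamma> h)) (dm \<tau> (tail \<Gamma> h)) (act (dplus \<tau> \<omega>) g x h)"
    "iT \<tau> (act (dplus \<tau> \<omega>) g x) h = act \<tau> (gT \<tau> g) (iT \<tau> x) h"
    "iW \<tau> \<omega> (act (dplus \<tau> \<omega>) g x) h = act \<omega> (gW \<tau> \<omega> g) (iW \<tau> \<omega> x) h"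
    if h: "h \<in> A" for h
  proof -
    note gh = QD(1,3)[OF g head_in[OF h]] and gt = QD(1,3)[OF g'(1) tail_in[OF h]]
      and xh = SD[OF x h]
    note b1 = blk_mult[OF gh xh]
    note b2 = blk_mult[OF mult_carrier_mat[OF gh(1) xh(1)] b1(1) gt]
    have tl: "gi \<tau> (gT \<tau> g) (tail \<Gamma> h) = blk_T (dm \<tau> (tail \<Gamma> h)) (dm \<tau> (tail \<Gamma> h)) (?g' (tail \<Gamma> h))"
      "gi \<omega> (gW \<tau> \<omega> g) (tail \<Gamma> h) =
        blk_W (dm \<tau> (tail \<Gamma> h)) (dm \<tau> (tail \<Gamma> h)) (dm \<omega> (tail \<Gamma> h)) (dm \<omega> (tail \<Gamma> h)) (?g' (tail \<Gamma> h))"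
      unfolding g'(2,3)[symmetric] using h by (simp_all add: gT_def gW_def)
    show "blk_lower (dm \<tau> (head \<Gamma> h)) (dm \<tau> (tail \<Gamma> h)) (act (dplus \<tau> \<omega>) g x h)"
      "iT \<tau> (act (dplus \<tau> \<omega>) g x) h = act \<tau> (gT \<tau> g) (iT \<tau> x) h"
      "iW \<tau> \<omega> (act (dplus \<tau> \<omega>) g x) h = act \<omega> (gW \<tau> \<omega> g) (iW \<tau> \<omega> x) h"
      using h b1 b2 tl by (simp_all add: gauge_act_def iT_eq iW_eq gT_def gW_def)
  qed
  show "act (dplus \<tau> \<omega>) g x \<in> S \<tau> \<omega>"
    using act_in[OF Q_G[OF g] S_E[OF x]] b(1) by (auto simp: S_def)
  show "iT \<tau> (act (dplus \<tau> \<omega>) g x) = act \<tau> (gT \<tau> g) (iT \<tau> x)"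
    "iW \<tau> \<omega> (act (dplus \<tau> \<omega>) g x) = act \<omega> (gW \<tau> \<omega> g) (iW \<tau> \<omega> x)"
    using b(2,3) repD(2)[OF act_in[OF gT_in[OF g] iT_in]] repD(2)[OF act_in[OF gW_in[OF g] iW_in]]
    by (auto intro!: extensionalityI[of _ A] simp: iT_eq iW_eq)
qed

lemmas blk_fr = blk_map_mat[where \<theta> = "\<lambda>z :: 'k. z ^ q", OF fr.hom_zero]

lemma iTW_FE:
  assumes "x \<in> E (dplus \<tau> \<omega>)"
  shows "iT \<tau> (FE x) = FE (iT \<tau> x)" "iW \<tau> \<omega> (FE x) = FE (iW \<tau> \<omega> x)"
proof -
  have b: "blk_T (dm \<tau> (head \<Gamma> h)) (dm \<tau> (tail \<Gamma> h)) (fr (x h)) = fr (blk_T (dm \<tau> (head \<Gamma> h)) (dm \<tau> (tail \<Gamma> h)) (x h))"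
    "blk_W (dm \<tau> (head \<Gamma> h)) (dm \<tau> (tail \<Gamma> h)) (dm \<omega> (head \<Gamma> h)) (dm \<omega> (tail \<Gamma> h)) (fr (x h)) =
      fr (blk_W (dm \<tau> (head \<Gamma> h)) (dm \<tau> (tail \<Gamma> h)) (dm \<omega> (head \<Gamma> h)) (dm \<omega> (tail \<Gamma> h)) (x h))"
    if "h \<in> A" for h
    using blk_fr[of "x h" "dm \<tau> (head \<Gamma> h)" "dm \<omega> (head \<Gamma> h)" "dm \<tau> (tail \<Gamma> h)" "dm \<omega> (tail \<Gamma> h)"]
      repD(1)[OF assms that] by simp_all
  show "iT \<tau> (FE x) = FE (iT \<tau> x)" "iW \<tau> \<omega> (FE x) = FE (iW \<tau> \<omega> x)"
    unfolding iT_eq iW_eq frob_rep_def using b[OF ainv(1)]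
    by (auto intro!: restrict_ext)
qed

lemma iTW_EF [simp]: "x \<in> EF (dplus \<tau> \<omega>) \<Longrightarrow> iT \<tau> x \<in> EF \<tau>" "x \<in> EF (dplus \<tau> \<omega>) \<Longrightarrow> iW \<tau> \<omega> x \<in> EF \<omega>"
  using iTW_FE[of x \<tau> \<omega>] by (auto simp: EF_iff)

lemma gTW_FG:
  assumes "g \<in> G (dplus \<tau> \<omega>)"
  shows "gT \<tau> (FG g) = FG (gT \<tau> g)" "gW \<tau> \<omega> (FG g) = FG (gW \<tau> \<omega> g)"
proof -
  have b: "blk_T (dm \<tau> v) (dm \<tau> v) (fr (g v)) = fr (blk_T (dm \<tau> v) (dm \<tau> v) (g v))"
    "blk_W (dm \<tau> v) (dm \<tau> v) (dm \<omega> v) (dm \<omega> v) (fr (g v)) =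
      fr (blk_W (dm \<tau> v) (dm \<tau> v) (dm \<omega> v) (dm \<omega> v) (g v))"
    if "v \<in> V" for v
    using blk_fr[of "g v" "dm \<tau> v" "dm \<omega> v" "dm \<tau> v" "dm \<omega> v"]
      gaugeD(1)[OF assms that] by simp_all
  show "gT \<tau> (FG g) = FG (gT \<tau> g)" "gW \<tau> \<omega> (FG g) = FG (gW \<tau> \<omega> g)"
    unfolding gT_def gW_def frob_gauge_def using b[OF vinv(1)]
    by (auto intro!: restrict_ext)
qed

lemma FG_Q:
  assumes g: "g \<in> Q \<tau> \<omega>"
  shows "FG g \<in> Q \<tau> \<omega>"
proof -
  have "blk_lower (dm \<tau> v) (dm \<tau> v) (FG g v)" if v: "v \<in> V" for v
    using blk_fr(1)[OF QD(1,3)[OF g vinv(1)[OF v]]] v by (simp add: frob_gauge_def)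
  then show ?thesis using FG_in[OF Q_G[OF g]] by (simp add: parab_iff)
qed

lemma FG_U: "g \<in> U \<tau> \<omega> \<Longrightarrow> FG g \<in> U \<tau> \<omega>"
  by (auto simp: unip_iff FG_Q gTW_FG[OF Q_G])

lemma FG_root_Q:
  assumes g: "g \<in> Q \<tau> \<omega>"
  shows "FG_root g \<in> Q \<tau> \<omega>"
proof -
  have "blk_lower (dm \<tau> v) (dm \<tau> v) (FG_root g v)" if v: "v \<in> V" for v
    using blk_map_mat(1)[where \<theta> = fr_root, OF fr_root.hom_zero QD(1,3)[OF g vaut_in[OF v]]] v
    by (simp add: FG_root_def)
  then show ?thesis using FG_root_in[OF Q_G[OF g]] by (simp add: parab_iff)
qed

lemma FG_root_U:
  assumes g: "g \<in> U \<tau> \<omega>"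
  shows "FG_root g \<in> U \<tau> \<omega>"
proof -
  have inj: "g' = g''" if "FG g' = FG g''" "g' \<in> G \<nu>" "g'' \<in> G \<nu>" for g' g'' \<nu>
  proof (rule extensionalityI[OF gaugeD(3)[OF that(2)] gaugeD(3)[OF that(3)]])
    fix v assume v: "v \<in> V"
    have eq: "fr (g' v) = fr (g'' v)" using fun_cong[OF that(1), of "vaut \<Gamma> v"] v by (simp add: frob_gauge_def)
    show "g' v = g'' v"
    proof (rule eq_matI)
      fix i j assume "i < dim_row (g'' v)" "j < dim_col (g'' v)"
      then show "g' v $$ (i, j) = g'' v $$ (i, j)"
        using arg_cong[OF eq, of "\<lambda>B. B $$ (i, j)"] gaugeD(1)[OF that(2) v] gaugeD(1)[OF that(3) v]
        by (auto intro: fr_inj)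
    qed (use gaugeD(1)[OF that(2) v] gaugeD(1)[OF that(3) v] in auto)
  qed
  have Qg: "g \<in> Q \<tau> \<omega>" using g by (rule U_Q)
  note r = FG_root_Q[OF Qg] and rr = FG_FG_root[OF Q_G[OF Qg]]
  have "gT \<tau> (FG_root g) = gunit \<tau>"
    by (rule inj[of _ _ \<tau>]) (use gTW_FG(1)[OF Q_G[OF r]] rr g r in \<open>auto simp: unip_iff\<close>)
  moreover have "gW \<tau> \<omega> (FG_root g) = gunit \<omega>"
    by (rule inj[of _ _ \<omega>]) (use gTW_FG(2)[OF Q_G[OF r]] rr g r in \<open>auto simp: unip_iff\<close>)
  ultimately show ?thesis using r by (simp add: unip_iff)
qed

end

section \<open>Frobenius-stable subspaces\<close>

text \<open>
  The span of \<open>D\<close>, generated by adding one multiple at a time, so that Artin-Schreier equations with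
  right-hand side in the span can be solved by induction.
\<close>

inductive_set lin_comb :: "nat \<Rightarrow> 'a::comm_ring_1 vec set \<Rightarrow> 'a vec set" for n D where
  zero: "0\<^sub>v n \<in> lin_comb n D"
| step: "f \<in> D \<Longrightarrow> w \<in> lin_comb n D \<Longrightarrow> c \<cdot>\<^sub>v f + w \<in> lin_comb n D"

lemma lin_comb_carrier:
  assumes "D \<subseteq> carrier_vec n" "w \<in> lin_comb n D"
  shows "w \<in> carrier_vec n"
  using assms(2) by induction (use assms(1) in auto)

lemma lin_comb_smult:
  assumes "D \<subseteq> carrier_vec n" "w \<in> lin_comb n D"
  shows "c \<cdot>\<^sub>v w \<in> lin_comb n D"
  using assms(2)
proof induction
  case zero
  have "c \<cdot>\<^sub>v 0\<^sub>v n = (0\<^sub>v n :: 'a vec)" by (intro eq_vecI) auto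
  then show ?case by (simp add: lin_comb.zero)
next
  case (step f w d)
  have "c \<cdot>\<^sub>v (d \<cdot>\<^sub>v f + w) = (c * d) \<cdot>\<^sub>v f + c \<cdot>\<^sub>v w"
    using step assms(1) lin_comb_carrier[OF assms(1) step.hyps(2)]
    by (subst smult_add_distrib_vec[of _ n]) (auto simp: smult_smult_assoc)
  then show ?case using step by (simp add: lin_comb.step)
qed

context frobenius
begin

definition stable_subspaces :: "nat \<Rightarrow> nat \<Rightarrow> 'k vec set set" where
  "stable_subspaces m n = {W. W \<subseteq> carrier_vec n \<and> 0\<^sub>v n \<in> W \<and> (\<forall>u\<in>W. \<forall>w\<in>W. u + w \<in> W) \<and>
     (\<forall>c. \<forall>w\<in>W. c \<cdot>\<^sub>v w \<in> W) \<and> (\<forall>w\<in>W. map_vec (\<lambda>z. z ^ (q ^ m)) w \<in> W)}"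

text \<open>
  Descent for vector spaces. Scale \<open>w\<close> to have a coordinate equal to 1 and subtract the result from its image
  under Frobenius: the difference \<open>u\<close> has fewer nonzero coordinates, so by induction it is a combination of fixed
  vectors. Solving \<open>z ^ (q ^ m) = z + u\<close> in their span shows that \<open>w\<close> differs from a vector of the span by a
  fixed one.
\<close>

lemma stable_subspace_spanned:
  assumes W: "W \<in> stable_subspaces m n" and m: "m > 0"
  defines "D \<equiv> {w \<in> carrier_vec n. map_vec (\<lambda>z. z ^ (q ^ m)) w = w}"
  shows "W = lin_comb n (W \<inter> D)"
proof
  let ?F = "map_vec (\<lambda>z :: 'k. z ^ (q ^ m))"
  have c: "W \<inter> D \<subseteq> carrier_vec n" by (auto simp: D_def)
  note Wc = W[unfolded stable_subspaces_def, simplified]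
  show sub: "lin_comb n (W \<inter> D) \<subseteq> W"
  proof
    fix w :: "'k vec" assume "w \<in> lin_comb n (W \<inter> D)"
    then show "w \<in> W" by induction (use Wc in auto)
  qed
  have solve: "\<exists>z\<in>lin_comb n (W \<inter> D). ?F z = z + u" if "u \<in> lin_comb n (W \<inter> D)" for u
    using that
  proof induction
    case zero
    have "?F (0\<^sub>v n) = 0\<^sub>v n + 0\<^sub>v n" using q_gt_1 by (intro eq_vecI) (auto)
    then show ?case using lin_comb.zero by blast
  next
    case (step f u d)
    then obtain z :: "'k vec" where z: "z \<in> lin_comb n (W \<inter> D)" "?F z = z + u" by blast
    have "q ^ m > 1" using m q_gt_1 one_less_power by blast
    then obtain t where t: "t ^ (q ^ m) + (- d) = 1 * t" using root_exists by blast
    then have t: "t ^ (q ^ m) = t + d" by (simp add: algebra_simps)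
    have f: "f \<in> carrier_vec n" "?F f = f" using step(1) by (auto simp: D_def)
    have cz: "z \<in> carrier_vec n" "u \<in> carrier_vec n"
      using lin_comb_carrier[OF c] z(1) step(2) by blast+
    have "?F (t \<cdot>\<^sub>v f + z) = (t \<cdot>\<^sub>v f + z) + (d \<cdot>\<^sub>v f + u)"
    proof (rule eq_vecI)
      fix i assume i: "i < dim_vec ((t \<cdot>\<^sub>v f + z) + (d \<cdot>\<^sub>v f + u))"
      have i: "i < n" using i cz by simp
      have "f $ i ^ (q ^ m) = f $ i" using arg_cong[OF f(2), of "\<lambda>w :: 'k vec. w $ i"] f(1) i by simp
      moreover have "z $ i ^ (q ^ m) = z $ i + u $ i"
        using arg_cong[OF z(2), of "\<lambda>w :: 'k vec. w $ i"] cz i by simp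
      ultimately show "?F (t \<cdot>\<^sub>v f + z) $ i = ((t \<cdot>\<^sub>v f + z) + (d \<cdot>\<^sub>v f + u)) $ i"
        using i f(1) cz t by (simp add: fr_add_pow power_mult_distrib algebra_simps)
    qed (use f(1) cz in auto)
    then show ?case using lin_comb.step[OF step(1) z(1)] by blast
  qed
  show "W \<subseteq> lin_comb n (W \<inter> D)"
  proof
    fix w :: "'k vec" assume "w \<in> W"
    then show "w \<in> lin_comb n (W \<inter> D)"
    proof (induction "card {i. i < n \<and> (w :: 'k vec) $ i \<noteq> 0}" arbitrary: w rule: less_induct)
      case less
      have wc: "w \<in> carrier_vec n" using less(2) Wc by blast
      show ?case
      proof (cases "\<exists>j<n. w $ j \<noteq> 0")
        case False
        then have "w = 0\<^sub>v n" using wc by (intro eq_vecI) auto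
        then show ?thesis by (simp add: lin_comb.zero)
      next
        case True
        then obtain j where j: "j < n" "w $ j \<noteq> 0" by blast
        define w1 :: "'k vec" where "w1 = inverse (w $ j) \<cdot>\<^sub>v w"
        have w1: "w1 \<in> W" "w1 \<in> carrier_vec n" "w1 $ j = 1"
          using Wc less(2) wc j by (auto simp: w1_def)
        define u :: "'k vec" where "u = ?F w1 + (- 1) \<cdot>\<^sub>v w1"
        have u: "u \<in> W" "u \<in> carrier_vec n" using Wc w1 unfolding u_def by auto
        have ui: "u $ i = w1 $ i ^ (q ^ m) - w1 $ i" if "i < n" for i
          using that w1(2) by (simp add: u_def)
        have "q ^ m > 0" using q_gt_1 by simp
        then have "{i. i < n \<and> u $ i \<noteq> 0} \<subseteq> {i. i < n \<and> w $ i \<noteq> 0}"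
          using ui wc by (auto simp: w1_def power_0_left)
        moreover have "j \<in> {i. i < n \<and> w $ i \<noteq> 0}" "j \<notin> {i. i < n \<and> u $ i \<noteq> 0}"
          using j ui[OF j(1)] w1(3) by auto
        ultimately have "{i. i < n \<and> u $ i \<noteq> 0} \<subset> {i. i < n \<and> w $ i \<noteq> 0}" by blast
        then have "card {i. i < n \<and> u $ i \<noteq> 0} < card {i. i < n \<and> w $ i \<noteq> 0}"
          by (intro psubset_card_mono) auto
        then have "u \<in> lin_comb n (W \<inter> D)" using less(1) u by blast
        then obtain z :: "'k vec" where z: "z \<in> lin_comb n (W \<inter> D)" "?F z = z + u" using solve by blast
        have zc: "z \<in> carrier_vec n" using lin_comb_carrier[OF c z(1)] .
        define f :: "'k vec" where "f = w1 + (- 1) \<cdot>\<^sub>v z"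
        have "f \<in> W" using z(1) sub w1(1) Wc unfolding f_def by blast
        moreover have "?F f = f"
        proof (rule eq_vecI)
          fix i assume "i < dim_vec f"
          then have i: "i < n" using w1(2) zc by (simp add: f_def)
          have zi: "z $ i ^ (q ^ m) = z $ i + u $ i"
            using arg_cong[OF z(2), of "\<lambda>w :: 'k vec. w $ i"] zc u i by simp
          have "(w1 $ i - z $ i) ^ (q ^ m) + z $ i ^ (q ^ m) = w1 $ i ^ (q ^ m)"
            using fr_add_pow[of "w1 $ i - z $ i" "z $ i" m] by simp
          then have "(w1 $ i - z $ i) ^ (q ^ m) = w1 $ i - z $ i"
            unfolding zi ui[OF i] by (simp add: algebra_simps)
          then show "?F f $ i = f $ i" using i w1(2) zc by (simp add: f_def)
        qed simp
        ultimately have f: "f \<in> W \<inter> D" using w1(2) zc by (simp add: D_def f_def)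
        have "w1 = 1 \<cdot>\<^sub>v f + z" using w1(2) zc by (intro eq_vecI) (auto simp: f_def)
        then have "w1 \<in> lin_comb n (W \<inter> D)" using lin_comb.step[OF f z(1)] by metis
        moreover have "w = (w $ j) \<cdot>\<^sub>v w1" using j wc by (intro eq_vecI) (auto simp: w1_def)
        ultimately show ?thesis using lin_comb_smult[OF c] by metis
      qed
    qed
  qed
qed

text \<open>
  A stable subspace is determined by the set of its fixed vectors, of which there are finitely many.
\<close>

lemma finite_stable_subspaces:
  assumes m: "m > 0"
  shows "finite (stable_subspaces m n)"
proof -
  let ?D = "{w \<in> carrier_vec n. map_vec (\<lambda>z :: 'k. z ^ (q ^ m)) w = w}"
  have "?D \<subseteq> (\<lambda>f. vec n f) ` ({..<n} \<rightarrow>\<^sub>E {x :: 'k. x ^ (q ^ m) = x})"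
  proof
    fix w :: "'k vec" assume w: "w \<in> ?D"
    then have wc: "w \<in> carrier_vec n" and F: "map_vec (\<lambda>z. z ^ (q ^ m)) w = w" by auto
    have "w $ i ^ (q ^ m) = w $ i" if "i < n" for i
    proof -
      have "w $ i ^ (q ^ m) = map_vec (\<lambda>z. z ^ (q ^ m)) w $ i" using wc that by auto
      then show ?thesis unfolding F .
    qed
    then have "(\<lambda>i\<in>{..<n}. w $ i) \<in> {..<n} \<rightarrow>\<^sub>E {x. x ^ (q ^ m) = x}" by auto
    moreover have "w = vec n (\<lambda>i\<in>{..<n}. w $ i)" by (rule eq_vecI) (use wc in auto)
    ultimately show "w \<in> (\<lambda>f. vec n f) ` ({..<n} \<rightarrow>\<^sub>E {x. x ^ (q ^ m) = x})" by blast
  qed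
  moreover have "finite ({..<n} \<rightarrow>\<^sub>E {x :: 'k. x ^ (q ^ m) = x})"
    by (rule finite_PiE[OF finite_lessThan]) (rule finite_fixed[OF m])
  ultimately have "finite ?D" using finite_imageI finite_subset by blast
  then have "finite ((\<lambda>W. W \<inter> ?D) ` stable_subspaces m n)"
    by (rule finite_subset[rotated, OF finite_Pow_iff[THEN iffD2]]) blast
  moreover have "inj_on (\<lambda>W. W \<inter> ?D) (stable_subspaces m n)"
  proof (rule inj_onI)
    fix W W' assume W: "W \<in> stable_subspaces m n" "W' \<in> stable_subspaces m n" and eq: "W \<inter> ?D = W' \<inter> ?D"
    show "W = W'"
      using stable_subspace_spanned[OF W(1) m] stable_subspace_spanned[OF W(2) m] unfolding eq by simp
  qed
  ultimately show ?thesis by (rule finite_imageD)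
qed

end

section \<open>The induction product as a sum over the gauge group\<close>

context hall_data
begin

text \<open>The isomorphism of \<open>Hom(T, W)\<close> with the unipotent radical.\<close>

definition Ulift :: "('v set \<Rightarrow> nat) \<Rightarrow> ('v set \<Rightarrow> nat) \<Rightarrow> ('v \<Rightarrow> 'k mat) \<Rightarrow> 'v \<Rightarrow> 'k mat" where
  "Ulift \<tau> \<omega> M = (\<lambda>v\<in>V. lower_mat (1\<^sub>m (dm \<tau> v)) (M v) (1\<^sub>m (dm \<omega> v)))"

lemma Ulift_in:
  assumes M: "\<And>v. v \<in> V \<Longrightarrow> M v \<in> carrier_mat (dm \<omega> v) (dm \<tau> v)"
  shows "Ulift \<tau> \<omega> M \<in> U \<tau> \<omega>"
proof -
  note b = blk_of_lower_mat[OF one_carrier_mat M one_carrier_mat]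
  have "det (lower_mat (1\<^sub>m (dm \<tau> v)) (M v) (1\<^sub>m (dm \<omega> v))) = 1" if "v \<in> V" for v
    by (subst det_four_block_mat_upper_right_zero) (use M[OF that] in auto)
  then have "Ulift \<tau> \<omega> M \<in> G (dplus \<tau> \<omega>)" using M by (auto simp: gauge_iff Ulift_def)
  then show ?thesis using b
    by (auto simp: unip_iff parab_iff gT_def gW_def gunit_def Ulift_def intro!: restrict_ext)
qed

lemma U_eq_Ulift:
  assumes "u \<in> U \<tau> \<omega>"
  shows "u = Ulift \<tau> \<omega> (\<lambda>v. blk_L (dm \<tau> v) (dm \<omega> v) (dm \<tau> v) (u v))"
proof (rule extensionalityI[of _ V])
  show "u \<in> extensional V" using gaugeD(3)[OF Q_G[OF U_Q[OF assms]]] .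
  fix v assume v: "v \<in> V"
  note q = QD[OF U_Q[OF assms] v]
  have "blk_T (dm \<tau> v) (dm \<tau> v) (u v) = 1\<^sub>m (dm \<tau> v)"
    "blk_W (dm \<tau> v) (dm \<tau> v) (dm \<omega> v) (dm \<omega> v) (u v) = 1\<^sub>m (dm \<omega> v)"
  proof -
    have "gT \<tau> u v = gunit \<tau> v" "gW \<tau> \<omega> u v = gunit \<omega> v" using assms by (simp_all add: unip_iff)
    then show "blk_T (dm \<tau> v) (dm \<tau> v) (u v) = 1\<^sub>m (dm \<tau> v)"
      "blk_W (dm \<tau> v) (dm \<tau> v) (dm \<omega> v) (dm \<omega> v) (u v) = 1\<^sub>m (dm \<omega> v)"
      using v by (simp_all add: gT_def gW_def gunit_def)
  qed
  then show "u v = Ulift \<tau> \<omega> (\<lambda>v. blk_L (dm \<tau> v) (dm \<omega> v) (dm \<tau> v) (u v)) v"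
    using blk_lower_decomp[OF q(1,3)] v by (simp add: Ulift_def)
qed (simp add: Ulift_def)

text \<open>
  The unipotent radical is isomorphic to the additive group of \<open>Hom(T, W)\<close>, so the equation can be
  solved separately for each matrix coefficient.
\<close>

lemma lang_U:
  assumes b: "b \<in> U \<tau> \<omega>"
  shows "\<exists>u\<in>U \<tau> \<omega>. u = gm (FG u) b"
proof -
  define B where "B v = blk_L (dm \<tau> v) (dm \<omega> v) (dm \<tau> v) (b v)" for v
  have Bc [simp]: "B v \<in> carrier_mat (dm \<omega> v) (dm \<tau> v)" for v by (simp add: B_def)
  have Bd [simp]: "dim_row (B v) = dm \<omega> v" "dim_col (B v) = dm \<tau> v" for v by (simp_all add: B_def)
  have "\<exists>z. \<forall>v\<in>V. z (vaut \<Gamma> v) = z v ^ q + B (vaut \<Gamma> v) $$ ij" for ij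
    using twisted_artin_schreier[OF fin_V vaut_bij, of "\<lambda>v. B v $$ ij"] .
  then obtain z where z: "\<And>ij v. v \<in> V \<Longrightarrow> z ij (vaut \<Gamma> v) = z ij v ^ q + B (vaut \<Gamma> v) $$ ij"
    by metis
  define M where "M v = mat (dm \<omega> v) (dm \<tau> v) (\<lambda>ij. z ij v)" for v
  have Mc [simp]: "M v \<in> carrier_mat (dm \<omega> v) (dm \<tau> v)" for v by (simp add: M_def)
  have Md [simp]: "dim_row (M v) = dm \<omega> v" "dim_col (M v) = dm \<tau> v" for v by (simp_all add: M_def)
  have eq: "M v = fr (M (vinv v)) + B v" if v: "v \<in> V" for v
  proof (rule eq_matI)
    fix i j assume "i < dim_row (fr (M (vinv v)) + B v)" "j < dim_col (fr (M (vinv v)) + B v)"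
    then have "i < dm \<omega> v" "j < dm \<tau> v" by auto
    then show "M v $$ (i, j) = (fr (M (vinv v)) + B v) $$ (i, j)"
      using z[OF vinv(1)[OF v], of "(i, j)"] v by (simp add: M_def)
  qed (use v in auto)
  let ?u = "Ulift \<tau> \<omega> M"
  have u: "?u \<in> U \<tau> \<omega>" by (rule Ulift_in) simp
  have "?u v = gm (FG ?u) b v" if v: "v \<in> V" for v
  proof -
    have Mv: "M (vinv v) \<in> carrier_mat (dm \<omega> v) (dm \<tau> v)" using Mc[of "vinv v"] v by simp
    then have Fv: "fr (M (vinv v)) \<in> carrier_mat (dm \<omega> v) (dm \<tau> v)" by simp
    have bv: "b v = lower_mat (1\<^sub>m (dm \<tau> v)) (B v) (1\<^sub>m (dm \<omega> v))"
      using fun_cong[OF U_eq_Ulift[OF b], of v] v by (simp add: Ulift_def B_def)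
    have "FG ?u v = lower_mat (1\<^sub>m (dm \<tau> v)) (fr (M (vinv v))) (1\<^sub>m (dm \<omega> v))"
      using v Mv q_gt_1 by (auto simp: frob_gauge_def Ulift_def intro!: eq_matI)
    then have "FG ?u v * b v =
        lower_mat (1\<^sub>m (dm \<tau> v) * 1\<^sub>m (dm \<tau> v)) (fr (M (vinv v)) * 1\<^sub>m (dm \<tau> v) + 1\<^sub>m (dm \<omega> v) * B v)
          (1\<^sub>m (dm \<omega> v) * 1\<^sub>m (dm \<omega> v))"
      unfolding bv using lower_mat_mult[OF one_carrier_mat Fv one_carrier_mat one_carrier_mat Bc one_carrier_mat]
      by (simp only:)
    also have "\<dots> = ?u v" using v eq[OF v] right_mult_one_mat[OF Fv]
      by (simp add: Ulift_def left_mult_one_mat[OF Bc])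
    finally show ?thesis using v by (simp add: gauge_mult_def)
  qed
  then have "?u = gm (FG ?u) b"
    by (intro extensionalityI[of _ V]) (auto simp: Ulift_def gauge_mult_def)
  with u show ?thesis by blast
qed

definition UF where "UF \<tau> \<omega> = {u \<in> U \<tau> \<omega>. FG u = u}"

lemma UF_GF: "UF \<tau> \<omega> \<subseteq> GF (dplus \<tau> \<omega>)"
  using Q_G U_Q by (auto simp: UF_def GF_iff)

lemma card_UF_pos: "card (UF \<tau> \<omega>) > 0"
proof -
  have "gunit (dplus \<tau> \<omega>) \<in> UF \<tau> \<omega>" by (simp add: UF_def)
  then show ?thesis using finite_subset[OF UF_GF finite_GF] by (auto simp: card_gt_0_iff)
qed

end

text \<open>
  The products on the whole representation spaces and on their open parts are described at once, by an arbitrary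
  invariant family \<open>Y\<close> of subsets.
\<close>

locale hall_open = hall_data p e q K \<Gamma>
  for p e q :: nat and K :: "'k::alg_closed_field itself" and \<Gamma> :: "('v, 'h) aut_digraph" +
  fixes Y :: "('v set \<Rightarrow> nat) \<Rightarrow> ('h \<Rightarrow> 'k mat) set"
  assumes Y_E: "Y \<nu> \<subseteq> E \<nu>"
    and Y_act: "g \<in> G \<nu> \<Longrightarrow> x \<in> Y \<nu> \<Longrightarrow> act \<nu> g x \<in> Y \<nu>"
begin

context
  fixes \<tau> \<omega> :: "'v set \<Rightarrow> nat"
begin

abbreviation (input) "N \<equiv> dplus \<tau> \<omega>"
abbreviation (input) "SY \<equiv> stab_rep \<Gamma> Y \<tau> \<omega>"

lemma SY: "SY = S \<tau> \<omega> \<inter> Y N" by (rule stab_rep_eq[of Y, OF Y_E])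

lemma SY_E: "x \<in> SY \<Longrightarrow> x \<in> E N" using Y_E SY by blast

lemma SY_act: "g \<in> Q \<tau> \<omega> \<Longrightarrow> x \<in> SY \<Longrightarrow> act N g x \<in> SY"
  unfolding SY using S_act(1) Y_act Q_G by blast

text \<open>The class of \<open>(g, x)\<close> in \<open>G \<times>\<^sub>P S\<close>.\<close>

definition cls where "cls P g x = {(gm g (gi N b), act N b x) | b. b \<in> P}"

lemma twist_image:
  assumes "g \<in> G N" "x \<in> SY"
  shows "twist_rel \<Gamma> Y \<tau> \<omega> P `` {(g, x)} = cls P g x"
  using assms by (auto simp: twist_rel_def cls_def)

text \<open>
  What the classes for \<open>P = U\<close> and for \<open>P = Q\<close> have in common: \<open>P\<close> is a subgroup which Frobenius maps onto
  itself.
\<close>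

definition frob_subgp where
  "frob_subgp P \<longleftrightarrow> P \<subseteq> Q \<tau> \<omega> \<and> gunit N \<in> P \<and> (\<forall>b\<in>P. \<forall>c\<in>P. gm b c \<in> P) \<and> (\<forall>b\<in>P. gi N b \<in> P) \<and>
    (\<forall>b\<in>P. FG b \<in> P) \<and> (\<forall>b\<in>P. FG_root b \<in> P)"

lemma frob_subgp_U: "frob_subgp (U \<tau> \<omega>)" and frob_subgp_Q: "frob_subgp (Q \<tau> \<omega>)"
  using U_Q FG_U FG_root_U FG_Q FG_root_Q by (auto simp: frob_subgp_def)

lemma frob_subgpD:
  assumes "frob_subgp P" "b \<in> P"
  shows "b \<in> Q \<tau> \<omega>" "b \<in> G N"
  using assms Q_G by (auto simp: frob_subgp_def)

lemma cls_shift_sub: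
  assumes P: "frob_subgp P" "b \<in> P" and g: "g \<in> G N" and x: "x \<in> SY"
  shows "cls P (gm g (gi N b)) (act N b x) \<subseteq> cls P g x"
proof
  fix t assume "t \<in> cls P (gm g (gi N b)) (act N b x)"
  then obtain c where c: "c \<in> P" "t = (gm (gm g (gi N b)) (gi N c), act N c (act N b x))"
    by (auto simp: cls_def)
  note bG = frob_subgpD(2)[OF P] and cG = frob_subgpD(2)[OF P(1) c(1)]
  have "t = (gm g (gi N (gm c b)), act N (gm c b) x)"
    using c(2) bG cG g SY_E[OF x] by (simp add: gi_gm gm_assoc[of _ N] act_gm)
  then show "t \<in> cls P g x" using P c by (auto simp: cls_def frob_subgp_def)
qed

text \<open>Applying the inclusion to \<open>b\<close> and to its inverse gives equality.\<close>

lemma cls_shift: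
  assumes P: "frob_subgp P" "b \<in> P" and g: "g \<in> G N" and x: "x \<in> SY"
  shows "cls P (gm g (gi N b)) (act N b x) = cls P g x"
proof
  show "cls P (gm g (gi N b)) (act N b x) \<subseteq> cls P g x" by (rule cls_shift_sub[OF assms])
  note bG = frob_subgpD(2)[OF P] and bQ = frob_subgpD(1)[OF P]
  have "cls P (gm (gm g (gi N b)) (gi N (gi N b))) (act N (gi N b) (act N b x)) \<subseteq>
      cls P (gm g (gi N b)) (act N b x)"
    by (rule cls_shift_sub) (use P g bG SY_act[OF bQ x] in \<open>auto simp: frob_subgp_def\<close>)
  then show "cls P g x \<subseteq> cls P (gm g (gi N b)) (act N b x)"
    using bG g SY_E[OF x] by simp
qed

lemma cls_self:
  assumes "frob_subgp P" "g \<in> G N" "x \<in> SY"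
  shows "(g, x) \<in> cls P g x"
proof -
  have "(g, x) = (gm g (gi N (gunit N)), act N (gunit N) x)" using assms(2) SY_E[OF assms(3)] by simp
  then show ?thesis using assms(1) unfolding cls_def frob_subgp_def by blast
qed

lemma cls_member:
  assumes "frob_subgp P" "g \<in> G N" "x \<in> SY" "(g', x') \<in> cls P g x"
  shows "\<exists>b\<in>P. b \<in> G N \<and> g' = gm g (gi N b) \<and> x' = act N b x \<and> g' \<in> G N \<and> x' \<in> SY"
proof -
  from assms(4) obtain b where b: "b \<in> P" "g' = gm g (gi N b)" "x' = act N b x" by (auto simp: cls_def)
  then show ?thesis using frob_subgpD[OF assms(1) b(1)] assms SY_act by auto
qed

lemma quotient_eq_cls: "(G N \<times> SY) // twist_rel \<Gamma> Y \<tau> \<omega> P = {cls P g x | g x. g \<in> G N \<and> x \<in> SY}"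
  unfolding quotient_def using twist_image by fast

lemma p3_cls:
  assumes "frob_subgp P" "g \<in> G N" "x \<in> SY"
  shows "p3 \<Gamma> \<tau> \<omega> (cls P g x) = act N g x"
proof -
  have "(\<lambda>(g, x). act N g x) ` cls P g x = {act N g x}"
  proof
    show "(\<lambda>(g, x). act N g x) ` cls P g x \<subseteq> {act N g x}"
    proof safe
      fix g' x' assume "(g', x') \<in> cls P g x"
      from cls_member[OF assms this] obtain b where b: "b \<in> G N" "g' = gm g (gi N b)" "x' = act N b x"
        by blast
      have "act N g' x' = act N (gm g' b) x" using b assms(2) SY_E[OF assms(3)] by (simp add: act_gm)
      then show "act N g' x' = act N g x" using b assms(2) by simp
    qed
    show "{act N g x} \<subseteq> (\<lambda>(g, x). act N g x) ` cls P g x"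
      using cls_self[OF assms] by force
  qed
  then show ?thesis by (simp add: p3_def)
qed

lemma p1_cls:
  assumes "g \<in> G N" "x \<in> SY"
  shows "p1 \<Gamma> \<tau> \<omega> (cls (U \<tau> \<omega>) g x) = (iT \<tau> x, iW \<tau> \<omega> x)"
proof -
  have x: "x \<in> S \<tau> \<omega>" using assms SY by blast
  have "(\<lambda>(g, x). (iT \<tau> x, iW \<tau> \<omega> x)) ` cls (U \<tau> \<omega>) g x = {(iT \<tau> x, iW \<tau> \<omega> x)}"
  proof
    show "(\<lambda>(g, x). (iT \<tau> x, iW \<tau> \<omega> x)) ` cls (U \<tau> \<omega>) g x \<subseteq> {(iT \<tau> x, iW \<tau> \<omega> x)}"
      using S_act(2,3)[OF U_Q x] by (auto simp: cls_def unip_iff)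
    show "{(iT \<tau> x, iW \<tau> \<omega> x)} \<subseteq> (\<lambda>(g, x). (iT \<tau> x, iW \<tau> \<omega> x)) ` cls (U \<tau> \<omega>) g x"
      using cls_self[OF frob_subgp_U assms] by force
  qed
  then show ?thesis by (simp add: p1_def)
qed

lemma p2_cls:
  assumes "g \<in> G N" "x \<in> SY"
  shows "p2 \<Gamma> Y \<tau> \<omega> (cls (U \<tau> \<omega>) g x) = cls (Q \<tau> \<omega>) g x"
proof
  show "p2 \<Gamma> Y \<tau> \<omega> (cls (U \<tau> \<omega>) g x) \<subseteq> cls (Q \<tau> \<omega>) g x"
  proof
    fix t assume "t \<in> p2 \<Gamma> Y \<tau> \<omega> (cls (U \<tau> \<omega>) g x)"
    then obtain g' x' where 1: "(g', x') \<in> cls (U \<tau> \<omega>) g x" "t \<in> twist_rel \<Gamma> Y \<tau> \<omega> (Q \<tau> \<omega>) `` {(g', x')}"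
      by (auto simp: p2_def)
    from cls_member[OF frob_subgp_U assms 1(1)] obtain b where b: "b \<in> U \<tau> \<omega>" "g' = gm g (gi N b)"
      "x' = act N b x" "g' \<in> G N" "x' \<in> SY" by blast
    have "t \<in> cls (Q \<tau> \<omega>) g' x'" using 1(2) twist_image[OF b(4,5)] by simp
    then show "t \<in> cls (Q \<tau> \<omega>) g x" using cls_shift[OF frob_subgp_Q U_Q[OF b(1)] assms] b by simp
  qed
  have "cls (Q \<tau> \<omega>) g x = twist_rel \<Gamma> Y \<tau> \<omega> (Q \<tau> \<omega>) `` {(g, x)}" by (rule twist_image[OF assms, symmetric])
  then show "cls (Q \<tau> \<omega>) g x \<subseteq> p2 \<Gamma> Y \<tau> \<omega> (cls (U \<tau> \<omega>) g x)"
    using cls_self[OF frob_subgp_U assms] by (auto simp: p2_def)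
qed

lemma frob_cls:
  assumes P: "frob_subgp P" and g: "g \<in> GF N" and x: "x \<in> SY" "FE x = x"
  shows "frob_class \<Gamma> q (cls P g x) = cls P g x"
proof -
  have gG: "g \<in> G N" "FG g = g" using g by (auto simp: GF_iff)
  have F: "map_prod FG FE (gm g (gi N b), act N b x) = (gm g (gi N (FG b)), act N (FG b) x)"
    if "b \<in> P" for b
    using frob_subgpD(2)[OF P that] gG SY_E[OF x(1)] x(2) by (simp add: FG_gm[of _ N] FG_gi FE_act)
  have "frob_class \<Gamma> q (cls P g x) = {(gm g (gi N (FG b)), act N (FG b) x) | b. b \<in> P}"
    using F unfolding frob_class_def cls_def by (auto simp: image_iff) (metis F)+
  also have "\<dots> = cls P g x"
  proof
    show "{(gm g (gi N (FG b)), act N (FG b) x) | b. b \<in> P} \<subseteq> cls P g x"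
      using P by (auto simp: cls_def frob_subgp_def)
    show "cls P g x \<subseteq> {(gm g (gi N (FG b)), act N (FG b) x) | b. b \<in> P}"
    proof
      fix t assume "t \<in> cls P g x"
      then obtain b where b: "b \<in> P" "t = (gm g (gi N b), act N b x)" by (auto simp: cls_def)
      then have "FG_root b \<in> P" "FG (FG_root b) = b"
        using P FG_FG_root[OF frob_subgpD(2)[OF P b(1)]] by (auto simp: frob_subgp_def)
      then show "t \<in> {(gm g (gi N (FG b)), act N (FG b) x) | b. b \<in> P}" using b(2)
        by (metis (mono_tags, lifting) mem_Collect_eq)
    qed
  qed
  finally show ?thesis .
qed

abbreviation (input) "E1F \<equiv> fixed_pts (frob_class \<Gamma> q) (E1 \<Gamma> Y \<tau> \<omega>)"
abbreviation (input) "E2F \<equiv> fixed_pts (frob_class \<Gamma> q) (E2 \<Gamma> Y \<tau> \<omega>)"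

text \<open>
  A fixed class is moved by Frobenius within itself, by some element \<open>b\<close> of \<open>P\<close>; fixed representatives
  exist once \<open>b\<close> can be removed.
\<close>

lemma frob_fixed_cls:
  assumes P: "frob_subgp P" and g: "g \<in> G N" and x: "x \<in> SY" and F: "frob_class \<Gamma> q (cls P g x) = cls P g x"
  shows "\<exists>b\<in>P. FG g = gm g (gi N b) \<and> FE x = act N b x"
proof -
  have "(FG g, FE x) \<in> frob_class \<Gamma> q (cls P g x)"
    using cls_self[OF P g x] by (force simp: frob_class_def)
  then show ?thesis unfolding F by (auto simp: cls_def)
qed

text \<open>
  Changing the representative by the solution \<open>u\<close> of Lang's equation \<open>u = F(u) b\<close> removes \<open>b\<close>.
\<close>

lemma E1F_eq: "E1F = {cls (U \<tau> \<omega>) g x | g x. g \<in> GF N \<and> x \<in> SY \<and> FE x = x}"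
proof (intro equalityI subsetI)
  fix c assume "c \<in> E1F"
  then obtain g x where c: "c = cls (U \<tau> \<omega>) g x" "g \<in> G N" "x \<in> SY" "frob_class \<Gamma> q c = c"
    by (auto simp: fixed_pts_def E1_def quotient_eq_cls)
  obtain b where b: "b \<in> U \<tau> \<omega>" "FG g = gm g (gi N b)" "FE x = act N b x"
    using frob_fixed_cls[OF frob_subgp_U c(2,3)] c by blast
  obtain u where u: "u \<in> U \<tau> \<omega>" "u = gm (FG u) b" using lang_U[OF b(1)] by blast
  note uG = frob_subgpD(2)[OF frob_subgp_U u(1)] and uQ = U_Q[OF u(1)] and bG = frob_subgpD(2)[OF frob_subgp_U b(1)]
  have "FG (gm g (gi N u)) = gm (gm g (gi N b)) (gi N (FG u))"
    using uG c(2) b(2) by (simp add: FG_gm[of _ N] FG_gi)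
  also have "\<dots> = gm g (gi N (gm (FG u) b))"
    using uG bG c(2) by (simp add: gi_gm gm_assoc[of _ N])
  finally have "gm g (gi N u) \<in> GF N" using u(2) uG c(2) by (simp add: GF_iff)
  moreover have "FE (act N u x) = act N (gm (FG u) b) x"
    using uG bG SY_E[OF c(3)] b(3) by (simp add: FE_act act_gm)
  then have "FE (act N u x) = act N u x" using u(2) by simp
  ultimately show "c \<in> {cls (U \<tau> \<omega>) g x | g x. g \<in> GF N \<and> x \<in> SY \<and> FE x = x}"
    using cls_shift[OF frob_subgp_U u(1) c(2,3)] c(1) SY_act[OF uQ c(3)] by blast
next
  fix c assume "c \<in> {cls (U \<tau> \<omega>) g x | g x. g \<in> GF N \<and> x \<in> SY \<and> FE x = x}"
  then obtain g x where c: "c = cls (U \<tau> \<omega>) g x" "g \<in> GF N" "x \<in> SY" "FE x = x" by blast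
  then have "c \<in> E1 \<Gamma> Y \<tau> \<omega>" unfolding E1_def quotient_eq_cls using GF_G by blast
  then show "c \<in> E1F" using frob_cls[OF frob_subgp_U c(2-4)] c(1) by (simp add: fixed_pts_def)
qed

lemma finite_E1F: "finite E1F"
proof -
  have "E1F \<subseteq> (\<lambda>(g, x). cls (U \<tau> \<omega>) g x) ` (GF N \<times> EF N)"
  proof
    fix c assume "c \<in> E1F"
    then obtain g x where c: "c = cls (U \<tau> \<omega>) g x" "g \<in> GF N" "x \<in> SY" "FE x = x"
      unfolding E1F_eq by blast
    have "(g, x) \<in> GF N \<times> EF N" using c SY_E[OF c(3)] by (simp add: EF_iff)
    then show "c \<in> (\<lambda>(g, x). cls (U \<tau> \<omega>) g x) ` (GF N \<times> EF N)"
      using c(1) by (auto intro: image_eqI[of _ _ "(g, x)"])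
  qed
  then show ?thesis by (rule finite_subset) simp
qed

lemma p2_E2F:
  assumes "c \<in> E1F"
  shows "p2 \<Gamma> Y \<tau> \<omega> c \<in> E2F"
proof -
  obtain g x where c: "c = cls (U \<tau> \<omega>) g x" "g \<in> GF N" "x \<in> SY" "FE x = x"
    using assms unfolding E1F_eq by blast
  have eq: "p2 \<Gamma> Y \<tau> \<omega> c = cls (Q \<tau> \<omega>) g x" unfolding c(1) by (rule p2_cls[OF GF_G[OF c(2)] c(3)])
  then have "p2 \<Gamma> Y \<tau> \<omega> c \<in> E2 \<Gamma> Y \<tau> \<omega>" unfolding E2_def quotient_eq_cls using GF_G[OF c(2)] c(3) by blast
  then show ?thesis using frob_cls[OF frob_subgp_Q c(2,3,4)] eq by (simp add: fixed_pts_def)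
qed

text \<open>
  A class in the fibre of \<open>p3\<close> over \<open>y\<close> is determined by the graded subspace \<open>g W\<close> of \<open>V\<close>, as \<open>x = g\<inverse> y\<close>. If the
  class is fixed, then Frobenius maps \<open>g W\<close> at \<open>v\<close> to \<open>g W\<close> at \<open>a v\<close>, so each component is stable under a power of
  Frobenius and there are only finitely many possibilities.
\<close>

lemma finite_E2F_fibre: "finite {d \<in> E2F. p3 \<Gamma> \<tau> \<omega> d = y}"
proof -
  let ?W = "\<lambda>v. coordW (dm \<tau> v) (dm \<omega> v) :: 'k vec set"
  let ?T = "{d \<in> E2F. p3 \<Gamma> \<tau> \<omega> d = y}"
  have "\<forall>d\<in>?T. \<exists>t. fst t \<in> G N \<and> snd t \<in> SY \<and> d = cls (Q \<tau> \<omega>) (fst t) (snd t)"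
    by (auto simp: fixed_pts_def E2_def quotient_eq_cls)
  from bchoice[OF this] obtain t
    where t: "\<forall>d\<in>?T. fst (t d) \<in> G N \<and> snd (t d) \<in> SY \<and> d = cls (Q \<tau> \<omega>) (fst (t d)) (snd (t d))"
    by blast
  define gg xx where "gg d = fst (t d)" and "xx d = snd (t d)" for d
  have gx: "gg d \<in> G N \<and> xx d \<in> SY \<and> d = cls (Q \<tau> \<omega>) (gg d) (xx d)" if "d \<in> ?T" for d
    using t that unfolding gg_def xx_def by blast
  have xx: "xx d = act N (gi N (gg d)) y" if "d \<in> ?T" for d
  proof -
    have "y = p3 \<Gamma> \<tau> \<omega> (cls (Q \<tau> \<omega>) (gg d) (xx d))" using gx[OF that] that by simp
    also have "\<dots> = act N (gg d) (xx d)" using gx[OF that] p3_cls[OF frob_subgp_Q] by blast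
    finally have y: "y = act N (gg d) (xx d)" .
    show ?thesis unfolding y using act_cancel(1) gx[OF that] SY_E by simp
  qed
  obtain n where n: "\<And>v. v \<in> V \<Longrightarrow> n v > 0 \<and> (vaut \<Gamma> ^^ n v) v = v"
    using returns_of_bij_betw[OF fin_V vaut_bij] by metis
  \<comment> \<open>The graded subspace \<open>g W\<close>.\<close>
  define \<Theta> where "\<Theta> d = (\<lambda>v\<in>V. (\<lambda>w. gg d v *\<^sub>v w) ` ?W v)" for d
  have mem: "\<Theta> d v \<in> stable_subspaces (n v) (dm N v)" if d: "d \<in> ?T" and v: "v \<in> V" for d v
  proof -
    have g: "gg d \<in> G N" "xx d \<in> SY" "d = cls (Q \<tau> \<omega>) (gg d) (xx d)" using gx[OF d] by auto
    have gv: "gg d v \<in> carrier_mat (dm \<tau> v + dm \<omega> v) (dm \<tau> v + dm \<omega> v)" if "v \<in> V" for v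
      using gaugeD(1)[OF g(1) that] by simp
    obtain b where b: "b \<in> Q \<tau> \<omega>" "FG (gg d) = gm (gg d) (gi N b)"
      using frob_fixed_cls[OF frob_subgp_Q g(1,2)] g(3) d by (auto simp: fixed_pts_def)
    have b': "gi N b \<in> Q \<tau> \<omega>" using b by simp
    \<comment> \<open>Since \<open>F(g) = g b\<inverse>\<close> with \<open>b\<close> in \<open>Q\<close>, and \<open>b\<close> and Frobenius preserve the coordinate subspace.\<close>
    have step: "map_vec (\<lambda>z. z ^ q) w \<in> \<Theta> d (vaut \<Gamma> v)" if v: "v \<in> V" and w: "w \<in> \<Theta> d v" for v w
    proof -
      obtain w0 where w0: "w0 \<in> ?W v" "w = gg d v *\<^sub>v w0" using w v by (auto simp: \<Theta>_def)
      let ?w1 = "map_vec (\<lambda>z. z ^ q) w0" and ?v' = "vaut \<Gamma> v"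
      have w1: "?w1 \<in> ?W ?v'" using w0(1) v q_gt_1 by auto
      have "fr (gg d v) = gg d ?v' * gi N b ?v'"
        using fun_cong[OF b(2), of ?v'] v by (simp add: frob_gauge_def gauge_mult_def)
      moreover have "map_vec (\<lambda>z. z ^ q) w = fr (gg d v) *\<^sub>v ?w1"
        unfolding w0(2) by (rule semiring_hom.mult_mat_vec_hom[OF _ gv[OF v]])
          (use w0(1) field_hom.axioms(1)[OF fr_hom] in \<open>auto intro: idom_hom.axioms comm_ring_hom.axioms ring_hom.axioms\<close>)
      ultimately have "map_vec (\<lambda>z. z ^ q) w = gg d ?v' *\<^sub>v (gi N b ?v' *\<^sub>v ?w1)"
        using gv[of ?v'] QD(1)[OF b', of ?v'] w1 v by (simp add: assoc_mult_mat_vec[of _ _ "dm \<tau> v + dm \<omega> v"])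
      moreover have "gi N b ?v' *\<^sub>v ?w1 \<in> ?W ?v'"
        using coordW_stable_iff[OF QD(1)[OF b' vaut_in[OF v]]] QD(3)[OF b' vaut_in[OF v]] w1 by blast
      ultimately show ?thesis using v by (auto simp: \<Theta>_def)
    qed
    have iter: "(vaut \<Gamma> ^^ m) v \<in> V \<and> map_vec (\<lambda>z. z ^ (q ^ m)) w \<in> \<Theta> d ((vaut \<Gamma> ^^ m) v)"
      if "v \<in> V" "w \<in> \<Theta> d v" for m v w
    proof (induction m)
      case 0
      have "map_vec (\<lambda>z. z ^ (q ^ 0)) w = w" by (intro eq_vecI) auto
      then show ?case using that by simp
    next
      case (Suc m)
      have "map_vec (\<lambda>z. z ^ (q ^ Suc m)) w = map_vec (\<lambda>z. z ^ q) (map_vec (\<lambda>z. z ^ (q ^ m)) w)"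
        by (intro eq_vecI) (simp_all add: fr_pow_Suc del: power_Suc)
      then show ?case using step[of "(vaut \<Gamma> ^^ m) v"] Suc by simp
    qed
    have "map_vec (\<lambda>z. z ^ (q ^ n v)) w \<in> \<Theta> d v" if "w \<in> \<Theta> d v" for w
      using iter[OF v that, of "n v"] n[OF v] by simp
    moreover have "\<Theta> d v \<subseteq> carrier_vec (dm N v)" using gv[OF v] v by (auto simp: \<Theta>_def)
    moreover have "0\<^sub>v (dm N v) \<in> \<Theta> d v"
    proof -
      have "0\<^sub>v (dm N v) = gg d v *\<^sub>v 0\<^sub>v (dm N v)" using mat_mult_zero_vec[OF gv[OF v]] by simp
      moreover have "0\<^sub>v (dm N v) \<in> ?W v" by auto
      ultimately show ?thesis using v unfolding \<Theta>_def by auto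
    qed
    moreover have "u + w \<in> \<Theta> d v" if uw: "u \<in> \<Theta> d v" "w \<in> \<Theta> d v" for u w
    proof -
      obtain u0 w0 where 0: "u0 \<in> ?W v" "u = gg d v *\<^sub>v u0" "w0 \<in> ?W v" "w = gg d v *\<^sub>v w0"
        using uw v by (auto simp: \<Theta>_def)
      have "u + w = gg d v *\<^sub>v (u0 + w0)" using 0 gv[OF v] by (simp add: mult_add_distrib_mat_vec)
      moreover have "u0 + w0 \<in> ?W v" using 0 by auto
      ultimately show ?thesis using v by (auto simp: \<Theta>_def)
    qed
    moreover have "k \<cdot>\<^sub>v w \<in> \<Theta> d v" if w: "w \<in> \<Theta> d v" for k w
    proof -
      obtain w0 where 0: "w0 \<in> ?W v" "w = gg d v *\<^sub>v w0" using w v by (auto simp: \<Theta>_def)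
      have "k \<cdot>\<^sub>v w = gg d v *\<^sub>v (k \<cdot>\<^sub>v w0)" using 0 gv[OF v] by (simp add: mult_mat_vec)
      moreover have "k \<cdot>\<^sub>v w0 \<in> ?W v" using 0 by auto
      ultimately show ?thesis using v by (auto simp: \<Theta>_def)
    qed
    ultimately show ?thesis unfolding stable_subspaces_def by blast
  qed
  have "\<Theta> ` ?T \<subseteq> (\<Pi>\<^sub>E v\<in>V. stable_subspaces (n v) (dm N v))"
    using mem by (auto simp: PiE_iff \<Theta>_def)
  moreover have "finite (\<Pi>\<^sub>E v\<in>V. stable_subspaces (n v) (dm N v))"
    by (rule finite_PiE[OF fin_V]) (rule finite_stable_subspaces, use n in blast)
  ultimately have "finite (\<Theta> ` ?T)" by (rule finite_subset)
  moreover have "inj_on \<Theta> ?T"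
  proof (rule inj_onI)
    fix d d' assume d: "d \<in> ?T" "d' \<in> ?T" and eq: "\<Theta> d = \<Theta> d'"
    note g = gx[OF d(1)] and g' = gx[OF d(2)]
    \<comment> \<open>If \<open>g W = g' W\<close>, then \<open>g'\<inverse> g\<close> stabilises \<open>W\<close>.\<close>
    let ?b = "gm (gi N (gg d')) (gg d)"
    have b: "?b \<in> G N" using g g' by simp
    have "(\<lambda>w. ?b v *\<^sub>v w) ` subsp_W \<Gamma> \<tau> \<omega> v = subsp_W \<Gamma> \<tau> \<omega> v" if v: "v \<in> V" for v
    proof -
      let ?i = "gi N (gg d') v"
      have c: "?i \<in> carrier_mat (dm N v) (dm N v)" "gg d v \<in> carrier_mat (dm N v) (dm N v)"
        "gg d' v \<in> carrier_mat (dm N v) (dm N v)"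
        using gaugeD(1)[OF gi_in v] gaugeD(1)[OF _ v] g g' by blast+
      have W: "?W v \<subseteq> carrier_vec (dm N v)" by auto
      have "(\<lambda>w. ?b v *\<^sub>v w) ` ?W v = (\<lambda>w. ?i *\<^sub>v (gg d v *\<^sub>v w)) ` ?W v"
        using c W v by (intro image_cong refl) (auto simp: gauge_mult_def intro!: assoc_mult_mat_vec)
      also have "\<dots> = (\<lambda>w. ?i *\<^sub>v w) ` \<Theta> d v" using v by (simp add: \<Theta>_def image_image)
      also have "\<dots> = (\<lambda>w. ?i *\<^sub>v (gg d' v *\<^sub>v w)) ` ?W v" using v unfolding eq by (simp add: \<Theta>_def image_image)
      also have "\<dots> = (\<lambda>w. w) ` ?W v"
      proof (intro image_cong refl)
        fix w assume "w \<in> ?W v"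
        then have w: "w \<in> carrier_vec (dm N v)" using W by blast
        have "?i *\<^sub>v (gg d' v *\<^sub>v w) = (?i * gg d' v) *\<^sub>v w" using c w by (simp add: assoc_mult_mat_vec)
        then show "?i *\<^sub>v (gg d' v *\<^sub>v w) = w" using gi_at(2)[of "gg d'" N v] g' v w by simp
      qed
      finally show ?thesis by (simp add: subsp_W_def)
    qed
    then have bQ: "?b \<in> Q \<tau> \<omega>" using b by (simp add: parab_def)
    have "cls (Q \<tau> \<omega>) (gm (gg d) (gi N ?b)) (act N ?b (xx d)) = d"
      using cls_shift[OF frob_subgp_Q bQ] g by simp
    moreover have "gm (gg d) (gi N ?b) = gg d'" using g g' by (simp add: gi_gm)
    moreover have "act N ?b (xx d) = xx d'"
    proof -
      have xE: "xx d \<in> E N" using g SY_E by blast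
      have "y = p3 \<Gamma> \<tau> \<omega> (cls (Q \<tau> \<omega>) (gg d) (xx d))" using g d(1) by simp
      also have "\<dots> = act N (gg d) (xx d)" using g p3_cls[OF frob_subgp_Q] by blast
      finally have "y = act N (gg d) (xx d)" .
      then show ?thesis using xx[OF d(2)] g g' xE by (simp add: act_gm)
    qed
    ultimately show "d = d'" using g' by simp
  qed
  ultimately show ?thesis by (rule finite_imageD)
qed

text \<open>Two successive push-forwards are one push-forward, as long as the fibres are finite.\<close>

lemma Ind_eq_sum_E1F:
  "Ind \<Gamma> q s Y \<tau> \<omega> f f' y = inverse s ^ m_form \<Gamma> \<tau> \<omega> *
    (1 / of_nat (card (GF \<tau>) * card (GF \<omega>))) *
    (\<Sum>c | c \<in> E1F \<and> p3 \<Gamma> \<tau> \<omega> (p2 \<Gamma> Y \<tau> \<omega> c) = y. (\<lambda>(xT, xW). f xT * f' xW) (p1 \<Gamma> \<tau> \<omega> c))"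
proof -
  let ?C = "{c. c \<in> E1F \<and> p3 \<Gamma> \<tau> \<omega> (p2 \<Gamma> Y \<tau> \<omega> c) = y}"
  let ?T = "{d. d \<in> E2F \<and> p3 \<Gamma> \<tau> \<omega> d = y}"
  let ?h = "\<lambda>c. (\<lambda>(xT, xW). f xT * f' xW) (p1 \<Gamma> \<tau> \<omega> c)"
  have "(\<Sum>d\<in>?T. \<Sum>c | c \<in> E1F \<and> p2 \<Gamma> Y \<tau> \<omega> c = d. ?h c) =
      (\<Sum>d\<in>?T. \<Sum>c | c \<in> ?C \<and> p2 \<Gamma> Y \<tau> \<omega> c = d. ?h c)"
    by (intro sum.cong refl) auto
  also have "\<dots> = sum ?h ?C"
    by (rule sum.group) (use finite_E1F finite_E2F_fibre p2_E2F in auto)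
  finally show ?thesis
    by (simp add: Ind_def pushforward_def card_cartesian_product comp_def)
qed

text \<open>
  The classes in the sum over \<open>E1\<close> are those of \<open>(g\<inverse>, g y)\<close> with \<open>g\<close> fixed and \<open>g y\<close> stabilising \<open>W\<close>, and two
  such \<open>g\<close> give the same class if and only if they differ by a fixed point of \<open>U\<close>.
\<close>

lemma Ind_formula:
  assumes y: "y \<in> Y N" "FE y = y"
  shows "Ind \<Gamma> q s Y \<tau> \<omega> f f' y = inverse s ^ m_form \<Gamma> \<tau> \<omega> *
    (1 / of_nat (card (GF \<tau>) * card (GF \<omega>) * card (UF \<tau> \<omega>))) *
    (\<Sum>g | g \<in> GF N \<and> act N g y \<in> S \<tau> \<omega>. f (iT \<tau> (act N g y)) * f' (iW \<tau> \<omega> (act N g y)))"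
proof -
  let ?C = "{c. c \<in> E1F \<and> p3 \<Gamma> \<tau> \<omega> (p2 \<Gamma> Y \<tau> \<omega> c) = y}"
  let ?h = "\<lambda>c. (\<lambda>(xT, xW). f xT * f' xW) (p1 \<Gamma> \<tau> \<omega> c)"
  let ?N = "{g. g \<in> GF N \<and> act N g y \<in> S \<tau> \<omega>}"
  \<comment> \<open>\<open>p3\<close> maps the class of \<open>(g\<inverse>, g y)\<close> to \<open>y\<close>.\<close>
  define \<Psi> where "\<Psi> g = cls (U \<tau> \<omega>) (gi N g) (act N g y)" for g
  have yE: "y \<in> E N" using y(1) Y_E by blast
  have N: "g \<in> G N" "FG g = g" "gi N g \<in> G N" "act N g y \<in> SY" "FE (act N g y) = act N g y"
    if "g \<in> ?N" for g
    using that y yE Y_act SY by (auto simp: GF_iff FE_act)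
  have im: "\<Psi> ` ?N = ?C"
  proof (intro equalityI subsetI)
    fix c assume "c \<in> \<Psi> ` ?N"
    then obtain g where g: "g \<in> ?N" "c = \<Psi> g" by blast
    note n = N[OF g(1)]
    have "gi N g \<in> GF N" using g(1) by simp
    then have "c \<in> E1F" unfolding E1F_eq g(2) \<Psi>_def using n(4,5) by blast
    moreover have "p3 \<Gamma> \<tau> \<omega> (p2 \<Gamma> Y \<tau> \<omega> c) = y"
      unfolding g(2) \<Psi>_def using n yE by (simp add: p2_cls p3_cls[OF frob_subgp_Q])
    ultimately show "c \<in> ?C" by blast
  next
    fix c assume c: "c \<in> ?C"
    then have "c \<in> E1F" by blast
    then obtain g x where gx: "c = cls (U \<tau> \<omega>) g x" "g \<in> GF N" "x \<in> SY" "FE x = x"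
      unfolding E1F_eq by blast
    have gG: "g \<in> G N" using gx GF_G by blast
    have y': "act N g x = y" using c gx(1) p2_cls[OF gG gx(3)] p3_cls[OF frob_subgp_Q gG gx(3)] by simp
    have "x = act N (gi N g) y" using y' gG SY_E[OF gx(3)] by auto
    then have "gi N g \<in> ?N" "c = \<Psi> (gi N g)" using gx gG SY by (auto simp: \<Psi>_def)
    then show "c \<in> \<Psi> ` ?N" by blast
  qed
  have fibre: "card {g \<in> ?N. \<Psi> g = \<Psi> g0} = card (UF \<tau> \<omega>)" if g0: "g0 \<in> ?N" for g0
  proof -
    note n0 = N[OF g0]
    have "{g \<in> ?N. \<Psi> g = \<Psi> g0} = (\<lambda>u. gm u g0) ` UF \<tau> \<omega>"
    proof (intro equalityI subsetI)
      fix g assume g: "g \<in> {g \<in> ?N. \<Psi> g = \<Psi> g0}"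
      then have n: "g \<in> G N" "FG g = g" "gi N g \<in> G N" "act N g y \<in> SY" using N by auto
      have "(gi N g, act N g y) \<in> cls (U \<tau> \<omega>) (gi N g0) (act N g0 y)"
        using g cls_self[OF frob_subgp_U n(3,4)] by (simp add: \<Psi>_def)
      from cls_member[OF frob_subgp_U n0(3,4) this]
      obtain b where b: "b \<in> U \<tau> \<omega>" "b \<in> G N" "gi N g = gm (gi N g0) (gi N b)" by blast
      have "gi N (gi N g) = gi N (gm (gi N g0) (gi N b))" by (simp only: b(3))
      then have gb: "g = gm b g0" using n n0 b(2) by (simp add: gi_gm)
      then have "b = gm g (gi N g0)" using n0 b by simp
      then have "FG b = b" using n n0 by (simp add: FG_gm[of _ N] FG_gi)
      then show "g \<in> (\<lambda>u. gm u g0) ` UF \<tau> \<omega>" using b gb by (auto simp: UF_def)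
    next
      fix g assume "g \<in> (\<lambda>u. gm u g0) ` UF \<tau> \<omega>"
      then obtain u where u: "u \<in> UF \<tau> \<omega>" "g = gm u g0" by blast
      then have uU: "u \<in> U \<tau> \<omega>" "u \<in> GF N" using UF_GF by (auto simp: UF_def)
      have uG: "u \<in> G N" using uU GF_G by blast
      have a: "act N g y = act N u (act N g0 y)" using u(2) uG n0 yE by (simp add: act_gm)
      have "g \<in> ?N" unfolding u(2)[symmetric] using u(2) g0 uU a S_act(1)[OF U_Q[OF uU(1)]] by simp
      moreover have "gi N g = gm (gi N g0) (gi N u)" using u(2) uG n0 by (simp add: gi_gm)
      then have "\<Psi> g = \<Psi> g0" unfolding \<Psi>_def a
        using cls_shift[OF frob_subgp_U uU(1) n0(3,4)] by simp
      ultimately show "g \<in> {g \<in> ?N. \<Psi> g = \<Psi> g0}" by blast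
    qed
    moreover have "inj_on (\<lambda>u. gm u g0) (UF \<tau> \<omega>)"
    proof (rule inj_onI)
      fix u u' assume u: "u \<in> UF \<tau> \<omega>" "u' \<in> UF \<tau> \<omega>" "gm u g0 = gm u' g0"
      then have "u \<in> G N" "u' \<in> G N" using UF_GF GF_G by blast+
      then show "u = u'" using gm_cancel(3)[OF n0(1)] u(3) by metis
    qed
    ultimately show ?thesis by (simp add: card_image)
  qed
  have finN: "finite ?N" by (rule finite_subset[OF _ finite_GF[of N]]) blast
  have h: "?h (\<Psi> g) = f (iT \<tau> (act N g y)) * f' (iW \<tau> \<omega> (act N g y))" if "g \<in> ?N" for g
    using N[OF that] by (simp add: \<Psi>_def p1_cls)
  have "(\<Sum>g\<in>?N. f (iT \<tau> (act N g y)) * f' (iW \<tau> \<omega> (act N g y))) = (\<Sum>g\<in>?N. ?h (\<Psi> g))"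
    using h by (intro sum.cong) auto
  also have "\<dots> = (\<Sum>c\<in>\<Psi> ` ?N. \<Sum>g | g \<in> ?N \<and> \<Psi> g = c. ?h (\<Psi> g))"
    by (rule sum.image_gen[OF finN])
  also have "\<dots> = (\<Sum>c\<in>\<Psi> ` ?N. of_nat (card (UF \<tau> \<omega>)) * ?h c)"
  proof (intro sum.cong refl)
    fix c assume "c \<in> \<Psi> ` ?N"
    then obtain g0 where g0: "g0 \<in> ?N" "c = \<Psi> g0" by blast
    have "(\<Sum>g | g \<in> ?N \<and> \<Psi> g = c. ?h (\<Psi> g)) = (\<Sum>g\<in>{g \<in> ?N. \<Psi> g = \<Psi> g0}. ?h c)"
      using g0 by (intro sum.cong) auto
    also have "\<dots> = of_nat (card {g \<in> ?N. \<Psi> g = \<Psi> g0}) * ?h c" by simp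
    finally show "(\<Sum>g | g \<in> ?N \<and> \<Psi> g = c. ?h (\<Psi> g)) = of_nat (card (UF \<tau> \<omega>)) * ?h c"
      using fibre[OF g0(1)] by simp
  qed
  also have "\<dots> = of_nat (card (UF \<tau> \<omega>)) * sum ?h ?C" unfolding im by (simp add: sum_distrib_left)
  finally show ?thesis unfolding Ind_eq_sum_E1F using card_UF_pos[of \<tau> \<omega>] by simp
qed

end

end

section \<open>Counting Frobenius-fixed families\<close>

context frobenius
begin

lemma mfamD:
  assumes "M \<in> mfam B a r c" "v \<in> B"
  shows "M v \<in> carrier_mat (r v) (c v)" "M (a v) = fr (M v)"
  using assms by (auto simp: mfam_def)

lemma mfam_ext: "M \<in> mfam B a r c \<Longrightarrow> M \<in> extensional B"
  by (auto simp: mfam_def PiE_iff)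

lemma mfam_eqI:
  assumes "M \<in> extensional B" "M' \<in> extensional B"
    and "\<And>v i j. v \<in> B \<Longrightarrow> dim_row (M v) = dim_row (M' v)" "\<And>v i j. v \<in> B \<Longrightarrow> dim_col (M v) = dim_col (M' v)"
    and "\<And>v i j. v \<in> B \<Longrightarrow> i < dim_row (M' v) \<Longrightarrow> j < dim_col (M' v) \<Longrightarrow> M v $$ (i, j) = M' v $$ (i, j)"
  shows "M = M'"
  using assms by (intro extensionalityI[of _ B]) (auto intro!: eq_matI)

lemma mfam_dims [simp]:
  assumes "M \<in> mfam B a r c" "v \<in> B"
  shows "dim_row (M v) = r v" "dim_col (M v) = c v"
  using mfamD(1)[OF assms] by auto

lemma mfam_index:
  assumes "M \<in> mfam B a r c" "v \<in> B" "i < r v" "j < c v"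
  shows "M (a v) $$ (i, j) = M v $$ (i, j) ^ q"
  using mfamD[OF assms(1,2)] assms(3,4) by simp

lemma mfamI:
  assumes "M \<in> extensional B"
    and "\<And>v. v \<in> B \<Longrightarrow> M v \<in> carrier_mat (r v) (c v)"
    and "\<And>v. v \<in> B \<Longrightarrow> M (a v) \<in> carrier_mat (r v) (c v)"
    and "\<And>v i j. v \<in> B \<Longrightarrow> i < r v \<Longrightarrow> j < c v \<Longrightarrow> M (a v) $$ (i, j) = M v $$ (i, j) ^ q"
  shows "M \<in> mfam B a r c"
proof -
  have "M (a v) = fr (M v)" if v: "v \<in> B" for v
    by (rule eq_matI) (use assms(2-4)[OF v] in auto)
  then show ?thesis using assms(1,2) by (auto simp: mfam_def PiE_iff)
qed

lemma mfam_map: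
  assumes M: "M \<in> mfam B a r c" and a: "\<And>v. v \<in> B \<Longrightarrow> a v \<in> B"
    and c: "\<And>v. v \<in> B \<Longrightarrow> op v (M v) \<in> carrier_mat (r' v) (c' v)"
    and f: "\<And>v. v \<in> B \<Longrightarrow> op (a v) (fr (M v)) = fr (op v (M v))"
  shows "(\<lambda>v\<in>B. op v (M v)) \<in> mfam B a r' c'"
  using assms mfamD[OF M] by (auto simp: mfam_def)

lemma card_mfam_transpose:
  assumes a: "\<And>v. v \<in> B \<Longrightarrow> a v \<in> B"
  shows "card (mfam B a r c) = card (mfam B a c r)"
proof -
  let ?t = "\<lambda>M. \<lambda>v\<in>B. transpose_mat (M v)"
  have 1: "?t M \<in> mfam B a c r" if M: "M \<in> mfam B a r c" for M r c
    by (rule mfam_map[OF M a]) (use mfamD(1)[OF M] in \<open>auto simp: map_mat_transpose\<close>)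
  have 2: "?t (?t M) = M" if M: "M \<in> mfam B a r c" for M r c
    using mfam_ext[OF M] by (auto simp: fun_eq_iff extensional_def)
  show ?thesis
    by (rule bij_betw_same_card[of ?t]) (rule bij_betw_byWitness[where f' = ?t]; use 1 2 in blast)
qed

text \<open>
  Cut each matrix into its first \<open>c v\<close> and its last \<open>c' v\<close> columns.
\<close>

lemma card_mfam_cols:
  assumes a: "\<And>v. v \<in> B \<Longrightarrow> a v \<in> B" "\<And>v. v \<in> B \<Longrightarrow> r (a v) = r v"
    "\<And>v. v \<in> B \<Longrightarrow> c (a v) = c v" "\<And>v. v \<in> B \<Longrightarrow> c' (a v) = c' v"
  shows "card (mfam B a r (\<lambda>v. c v + c' v)) = card (mfam B a r c) * card (mfam B a r c')"
proof -
  define L where "L M = (\<lambda>v\<in>B. mat (r v) (c v) (\<lambda>(i, j). M v $$ (i, j)))" for M :: "'a \<Rightarrow> 'k mat"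
  define R where "R M = (\<lambda>v\<in>B. mat (r v) (c' v) (\<lambda>(i, j). M v $$ (i, c v + j)))" for M :: "'a \<Rightarrow> 'k mat"
  define J where "J M M' = (\<lambda>v\<in>B. mat (r v) (c v + c' v)
      (\<lambda>(i, j). if j < c v then M v $$ (i, j) else M' v $$ (i, j - c v)))" for M M' :: "'a \<Rightarrow> 'k mat"
  have LR: "L M \<in> mfam B a r c" "R M \<in> mfam B a r c'" if M: "M \<in> mfam B a r (\<lambda>v. c v + c' v)" for M
    by (rule mfamI; use a mfam_index[OF M] in \<open>simp add: L_def R_def\<close>)+
  have J: "J M M' \<in> mfam B a r (\<lambda>v. c v + c' v)" if M: "M \<in> mfam B a r c" "M' \<in> mfam B a r c'" for M M'
    by (rule mfamI) (use a mfam_index[OF M(1)] mfam_index[OF M(2)] in \<open>auto simp: J_def\<close>)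
  have 1: "J (L M) (R M) = M" if M: "M \<in> mfam B a r (\<lambda>v. c v + c' v)" for M
    by (rule mfam_eqI[OF _ mfam_ext[OF M]]) (use mfam_dims[OF M] in \<open>simp_all add: J_def L_def R_def\<close>)
  have 2: "L (J M M') = M" if M: "M \<in> mfam B a r c" for M M'
    by (rule mfam_eqI[OF _ mfam_ext[OF M]]) (use mfam_dims[OF M] in \<open>simp_all add: J_def L_def\<close>)
  have 3: "R (J M M') = M'" if M: "M' \<in> mfam B a r c'" for M M'
    by (rule mfam_eqI[OF _ mfam_ext[OF M]]) (use mfam_dims[OF M] in \<open>simp_all add: J_def R_def\<close>)
  have "bij_betw (\<lambda>M. (L M, R M)) (mfam B a r (\<lambda>v. c v + c' v)) (mfam B a r c \<times> mfam B a r c')"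
    by (rule bij_betw_byWitness[where f' = "\<lambda>(M, M'). J M M'"]) (use LR J 1 2 3 in auto)
  from bij_betw_same_card[OF this] show ?thesis by (simp add: card_cartesian_product)
qed

lemma card_mfam_empty:
  assumes a: "\<And>v. v \<in> B \<Longrightarrow> a v \<in> B" "\<And>v. v \<in> B \<Longrightarrow> r v = 0" "\<And>v. v \<in> B \<Longrightarrow> c (a v) = c v"
  shows "card (mfam B a r c) = 1"
proof -
  have "mfam B a r c = {\<lambda>v\<in>B. 0\<^sub>m 0 (c v) :: 'k mat}"
  proof (intro equalityI subsetI)
    fix M assume M: "M \<in> mfam B a r c"
    have "M = (\<lambda>v\<in>B. 0\<^sub>m 0 (c v))"
      by (rule mfam_eqI[OF mfam_ext[OF M]]) (use mfam_dims[OF M] a(2) in simp_all)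
    then show "M \<in> {\<lambda>v\<in>B. 0\<^sub>m 0 (c v) :: 'k mat}" by simp
  next
    fix M assume "M \<in> {\<lambda>v\<in>B. 0\<^sub>m 0 (c v) :: 'k mat}"
    then show "M \<in> mfam B a r c" using a by (auto simp: mfam_def intro!: eq_matI)
  qed
  then show ?thesis by simp
qed

end

context hall_data
begin

text \<open>
  The number of Frobenius-fixed points of \<open>Hom(T, W)\<close>. It is bimultiplicative, which makes the normalising
  constants of the product compatible with associativity.
\<close>

definition hom_card :: "('v set \<Rightarrow> nat) \<Rightarrow> ('v set \<Rightarrow> nat) \<Rightarrow> nat" where
  "hom_card \<tau> \<omega> = card (mfam V (vaut \<Gamma>) (dm \<omega>) (dm \<tau>))"

lemma hom_card_transpose: "hom_card \<tau> \<omega> = card (mfam V (vaut \<Gamma>) (dm \<tau>) (dm \<omega>))"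
  unfolding hom_card_def by (rule card_mfam_transpose) simp

lemma hom_card_dplus:
  "hom_card (dplus \<tau> \<tau>') \<omega> = hom_card \<tau> \<omega> * hom_card \<tau>' \<omega>"
  "hom_card \<omega> (dplus \<tau> \<tau>') = hom_card \<omega> \<tau> * hom_card \<omega> \<tau>'"
proof -
  have dm: "dm (dplus \<tau> \<tau>') = (\<lambda>v. dm \<tau> v + dm \<tau>' v)" by (simp add: fun_eq_iff)
  show "hom_card (dplus \<tau> \<tau>') \<omega> = hom_card \<tau> \<omega> * hom_card \<tau>' \<omega>"
    unfolding hom_card_def dm by (rule card_mfam_cols) auto
  show "hom_card \<omega> (dplus \<tau> \<tau>') = hom_card \<omega> \<tau> * hom_card \<omega> \<tau>'"
    unfolding hom_card_transpose unfolding dm by (rule card_mfam_cols) auto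
qed

text \<open>\<open>Ulift\<close> commutes with Frobenius.\<close>

lemma Ulift_fixed_iff:
  assumes M: "M \<in> extensional V" "\<And>v. v \<in> V \<Longrightarrow> M v \<in> carrier_mat (dm \<omega> v) (dm \<tau> v)"
  shows "FG (Ulift \<tau> \<omega> M) = Ulift \<tau> \<omega> M \<longleftrightarrow> M \<in> mfam V (vaut \<Gamma>) (dm \<omega>) (dm \<tau>)"
proof -
  have G: "Ulift \<tau> \<omega> M \<in> G (dplus \<tau> \<omega>)" using Ulift_in[OF M(2)] U_Q Q_G by blast
  have 1: "fr (lower_mat (1\<^sub>m (dm \<tau> v)) (M v) (1\<^sub>m (dm \<omega> v))) =
      lower_mat (1\<^sub>m (dm \<tau> v)) (fr (M v)) (1\<^sub>m (dm \<omega> v))" if "v \<in> V" for v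
    using M(2)[OF that] q_gt_1 by (auto intro!: eq_matI)
  have 2: "lower_mat (1\<^sub>m (dm \<tau> v)) A (1\<^sub>m (dm \<omega> v)) = lower_mat (1\<^sub>m (dm \<tau> v)) B (1\<^sub>m (dm \<omega> v)) \<longleftrightarrow> A = B"
    if "A \<in> carrier_mat (dm \<omega> v) (dm \<tau> v)" "B \<in> carrier_mat (dm \<omega> v) (dm \<tau> v)" for A B :: "'k mat" and v
    using blk_of_lower_mat(3)[OF one_carrier_mat that(1) one_carrier_mat]
      blk_of_lower_mat(3)[OF one_carrier_mat that(2) one_carrier_mat] by metis
  have "FG (Ulift \<tau> \<omega> M) = Ulift \<tau> \<omega> M \<longleftrightarrow>
      (\<forall>v\<in>V. lower_mat (1\<^sub>m (dm \<tau> v)) (M (vaut \<Gamma> v)) (1\<^sub>m (dm \<omega> v)) =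
        lower_mat (1\<^sub>m (dm \<tau> v)) (fr (M v)) (1\<^sub>m (dm \<omega> v)))"
    unfolding frob_gauge_iff[OF G] using 1 by (auto simp: Ulift_def)
  also have "\<dots> \<longleftrightarrow> (\<forall>v\<in>V. M (vaut \<Gamma> v) = fr (M v))"
  proof (intro ball_cong refl 2)
    fix v assume v: "v \<in> V"
    show "M (vaut \<Gamma> v) \<in> carrier_mat (dm \<omega> v) (dm \<tau> v)" "fr (M v) \<in> carrier_mat (dm \<omega> v) (dm \<tau> v)"
      using M(2)[OF vaut_in[OF v]] M(2)[OF v] v by simp_all
  qed
  finally show ?thesis using M by (auto simp: mfam_def PiE_iff)
qed

lemma card_UF: "card (UF \<tau> \<omega>) = hom_card \<tau> \<omega>"
  unfolding hom_card_def
proof (rule bij_betw_same_card[symmetric, of "Ulift \<tau> \<omega>"])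
  let ?F = "mfam V (vaut \<Gamma>) (dm \<omega>) (dm \<tau>)"
  show "bij_betw (Ulift \<tau> \<omega>) ?F (UF \<tau> \<omega>)"
    unfolding bij_betw_def
  proof
    show "inj_on (Ulift \<tau> \<omega>) ?F"
    proof (rule inj_onI)
      fix M M' assume M: "M \<in> ?F" "M' \<in> ?F" and eq: "Ulift \<tau> \<omega> M = Ulift \<tau> \<omega> M'"
      show "M = M'"
      proof (rule extensionalityI[OF mfam_ext[OF M(1)] mfam_ext[OF M(2)]])
        fix v assume v: "v \<in> V"
        note c = mfamD(1)[OF M(1) v] mfamD(1)[OF M(2) v]
        have "lower_mat (1\<^sub>m (dm \<tau> v)) (M v) (1\<^sub>m (dm \<omega> v)) = lower_mat (1\<^sub>m (dm \<tau> v)) (M' v) (1\<^sub>m (dm \<omega> v))"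
          using fun_cong[OF eq, of v] v by (simp add: Ulift_def)
        then show "M v = M' v"
          using blk_of_lower_mat(3)[OF one_carrier_mat c(1) one_carrier_mat]
            blk_of_lower_mat(3)[OF one_carrier_mat c(2) one_carrier_mat] by metis
      qed
    qed
    show "Ulift \<tau> \<omega> ` ?F = UF \<tau> \<omega>"
    proof (intro equalityI subsetI)
      fix u assume "u \<in> Ulift \<tau> \<omega> ` ?F"
      then obtain M where M: "M \<in> ?F" "u = Ulift \<tau> \<omega> M" by blast
      then show "u \<in> UF \<tau> \<omega>"
        using Ulift_in[of M \<omega> \<tau>] mfamD(1)[OF M(1)] Ulift_fixed_iff[OF mfam_ext[OF M(1)]] by (simp add: UF_def)
    next
      fix u assume u: "u \<in> UF \<tau> \<omega>"
      let ?M = "\<lambda>v\<in>V. blk_L (dm \<tau> v) (dm \<omega> v) (dm \<tau> v) (u v)"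
      have "Ulift \<tau> \<omega> ?M = Ulift \<tau> \<omega> (\<lambda>v. blk_L (dm \<tau> v) (dm \<omega> v) (dm \<tau> v) (u v))"
        by (auto simp: Ulift_def)
      then have eq: "u = Ulift \<tau> \<omega> ?M" using U_eq_Ulift u by (auto simp: UF_def)
      have "FG (Ulift \<tau> \<omega> ?M) = Ulift \<tau> \<omega> ?M" using u unfolding eq[symmetric] by (simp add: UF_def)
      then have "?M \<in> ?F" by (subst (asm) Ulift_fixed_iff) auto
      then show "u \<in> Ulift \<tau> \<omega> ` ?F" using eq by blast
    qed
  qed
qed

lemma m_form_dplus:
  "m_form \<Gamma> (dplus \<tau> \<tau>') \<omega> = m_form \<Gamma> \<tau> \<omega> + m_form \<Gamma> \<tau>' \<omega>"
  "m_form \<Gamma> \<omega> (dplus \<tau> \<tau>') = m_form \<Gamma> \<omega> \<tau> + m_form \<Gamma> \<omega> \<tau>'"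
  by (simp_all add: m_form_def algebra_simps sum.distrib)

section \<open>Associativity of the induction product\<close>

sublocale full: hall_open p e q K \<Gamma> "rep_space \<Gamma>"
  by unfold_locales auto

abbreviation ind where "ind s \<tau> \<omega> f f' y \<equiv> Ind \<Gamma> q s (rep_space \<Gamma> :: _ \<Rightarrow> ('h \<Rightarrow> 'k mat) set) \<tau> \<omega> f f' y"

definition ind_const :: "complex \<Rightarrow> ('v set \<Rightarrow> nat) \<Rightarrow> ('v set \<Rightarrow> nat) \<Rightarrow> complex" where
  "ind_const s \<tau> \<omega> = inverse s ^ m_form \<Gamma> \<tau> \<omega> * (1 / of_nat (card (GF \<tau>) * card (GF \<omega>) * hom_card \<tau> \<omega>))"

definition orb_sum where
  "orb_sum \<nu> \<phi> y = (\<Sum>g\<in>GF \<nu>. \<phi> (act \<nu> g y) :: complex)"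

definition conv where
  "conv \<tau> \<omega> f f' z = (if z \<in> S \<tau> \<omega> then f (iT \<tau> z) * f' (iW \<tau> \<omega> z) else (0 :: complex))"

lemma ind_eq:
  assumes "y \<in> EF (dplus \<tau> \<omega>)"
  shows "ind s \<tau> \<omega> f f' y = ind_const s \<tau> \<omega> * orb_sum (dplus \<tau> \<omega>) (conv \<tau> \<omega> f f') y"
  unfolding ind_const_def orb_sum_def conv_def card_UF[symmetric]
  by (subst full.Ind_formula) (use assms in \<open>auto simp: EF_iff sum.inter_filter intro!: sum.cong\<close>)

lemma orb_sum_act:
  assumes "k \<in> GF \<nu>" "y \<in> EF \<nu>"
  shows "orb_sum \<nu> \<phi> (act \<nu> k y) = orb_sum \<nu> \<phi> y"
    "orb_sum \<nu> (\<lambda>z. \<phi> (act \<nu> k z)) y = orb_sum \<nu> \<phi> y"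
proof -
  have k: "k \<in> G \<nu>" "gi \<nu> k \<in> GF \<nu>" and y: "y \<in> E \<nu>" using assms GF_G EF_E by auto
  have a: "act \<nu> g (act \<nu> k y) = act \<nu> (gm g k) y" "act \<nu> k (act \<nu> g y) = act \<nu> (gm k g) y"
    if "g \<in> GF \<nu>" for g using GF_G[OF that] k y by (simp_all add: act_gm)
  show "orb_sum \<nu> \<phi> (act \<nu> k y) = orb_sum \<nu> \<phi> y" unfolding orb_sum_def
    by (rule sum.reindex_bij_witness[of _ "\<lambda>g. gm g (gi \<nu> k)" "\<lambda>g. gm g k"])
      (use k a assms GF_G in auto)
  show "orb_sum \<nu> (\<lambda>z. \<phi> (act \<nu> k z)) y = orb_sum \<nu> \<phi> y" unfolding orb_sum_def
    by (rule sum.reindex_bij_witness[of _ "\<lambda>g. gm (gi \<nu> k) g" "\<lambda>g. gm k g"])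
      (use k a assms GF_G in auto)
qed

lemma orb_sum_cong:
  assumes "y \<in> EF \<nu>" "\<And>z. z \<in> EF \<nu> \<Longrightarrow> \<phi> z = \<psi> z"
  shows "orb_sum \<nu> \<phi> y = orb_sum \<nu> \<psi> y"
  unfolding orb_sum_def using assms by (intro sum.cong) auto

text \<open>The Levi subgroup.\<close>

definition gdiag :: "('v set \<Rightarrow> nat) \<Rightarrow> ('v set \<Rightarrow> nat) \<Rightarrow> ('v \<Rightarrow> 'k mat) \<Rightarrow> ('v \<Rightarrow> 'k mat) \<Rightarrow> 'v \<Rightarrow> 'k mat" where
  "gdiag \<tau> \<omega> k l = (\<lambda>v\<in>V. lower_mat (k v) (0\<^sub>m (dm \<omega> v) (dm \<tau> v)) (l v))"

lemma gdiag:
  assumes k: "k \<in> G \<tau>" and l: "l \<in> G \<omega>"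
  shows "gdiag \<tau> \<omega> k l \<in> Q \<tau> \<omega>" "gT \<tau> (gdiag \<tau> \<omega> k l) = k" "gW \<tau> \<omega> (gdiag \<tau> \<omega> k l) = l"
proof -
  have b: "blk_lower (dm \<tau> v) (dm \<tau> v) (gdiag \<tau> \<omega> k l v)" "blk_T (dm \<tau> v) (dm \<tau> v) (gdiag \<tau> \<omega> k l v) = k v"
    "blk_W (dm \<tau> v) (dm \<tau> v) (dm \<omega> v) (dm \<omega> v) (gdiag \<tau> \<omega> k l v) = l v"
    "gdiag \<tau> \<omega> k l v \<in> carrier_mat (dm \<tau> v + dm \<omega> v) (dm \<tau> v + dm \<omega> v)" "det (gdiag \<tau> \<omega> k l v) \<noteq> 0"
    if v: "v \<in> V" for v
  proof -
    note c = gaugeD[OF k] gaugeD[OF l]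
    note bb = blk_of_lower_mat[OF c(1)[OF v] zero_carrier_mat c(4)[OF v]]
    show "blk_lower (dm \<tau> v) (dm \<tau> v) (gdiag \<tau> \<omega> k l v)" "blk_T (dm \<tau> v) (dm \<tau> v) (gdiag \<tau> \<omega> k l v) = k v"
      "blk_W (dm \<tau> v) (dm \<tau> v) (dm \<omega> v) (dm \<omega> v) (gdiag \<tau> \<omega> k l v) = l v"
      using bb v by (simp_all add: gdiag_def)
    show "gdiag \<tau> \<omega> k l v \<in> carrier_mat (dm \<tau> v + dm \<omega> v) (dm \<tau> v + dm \<omega> v)"
      using c(1)[OF v] c(4)[OF v] v by (simp add: gdiag_def)
    have "det (gdiag \<tau> \<omega> k l v) = det (k v) * det (l v)"
      unfolding gdiag_def using v c(1)[OF v] c(4)[OF v]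
      by (simp, subst det_four_block_mat_upper_right_zero) auto
    then show "det (gdiag \<tau> \<omega> k l v) \<noteq> 0" using c(2)[OF v] c(5)[OF v] by simp
  qed
  show "gdiag \<tau> \<omega> k l \<in> Q \<tau> \<omega>" unfolding parab_iff gauge_iff using b by (auto simp: gdiag_def)
  show "gT \<tau> (gdiag \<tau> \<omega> k l) = k" "gW \<tau> \<omega> (gdiag \<tau> \<omega> k l) = l"
    using b gaugeD(3)[OF k] gaugeD(3)[OF l]
    by (auto simp: gT_def gW_def intro!: extensionalityI[of _ V])
qed

lemma gdiag_GF:
  assumes k: "k \<in> GF \<tau>" and l: "l \<in> GF \<omega>"
  shows "gdiag \<tau> \<omega> k l \<in> GF (dplus \<tau> \<omega>)"
proof -
  have kl: "k \<in> G \<tau>" "l \<in> G \<omega>" using assms GF_G by auto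
  have G: "gdiag \<tau> \<omega> k l \<in> G (dplus \<tau> \<omega>)" using gdiag(1)[OF kl] Q_G by blast
  have "gdiag \<tau> \<omega> k l (vaut \<Gamma> v) = fr (gdiag \<tau> \<omega> k l v)" if v: "v \<in> V" for v
  proof -
    have "k (vaut \<Gamma> v) = fr (k v)" "l (vaut \<Gamma> v) = fr (l v)"
      using frob_gauge_iff kl k l v by (auto simp: GF_iff)
    then show ?thesis using v gaugeD(1)[OF kl(1) v] gaugeD(1)[OF kl(2) v] q_gt_1
      by (auto simp: gdiag_def intro!: eq_matI)
  qed
  then show ?thesis using G frob_gauge_iff[OF G] by (simp add: GF_iff)
qed

lemma S_act_iff:
  assumes "b \<in> Q \<tau> \<omega>" "z \<in> E (dplus \<tau> \<omega>)"
  shows "act (dplus \<tau> \<omega>) b z \<in> S \<tau> \<omega> \<longleftrightarrow> z \<in> S \<tau> \<omega>"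
  using S_act(1)[OF assms(1), of z] S_act(1)[OF Q_gi(1)[OF assms(1)], of "act (dplus \<tau> \<omega>) b z"]
    act_cancel(1)[OF Q_G[OF assms(1)] assms(2)] by auto

text \<open>
  An element of the group of one block acts on the big representation through the Levi subgroup, and the sum
  over the big group is invariant under that; so the inner sum only contributes its number of terms.
\<close>

lemma orb_sum_conv_left:
  assumes y: "y \<in> EF (dplus \<sigma> \<omega>)"
  shows "orb_sum (dplus \<sigma> \<omega>) (conv \<sigma> \<omega> (orb_sum \<sigma> \<phi>) f) y =
    of_nat (card (GF \<sigma>)) * orb_sum (dplus \<sigma> \<omega>) (conv \<sigma> \<omega> \<phi> f) y"
proof -
  let ?N = "dplus \<sigma> \<omega>"
  let ?k = "\<lambda>k. gdiag \<sigma> \<omega> k (gunit \<omega>)"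
  have "conv \<sigma> \<omega> (orb_sum \<sigma> \<phi>) f z = (\<Sum>k\<in>GF \<sigma>. conv \<sigma> \<omega> \<phi> f (act ?N (?k k) z))"
    if z: "z \<in> EF ?N" for z
  proof -
    have zE: "z \<in> E ?N" using z EF_E by blast
    have "conv \<sigma> \<omega> \<phi> f (act ?N (?k k) z) =
        (if z \<in> S \<sigma> \<omega> then \<phi> (act \<sigma> k (iT \<sigma> z)) * f (iW \<sigma> \<omega> z) else 0)" if "k \<in> GF \<sigma>" for k
    proof -
      note g = gdiag[OF GF_G[OF that] gunit_in[of \<omega>]]
      show ?thesis using S_act_iff[OF g(1) zE] S_act(2,3)[OF g(1)] g(2,3) by (auto simp: conv_def)
    qed
    then show ?thesis
      by (simp add: conv_def[of _ _ "orb_sum \<sigma> \<phi>"] orb_sum_def sum_distrib_right)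
  qed
  then have "orb_sum ?N (conv \<sigma> \<omega> (orb_sum \<sigma> \<phi>) f) y =
      orb_sum ?N (\<lambda>z. \<Sum>k\<in>GF \<sigma>. conv \<sigma> \<omega> \<phi> f (act ?N (?k k) z)) y"
    by (intro orb_sum_cong y)
  also have "\<dots> = (\<Sum>k\<in>GF \<sigma>. orb_sum ?N (\<lambda>z. conv \<sigma> \<omega> \<phi> f (act ?N (?k k) z)) y)"
    unfolding orb_sum_def by (rule sum.swap)
  also have "\<dots> = (\<Sum>k\<in>GF \<sigma>. orb_sum ?N (conv \<sigma> \<omega> \<phi> f) y)"
    by (intro sum.cong refl orb_sum_act(2) gdiag_GF y) auto
  finally show ?thesis by simp
qed

lemma orb_sum_conv_right:
  assumes y: "y \<in> EF (dplus \<tau> \<sigma>)"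
  shows "orb_sum (dplus \<tau> \<sigma>) (conv \<tau> \<sigma> f (orb_sum \<sigma> \<phi>)) y =
    of_nat (card (GF \<sigma>)) * orb_sum (dplus \<tau> \<sigma>) (conv \<tau> \<sigma> f \<phi>) y"
proof -
  let ?N = "dplus \<tau> \<sigma>"
  let ?k = "\<lambda>k. gdiag \<tau> \<sigma> (gunit \<tau>) k"
  have "conv \<tau> \<sigma> f (orb_sum \<sigma> \<phi>) z = (\<Sum>k\<in>GF \<sigma>. conv \<tau> \<sigma> f \<phi> (act ?N (?k k) z))"
    if z: "z \<in> EF ?N" for z
  proof -
    have zE: "z \<in> E ?N" using z EF_E by blast
    have "conv \<tau> \<sigma> f \<phi> (act ?N (?k k) z) =
        (if z \<in> S \<tau> \<sigma> then f (iT \<tau> z) * \<phi> (act \<sigma> k (iW \<tau> \<sigma> z)) else 0)" if "k \<in> GF \<sigma>" for k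
    proof -
      note g = gdiag[OF gunit_in[of \<tau>] GF_G[OF that]]
      show ?thesis using S_act_iff[OF g(1) zE] S_act(2,3)[OF g(1)] g(2,3) by (auto simp: conv_def)
    qed
    then show ?thesis
      by (simp add: conv_def[of _ _ _ "orb_sum \<sigma> \<phi>"] orb_sum_def sum_distrib_left)
  qed
  then have "orb_sum ?N (conv \<tau> \<sigma> f (orb_sum \<sigma> \<phi>)) y =
      orb_sum ?N (\<lambda>z. \<Sum>k\<in>GF \<sigma>. conv \<tau> \<sigma> f \<phi> (act ?N (?k k) z)) y"
    by (intro orb_sum_cong y)
  also have "\<dots> = (\<Sum>k\<in>GF \<sigma>. orb_sum ?N (\<lambda>z. conv \<tau> \<sigma> f \<phi> (act ?N (?k k) z)) y)"
    unfolding orb_sum_def by (rule sum.swap)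
  also have "\<dots> = (\<Sum>k\<in>GF \<sigma>. orb_sum ?N (conv \<tau> \<sigma> f \<phi>) y)"
    by (intro sum.cong refl orb_sum_act(2) gdiag_GF y) auto
  finally show ?thesis by simp
qed

lemma dplus_assoc: "dplus (dplus a b) c = dplus a (dplus b c)"
  by (simp add: dplus_def add.assoc)

text \<open>
  Both sides are \<open>f f' f''\<close> on the three diagonal blocks if all arrows are block triangular with three
  blocks, and zero otherwise.
\<close>

lemma conv_assoc:
  assumes z: "z \<in> E (dplus (dplus a b) c)"
  shows "conv (dplus a b) c (conv a b f f') f'' z = conv a (dplus b c) f (conv b c f' f'') z"
proof -
  have zE: "z \<in> E (dplus a (dplus b c))" using z by (simp add: dplus_assoc)
  have "z \<in> S (dplus a b) c \<and> iT (dplus a b) z \<in> S a b \<longleftrightarrow>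
      z \<in> S a (dplus b c) \<and> iW a (dplus b c) z \<in> S b c"
  proof -
    have "blk_lower (dm a (head \<Gamma> h) + dm b (head \<Gamma> h)) (dm a (tail \<Gamma> h) + dm b (tail \<Gamma> h)) (z h) \<and>
        blk_lower (dm a (head \<Gamma> h)) (dm a (tail \<Gamma> h))
          (blk_T (dm a (head \<Gamma> h) + dm b (head \<Gamma> h)) (dm a (tail \<Gamma> h) + dm b (tail \<Gamma> h)) (z h)) \<longleftrightarrow>
        blk_lower (dm a (head \<Gamma> h)) (dm a (tail \<Gamma> h)) (z h) \<and>
        blk_lower (dm b (head \<Gamma> h)) (dm b (tail \<Gamma> h))
          (blk_W (dm a (head \<Gamma> h)) (dm a (tail \<Gamma> h)) (dm b (head \<Gamma> h) + dm c (head \<Gamma> h))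
            (dm b (tail \<Gamma> h) + dm c (tail \<Gamma> h)) (z h))" if "h \<in> A" for h
      by (rule blk_lower_nested) (use repD(1)[OF z that] in simp)
    note nested = this
    have T: "iT (dplus a b) z \<in> S a b \<longleftrightarrow> (\<forall>h\<in>A. blk_lower (dm a (head \<Gamma> h)) (dm a (tail \<Gamma> h))
          (blk_T (dm a (head \<Gamma> h) + dm b (head \<Gamma> h)) (dm a (tail \<Gamma> h) + dm b (tail \<Gamma> h)) (z h)))"
      unfolding S_def mem_Collect_eq by (simp only: iT_in simp_thms) (simp add: iT_eq)
    have W: "iW a (dplus b c) z \<in> S b c \<longleftrightarrow> (\<forall>h\<in>A. blk_lower (dm b (head \<Gamma> h)) (dm b (tail \<Gamma> h))
          (blk_W (dm a (head \<Gamma> h)) (dm a (tail \<Gamma> h)) (dm b (head \<Gamma> h) + dm c (head \<Gamma> h))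
            (dm b (tail \<Gamma> h) + dm c (tail \<Gamma> h)) (z h)))"
      unfolding S_def mem_Collect_eq by (simp only: iW_in simp_thms) (simp add: iW_eq)
    have z1: "z \<in> S (dplus a b) c \<longleftrightarrow>
        (\<forall>h\<in>A. blk_lower (dm a (head \<Gamma> h) + dm b (head \<Gamma> h)) (dm a (tail \<Gamma> h) + dm b (tail \<Gamma> h)) (z h))"
      and z2: "z \<in> S a (dplus b c) \<longleftrightarrow> (\<forall>h\<in>A. blk_lower (dm a (head \<Gamma> h)) (dm a (tail \<Gamma> h)) (z h))"
      using z zE by (simp_all add: S_def)
    show ?thesis unfolding T W z1 z2 using nested by blast
  qed
  moreover have "iT a (iT (dplus a b) z) = iT a z" "iW a b (iT (dplus a b) z) = iT b (iW a (dplus b c) z)"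
    "iW (dplus a b) c z = iW b c (iW a (dplus b c) z)"
    by (auto simp: iT_eq iW_eq blk_nested intro!: restrict_ext)
  ultimately show ?thesis by (auto simp: conv_def)
qed

lemma orb_sum_smult: "orb_sum \<nu> (\<lambda>z. k * \<phi> z) y = k * orb_sum \<nu> \<phi> y"
  by (simp add: orb_sum_def sum_distrib_left)

lemma conv_smult:
  "conv \<tau> \<omega> (\<lambda>z. k * f z) f' = (\<lambda>z. k * conv \<tau> \<omega> f f' z)"
  "conv \<tau> \<omega> f (\<lambda>z. k * f' z) = (\<lambda>z. k * conv \<tau> \<omega> f f' z)"
  by (auto simp: conv_def fun_eq_iff)

lemma conv_cong:
  assumes "z \<in> EF (dplus \<tau> \<omega>)"
    and "\<And>z. z \<in> EF \<tau> \<Longrightarrow> f z = g z" "\<And>z. z \<in> EF \<omega> \<Longrightarrow> f' z = g' z"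
  shows "conv \<tau> \<omega> f f' z = conv \<tau> \<omega> g g' z"
  using assms by (simp add: conv_def)

lemma ind_cong:
  assumes "y \<in> EF (dplus \<tau> \<omega>)"
    and "\<And>z. z \<in> EF \<tau> \<Longrightarrow> f z = g z" "\<And>z. z \<in> EF \<omega> \<Longrightarrow> f' z = g' z"
  shows "ind s \<tau> \<omega> f f' y = ind s \<tau> \<omega> g g' y"
  unfolding ind_eq[OF assms(1)] using orb_sum_cong[OF assms(1) conv_cong[OF _ assms(2,3)]] by simp

lemma GF_nonempty: "GF \<nu> \<noteq> {}"
  using GF_closed(1)[of \<nu>] by blast

text \<open>
  Both sides have the same three groups and the same three spaces \<open>Hom\<close> in the denominator, because \<open>hom_card\<close> is
  bimultiplicative, and the same exponent of \<open>s\<close>, because \<open>m_form\<close> is biadditive.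
\<close>

lemma ind_const_assoc:
  "ind_const s (dplus a b) c * ind_const s a b * of_nat (card (GF (dplus a b))) =
   ind_const s a (dplus b c) * ind_const s b c * of_nat (card (GF (dplus b c)))"
proof -
  have nz: "of_nat (card (GF \<nu>)) \<noteq> (0 :: complex)" for \<nu> using GF_nonempty by simp
  have "ind_const s (dplus a b) c * ind_const s a b * of_nat (card (GF (dplus a b))) =
      inverse s ^ (m_form \<Gamma> a c + m_form \<Gamma> b c + m_form \<Gamma> a b) *
      (1 / of_nat (card (GF a) * card (GF b) * card (GF c) * (hom_card a c * hom_card b c * hom_card a b)))"
    unfolding ind_const_def m_form_dplus hom_card_dplus using nz[of "dplus a b"]
    by (simp add: power_add field_simps)
  moreover have "ind_const s a (dplus b c) * ind_const s b c * of_nat (card (GF (dplus b c))) =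
      inverse s ^ (m_form \<Gamma> a c + m_form \<Gamma> b c + m_form \<Gamma> a b) *
      (1 / of_nat (card (GF a) * card (GF b) * card (GF c) * (hom_card a c * hom_card b c * hom_card a b)))"
    unfolding ind_const_def m_form_dplus hom_card_dplus using nz[of "dplus b c"]
    by (simp add: power_add field_simps)
  ultimately show ?thesis by simp
qed

lemma ind_assoc:
  assumes y: "y \<in> EF (dplus (dplus a b) c)"
  shows "ind s (dplus a b) c (ind s a b f f') f'' y = ind s a (dplus b c) f (ind s b c f' f'') y"
proof -
  have y': "y \<in> EF (dplus a (dplus b c))" using y by (simp add: dplus_assoc)
  have "ind s (dplus a b) c (ind s a b f f') f'' y =
      ind s (dplus a b) c (\<lambda>z. ind_const s a b * orb_sum (dplus a b) (conv a b f f') z) f'' y"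
    by (rule ind_cong[OF y]) (simp_all add: ind_eq)
  also have "\<dots> = ind_const s (dplus a b) c * ind_const s a b * of_nat (card (GF (dplus a b))) *
      orb_sum (dplus (dplus a b) c) (conv (dplus a b) c (conv a b f f') f'') y"
    by (simp add: ind_eq[OF y] conv_smult orb_sum_smult orb_sum_conv_left[OF y])
  also have "orb_sum (dplus (dplus a b) c) (conv (dplus a b) c (conv a b f f') f'') y =
      orb_sum (dplus a (dplus b c)) (conv a (dplus b c) f (conv b c f' f'')) y"
    by (subst (1) orb_sum_cong[OF y conv_assoc[OF EF_E]]) (simp_all add: dplus_assoc)
  also have "ind_const s (dplus a b) c * ind_const s a b * of_nat (card (GF (dplus a b))) * \<dots> =
      ind s a (dplus b c) f (\<lambda>z. ind_const s b c * orb_sum (dplus b c) (conv b c f' f'') z) y"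
    unfolding ind_const_assoc by (simp add: ind_eq[OF y'] conv_smult orb_sum_smult orb_sum_conv_right[OF y'])
  also have "\<dots> = ind s a (dplus b c) f (ind s b c f' f'') y"
    by (rule ind_cong[OF y']) (simp_all add: ind_eq)
  finally show ?thesis .
qed

lemma ind_act:
  assumes "g \<in> GF (dplus \<tau> \<omega>)" "y \<in> EF (dplus \<tau> \<omega>)"
  shows "ind s \<tau> \<omega> f f' (act (dplus \<tau> \<omega>) g y) = ind s \<tau> \<omega> f f' y"
  using assms by (simp add: ind_eq orb_sum_act)

text \<open>
  An element of the parabolic subgroup is uniquely a product of its Levi part and an element of the unipotent
  radical. So the constant in front of the sum for \<open>ind\<close> is a power of \<open>s\<close> over the number of fixed
  points of the parabolic subgroup.
\<close>

lemma card_QF: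
  "card {g \<in> GF (dplus \<tau> \<omega>). g \<in> Q \<tau> \<omega>} = card (GF \<tau>) * card (GF \<omega>) * hom_card \<tau> \<omega>"
proof -
  let ?N = "dplus \<tau> \<omega>"
  let ?j = "\<lambda>(k, l, u). gm (gdiag \<tau> \<omega> k l) u"
  let ?i = "\<lambda>g. (gT \<tau> g, gW \<tau> \<omega> g, gm (gi ?N (gdiag \<tau> \<omega> (gT \<tau> g) (gW \<tau> \<omega> g))) g)"
  have "bij_betw ?j (GF \<tau> \<times> GF \<omega> \<times> UF \<tau> \<omega>) {g \<in> GF ?N. g \<in> Q \<tau> \<omega>}"
  proof (rule bij_betw_byWitness[where f' = ?i])
    show "\<forall>t\<in>GF \<tau> \<times> GF \<omega> \<times> UF \<tau> \<omega>. ?i (?j t) = t"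
    proof (rule ballI)
      fix t assume "t \<in> GF \<tau> \<times> GF \<omega> \<times> UF \<tau> \<omega>"
      then obtain k l u where t: "t = (k, l, u)" and k: "k \<in> GF \<tau>" and l: "l \<in> GF \<omega>" and u: "u \<in> UF \<tau> \<omega>"
        by (metis mem_Sigma_iff surj_pair)
      note d = gdiag[OF GF_G[OF k] GF_G[OF l]]
      have uU: "u \<in> Q \<tau> \<omega>" "gT \<tau> u = gunit \<tau>" "gW \<tau> \<omega> u = gunit \<omega>" using u by (auto simp: UF_def unip_iff)
      have "gT \<tau> (gm (gdiag \<tau> \<omega> k l) u) = k" "gW \<tau> \<omega> (gm (gdiag \<tau> \<omega> k l) u) = l"
        using Q_gm(2,3)[OF d(1) uU(1)] d uU k l GF_G by simp_all
      then show "?i (?j t) = t" unfolding t using Q_G[OF d(1)] Q_G[OF uU(1)] by simp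
    qed
    show "\<forall>g\<in>{g \<in> GF ?N. g \<in> Q \<tau> \<omega>}. ?j (?i g) = g"
      using gdiag(1)[OF gT_in gW_in] Q_G by auto
    show "?j ` (GF \<tau> \<times> GF \<omega> \<times> UF \<tau> \<omega>) \<subseteq> {g \<in> GF ?N. g \<in> Q \<tau> \<omega>}"
    proof (intro image_subsetI)
      fix t assume "t \<in> GF \<tau> \<times> GF \<omega> \<times> UF \<tau> \<omega>"
      then obtain k l u where t: "t = (k, l, u)" and k: "k \<in> GF \<tau>" and l: "l \<in> GF \<omega>" and u: "u \<in> UF \<tau> \<omega>"
        by (metis mem_Sigma_iff surj_pair)
      have uQ: "u \<in> Q \<tau> \<omega>" and uG: "u \<in> GF ?N" using u U_Q Q_G by (auto simp: UF_def GF_iff)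
      show "?j t \<in> {g \<in> GF ?N. g \<in> Q \<tau> \<omega>}"
        using Q_gm(1)[OF gdiag(1)[OF GF_G[OF k] GF_G[OF l]] uQ] GF_closed(2)[OF gdiag_GF[OF k l] uG] by (simp add: t)
    qed
    show "?i ` {g \<in> GF ?N. g \<in> Q \<tau> \<omega>} \<subseteq> GF \<tau> \<times> GF \<omega> \<times> UF \<tau> \<omega>"
    proof (intro image_subsetI)
      fix g assume "g \<in> {g \<in> GF ?N. g \<in> Q \<tau> \<omega>}"
      then have g: "g \<in> GF ?N" "g \<in> Q \<tau> \<omega>" "FG g = g" by (auto simp: GF_iff)
      have k: "gT \<tau> g \<in> GF \<tau>" and l: "gW \<tau> \<omega> g \<in> GF \<omega>"
        using gTW_FG[OF Q_G[OF g(2)]] g by (auto simp: GF_iff)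
      let ?d = "gdiag \<tau> \<omega> (gT \<tau> g) (gW \<tau> \<omega> g)"
      note d = gdiag[OF GF_G[OF k] GF_G[OF l]]
      have "gm (gi ?N ?d) g \<in> U \<tau> \<omega>"
        unfolding unip_iff Q_gm(2,3)[OF Q_gi(1)[OF d(1)] g(2)] Q_gi(2,3)[OF d(1)] d(2,3)
        using Q_gm(1)[OF Q_gi(1)[OF d(1)] g(2)] GF_G[OF k] GF_G[OF l] by simp
      moreover have "gm (gi ?N ?d) g \<in> GF ?N" using gdiag_GF[OF k l] g(1) by simp
      ultimately show "?i g \<in> GF \<tau> \<times> GF \<omega> \<times> UF \<tau> \<omega>" using k l by (simp add: UF_def GF_iff)
    qed
  qed
  from bij_betw_same_card[OF this] show ?thesis
    by (simp add: card_cartesian_product card_UF)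
qed

lemma ind_const_eq: "ind_const s \<tau> \<omega> = inverse s ^ m_form \<Gamma> \<tau> \<omega> * (1 / of_nat (card {g \<in> GF (dplus \<tau> \<omega>). g \<in> Q \<tau> \<omega>}))"
  unfolding ind_const_def card_QF by simp

subsection \<open>The unit\<close>

abbreviation (input) d0 :: "'v set \<Rightarrow> nat" where "d0 \<equiv> \<lambda>i. 0"

lemma dm_0 [simp]: "dm d0 v = 0" by (simp add: vdim_def)

lemma dplus_0 [simp]: "dplus \<nu> d0 = \<nu>" "dplus d0 \<nu> = \<nu>" by (simp_all add: dplus_def)

lemma card_GF_0: "card (GF d0) = 1"
proof -
  have "GF d0 = mfam V (vaut \<Gamma>) (dm d0) (dm d0)"
    using GF_iff_mfam[of _ d0] mfamD(1)[of _ V "vaut \<Gamma>" "dm d0" "dm d0"] by (auto simp: det_dim_zero)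
  then show ?thesis using card_mfam_empty[of V "vaut \<Gamma>" "dm d0" "dm d0"] by simp
qed

lemma hom_card_0: "hom_card \<nu> d0 = 1" "hom_card d0 \<nu> = 1"
  unfolding hom_card_def
  using card_mfam_empty[of V "vaut \<Gamma>" "dm d0" "dm \<nu>"] hom_card_transpose[of d0 \<nu>] by (simp_all add: hom_card_def)

lemma ind_const_0: "ind_const s \<nu> d0 = 1 / of_nat (card (GF \<nu>))" "ind_const s d0 \<nu> = 1 / of_nat (card (GF \<nu>))"
  by (simp_all add: ind_const_def card_GF_0 hom_card_0 m_form_def)

lemma rep_dims:
  assumes "x \<in> E \<nu>" "h \<in> A"
  shows "dim_row (x h) = dm \<nu> (head \<Gamma> h)" "dim_col (x h) = dm \<nu> (tail \<Gamma> h)"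
  using repD(1)[OF assms] by auto

lemma S_0: "S \<nu> d0 = E \<nu>" "S d0 \<nu> = E \<nu>"
  using rep_dims(2)[of _ \<nu>] by (auto simp: S_def blk_lower_def)

lemma iT_id: "z \<in> E \<nu> \<Longrightarrow> iT \<nu> z = z" and iW_id: "z \<in> E \<nu> \<Longrightarrow> iW d0 \<nu> z = z"
proof -
  assume z: "z \<in> E \<nu>"
  have "iT \<nu> z h = z h \<and> iW d0 \<nu> z h = z h" if "h \<in> A" for h
    unfolding iT_eq iW_eq using that rep_dims[OF z that] by (auto intro!: eq_matI)
  then show "iT \<nu> z = z" "iW d0 \<nu> z = z"
    using repD(2)[OF z] by (auto simp: iT_eq iW_eq intro!: extensionalityI[of _ A])
qed

text \<open>
  For a zero dimension vector every representation is stable, the block is the representation itself, and the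
  sum has equal terms.
\<close>

lemma ind_one:
  assumes y: "y \<in> EF \<nu>" and f: "\<And>g. g \<in> GF \<nu> \<Longrightarrow> f (act \<nu> g y) = f y"
  shows "ind s \<nu> d0 f (\<lambda>z. 1) y = f y" "ind s d0 \<nu> (\<lambda>z. 1) f y = f y"
proof -
  have z: "act \<nu> g y \<in> E \<nu>" if "g \<in> GF \<nu>" for g using that y GF_G EF_E by auto
  have s: "orb_sum \<nu> (conv \<nu> d0 f (\<lambda>z. 1)) y = of_nat (card (GF \<nu>)) * f y"
    "orb_sum \<nu> (conv d0 \<nu> (\<lambda>z. 1) f) y = of_nat (card (GF \<nu>)) * f y"
    unfolding orb_sum_def conv_def using z f by (simp_all add: S_0 iT_id iW_id)
  show "ind s \<nu> d0 f (\<lambda>z. 1) y = f y" "ind s d0 \<nu> (\<lambda>z. 1) f y = f y"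
    using ind_eq[of y \<nu> d0] ind_eq[of y d0 \<nu>] y s GF_nonempty by (simp_all add: ind_const_0)
qed

lemma conv_sum:
  "conv \<tau> \<omega> (\<lambda>z. \<Sum>i\<in>I. F i z) f' = (\<lambda>z. \<Sum>i\<in>I. conv \<tau> \<omega> (F i) f' z)"
  "conv \<tau> \<omega> f (\<lambda>z. \<Sum>i\<in>I. F i z) = (\<lambda>z. \<Sum>i\<in>I. conv \<tau> \<omega> f (F i) z)"
  by (auto simp: conv_def fun_eq_iff sum_distrib_left sum_distrib_right)

lemma orb_sum_sum: "orb_sum \<nu> (\<lambda>z. \<Sum>i\<in>I. F i z) y = (\<Sum>i\<in>I. orb_sum \<nu> (F i) y)"
  unfolding orb_sum_def by (rule sum.swap)

lemma ind_sum:
  assumes "y \<in> EF (dplus \<tau> \<omega>)"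
  shows "ind s \<tau> \<omega> (\<lambda>z. \<Sum>i\<in>I. F i z) f' y = (\<Sum>i\<in>I. ind s \<tau> \<omega> (F i) f' y)"
    "ind s \<tau> \<omega> f (\<lambda>z. \<Sum>i\<in>I. F i z) y = (\<Sum>i\<in>I. ind s \<tau> \<omega> f (F i) y)"
  by (simp_all add: ind_eq[OF assms] conv_sum orb_sum_sum sum_distrib_left)

lemma ind_add:
  assumes "y \<in> EF (dplus \<tau> \<omega>)"
  shows "ind s \<tau> \<omega> (\<lambda>z. f z + g z) f' y = ind s \<tau> \<omega> f f' y + ind s \<tau> \<omega> g f' y"
    "ind s \<tau> \<omega> f (\<lambda>z. f' z + g' z) y = ind s \<tau> \<omega> f f' y + ind s \<tau> \<omega> f g' y"
  unfolding ind_eq[OF assms] orb_sum_def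
  by (simp_all add: conv_def sum.distrib[symmetric] distrib_left[symmetric])
    (intro disjI2 sum.cong refl; simp add: algebra_simps)+

lemma ind_smult:
  assumes "y \<in> EF (dplus \<tau> \<omega>)"
  shows "ind s \<tau> \<omega> (\<lambda>z. k * f z) f' y = k * ind s \<tau> \<omega> f f' y"
    "ind s \<tau> \<omega> f (\<lambda>z. k * f' z) y = k * ind s \<tau> \<omega> f f' y"
  by (simp_all add: ind_eq[OF assms] conv_smult orb_sum_smult)

lemma ind_zero:
  assumes "y \<in> EF (dplus \<tau> \<omega>)" "(\<forall>z\<in>EF \<tau>. f z = 0) \<or> (\<forall>z\<in>EF \<omega>. f' z = 0)"
  shows "ind s \<tau> \<omega> f f' y = 0"
proof -
  have "conv \<tau> \<omega> f f' z = 0" if "z \<in> EF (dplus \<tau> \<omega>)" for z using assms(2) that by (auto simp: conv_def)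
  then have "orb_sum (dplus \<tau> \<omega>) (conv \<tau> \<omega> f f') y = 0" unfolding orb_sum_def using assms(1) by simp
  then show ?thesis by (simp add: ind_eq[OF assms(1)])
qed

end

section \<open>The Hall algebra\<close>

abbreviation Kc :: "complex \<Rightarrow> complex set" where "Kc s \<equiv> carrier (coeff_field s)"

lemma coeff_field_simps [simp]:
  "monoid.mult (coeff_field s) = (*)" "ring.add (coeff_field s) = (+)"
  "one (coeff_field s) = 1" "ring.zero (coeff_field s) = 0"
  by (simp_all add: coeff_field_def ring_of_type_algebra_def)

lemma coeff_field_field: "field (coeff_field s)"
proof -
  interpret C: field "ring_of_type_algebra :: complex ring" by (rule field_from_type_algebra)
  show ?thesis unfolding coeff_field_def
    by (rule C.generate_field_is_field) (simp add: ring_of_type_algebra_def)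
qed

lemma coeff_field_cring: "cring (coeff_field s)"
  using coeff_field_field by (simp add: field_def domain_def)

lemma Kc_closed [simp]:
  shows "0 \<in> Kc s" "1 \<in> Kc s" "s \<in> Kc s"
    "x \<in> Kc s \<Longrightarrow> y \<in> Kc s \<Longrightarrow> x + y \<in> Kc s" "x \<in> Kc s \<Longrightarrow> y \<in> Kc s \<Longrightarrow> x * y \<in> Kc s"
    "x \<in> Kc s \<Longrightarrow> - x \<in> Kc s" "x \<in> Kc s \<Longrightarrow> inverse x \<in> Kc s"
proof -
  let ?R = "ring_of_type_algebra :: complex ring"
  interpret C: field ?R by (rule field_from_type_algebra)
  interpret F: field "coeff_field s" by (rule coeff_field_field)
  have Kc: "Kc s = generate_field ?R {s}" by (simp add: coeff_field_def)
  have R: "monoid.mult ?R = (*)" "ring.add ?R = (+)" "one ?R = 1" "ring.zero ?R = 0" "carrier ?R = UNIV"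
    by (simp_all add: ring_of_type_algebra_def)
  show "0 \<in> Kc s" "1 \<in> Kc s" using F.zero_closed F.one_closed by simp_all
  show "s \<in> Kc s" unfolding Kc by (rule generate_field.incl) simp
  show "x \<in> Kc s \<Longrightarrow> y \<in> Kc s \<Longrightarrow> x + y \<in> Kc s" "x \<in> Kc s \<Longrightarrow> y \<in> Kc s \<Longrightarrow> x * y \<in> Kc s"
    using F.a_closed[of x y] F.m_closed[of x y] by simp_all
  have "\<ominus>\<^bsub>?R\<^esub> x = - x" for x :: complex by (rule C.minus_equality) (simp_all add: R)
  then show "x \<in> Kc s \<Longrightarrow> - x \<in> Kc s" unfolding Kc using generate_field.a_inv[of x ?R] by simp
  show "inverse x \<in> Kc s" if x: "x \<in> Kc s"
  proof (cases "x = 0")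
    case False
    have "inv\<^bsub>?R\<^esub> x = inverse x" by (rule C.comm_inv_char) (use False in \<open>simp_all add: R\<close>)
    then show ?thesis using x False unfolding Kc using generate_field.m_inv[of x ?R] by (simp add: R)
  qed (use F.zero_closed in simp)
qed

lemma Kc_closed' [simp]:
  "x \<in> Kc s \<Longrightarrow> x ^ n \<in> Kc s" "of_nat n \<in> Kc s" "(\<And>i. i \<in> I \<Longrightarrow> F i \<in> Kc s) \<Longrightarrow> sum F I \<in> Kc s"
  "x \<in> Kc s \<Longrightarrow> y \<in> Kc s \<Longrightarrow> x / y \<in> Kc s"
proof -
  show "x \<in> Kc s \<Longrightarrow> x ^ n \<in> Kc s" by (induction n) auto
  show "of_nat n \<in> Kc s" by (induction n) auto
  show "(\<And>i. i \<in> I \<Longrightarrow> F i \<in> Kc s) \<Longrightarrow> sum F I \<in> Kc s" by (induction I rule: infinite_finite_induct) auto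
  show "x \<in> Kc s \<Longrightarrow> y \<in> Kc s \<Longrightarrow> x / y \<in> Kc s" by (simp add: divide_inverse)
qed

context hall_open
begin

abbreviation YF :: "('v set \<Rightarrow> nat) \<Rightarrow> ('h \<Rightarrow> 'k mat) set" where "YF \<nu> \<equiv> fixed_pts FE (Y \<nu>)"

lemma YF_EF: "YF \<nu> \<subseteq> EF \<nu>"
  using Y_E[of \<nu>] by (auto simp: fixed_pts_def EF_iff)

lemma YF_act: "g \<in> GF \<nu> \<Longrightarrow> x \<in> YF \<nu> \<Longrightarrow> act \<nu> g x \<in> YF \<nu>"
  using act_EF[of g \<nu> x] YF_EF[of \<nu>] Y_act[OF GF_G] by (auto simp: fixed_pts_def EF_iff)

lemma hall_space_iff:
  "f \<in> hall_space \<Gamma> q s D Y \<longleftrightarrow> f \<in> extensional D \<and>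
    (\<forall>\<nu>\<in>D. f \<nu> \<in> extensional (YF \<nu>) \<and> (\<forall>x\<in>YF \<nu>. f \<nu> x \<in> Kc s) \<and>
      (\<forall>g\<in>GF \<nu>. \<forall>x\<in>YF \<nu>. f \<nu> (act \<nu> g x) = f \<nu> x)) \<and>
    finite {\<nu> \<in> D. \<exists>x\<in>YF \<nu>. f \<nu> x \<noteq> 0}"
  by (auto simp: hall_space_def inv_funs_def PiE_iff)

lemma hall_spaceD:
  assumes "f \<in> hall_space \<Gamma> q s D Y"
  shows "\<nu> \<in> D \<Longrightarrow> x \<in> YF \<nu> \<Longrightarrow> f \<nu> x \<in> Kc s"
    "\<nu> \<in> D \<Longrightarrow> g \<in> GF \<nu> \<Longrightarrow> x \<in> YF \<nu> \<Longrightarrow> f \<nu> (act \<nu> g x) = f \<nu> x"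
    "finite {\<nu> \<in> D. \<exists>x\<in>YF \<nu>. f \<nu> x \<noteq> 0}"
  using assms by (auto simp: hall_space_iff)

lemma hall_tab_apply [simp]: "\<nu> \<in> D \<Longrightarrow> x \<in> YF \<nu> \<Longrightarrow> hall_tab \<Gamma> q D Y F \<nu> x = F \<nu> x"
  by (simp add: hall_tab_def)

lemma hall_tab_in:
  assumes "\<And>\<nu> x. \<nu> \<in> D \<Longrightarrow> x \<in> YF \<nu> \<Longrightarrow> F \<nu> x \<in> Kc s"
    and "\<And>\<nu> g x. \<nu> \<in> D \<Longrightarrow> g \<in> GF \<nu> \<Longrightarrow> x \<in> YF \<nu> \<Longrightarrow> F \<nu> (act \<nu> g x) = F \<nu> x"
    and "finite C" "\<And>\<nu> x. \<nu> \<in> D \<Longrightarrow> x \<in> YF \<nu> \<Longrightarrow> F \<nu> x \<noteq> 0 \<Longrightarrow> \<nu> \<in> C"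
  shows "hall_tab \<Gamma> q D Y F \<in> hall_space \<Gamma> q s D Y"
proof -
  have "{\<nu> \<in> D. \<exists>x\<in>YF \<nu>. hall_tab \<Gamma> q D Y F \<nu> x \<noteq> 0} \<subseteq> C" using assms(4) by auto
  then have "finite {\<nu> \<in> D. \<exists>x\<in>YF \<nu>. hall_tab \<Gamma> q D Y F \<nu> x \<noteq> 0}" using assms(3) finite_subset by blast
  then show ?thesis unfolding hall_space_iff using assms(1,2) YF_act
    by (auto simp: hall_tab_def)
qed

lemma hall_space_eqI:
  assumes "f \<in> hall_space \<Gamma> q s D Y" "f' \<in> hall_space \<Gamma> q s' D Y"
    and "\<And>\<nu> x. \<nu> \<in> D \<Longrightarrow> x \<in> YF \<nu> \<Longrightarrow> f \<nu> x = f' \<nu> x"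
  shows "f = f'"
proof (rule extensionalityI[of _ D])
  fix \<nu> assume \<nu>: "\<nu> \<in> D"
  show "f \<nu> = f' \<nu>"
    by (rule extensionalityI[of _ "YF \<nu>"]) (use assms \<nu> in \<open>auto simp: hall_space_iff\<close>)
qed (use assms in \<open>auto simp: hall_space_iff\<close>)

lemma hall_algebra_simps:
  "carrier (hall_algebra \<Gamma> q s D Y) = hall_space \<Gamma> q s D Y"
  "f \<oplus>\<^bsub>hall_algebra \<Gamma> q s D Y\<^esub> f' = hall_tab \<Gamma> q D Y (\<lambda>\<nu> x. f \<nu> x + f' \<nu> x)"
  "c \<odot>\<^bsub>hall_algebra \<Gamma> q s D Y\<^esub> f = hall_tab \<Gamma> q D Y (\<lambda>\<nu> x. c * f \<nu> x)"
  "\<zero>\<^bsub>hall_algebra \<Gamma> q s D Y\<^esub> = hall_tab \<Gamma> q D Y (\<lambda>\<nu> x. 0)"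
  "\<one>\<^bsub>hall_algebra \<Gamma> q s D Y\<^esub> = hall_tab \<Gamma> q D Y (\<lambda>\<nu> x. if \<nu> = (\<lambda>i. 0) then 1 else 0)"
  by (simp_all add: hall_algebra_def)

lemma hall_closed:
  assumes "f \<in> hall_space \<Gamma> q s D Y" "f' \<in> hall_space \<Gamma> q s D Y" "c \<in> Kc s"
  shows "hall_tab \<Gamma> q D Y (\<lambda>\<nu> x. f \<nu> x + f' \<nu> x) \<in> hall_space \<Gamma> q s D Y"
    "hall_tab \<Gamma> q D Y (\<lambda>\<nu> x. c * f \<nu> x) \<in> hall_space \<Gamma> q s D Y"
proof -
  note f = hall_spaceD[OF assms(1)] and f' = hall_spaceD[OF assms(2)]
  let ?s = "\<lambda>f. {\<nu> \<in> D. \<exists>x\<in>YF \<nu>. f \<nu> x \<noteq> (0 :: complex)}"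
  show "hall_tab \<Gamma> q D Y (\<lambda>\<nu> x. f \<nu> x + f' \<nu> x) \<in> hall_space \<Gamma> q s D Y"
    by (rule hall_tab_in[of _ _ _ "?s f \<union> ?s f'"]) (use f f' in auto)
  show "hall_tab \<Gamma> q D Y (\<lambda>\<nu> x. c * f \<nu> x) \<in> hall_space \<Gamma> q s D Y"
    by (rule hall_tab_in[of _ _ _ "?s f"]) (use f assms(3) in auto)
qed

lemma hall_consts:
  "hall_tab \<Gamma> q D Y (\<lambda>\<nu> x. 0) \<in> hall_space \<Gamma> q s D Y"
  "hall_tab \<Gamma> q D Y (\<lambda>\<nu> x. if \<nu> = (\<lambda>i. 0) then 1 else 0) \<in> hall_space \<Gamma> q s D Y"
proof -
  show "hall_tab \<Gamma> q D Y (\<lambda>\<nu> x. 0) \<in> hall_space \<Gamma> q s D Y"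
    by (rule hall_tab_in[of _ _ _ "{}"]) auto
  show "hall_tab \<Gamma> q D Y (\<lambda>\<nu> x. if \<nu> = (\<lambda>i. 0) then 1 else 0) \<in> hall_space \<Gamma> q s D Y"
    by (rule hall_tab_in[of _ _ _ "{\<lambda>i. 0}"]) (auto split: if_splits)
qed

end

context hall_data
begin

abbreviation D :: "('v set \<Rightarrow> nat) set" where "D \<equiv> dim_vectors \<Gamma>"

lemma finite_vorbits: "finite (vorbits \<Gamma>)" by (simp add: vorbits_def)

lemma dplus_in_D: "dplus \<tau> \<omega> \<in> D \<longleftrightarrow> \<tau> \<in> D \<and> \<omega> \<in> D"
  by (auto simp: dim_vectors_def dplus_def)

lemma zero_in_D: "(\<lambda>i. 0) \<in> D" by (simp add: dim_vectors_def)

definition dec :: "('v set \<Rightarrow> nat) \<Rightarrow> (('v set \<Rightarrow> nat) \<times> ('v set \<Rightarrow> nat)) set" where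
  "dec \<nu> = {(\<tau>, \<omega>). \<tau> \<in> D \<and> \<omega> \<in> D \<and> dplus \<tau> \<omega> = \<nu>}"

lemma finite_dec: "finite (dec \<nu>)"
proof (cases "\<nu> \<in> D")
  case True
  let ?L = "{\<tau>. \<forall>i. (i \<in> vorbits \<Gamma> \<longrightarrow> \<tau> i \<in> {..Max (\<nu> ` vorbits \<Gamma>)}) \<and> (i \<notin> vorbits \<Gamma> \<longrightarrow> \<tau> i = 0)}"
  have L: "finite ?L" by (rule finite_set_of_finite_funs) (use finite_vorbits in auto)
  have M: "\<nu> i \<le> Max (\<nu> ` vorbits \<Gamma>)" if "i \<in> vorbits \<Gamma>" for i using that finite_vorbits by simp
  have le: "\<tau> i \<le> \<nu> i \<and> \<omega> i \<le> \<nu> i" if "dplus \<tau> \<omega> = \<nu>" for \<tau> \<omega> i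
    using that by (auto simp: dplus_def)
  have "dec \<nu> \<subseteq> ?L \<times> ?L"
  proof safe
    fix \<tau> \<omega> assume "(\<tau>, \<omega>) \<in> dec \<nu>"
    then have d: "\<tau> \<in> D" "\<omega> \<in> D" "dplus \<tau> \<omega> = \<nu>" by (auto simp: dec_def)
    show "\<tau> i \<le> Max (\<nu> ` vorbits \<Gamma>)" if "i \<in> vorbits \<Gamma>" for i
      using le[OF d(3), of i] M[OF that] by linarith
    show "\<omega> i \<le> Max (\<nu> ` vorbits \<Gamma>)" if "i \<in> vorbits \<Gamma>" for i
      using le[OF d(3), of i] M[OF that] by linarith
    show "\<tau> i = 0" if "i \<notin> vorbits \<Gamma>" for i using that d by (simp add: dim_vectors_def)
    show "\<omega> i = 0" if "i \<notin> vorbits \<Gamma>" for i using that d by (simp add: dim_vectors_def)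
  qed
  then show ?thesis using L finite_subset by blast
next
  case False
  then have "dec \<nu> = {}" using dplus_in_D by (auto simp: dec_def)
  then show ?thesis by simp
qed

lemma decD:
  assumes "d \<in> dec \<nu>"
  shows "fst d \<in> D" "snd d \<in> D" "dplus (fst d) (snd d) = \<nu>"
  using assms by (auto simp: dec_def)

abbreviation HA where "HA s \<equiv> (hall \<Gamma> q s :: (complex, ('v, 'h, 'k) hall_elt) module)"
abbreviation HS where "HS s \<equiv> (hall_space \<Gamma> q s D (rep_space \<Gamma>) :: ('v, 'h, 'k) hall_elt set)"
abbreviation tab where "tab \<equiv> hall_tab \<Gamma> q D (rep_space \<Gamma> :: _ \<Rightarrow> ('h \<Rightarrow> 'k mat) set)"

lemma fixed_EF: "fixed_pts FE (E \<nu>) = EF \<nu>" by (simp add: EF_def)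

lemmas HS_D = full.hall_spaceD[where D = D, unfolded fixed_EF]
lemmas HS_eqI = full.hall_space_eqI[where D = D, unfolded fixed_EF]
lemmas tab_apply [simp] = full.hall_tab_apply[where D = D, unfolded fixed_EF]
lemmas tab_in = full.hall_tab_in[where D = D, unfolded fixed_EF]
lemmas HS_closed = full.hall_closed[where D = D]
lemmas HS_consts = full.hall_consts[where D = D]
lemmas HA_simps = full.hall_algebra_simps[where D = D, folded hall_def]

lemma HA_mult:
  "f \<otimes>\<^bsub>HA s\<^esub> f' = tab (\<lambda>\<nu> x. \<Sum>p\<in>dec \<nu>. ind s (fst p) (snd p) (f (fst p)) (f' (snd p)) x)"
  by (simp add: hall_def hall_algebra_def dec_def case_prod_unfold)

lemma HA_mult_apply:
  assumes "\<nu> \<in> D" "x \<in> EF \<nu>"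
  shows "(f \<otimes>\<^bsub>HA s\<^esub> f') \<nu> x = (\<Sum>p\<in>dec \<nu>. ind s (fst p) (snd p) (f (fst p)) (f' (snd p)) x)"
  using assms by (simp add: HA_mult)

lemma ind_Kc:
  assumes "y \<in> EF (dplus \<tau> \<omega>)" "\<And>z. z \<in> EF \<tau> \<Longrightarrow> f z \<in> Kc s" "\<And>z. z \<in> EF \<omega> \<Longrightarrow> f' z \<in> Kc s"
  shows "ind s \<tau> \<omega> f f' y \<in> Kc s"
proof -
  have "conv \<tau> \<omega> f f' z \<in> Kc s" if "z \<in> EF (dplus \<tau> \<omega>)" for z
    using assms(2,3) that by (auto simp: conv_def)
  then have "orb_sum (dplus \<tau> \<omega>) (conv \<tau> \<omega> f f') y \<in> Kc s"
    unfolding orb_sum_def using assms(1) by (intro Kc_closed'(3)) auto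
  then show ?thesis unfolding ind_eq[OF assms(1)] ind_const_def by simp
qed

lemma HA_mult_in:
  assumes f: "f \<in> HS s" and f': "f' \<in> HS s"
  shows "f \<otimes>\<^bsub>HA s\<^esub> f' \<in> HS s"
proof -
  let ?s = "\<lambda>f. {\<nu> \<in> D. \<exists>x\<in>EF \<nu>. f \<nu> x \<noteq> (0 :: complex)}"
  show ?thesis unfolding HA_mult
  proof (rule tab_in[where C = "(\<lambda>(\<tau>, \<omega>). dplus \<tau> \<omega>) ` (?s f \<times> ?s f')"])
    show "finite ((\<lambda>(\<tau>, \<omega>). dplus \<tau> \<omega>) ` (?s f \<times> ?s f'))"
      using HS_D(3)[OF f] HS_D(3)[OF f'] by simp
    fix \<nu> x assume \<nu>: "\<nu> \<in> D" and x: "x \<in> EF \<nu>"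
    show "(\<Sum>p\<in>dec \<nu>. ind s (fst p) (snd p) (f (fst p)) (f' (snd p)) x) \<in> Kc s"
    proof (rule Kc_closed'(3))
      fix p assume p: "p \<in> dec \<nu>"
      show "ind s (fst p) (snd p) (f (fst p)) (f' (snd p)) x \<in> Kc s"
        by (rule ind_Kc) (use decD[OF p] x HS_D(1)[OF f] HS_D(1)[OF f'] in auto)
    qed
    show "(\<Sum>p\<in>dec \<nu>. ind s (fst p) (snd p) (f (fst p)) (f' (snd p)) (act \<nu> g x)) =
        (\<Sum>p\<in>dec \<nu>. ind s (fst p) (snd p) (f (fst p)) (f' (snd p)) x)" if g: "g \<in> GF \<nu>" for g
    proof (rule sum.cong[OF refl])
      fix p assume p: "p \<in> dec \<nu>"
      show "ind s (fst p) (snd p) (f (fst p)) (f' (snd p)) (act \<nu> g x) =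
          ind s (fst p) (snd p) (f (fst p)) (f' (snd p)) x"
        using ind_act[of g "fst p" "snd p" x] decD(3)[OF p] g x by simp
    qed
    assume nz: "(\<Sum>p\<in>dec \<nu>. ind s (fst p) (snd p) (f (fst p)) (f' (snd p)) x) \<noteq> 0"
    then obtain p where p: "p \<in> dec \<nu>" "ind s (fst p) (snd p) (f (fst p)) (f' (snd p)) x \<noteq> 0"
      by (meson sum.neutral)
    have "fst p \<in> ?s f" "snd p \<in> ?s f'"
      using ind_zero[of x "fst p" "snd p" "f (fst p)" "f' (snd p)"] p(2) x decD[OF p(1)] by auto
    then show "\<nu> \<in> (\<lambda>(\<tau>, \<omega>). dplus \<tau> \<omega>) ` (?s f \<times> ?s f')"
      using decD(3)[OF p(1)] by (intro image_eqI[of _ _ p]) (auto simp: case_prod_unfold mem_Times_iff)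
  qed
qed

text \<open>Both sides run over the decompositions of \<open>\<nu>\<close> into three summands.\<close>

lemma dec_assoc_sum:
  fixes F :: "_ \<Rightarrow> _ \<Rightarrow> _ \<Rightarrow> complex"
  assumes "\<nu> \<in> D"
  shows "(\<Sum>p\<in>dec \<nu>. \<Sum>r\<in>dec (fst p). F (fst r) (snd r) (snd p)) =
    (\<Sum>p\<in>dec \<nu>. \<Sum>r\<in>dec (snd p). F (fst p) (fst r) (snd r))"
proof -
  have "(\<Sum>p\<in>dec \<nu>. \<Sum>r\<in>dec (fst p). F (fst r) (snd r) (snd p)) =
      (\<Sum>t\<in>Sigma (dec \<nu>) (\<lambda>p. dec (fst p)). F (fst (snd t)) (snd (snd t)) (snd (fst t)))"
    by (subst sum.Sigma) (simp_all add: finite_dec case_prod_unfold)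
  also have "\<dots> = (\<Sum>t\<in>Sigma (dec \<nu>) (\<lambda>p. dec (snd p)). F (fst (fst t)) (fst (snd t)) (snd (snd t)))"
    by (rule sum.reindex_bij_witness[of _ "\<lambda>t. ((dplus (fst (fst t)) (fst (snd t)), snd (snd t)), (fst (fst t), fst (snd t)))"
          "\<lambda>t. ((fst (snd t), dplus (snd (snd t)) (snd (fst t))), (snd (snd t), snd (fst t)))"])
      (auto simp: dec_def dplus_assoc dplus_in_D)
  also have "\<dots> = (\<Sum>p\<in>dec \<nu>. \<Sum>r\<in>dec (snd p). F (fst p) (fst r) (snd r))"
    by (subst sum.Sigma) (simp_all add: finite_dec case_prod_unfold)
  finally show ?thesis .
qed

lemma HA_mult_assoc:
  assumes f: "f \<in> HS s" "f' \<in> HS s" "f'' \<in> HS s"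
  shows "(f \<otimes>\<^bsub>HA s\<^esub> f') \<otimes>\<^bsub>HA s\<^esub> f'' = f \<otimes>\<^bsub>HA s\<^esub> (f' \<otimes>\<^bsub>HA s\<^esub> f'')"
proof (rule HS_eqI[OF HA_mult_in HA_mult_in])
  fix \<nu> x assume \<nu>: "\<nu> \<in> D" and x: "x \<in> EF \<nu>"
  have "((f \<otimes>\<^bsub>HA s\<^esub> f') \<otimes>\<^bsub>HA s\<^esub> f'') \<nu> x =
      (\<Sum>p\<in>dec \<nu>. \<Sum>r\<in>dec (fst p). ind s (dplus (fst r) (snd r)) (snd p)
        (ind s (fst r) (snd r) (f (fst r)) (f' (snd r))) (f'' (snd p)) x)"
    unfolding HA_mult_apply[OF \<nu> x]
  proof (rule sum.cong[OF refl])
    fix p assume p: "p \<in> dec \<nu>"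
    have x': "x \<in> EF (dplus (fst p) (snd p))" using x decD[OF p] by simp
    have "ind s (fst p) (snd p) ((f \<otimes>\<^bsub>HA s\<^esub> f') (fst p)) (f'' (snd p)) x = ind s (fst p) (snd p)
        (\<lambda>z. \<Sum>r\<in>dec (fst p). ind s (fst r) (snd r) (f (fst r)) (f' (snd r)) z) (f'' (snd p)) x"
      by (rule ind_cong[OF x' HA_mult_apply[OF decD(1)[OF p]] refl])
    also have "\<dots> = (\<Sum>r\<in>dec (fst p). ind s (fst p) (snd p)
        (ind s (fst r) (snd r) (f (fst r)) (f' (snd r))) (f'' (snd p)) x)"
      by (rule ind_sum(1)[OF x'])
    also have "\<dots> = (\<Sum>r\<in>dec (fst p). ind s (dplus (fst r) (snd r)) (snd p)
        (ind s (fst r) (snd r) (f (fst r)) (f' (snd r))) (f'' (snd p)) x)"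
      by (rule sum.cong[OF refl]) (simp add: decD(3))
    finally show "ind s (fst p) (snd p) ((f \<otimes>\<^bsub>HA s\<^esub> f') (fst p)) (f'' (snd p)) x = \<dots>" .
  qed
  also have "\<dots> = (\<Sum>p\<in>dec \<nu>. \<Sum>r\<in>dec (snd p). ind s (dplus (fst p) (fst r)) (snd r)
        (ind s (fst p) (fst r) (f (fst p)) (f' (fst r))) (f'' (snd r)) x)"
    by (rule dec_assoc_sum[OF \<nu>, of "\<lambda>a b c. ind s (dplus a b) c (ind s a b (f a) (f' b)) (f'' c) x"])
  also have "\<dots> = (\<Sum>p\<in>dec \<nu>. \<Sum>r\<in>dec (snd p). ind s (fst p) (snd p)
        (f (fst p)) (ind s (fst r) (snd r) (f' (fst r)) (f'' (snd r))) x)"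
  proof (intro sum.cong[OF refl])
    fix p r assume p: "p \<in> dec \<nu>" and r: "r \<in> dec (snd p)"
    have "x \<in> EF (dplus (dplus (fst p) (fst r)) (snd r))"
      using x decD(3)[OF p] decD(3)[OF r] by (simp add: dplus_assoc)
    from ind_assoc[OF this, of s "f (fst p)" "f' (fst r)" "f'' (snd r)"]
    show "ind s (dplus (fst p) (fst r)) (snd r) (ind s (fst p) (fst r) (f (fst p)) (f' (fst r))) (f'' (snd r)) x =
      ind s (fst p) (snd p) (f (fst p)) (ind s (fst r) (snd r) (f' (fst r)) (f'' (snd r))) x"
      using decD(3)[OF r] by simp
  qed
  also have "\<dots> = (f \<otimes>\<^bsub>HA s\<^esub> (f' \<otimes>\<^bsub>HA s\<^esub> f'')) \<nu> x"
    unfolding HA_mult_apply[OF \<nu> x]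
  proof (rule sum.cong[OF refl])
    fix p assume p: "p \<in> dec \<nu>"
    have x': "x \<in> EF (dplus (fst p) (snd p))" using x decD[OF p] by simp
    have "ind s (fst p) (snd p) (f (fst p)) ((f' \<otimes>\<^bsub>HA s\<^esub> f'') (snd p)) x = ind s (fst p) (snd p)
        (f (fst p)) (\<lambda>z. \<Sum>r\<in>dec (snd p). ind s (fst r) (snd r) (f' (fst r)) (f'' (snd r)) z) x"
      by (rule ind_cong[OF x' refl HA_mult_apply[OF decD(2)[OF p]]])
    also have "\<dots> = (\<Sum>r\<in>dec (snd p). ind s (fst p) (snd p)
        (f (fst p)) (ind s (fst r) (snd r) (f' (fst r)) (f'' (snd r))) x)"
      by (rule ind_sum(2)[OF x'])
    finally show "(\<Sum>r\<in>dec (snd p). ind s (fst p) (snd p)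
        (f (fst p)) (ind s (fst r) (snd r) (f' (fst r)) (f'' (snd r))) x) =
      ind s (fst p) (snd p) (f (fst p)) ((f' \<otimes>\<^bsub>HA s\<^esub> f'') (snd p)) x" by simp
  qed
  finally show "((f \<otimes>\<^bsub>HA s\<^esub> f') \<otimes>\<^bsub>HA s\<^esub> f'') \<nu> x = (f \<otimes>\<^bsub>HA s\<^esub> (f' \<otimes>\<^bsub>HA s\<^esub> f'')) \<nu> x" .
qed (use f HA_mult_in in auto)

lemma HA_one_apply: "\<nu> \<in> D \<Longrightarrow> x \<in> EF \<nu> \<Longrightarrow> \<one>\<^bsub>HA s\<^esub> \<nu> x = (if \<nu> = (\<lambda>i. 0) then 1 else 0)"
  by (simp add: HA_simps)

lemma HA_one_in: "\<one>\<^bsub>HA s\<^esub> \<in> HS s"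
  unfolding HA_simps by (rule HS_consts(2))

lemma HA_one:
  assumes f: "f \<in> HS s"
  shows "\<one>\<^bsub>HA s\<^esub> \<otimes>\<^bsub>HA s\<^esub> f = f" "f \<otimes>\<^bsub>HA s\<^esub> \<one>\<^bsub>HA s\<^esub> = f"
proof -
  let ?d0 = "\<lambda>i :: 'v set. 0 :: nat"
  have v: "(\<one>\<^bsub>HA s\<^esub> \<otimes>\<^bsub>HA s\<^esub> f) \<nu> x = f \<nu> x" "(f \<otimes>\<^bsub>HA s\<^esub> \<one>\<^bsub>HA s\<^esub>) \<nu> x = f \<nu> x"
    if \<nu>: "\<nu> \<in> D" and x: "x \<in> EF \<nu>" for \<nu> x
  proof -
    note inv = HS_D(2)[OF f \<nu> _ x]
    have d: "(?d0, \<nu>) \<in> dec \<nu>" "(\<nu>, ?d0) \<in> dec \<nu>" using \<nu> zero_in_D by (auto simp: dec_def)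
    have "(\<one>\<^bsub>HA s\<^esub> \<otimes>\<^bsub>HA s\<^esub> f) \<nu> x = (\<Sum>p\<in>{(?d0, \<nu>)}. ind s (fst p) (snd p) (\<one>\<^bsub>HA s\<^esub> (fst p)) (f (snd p)) x)"
      unfolding HA_mult_apply[OF \<nu> x]
    proof (rule sum.mono_neutral_right[OF finite_dec])
      show "\<forall>p\<in>dec \<nu> - {(?d0, \<nu>)}. ind s (fst p) (snd p) (\<one>\<^bsub>HA s\<^esub> (fst p)) (f (snd p)) x = 0"
      proof
        fix p assume p: "p \<in> dec \<nu> - {(?d0, \<nu>)}"
        then have "fst p \<noteq> ?d0" by (auto simp: dec_def)
        then show "ind s (fst p) (snd p) (\<one>\<^bsub>HA s\<^esub> (fst p)) (f (snd p)) x = 0"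
          using p x decD[of p \<nu>] by (intro ind_zero) (auto simp: HA_one_apply)
      qed
    qed (use d in auto)
    also have "\<dots> = ind s ?d0 \<nu> (\<lambda>z. 1) (f \<nu>) x"
      using x by simp (rule ind_cong; simp add: HA_one_apply zero_in_D)
    also have "\<dots> = f \<nu> x" by (rule ind_one(2)[OF x inv])
    finally show "(\<one>\<^bsub>HA s\<^esub> \<otimes>\<^bsub>HA s\<^esub> f) \<nu> x = f \<nu> x" .
    have "(f \<otimes>\<^bsub>HA s\<^esub> \<one>\<^bsub>HA s\<^esub>) \<nu> x = (\<Sum>p\<in>{(\<nu>, ?d0)}. ind s (fst p) (snd p) (f (fst p)) (\<one>\<^bsub>HA s\<^esub> (snd p)) x)"
      unfolding HA_mult_apply[OF \<nu> x]
    proof (rule sum.mono_neutral_right[OF finite_dec])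
      show "\<forall>p\<in>dec \<nu> - {(\<nu>, ?d0)}. ind s (fst p) (snd p) (f (fst p)) (\<one>\<^bsub>HA s\<^esub> (snd p)) x = 0"
      proof
        fix p assume p: "p \<in> dec \<nu> - {(\<nu>, ?d0)}"
        then have "snd p \<noteq> ?d0" by (auto simp: dec_def)
        then show "ind s (fst p) (snd p) (f (fst p)) (\<one>\<^bsub>HA s\<^esub> (snd p)) x = 0"
          using p x decD[of p \<nu>] by (intro ind_zero) (auto simp: HA_one_apply)
      qed
    qed (use d in auto)
    also have "\<dots> = ind s \<nu> ?d0 (f \<nu>) (\<lambda>z. 1) x"
      using x by simp (rule ind_cong; simp add: HA_one_apply zero_in_D)
    also have "\<dots> = f \<nu> x" by (rule ind_one(1)[OF x inv])
    finally show "(f \<otimes>\<^bsub>HA s\<^esub> \<one>\<^bsub>HA s\<^esub>) \<nu> x = f \<nu> x" .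
  qed
  show "\<one>\<^bsub>HA s\<^esub> \<otimes>\<^bsub>HA s\<^esub> f = f" "f \<otimes>\<^bsub>HA s\<^esub> \<one>\<^bsub>HA s\<^esub> = f"
    by (rule HS_eqI[OF HA_mult_in]; use f HA_one_in v in blast)+
qed

lemma HA_distrib:
  assumes f: "f \<in> HS s" "g \<in> HS s" "h \<in> HS s"
  shows "(f \<oplus>\<^bsub>HA s\<^esub> g) \<otimes>\<^bsub>HA s\<^esub> h = f \<otimes>\<^bsub>HA s\<^esub> h \<oplus>\<^bsub>HA s\<^esub> g \<otimes>\<^bsub>HA s\<^esub> h"
    "h \<otimes>\<^bsub>HA s\<^esub> (f \<oplus>\<^bsub>HA s\<^esub> g) = h \<otimes>\<^bsub>HA s\<^esub> f \<oplus>\<^bsub>HA s\<^esub> h \<otimes>\<^bsub>HA s\<^esub> g"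
proof -
  have add: "a \<oplus>\<^bsub>HA s\<^esub> b \<in> HS s" if "a \<in> HS s" "b \<in> HS s" for a b
    unfolding HA_simps using HS_closed(1)[OF that] Kc_closed(1) by blast
  have app: "(a \<oplus>\<^bsub>HA s\<^esub> b) \<nu> x = a \<nu> x + b \<nu> x" if "\<nu> \<in> D" "x \<in> EF \<nu>" for a b \<nu> x
    using that by (simp add: HA_simps)
  show "(f \<oplus>\<^bsub>HA s\<^esub> g) \<otimes>\<^bsub>HA s\<^esub> h = f \<otimes>\<^bsub>HA s\<^esub> h \<oplus>\<^bsub>HA s\<^esub> g \<otimes>\<^bsub>HA s\<^esub> h"
  proof (rule HS_eqI[where s = s and s' = s])
    fix \<nu> x assume \<nu>: "\<nu> \<in> D" and x: "x \<in> EF \<nu>"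
    have "ind s (fst p) (snd p) ((f \<oplus>\<^bsub>HA s\<^esub> g) (fst p)) (h (snd p)) x =
        ind s (fst p) (snd p) (f (fst p)) (h (snd p)) x + ind s (fst p) (snd p) (g (fst p)) (h (snd p)) x"
      if p: "p \<in> dec \<nu>" for p
    proof -
      have x': "x \<in> EF (dplus (fst p) (snd p))" using x decD[OF p] by simp
      show ?thesis unfolding ind_add(1)[OF x', symmetric]
        by (rule ind_cong[OF x' app[OF decD(1)[OF p]] refl])
    qed
    then show "((f \<oplus>\<^bsub>HA s\<^esub> g) \<otimes>\<^bsub>HA s\<^esub> h) \<nu> x = (f \<otimes>\<^bsub>HA s\<^esub> h \<oplus>\<^bsub>HA s\<^esub> g \<otimes>\<^bsub>HA s\<^esub> h) \<nu> x"
      by (simp add: app[OF \<nu> x] HA_mult_apply[OF \<nu> x] sum.distrib)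
  qed (use f add HA_mult_in in auto)
  show "h \<otimes>\<^bsub>HA s\<^esub> (f \<oplus>\<^bsub>HA s\<^esub> g) = h \<otimes>\<^bsub>HA s\<^esub> f \<oplus>\<^bsub>HA s\<^esub> h \<otimes>\<^bsub>HA s\<^esub> g"
  proof (rule HS_eqI[where s = s and s' = s])
    fix \<nu> x assume \<nu>: "\<nu> \<in> D" and x: "x \<in> EF \<nu>"
    have "ind s (fst p) (snd p) (h (fst p)) ((f \<oplus>\<^bsub>HA s\<^esub> g) (snd p)) x =
        ind s (fst p) (snd p) (h (fst p)) (f (snd p)) x + ind s (fst p) (snd p) (h (fst p)) (g (snd p)) x"
      if p: "p \<in> dec \<nu>" for p
    proof -
      have x': "x \<in> EF (dplus (fst p) (snd p))" using x decD[OF p] by simp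
      show ?thesis unfolding ind_add(2)[OF x', symmetric]
        by (rule ind_cong[OF x' refl app[OF decD(2)[OF p]]])
    qed
    then show "(h \<otimes>\<^bsub>HA s\<^esub> (f \<oplus>\<^bsub>HA s\<^esub> g)) \<nu> x = (h \<otimes>\<^bsub>HA s\<^esub> f \<oplus>\<^bsub>HA s\<^esub> h \<otimes>\<^bsub>HA s\<^esub> g) \<nu> x"
      by (simp add: app[OF \<nu> x] HA_mult_apply[OF \<nu> x] sum.distrib)
  qed (use f add HA_mult_in in auto)
qed

lemma HA_smult_mult:
  assumes f: "f \<in> HS s" "g \<in> HS s" and c: "c \<in> Kc s"
  shows "(c \<odot>\<^bsub>HA s\<^esub> f) \<otimes>\<^bsub>HA s\<^esub> g = c \<odot>\<^bsub>HA s\<^esub> (f \<otimes>\<^bsub>HA s\<^esub> g)"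
    "f \<otimes>\<^bsub>HA s\<^esub> (c \<odot>\<^bsub>HA s\<^esub> g) = c \<odot>\<^bsub>HA s\<^esub> (f \<otimes>\<^bsub>HA s\<^esub> g)"
proof -
  have sm: "c \<odot>\<^bsub>HA s\<^esub> a \<in> HS s" if "a \<in> HS s" for a
    unfolding HA_simps by (rule HS_closed(2)[OF that that c])
  have app: "(c \<odot>\<^bsub>HA s\<^esub> a) \<nu> x = c * a \<nu> x" if "\<nu> \<in> D" "x \<in> EF \<nu>" for a \<nu> x
    using that by (simp add: HA_simps)
  show "(c \<odot>\<^bsub>HA s\<^esub> f) \<otimes>\<^bsub>HA s\<^esub> g = c \<odot>\<^bsub>HA s\<^esub> (f \<otimes>\<^bsub>HA s\<^esub> g)"
  proof (rule HS_eqI[where s = s and s' = s])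
    fix \<nu> x assume \<nu>: "\<nu> \<in> D" and x: "x \<in> EF \<nu>"
    have "ind s (fst p) (snd p) ((c \<odot>\<^bsub>HA s\<^esub> f) (fst p)) (g (snd p)) x =
        c * ind s (fst p) (snd p) (f (fst p)) (g (snd p)) x" if p: "p \<in> dec \<nu>" for p
    proof -
      have x': "x \<in> EF (dplus (fst p) (snd p))" using x decD[OF p] by simp
      show ?thesis unfolding ind_smult(1)[OF x', symmetric]
        by (rule ind_cong[OF x' app[OF decD(1)[OF p]] refl])
    qed
    then show "((c \<odot>\<^bsub>HA s\<^esub> f) \<otimes>\<^bsub>HA s\<^esub> g) \<nu> x = (c \<odot>\<^bsub>HA s\<^esub> (f \<otimes>\<^bsub>HA s\<^esub> g)) \<nu> x"
      by (simp add: app[OF \<nu> x] HA_mult_apply[OF \<nu> x] sum_distrib_left)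
  qed (use f sm HA_mult_in in auto)
  show "f \<otimes>\<^bsub>HA s\<^esub> (c \<odot>\<^bsub>HA s\<^esub> g) = c \<odot>\<^bsub>HA s\<^esub> (f \<otimes>\<^bsub>HA s\<^esub> g)"
  proof (rule HS_eqI[where s = s and s' = s])
    fix \<nu> x assume \<nu>: "\<nu> \<in> D" and x: "x \<in> EF \<nu>"
    have "ind s (fst p) (snd p) (f (fst p)) ((c \<odot>\<^bsub>HA s\<^esub> g) (snd p)) x =
        c * ind s (fst p) (snd p) (f (fst p)) (g (snd p)) x" if p: "p \<in> dec \<nu>" for p
    proof -
      have x': "x \<in> EF (dplus (fst p) (snd p))" using x decD[OF p] by simp
      show ?thesis unfolding ind_smult(2)[OF x', symmetric]
        by (rule ind_cong[OF x' refl app[OF decD(2)[OF p]]])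
    qed
    then show "(f \<otimes>\<^bsub>HA s\<^esub> (c \<odot>\<^bsub>HA s\<^esub> g)) \<nu> x = (c \<odot>\<^bsub>HA s\<^esub> (f \<otimes>\<^bsub>HA s\<^esub> g)) \<nu> x"
      by (simp add: app[OF \<nu> x] HA_mult_apply[OF \<nu> x] sum_distrib_left)
  qed (use f sm HA_mult_in in auto)
qed

theorem hall_assoc_algebra: "assoc_algebra (coeff_field s) (HA s)"
proof -
  have carr: "carrier (HA s) = HS s" by (simp add: HA_simps)
  have zero: "\<zero>\<^bsub>HA s\<^esub> \<in> HS s"
    unfolding HA_simps by (rule HS_consts(1))
  have add: "a \<oplus>\<^bsub>HA s\<^esub> b \<in> HS s" if "a \<in> HS s" "b \<in> HS s" for a b
    unfolding HA_simps using HS_closed(1)[OF that] Kc_closed(1) by blast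
  have sm: "c \<odot>\<^bsub>HA s\<^esub> a \<in> HS s" if "c \<in> Kc s" "a \<in> HS s" for a c
    unfolding HA_simps by (rule HS_closed(2)[OF that(2) that(2) that(1)])
  have app: "(a \<oplus>\<^bsub>HA s\<^esub> b) \<nu> x = a \<nu> x + b \<nu> x" "(c \<odot>\<^bsub>HA s\<^esub> a) \<nu> x = c * a \<nu> x" "\<zero>\<^bsub>HA s\<^esub> \<nu> x = 0"
    if "\<nu> \<in> D" "x \<in> EF \<nu>" for a b c \<nu> x
    using that by (simp_all add: HA_simps)
  have ag: "abelian_group (HA s)"
  proof (rule abelian_groupI; unfold carr)
    fix a b c assume a: "a \<in> HS s" and b: "b \<in> HS s" and c: "c \<in> HS s"
    show "a \<oplus>\<^bsub>HA s\<^esub> b \<oplus>\<^bsub>HA s\<^esub> c = a \<oplus>\<^bsub>HA s\<^esub> (b \<oplus>\<^bsub>HA s\<^esub> c)"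
      by (rule HS_eqI[where s = s and s' = s]) (use a b c add app in auto)
  next
    fix a b assume a: "a \<in> HS s" and b: "b \<in> HS s"
    show "a \<oplus>\<^bsub>HA s\<^esub> b = b \<oplus>\<^bsub>HA s\<^esub> a" by (rule HS_eqI[where s = s and s' = s]) (use a b add app in auto)
  next
    fix a assume a: "a \<in> HS s"
    show "\<zero>\<^bsub>HA s\<^esub> \<oplus>\<^bsub>HA s\<^esub> a = a" by (rule HS_eqI[where s = s and s' = s]) (use a zero add app in auto)
    have m: "- 1 \<in> Kc s" by simp
    have "((- 1) \<odot>\<^bsub>HA s\<^esub> a) \<oplus>\<^bsub>HA s\<^esub> a = \<zero>\<^bsub>HA s\<^esub>"
      by (rule HS_eqI[where s = s and s' = s]) (use a zero add sm[OF m] app in auto)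
    then show "\<exists>b\<in>HS s. b \<oplus>\<^bsub>HA s\<^esub> a = \<zero>\<^bsub>HA s\<^esub>" using sm[OF m a] by blast
  qed (use add zero in auto)
  have "monoid (HA s)"
    by (rule monoidI; unfold carr; rule HA_mult_in HA_one_in HA_mult_assoc HA_one)
  then have r: "ring (HA s)"
    by (intro ringI ag) (simp_all add: carr HA_distrib)
  have "module (coeff_field s) (HA s)"
  proof (rule moduleI[OF coeff_field_cring ag]; unfold carr coeff_field_simps)
    fix c d a assume c: "c \<in> Kc s" and d: "d \<in> Kc s" and a: "a \<in> HS s"
    show "(c + d) \<odot>\<^bsub>HA s\<^esub> a = c \<odot>\<^bsub>HA s\<^esub> a \<oplus>\<^bsub>HA s\<^esub> d \<odot>\<^bsub>HA s\<^esub> a"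
      by (rule HS_eqI[where s = s and s' = s]) (use c d a add sm app in \<open>auto simp: distrib_right\<close>)
    show "(c * d) \<odot>\<^bsub>HA s\<^esub> a = c \<odot>\<^bsub>HA s\<^esub> (d \<odot>\<^bsub>HA s\<^esub> a)"
      by (rule HS_eqI[where s = s and s' = s]) (use c d a sm app in auto)
  next
    fix c a b assume c: "c \<in> Kc s" and a: "a \<in> HS s" and b: "b \<in> HS s"
    show "c \<odot>\<^bsub>HA s\<^esub> (a \<oplus>\<^bsub>HA s\<^esub> b) = c \<odot>\<^bsub>HA s\<^esub> a \<oplus>\<^bsub>HA s\<^esub> c \<odot>\<^bsub>HA s\<^esub> b"
      by (rule HS_eqI[where s = s and s' = s]) (use c a b add sm app in \<open>auto simp: distrib_left\<close>)
  next
    fix a assume a: "a \<in> HS s"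
    show "1 \<odot>\<^bsub>HA s\<^esub> a = a" by (rule HS_eqI[where s = s and s' = s]) (use a sm app in auto)
  qed (use sm in auto)
  then show ?thesis using r HA_smult_mult
    by (intro assoc_algebra.intro assoc_algebra_axioms.intro) (simp_all add: carr)
qed

end

section \<open>Subalgebras, ideals, images and quotients of algebras\<close>

text \<open>The laws are transported along a surjection that respects the operations.\<close>

lemma assoc_algebra_image:
  assumes A: "assoc_algebra K A"
    and carr: "\<phi> ` carrier A = carrier B"
    and mult: "\<And>x y. x \<in> carrier A \<Longrightarrow> y \<in> carrier A \<Longrightarrow> \<phi> (x \<otimes>\<^bsub>A\<^esub> y) = \<phi> x \<otimes>\<^bsub>B\<^esub> \<phi> y"
    and add: "\<And>x y. x \<in> carrier A \<Longrightarrow> y \<in> carrier A \<Longrightarrow> \<phi> (x \<oplus>\<^bsub>A\<^esub> y) = \<phi> x \<oplus>\<^bsub>B\<^esub> \<phi> y"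
    and smult: "\<And>c x. c \<in> carrier K \<Longrightarrow> x \<in> carrier A \<Longrightarrow> \<phi> (c \<odot>\<^bsub>A\<^esub> x) = c \<odot>\<^bsub>B\<^esub> \<phi> x"
    and one: "\<phi> \<one>\<^bsub>A\<^esub> = \<one>\<^bsub>B\<^esub>" and zero: "\<phi> \<zero>\<^bsub>A\<^esub> = \<zero>\<^bsub>B\<^esub>"
  shows "assoc_algebra K B"
proof -
  interpret A: assoc_algebra K A by (rule A)
  have im: "\<phi> x \<in> carrier B" if "x \<in> carrier A" for x using that carr by blast
  have ex: "\<exists>x\<in>carrier A. y = \<phi> x" if "y \<in> carrier B" for y using that carr by blast
  have zB: "\<zero>\<^bsub>B\<^esub> \<in> carrier B" "\<one>\<^bsub>B\<^esub> \<in> carrier B" using im[of "\<zero>\<^bsub>A\<^esub>"] im[of "\<one>\<^bsub>A\<^esub>"] zero one by auto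
  have ag: "abelian_group B"
  proof (rule abelian_groupI)
    fix x y assume "x \<in> carrier B" "y \<in> carrier B"
    then obtain a b where ab: "a \<in> carrier A" "b \<in> carrier A" "x = \<phi> a" "y = \<phi> b" unfolding carr[symmetric] by blast
    show "x \<oplus>\<^bsub>B\<^esub> y \<in> carrier B" using ab im[of "a \<oplus>\<^bsub>A\<^esub> b"] add by simp
    show "x \<oplus>\<^bsub>B\<^esub> y = y \<oplus>\<^bsub>B\<^esub> x" using ab by (simp add: add[symmetric] A.M.a_comm)
  next
    fix x y z assume "x \<in> carrier B" "y \<in> carrier B" "z \<in> carrier B"
    then obtain a b c where ab: "a \<in> carrier A" "b \<in> carrier A" "c \<in> carrier A"
      "x = \<phi> a" "y = \<phi> b" "z = \<phi> c" unfolding carr[symmetric] by blast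
    show "x \<oplus>\<^bsub>B\<^esub> y \<oplus>\<^bsub>B\<^esub> z = x \<oplus>\<^bsub>B\<^esub> (y \<oplus>\<^bsub>B\<^esub> z)" using ab by (simp add: add[symmetric] A.M.a_assoc)
  next
    fix x assume "x \<in> carrier B"
    then obtain a where a: "a \<in> carrier A" "x = \<phi> a" unfolding carr[symmetric] by blast
    show "\<zero>\<^bsub>B\<^esub> \<oplus>\<^bsub>B\<^esub> x = x" using a by (simp add: add[symmetric] zero[symmetric])
    have "\<phi> (\<ominus>\<^bsub>A\<^esub> a) \<oplus>\<^bsub>B\<^esub> x = \<zero>\<^bsub>B\<^esub>" using a by (simp add: add[symmetric] zero[symmetric] A.M.l_neg)
    then show "\<exists>y\<in>carrier B. y \<oplus>\<^bsub>B\<^esub> x = \<zero>\<^bsub>B\<^esub>" using im[of "\<ominus>\<^bsub>A\<^esub> a"] a by blast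
  qed (rule zB)
  have "monoid B"
  proof (rule monoidI)
    fix x y assume "x \<in> carrier B" "y \<in> carrier B"
    then obtain a b where ab: "a \<in> carrier A" "b \<in> carrier A" "x = \<phi> a" "y = \<phi> b" unfolding carr[symmetric] by blast
    show "x \<otimes>\<^bsub>B\<^esub> y \<in> carrier B" using ab im[of "a \<otimes>\<^bsub>A\<^esub> b"] mult by simp
  next
    fix x y z assume "x \<in> carrier B" "y \<in> carrier B" "z \<in> carrier B"
    then obtain a b c where ab: "a \<in> carrier A" "b \<in> carrier A" "c \<in> carrier A"
      "x = \<phi> a" "y = \<phi> b" "z = \<phi> c" unfolding carr[symmetric] by blast
    show "x \<otimes>\<^bsub>B\<^esub> y \<otimes>\<^bsub>B\<^esub> z = x \<otimes>\<^bsub>B\<^esub> (y \<otimes>\<^bsub>B\<^esub> z)" using ab by (simp add: mult[symmetric] A.m_assoc)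
  next
    fix x assume "x \<in> carrier B"
    then obtain a where a: "a \<in> carrier A" "x = \<phi> a" unfolding carr[symmetric] by blast
    show "\<one>\<^bsub>B\<^esub> \<otimes>\<^bsub>B\<^esub> x = x" "x \<otimes>\<^bsub>B\<^esub> \<one>\<^bsub>B\<^esub> = x" using a by (simp_all add: mult[symmetric] one[symmetric])
  qed (rule zB)
  then have r: "ring B"
  proof (intro ringI ag)
    fix x y z assume "x \<in> carrier B" "y \<in> carrier B" "z \<in> carrier B"
    then obtain a b c where ab: "a \<in> carrier A" "b \<in> carrier A" "c \<in> carrier A"
      "x = \<phi> a" "y = \<phi> b" "z = \<phi> c" unfolding carr[symmetric] by blast
    show "(x \<oplus>\<^bsub>B\<^esub> y) \<otimes>\<^bsub>B\<^esub> z = x \<otimes>\<^bsub>B\<^esub> z \<oplus>\<^bsub>B\<^esub> y \<otimes>\<^bsub>B\<^esub> z" "z \<otimes>\<^bsub>B\<^esub> (x \<oplus>\<^bsub>B\<^esub> y) = z \<otimes>\<^bsub>B\<^esub> x \<oplus>\<^bsub>B\<^esub> z \<otimes>\<^bsub>B\<^esub> y"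
      using ab by (simp_all add: mult[symmetric] add[symmetric] A.l_distr A.r_distr)
  qed
  have "module K B"
  proof (rule moduleI[OF A.R.is_cring ag])
    fix c x assume "c \<in> carrier K" "x \<in> carrier B"
    then obtain a where a: "a \<in> carrier A" "x = \<phi> a" "c \<in> carrier K" unfolding carr[symmetric] by blast
    show "c \<odot>\<^bsub>B\<^esub> x \<in> carrier B" using a im[of "c \<odot>\<^bsub>A\<^esub> a"] smult by simp
  next
    fix c d x assume "c \<in> carrier K" "d \<in> carrier K" "x \<in> carrier B"
    then obtain a where a: "a \<in> carrier A" "x = \<phi> a" "c \<in> carrier K" "d \<in> carrier K" unfolding carr[symmetric] by blast
    show "(c \<oplus>\<^bsub>K\<^esub> d) \<odot>\<^bsub>B\<^esub> x = c \<odot>\<^bsub>B\<^esub> x \<oplus>\<^bsub>B\<^esub> d \<odot>\<^bsub>B\<^esub> x"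
      "(c \<otimes>\<^bsub>K\<^esub> d) \<odot>\<^bsub>B\<^esub> x = c \<odot>\<^bsub>B\<^esub> (d \<odot>\<^bsub>B\<^esub> x)"
      using a by (simp_all add: smult[symmetric] add[symmetric] A.smult_l_distr A.smult_assoc1)
  next
    fix c x y assume "c \<in> carrier K" "x \<in> carrier B" "y \<in> carrier B"
    then obtain a b where a: "a \<in> carrier A" "x = \<phi> a" "c \<in> carrier K" "b \<in> carrier A" "y = \<phi> b" unfolding carr[symmetric] by blast
    show "c \<odot>\<^bsub>B\<^esub> (x \<oplus>\<^bsub>B\<^esub> y) = c \<odot>\<^bsub>B\<^esub> x \<oplus>\<^bsub>B\<^esub> c \<odot>\<^bsub>B\<^esub> y"
      using a by (simp add: smult[symmetric] add[symmetric] A.smult_r_distr)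
  next
    fix x assume "x \<in> carrier B"
    then obtain a where a: "a \<in> carrier A" "x = \<phi> a" unfolding carr[symmetric] by blast
    show "\<one>\<^bsub>K\<^esub> \<odot>\<^bsub>B\<^esub> x = x" using a by (simp add: smult[symmetric])
  qed
  then show ?thesis
  proof (intro assoc_algebra.intro r assoc_algebra_axioms.intro)
    fix c x y assume "c \<in> carrier K" "x \<in> carrier B" "y \<in> carrier B"
    then obtain a b where a: "a \<in> carrier A" "x = \<phi> a" "c \<in> carrier K" "b \<in> carrier A" "y = \<phi> b" unfolding carr[symmetric] by blast
    show "(c \<odot>\<^bsub>B\<^esub> x) \<otimes>\<^bsub>B\<^esub> y = c \<odot>\<^bsub>B\<^esub> (x \<otimes>\<^bsub>B\<^esub> y)" "x \<otimes>\<^bsub>B\<^esub> (c \<odot>\<^bsub>B\<^esub> y) = c \<odot>\<^bsub>B\<^esub> (x \<otimes>\<^bsub>B\<^esub> y)"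
      using a by (simp_all add: smult[symmetric] mult[symmetric] A.smult_mult_left A.smult_mult_right)
  qed
qed

text \<open>Closure under scalars includes closure under negation.\<close>

lemma (in assoc_algebra) minus_eq_smult:
  "x \<in> carrier M \<Longrightarrow> \<ominus>\<^bsub>M\<^esub> x = (\<ominus>\<^bsub>R\<^esub> \<one>\<^bsub>R\<^esub>) \<odot>\<^bsub>M\<^esub> x"
  using smult_l_minus[of "\<one>\<^bsub>R\<^esub>" x] by simp

lemma subalgebra_ofI:
  fixes B :: "('c, 'a) module"
  assumes B: "assoc_algebra K B" and S: "S \<subseteq> carrier B" "\<one>\<^bsub>B\<^esub> \<in> S"
    and "\<And>x y. x \<in> S \<Longrightarrow> y \<in> S \<Longrightarrow> x \<otimes>\<^bsub>B\<^esub> y \<in> S" "\<And>x y. x \<in> S \<Longrightarrow> y \<in> S \<Longrightarrow> x \<oplus>\<^bsub>B\<^esub> y \<in> S"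
    and sm: "\<And>c x. c \<in> carrier K \<Longrightarrow> x \<in> S \<Longrightarrow> c \<odot>\<^bsub>B\<^esub> x \<in> S"
  shows "subalgebra_of K S B"
proof -
  interpret B: assoc_algebra K B by (rule B)
  have "\<ominus>\<^bsub>B\<^esub> x \<in> S" if "x \<in> S" for x
    using sm[of "\<ominus>\<^bsub>K\<^esub> \<one>\<^bsub>K\<^esub>" x] B.minus_eq_smult[of x] that S(1) by auto
  then have "subring S B" using assms(2-5) by (intro B.subringI) auto
  then show ?thesis using sm B by (simp add: subalgebra_of_def smult_stable_def)
qed

lemma subalgebra_is_algebra:
  fixes B :: "('c, 'a) module"
  assumes S: "subalgebra_of K S B"
  shows "assoc_algebra K (B\<lparr>carrier := S\<rparr>)"
proof -
  have sr: "subring S B" and sm: "\<And>c x. c \<in> carrier K \<Longrightarrow> x \<in> S \<Longrightarrow> c \<odot>\<^bsub>B\<^esub> x \<in> S"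
    and B: "assoc_algebra K B" using S by (auto simp: subalgebra_of_def smult_stable_def)
  interpret B: assoc_algebra K B by (rule B)
  have sub: "x \<in> carrier B" if "x \<in> S" for x using subringE(1)[OF sr] that by blast
  have ring: "ring (B\<lparr>carrier := S\<rparr>)" by (rule B.subring_is_ring[OF sr])
  then interpret S: ring "B\<lparr>carrier := S\<rparr>" .
  have "module K (B\<lparr>carrier := S\<rparr>)"
    by (rule moduleI[OF B.R.is_cring S.abelian_group_axioms])
      (use sub sm in \<open>simp_all add: B.smult_l_distr B.smult_r_distr B.smult_assoc1\<close>)
  then show ?thesis
    by (intro assoc_algebra.intro ring assoc_algebra_axioms.intro)
      (use sub in \<open>simp_all add: B.smult_mult_left B.smult_mult_right\<close>)
qed

lemma algebra_idealI:
  fixes B :: "('c, 'a) module"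
  assumes B: "assoc_algebra K B"
    and J: "J \<subseteq> carrier B" "\<zero>\<^bsub>B\<^esub> \<in> J" "\<And>x y. x \<in> J \<Longrightarrow> y \<in> J \<Longrightarrow> x \<oplus>\<^bsub>B\<^esub> y \<in> J"
    and sm: "\<And>c x. c \<in> carrier K \<Longrightarrow> x \<in> J \<Longrightarrow> c \<odot>\<^bsub>B\<^esub> x \<in> J"
    and m: "\<And>x y. x \<in> J \<Longrightarrow> y \<in> carrier B \<Longrightarrow> x \<otimes>\<^bsub>B\<^esub> y \<in> J" "\<And>x y. x \<in> J \<Longrightarrow> y \<in> carrier B \<Longrightarrow> y \<otimes>\<^bsub>B\<^esub> x \<in> J"
  shows "algebra_ideal K J B"
proof -
  interpret B: assoc_algebra K B by (rule B)
  have neg: "\<ominus>\<^bsub>B\<^esub> x \<in> J" if "x \<in> J" for x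
    using sm[of "\<ominus>\<^bsub>K\<^esub> \<one>\<^bsub>K\<^esub>" x] B.minus_eq_smult[of x] that J(1) by auto
  have "subgroup J (add_monoid B)"
    by (rule subgroup.intro) (use J neg in \<open>auto simp: a_inv_def\<close>)
  then have "ideal J B" by (rule idealI[OF B.ring_axioms]) (use m in auto)
  then show ?thesis using sm B by (simp add: algebra_ideal_def smult_stable_def)
qed

text \<open>The first isomorphism theorem.\<close>

lemma quotient_algebra_iso:
  fixes A :: "('c, 'a) module" and B :: "('c, 'b) module"
  assumes A: "assoc_algebra K A" and B: "assoc_algebra K B" and \<psi>: "\<psi> \<in> algebra_hom K A B"
    and onto: "\<psi> ` carrier A = carrier B" and J: "J = a_kernel A B \<psi>"
  shows "\<exists>\<phi>\<in>algebra_iso K (quotient_algebra A J) B. \<forall>x\<in>carrier A. \<phi> (J +>\<^bsub>A\<^esub> x) = \<psi> x"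
proof -
  interpret A: assoc_algebra K A by (rule A)
  interpret B: assoc_algebra K B by (rule B)
  have hom: "\<psi> \<in> Ring.ring_hom A B"
    and sm: "\<And>c x. c \<in> carrier K \<Longrightarrow> x \<in> carrier A \<Longrightarrow> \<psi> (c \<odot>\<^bsub>A\<^esub> x) = c \<odot>\<^bsub>B\<^esub> \<psi> x"
    using \<psi> by (auto simp: algebra_hom_def)
  interpret h: ring_hom_ring A B \<psi> by (rule ring_hom_ringI2[OF A.ring_axioms B.ring_axioms hom])
  have J_iff: "j \<in> J \<longleftrightarrow> j \<in> carrier A \<and> \<psi> j = \<zero>\<^bsub>B\<^esub>" for j unfolding J a_kernel_def' by blast
  have coset: "J +>\<^bsub>A\<^esub> x = {z \<in> carrier A. \<psi> z = \<psi> x}" if x: "x \<in> carrier A" for x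
  proof (intro equalityI subsetI)
    fix z assume "z \<in> J +>\<^bsub>A\<^esub> x"
    then obtain j where j: "j \<in> J" "z = j \<oplus>\<^bsub>A\<^esub> x" unfolding a_r_coset_def' by blast
    then have "j \<in> carrier A" "\<psi> j = \<zero>\<^bsub>B\<^esub>" using J_iff by blast+
    then show "z \<in> {z \<in> carrier A. \<psi> z = \<psi> x}" using x j(2) by simp
  next
    fix z assume z: "z \<in> {z \<in> carrier A. \<psi> z = \<psi> x}"
    then have "z \<ominus>\<^bsub>A\<^esub> x \<in> J" using x by (simp add: J_iff a_minus_def B.r_neg)
    moreover have "z = (z \<ominus>\<^bsub>A\<^esub> x) \<oplus>\<^bsub>A\<^esub> x"
      using x z by (simp add: a_minus_def A.M.a_assoc A.M.l_neg)
    ultimately show "z \<in> J +>\<^bsub>A\<^esub> x" unfolding a_r_coset_def' by blast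
  qed
  let ?\<phi> = "\<lambda>Y. the_elem (\<psi> ` Y)"
  have val: "?\<phi> (J +>\<^bsub>A\<^esub> x) = \<psi> x" if x: "x \<in> carrier A" for x
  proof -
    have "\<psi> ` (J +>\<^bsub>A\<^esub> x) = {\<psi> x}" unfolding coset[OF x] using x by auto
    then show ?thesis by simp
  qed
  have iso: "?\<phi> \<in> ring_iso (A Quot J) B" unfolding J by (rule h.FactRing_iso_set[OF onto])
  let ?A' = "quotient_algebra A J"
  have simps: "carrier ?A' = carrier (A Quot J)" "monoid.mult ?A' = monoid.mult (A Quot J)"
    "one ?A' = one (A Quot J)" "add ?A' = add (A Quot J)"
    "\<And>c Y. c \<odot>\<^bsub>?A'\<^esub> Y = (\<Union>x\<in>Y. J +>\<^bsub>A\<^esub> (c \<odot>\<^bsub>A\<^esub> x))"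
    by (simp_all add: quotient_algebra_def ring.defs module.defs)
  have "?\<phi> (c \<odot>\<^bsub>?A'\<^esub> Y) = c \<odot>\<^bsub>B\<^esub> ?\<phi> Y" if c: "c \<in> carrier K" and Y: "Y \<in> carrier ?A'" for c Y
  proof -
    obtain y where y: "y \<in> carrier A" "Y = J +>\<^bsub>A\<^esub> y"
      using Y unfolding simps FactRing_def A_RCOSETS_def' by auto
    have "c \<odot>\<^bsub>?A'\<^esub> Y = J +>\<^bsub>A\<^esub> (c \<odot>\<^bsub>A\<^esub> y)"
      unfolding simps y(2) coset[OF y(1)] coset[OF A.smult_closed[OF c y(1)]]
      using c y(1) by (auto simp: coset sm)
    then show ?thesis using val[OF A.smult_closed[OF c y(1)]] val[OF y(1)] sm[OF c y(1)] y(2) by simp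
  qed
  moreover have "?\<phi> \<in> Ring.ring_hom ?A' B"
    using iso unfolding ring_iso_def Ring.ring_hom_def simps by blast
  moreover have "bij_betw ?\<phi> (carrier ?A') (carrier B)"
    using iso unfolding ring_iso_def simps by blast
  ultimately have "?\<phi> \<in> algebra_iso K ?A' B" unfolding algebra_iso_def algebra_hom_def by blast
  then show ?thesis using val by (intro bexI[of _ ?\<phi>]) auto
qed

lemma algebra_hom_inverse:
  assumes A: "assoc_algebra K A" and \<phi>: "\<phi> \<in> algebra_hom K A B" and bij: "bij_betw \<phi> (carrier A) (carrier B)"
  shows "inv_into (carrier A) \<phi> \<in> algebra_hom K B A"
proof -
  interpret A: assoc_algebra K A by (rule A)
  let ?i = "inv_into (carrier A) \<phi>"
  have i: "?i y \<in> carrier A" "\<phi> (?i y) = y" if "y \<in> carrier B" for y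
    using that bij by (simp_all add: bij_betw_def inv_into_into f_inv_into_f)
  have l: "?i (\<phi> x) = x" if "x \<in> carrier A" for x using that bij by (simp add: bij_betw_inv_into_left)
  have h: "\<phi> (x \<otimes>\<^bsub>A\<^esub> y) = \<phi> x \<otimes>\<^bsub>B\<^esub> \<phi> y" "\<phi> (x \<oplus>\<^bsub>A\<^esub> y) = \<phi> x \<oplus>\<^bsub>B\<^esub> \<phi> y"
    if "x \<in> carrier A" "y \<in> carrier A" for x y
    using \<phi> that by (auto simp: algebra_hom_def Ring.ring_hom_def)
  have h': "\<phi> \<one>\<^bsub>A\<^esub> = \<one>\<^bsub>B\<^esub>" "\<And>c x. c \<in> carrier K \<Longrightarrow> x \<in> carrier A \<Longrightarrow> \<phi> (c \<odot>\<^bsub>A\<^esub> x) = c \<odot>\<^bsub>B\<^esub> \<phi> x"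
    using \<phi> by (auto simp: algebra_hom_def Ring.ring_hom_def)
  have "?i (x \<otimes>\<^bsub>B\<^esub> y) = ?i x \<otimes>\<^bsub>A\<^esub> ?i y" "?i (x \<oplus>\<^bsub>B\<^esub> y) = ?i x \<oplus>\<^bsub>A\<^esub> ?i y"
    if "x \<in> carrier B" "y \<in> carrier B" for x y
    using l[of "?i x \<otimes>\<^bsub>A\<^esub> ?i y"] l[of "?i x \<oplus>\<^bsub>A\<^esub> ?i y"] h[of "?i x" "?i y"] i that by simp_all
  moreover have "?i \<one>\<^bsub>B\<^esub> = \<one>\<^bsub>A\<^esub>" using l[of "\<one>\<^bsub>A\<^esub>"] h'(1) by simp
  moreover have "?i (c \<odot>\<^bsub>B\<^esub> x) = c \<odot>\<^bsub>A\<^esub> ?i x" if "c \<in> carrier K" "x \<in> carrier B" for c x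
    using l[of "c \<odot>\<^bsub>A\<^esub> ?i x"] h'(2)[of c "?i x"] i that by simp
  ultimately show ?thesis unfolding algebra_hom_def Ring.ring_hom_def using i by simp
qed

lemma algebra_hom_comp:
  assumes "\<phi> \<in> algebra_hom K A B" "\<psi> \<in> algebra_hom K B C"
  shows "(\<lambda>x. \<psi> (\<phi> x)) \<in> algebra_hom K A C"
  using assms by (auto simp: algebra_hom_def Ring.ring_hom_def Pi_iff)

section \<open>The open part and its complement\<close>

lemma invertible_mat_iff_det:
  fixes M :: "'k::field mat"
  assumes M: "M \<in> carrier_mat r c"
  shows "invertible_mat M \<longleftrightarrow> r = c \<and> det M \<noteq> 0"
proof
  assume i: "invertible_mat M"
  then have "square_mat M" by (simp only: invertible_mat_def)
  then have rc: "r = c" using M by simp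
  obtain N where N: "inverts_mat M N" "inverts_mat N M" using i unfolding invertible_mat_def by blast
  have N: "M * N = 1\<^sub>m r" "N * M = 1\<^sub>m (dim_row N)" using N M by (simp_all add: inverts_mat_def)
  have "dim_col N = r" using arg_cong[OF N(1), of dim_col] by simp
  moreover have "dim_row N = r" using arg_cong[OF N(2), of dim_col] M rc by simp
  ultimately have Nc: "N \<in> carrier_mat r r" by auto
  have "det M * det N = 1" using det_mult[of M r N] N M Nc rc by simp
  then show "r = c \<and> det M \<noteq> 0" using rc by auto
next
  assume rc: "r = c \<and> det M \<noteq> 0"
  then have "M \<in> carrier_mat r r" using M by simp
  note i = inv_mat_alg[OF this]
  show "invertible_mat M" unfolding invertible_mat_def inverts_mat_def
    using i rc M by (auto intro!: exI[of _ "inv\<^bsub>mat_alg r\<^esub> M"])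
qed

context hall_open
begin

lemma YF_act_iff:
  assumes "g \<in> GF \<nu>" "x \<in> EF \<nu>"
  shows "act \<nu> g x \<in> YF \<nu> \<longleftrightarrow> x \<in> YF \<nu>"
  using YF_act[OF assms(1), of x] YF_act[OF GF_closed(3)[OF assms(1)], of "act \<nu> g x"]
    act_cancel(1)[OF GF_G[OF assms(1)] EF_E[OF assms(2)]] by auto

lemma extend_zero_apply:
  "\<nu> \<in> D \<Longrightarrow> x \<in> EF \<nu> \<Longrightarrow> extend_zero \<Gamma> q D' Y D (rep_space \<Gamma>) f \<nu> x =
    (if \<nu> \<in> D' \<and> x \<in> YF \<nu> then f \<nu> x else 0)"
  by (simp add: extend_zero_def)

lemma extend_zero_in:
  assumes f: "f \<in> hall_space \<Gamma> q s D' Y"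
  shows "extend_zero \<Gamma> q D' Y D (rep_space \<Gamma>) f \<in> HS s"
  unfolding extend_zero_def
proof (rule tab_in[where C = "{\<nu> \<in> D'. \<exists>x\<in>YF \<nu>. f \<nu> x \<noteq> 0}"])
  show "finite {\<nu> \<in> D'. \<exists>x\<in>YF \<nu>. f \<nu> x \<noteq> 0}" by (rule hall_spaceD(3)[OF f])
next
  fix \<nu> x assume "\<nu> \<in> D" "x \<in> EF \<nu>"
  show "(if \<nu> \<in> D' \<and> x \<in> YF \<nu> then f \<nu> x else 0) \<in> Kc s" using hall_spaceD(1)[OF f] by auto
  show "\<nu> \<in> {\<nu> \<in> D'. \<exists>x\<in>YF \<nu>. f \<nu> x \<noteq> 0}" if "(if \<nu> \<in> D' \<and> x \<in> YF \<nu> then f \<nu> x else 0) \<noteq> 0"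
    using that by (auto split: if_splits)
next
  fix \<nu> g x assume "\<nu> \<in> D" "g \<in> GF \<nu>" "x \<in> EF \<nu>"
  then show "(if \<nu> \<in> D' \<and> act \<nu> g x \<in> YF \<nu> then f \<nu> (act \<nu> g x) else 0) =
      (if \<nu> \<in> D' \<and> x \<in> YF \<nu> then f \<nu> x else 0)"
    using hall_spaceD(2)[OF f] YF_act_iff by simp
qed

lemma hall_restrict_in:
  assumes f: "f \<in> HS s" and D': "D' \<subseteq> D"
  shows "hall_tab \<Gamma> q D' Y f \<in> hall_space \<Gamma> q s D' Y"
proof (rule hall_tab_in[where C = "{\<nu> \<in> D. \<exists>x\<in>EF \<nu>. f \<nu> x \<noteq> 0}"])
  show "finite {\<nu> \<in> D. \<exists>x\<in>EF \<nu>. f \<nu> x \<noteq> 0}" by (rule HS_D(3)[OF f])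
  fix \<nu> x assume x: "\<nu> \<in> D'" "x \<in> YF \<nu>"
  have x': "\<nu> \<in> D" "x \<in> EF \<nu>" using x D' YF_EF by blast+
  show "f \<nu> x \<in> Kc s" by (rule HS_D(1)[OF f x'])
  show "f \<nu> (act \<nu> g x) = f \<nu> x" if "g \<in> GF \<nu>" for g by (rule HS_D(2)[OF f x'(1) that x'(2)])
  show "\<nu> \<in> {\<nu> \<in> D. \<exists>x\<in>EF \<nu>. f \<nu> x \<noteq> 0}" if "f \<nu> x \<noteq> 0" using that x' by blast
qed

lemma extend_restrict:
  assumes "f \<in> HS s" "D' \<subseteq> D" "\<And>\<nu> x. \<nu> \<in> D \<Longrightarrow> x \<in> EF \<nu> \<Longrightarrow> f \<nu> x \<noteq> 0 \<Longrightarrow> \<nu> \<in> D' \<and> x \<in> YF \<nu>"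
  shows "extend_zero \<Gamma> q D' Y D (rep_space \<Gamma>) (hall_tab \<Gamma> q D' Y f) = f"
proof (rule HS_eqI[OF extend_zero_in[OF hall_restrict_in[OF assms(1,2)]] assms(1)])
  fix \<nu> x assume x: "\<nu> \<in> D" "x \<in> EF \<nu>"
  show "extend_zero \<Gamma> q D' Y D (rep_space \<Gamma>) (hall_tab \<Gamma> q D' Y f) \<nu> x = f \<nu> x"
    unfolding extend_zero_apply[OF x] using assms(3)[OF x] by auto
qed

lemma restrict_extend:
  assumes "f \<in> hall_space \<Gamma> q s D' Y" "D' \<subseteq> D"
  shows "hall_tab \<Gamma> q D' Y (extend_zero \<Gamma> q D' Y D (rep_space \<Gamma>) f) = f"
proof (rule hall_space_eqI[OF hall_restrict_in[OF extend_zero_in[OF assms(1)] assms(2)] assms(1)])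
  fix \<nu> x assume x: "\<nu> \<in> D'" "x \<in> YF \<nu>"
  then have "\<nu> \<in> D" "x \<in> EF \<nu>" using assms(2) YF_EF by auto
  then show "hall_tab \<Gamma> q D' Y (extend_zero \<Gamma> q D' Y D (rep_space \<Gamma>) f) \<nu> x = f \<nu> x"
    using x by (simp add: extend_zero_apply)
qed

text \<open>
  Up to extension by zero, functions on parts of the representation spaces are the functions which vanish off these
  parts. The ideal and the subalgebra of the theorem are of this kind.
\<close>

lemma extend_zero_image:
  assumes D': "D' \<subseteq> D"
  shows "extend_zero \<Gamma> q D' Y D (rep_space \<Gamma>) ` hall_space \<Gamma> q s D' Y =
    {f \<in> HS s. \<forall>\<nu>\<in>D. \<forall>x\<in>EF \<nu>. f \<nu> x \<noteq> 0 \<longrightarrow> \<nu> \<in> D' \<and> x \<in> YF \<nu>}" (is "?L = ?R")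
proof (intro equalityI subsetI)
  fix f assume "f \<in> ?L"
  then obtain f' where f': "f' \<in> hall_space \<Gamma> q s D' Y" "f = extend_zero \<Gamma> q D' Y D (rep_space \<Gamma>) f'"
    by blast
  show "f \<in> ?R" unfolding f'(2) using extend_zero_in[OF f'(1)] by (auto simp: extend_zero_apply split: if_splits)
next
  fix f assume f: "f \<in> ?R"
  then have "f = extend_zero \<Gamma> q D' Y D (rep_space \<Gamma>) (hall_tab \<Gamma> q D' Y f)"
    using extend_restrict[of f s D'] D' by auto
  moreover have "hall_tab \<Gamma> q D' Y f \<in> hall_space \<Gamma> q s D' Y"
    by (rule hall_restrict_in[OF _ D']) (use f in simp)
  ultimately show "f \<in> ?L" by (rule image_eqI)
qed

end

locale contraction_data = hall_data p e q K \<Gamma>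
  for p e q :: nat and K :: "'k::alg_closed_field itself" and \<Gamma> :: "('v, 'h) aut_digraph" +
  fixes ip im :: "'v set"
  assumes contractible: "contractible \<Gamma> ip im"
begin

abbreviation Br :: "'h set" where "Br \<equiv> bridges \<Gamma> ip im"

lemma orbitsD:
  assumes "O' \<in> vorbits \<Gamma>"
  shows "O' \<subseteq> V" "O' \<noteq> {}" "v \<in> O' \<Longrightarrow> orbit (vaut \<Gamma>) v = O'" "v \<in> O' \<Longrightarrow> vaut \<Gamma> v \<in> O'"
proof -
  obtain u where u: "u \<in> V" "O' = orbit (vaut \<Gamma>) u" using assms by (auto simp: vorbits_def)
  note a = fin_V vaut_bij
  show "O' \<subseteq> V" using orbit_of_bij_betw(2)[OF a u(1)] u(2) by simp
  show "O' \<noteq> {}" using self_in_orbit_of_bij_betw[OF a u(1)] u(2) by blast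
  show "v \<in> O' \<Longrightarrow> orbit (vaut \<Gamma>) v = O'"
    unfolding u(2) using orbit_swap[OF self_in_orbit_of_bij_betw[OF a u(1)]] orbit_trans by (metis subsetI subset_antisym)
  show "v \<in> O' \<Longrightarrow> vaut \<Gamma> v \<in> O'" unfolding u(2) by (rule orbit.step)
qed

lemma ip_orb: "ip \<in> vorbits \<Gamma>" and im_orb: "im \<in> vorbits \<Gamma>"
  and card_ip_im: "card ip = card im"
  and no_arrow: "h \<in> A \<Longrightarrow> tail \<Gamma> h \<in> ip \<union> im \<Longrightarrow> head \<Gamma> h \<in> ip \<union> im \<Longrightarrow> h \<in> Br"
  and card_Br: "card Br = card im"
proof -
  show *: "h \<in> A \<Longrightarrow> tail \<Gamma> h \<in> ip \<union> im \<Longrightarrow> head \<Gamma> h \<in> ip \<union> im \<Longrightarrow> h \<in> Br" for h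
    using contractible by (auto simp: contractible_def bridges_def)
  have "Br = {h \<in> A. tail \<Gamma> h \<in> ip \<union> im \<and> head \<Gamma> h \<in> ip \<union> im}"
    using * by (auto simp: bridges_def)
  then show "card Br = card im" using contractible by (simp add: contractible_def)
qed (use contractible in \<open>auto simp: contractible_def\<close>)

lemma im_V: "im \<subseteq> V" and fin_im: "finite im"
  using orbitsD(1)[OF im_orb] finite_subset[OF _ fin_V] by blast+

lemma BrD [simp]:
  assumes "h \<in> Br"
  shows "h \<in> A" "tail \<Gamma> h \<in> ip" "head \<Gamma> h \<in> im" "aaut \<Gamma> h \<in> Br"
  using assms orbitsD(4)[OF ip_orb] orbitsD(4)[OF im_orb] by (auto simp: bridges_def)

lemma Br_nonempty: "Br \<noteq> {}"
  using card_Br fin_im orbitsD(2)[OF im_orb] by (metis card.empty card_eq_0_iff)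

lemma ip_im_disjoint: "ip \<inter> im = {}"
proof (rule ccontr)
  assume "ip \<inter> im \<noteq> {}"
  then have "ip = im" using orbitsD(3)[OF ip_orb] orbitsD(3)[OF im_orb] by blast
  moreover obtain h where "h \<in> Br" using Br_nonempty by blast
  ultimately show False
    using orbit_tail_head[of h] orbitsD(3)[OF ip_orb, of "tail \<Gamma> h"] orbitsD(3)[OF im_orb, of "head \<Gamma> h"]
    by (metis BrD(1,2,3))
qed

text \<open>
  The powers of \<open>a\<close> permute the bridges and act transitively on an orbit, so every vertex of the orbit is
  an end of a bridge. There are as many bridges as vertices, so it is the end of only one.
\<close>

lemma bij_of_equivariant:
  assumes O': "O' \<in> vorbits \<Gamma>" "card O' = card Br" and t: "\<And>h. h \<in> Br \<Longrightarrow> t h \<in> O'"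
    and eq: "\<And>h. h \<in> Br \<Longrightarrow> t (aaut \<Gamma> h) = vaut \<Gamma> (t h)"
  shows "bij_betw t Br O'"
proof -
  obtain h0 where h0: "h0 \<in> Br" using Br_nonempty by blast
  have "O' \<subseteq> t ` Br"
  proof
    fix v assume "v \<in> O'"
    then have "v \<in> orbit (vaut \<Gamma>) (t h0)" using orbitsD(3)[OF O'(1) t[OF h0]] by simp
    then show "v \<in> t ` Br" by induction (use h0 eq[symmetric] in auto)
  qed
  then have im: "t ` Br = O'" using t by blast
  have "finite Br" by (rule finite_subset[OF _ fin_A]) (unfold bridges_def, blast)
  then have "inj_on t Br" by (rule eq_card_imp_inj_on) (simp add: im O'(2))
  with im show ?thesis by (simp add: bij_betw_def)
qed

lemma head_bij: "bij_betw (head \<Gamma>) Br im"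
  by (rule bij_of_equivariant) (use im_orb card_Br in simp_all)

lemma dm_ip: "v \<in> ip \<Longrightarrow> dm \<nu> v = \<nu> ip" and dm_im: "v \<in> im \<Longrightarrow> dm \<nu> v = \<nu> im"
  by (simp_all add: vdim_def orbitsD(3)[OF ip_orb] orbitsD(3)[OF im_orb])

abbreviation Dh :: "('v set \<Rightarrow> nat) set" where "Dh \<equiv> dim_vectors_hat \<Gamma> ip im"

lemma Dh_D: "Dh \<subseteq> D" and Dh_iff: "\<nu> \<in> Dh \<longleftrightarrow> \<nu> \<in> D \<and> \<nu> ip = \<nu> im"
  by (auto simp: dim_vectors_hat_def)

lemma Dh_dplus: "\<tau> \<in> Dh \<Longrightarrow> \<omega> \<in> Dh \<Longrightarrow> dplus \<tau> \<omega> \<in> Dh"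
  by (auto simp: dim_vectors_hat_def dplus_in_D) (simp add: dplus_def)

lemma Dh_zero: "(\<lambda>i. 0) \<in> Dh" by (simp add: dim_vectors_hat_def zero_in_D)

abbreviation Yh :: "('v set \<Rightarrow> nat) \<Rightarrow> ('h \<Rightarrow> 'k mat) set" where "Yh \<equiv> rep_heart \<Gamma> ip im"

lemma heart_iff: "x \<in> Yh \<nu> \<longleftrightarrow> x \<in> E \<nu> \<and> (\<forall>h\<in>Br. \<nu> im = \<nu> ip \<and> det (x h) \<noteq> 0)"
proof -
  have "invertible_mat (x h) \<longleftrightarrow> \<nu> im = \<nu> ip \<and> det (x h) \<noteq> 0" if "x \<in> E \<nu>" "h \<in> Br" for h
    using invertible_mat_iff_det[OF repD(1)[OF that(1)], of h] that(2) by (simp add: dm_ip dm_im)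
  then show ?thesis by (auto simp: rep_heart_def)
qed

lemma heart_act:
  assumes g: "g \<in> G \<nu>" and x: "x \<in> Yh \<nu>"
  shows "act \<nu> g x \<in> Yh \<nu>"
proof -
  have xE: "x \<in> E \<nu>" using x heart_iff by blast
  have "det (act \<nu> g x h) \<noteq> 0" if h: "h \<in> Br" for h
  proof -
    have eq: "\<nu> im = \<nu> ip" "det (x h) \<noteq> 0" using x h heart_iff by auto
    have c: "g (head \<Gamma> h) \<in> carrier_mat (\<nu> ip) (\<nu> ip)" "x h \<in> carrier_mat (\<nu> ip) (\<nu> ip)"
      "gi \<nu> g (tail \<Gamma> h) \<in> carrier_mat (\<nu> ip) (\<nu> ip)"
      using gaugeD(1)[OF g, of "head \<Gamma> h"] repD(1)[OF xE, of h] gi_at(1)[OF g, of "tail \<Gamma> h"] h eq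
      by (simp_all add: dm_ip dm_im)
    have "act \<nu> g x h = g (head \<Gamma> h) * x h * gi \<nu> g (tail \<Gamma> h)" using h by (simp add: gauge_act_def)
    then have "det (act \<nu> g x h) = det (g (head \<Gamma> h)) * det (x h) * det (gi \<nu> g (tail \<Gamma> h))"
      using c by (simp add: det_mult[of _ "\<nu> ip"])
    then show ?thesis using eq gaugeD(2)[OF g, of "head \<Gamma> h"] gi_at(4)[OF g, of "tail \<Gamma> h"] h by simp
  qed
  then show ?thesis using act_in[OF g xE] x heart_iff by blast
qed

sublocale heart: hall_open p e q K \<Gamma> "rep_heart \<Gamma> ip im"
  by unfold_locales (use heart_iff heart_act in auto)

sublocale compl: hall_open p e q K \<Gamma> "rep_compl \<Gamma> ip im"
proof unfold_locales
  fix \<nu> g and x :: "'h \<Rightarrow> 'k mat"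
  assume g: "g \<in> G \<nu>" and x: "x \<in> rep_compl \<Gamma> ip im \<nu>"
  then have xE: "x \<in> E \<nu>" "x \<notin> Yh \<nu>" by (auto simp: rep_compl_def)
  have "act \<nu> g x \<notin> Yh \<nu>"
    using heart_act[OF gi_in[OF g], of "act \<nu> g x"] xE act_cancel(1)[OF g xE(1)] by auto
  then show "act \<nu> g x \<in> rep_compl \<Gamma> ip im \<nu>" using act_in[OF g xE(1)] by (simp add: rep_compl_def)
qed (auto simp: rep_compl_def)

abbreviation hF where "hF \<equiv> heart.YF"

lemma compl_F: "compl.YF \<nu> = EF \<nu> - hF \<nu>"
  by (auto simp: fixed_pts_def rep_compl_def EF_iff)

text \<open>
  The determinant of a block triangular matrix is the product of those of its diagonal blocks.
\<close>

lemma heart_blocks: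
  assumes z: "z \<in> S \<tau> \<omega>" and d: "\<tau> \<in> Dh" "\<omega> \<in> Dh"
  shows "z \<in> Yh (dplus \<tau> \<omega>) \<longleftrightarrow> iT \<tau> z \<in> Yh \<tau> \<and> iW \<tau> \<omega> z \<in> Yh \<omega>"
proof -
  have eq: "\<tau> im = \<tau> ip" "\<omega> im = \<omega> ip" using d Dh_iff by auto
  have "det (z h) = det (iT \<tau> z h) * det (iW \<tau> \<omega> z h)" if h: "h \<in> Br" for h
    using det_blk_lower[of "z h" "\<tau> ip" "\<omega> ip"] SD[OF z, of h] h eq
    by (simp add: iT_eq iW_eq dm_ip dm_im)
  then show ?thesis unfolding heart_iff using S_E[OF z] eq by (auto simp: dplus_def)
qed

lemma heart_blocks_F:
  assumes "z \<in> S \<tau> \<omega>" "\<tau> \<in> Dh" "\<omega> \<in> Dh" "z \<in> EF (dplus \<tau> \<omega>)"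
  shows "z \<in> hF (dplus \<tau> \<omega>) \<longleftrightarrow> iT \<tau> z \<in> hF \<tau> \<and> iW \<tau> \<omega> z \<in> hF \<omega>"
  using heart_blocks[OF assms(1-3)] iTW_EF[OF assms(4)] assms(4) by (auto simp: fixed_pts_def EF_iff)

lemma Ind_heart:
  assumes "x \<in> hF (dplus \<tau> \<omega>)"
  shows "Ind \<Gamma> q s (rep_heart \<Gamma> ip im) \<tau> \<omega> f f' x = ind s \<tau> \<omega> f f' x"
proof -
  have "x \<in> Yh (dplus \<tau> \<omega>)" "x \<in> E (dplus \<tau> \<omega>)" "FE x = x"
    using assms heart_iff by (auto simp: fixed_pts_def)
  then show ?thesis using heart.Ind_formula[of x \<tau> \<omega>] full.Ind_formula[of x \<tau> \<omega>] by simp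
qed

text \<open>
  If \<open>x\<close> lies in the open part, then so does \<open>g x\<close>, and so do its blocks.
\<close>

lemma ind_heart_cong:
  assumes x: "x \<in> hF (dplus \<tau> \<omega>)" and d: "\<tau> \<in> Dh" "\<omega> \<in> Dh"
    and f: "\<And>z. z \<in> hF \<tau> \<Longrightarrow> f z = g z" "\<And>z. z \<in> hF \<omega> \<Longrightarrow> f' z = g' z"
  shows "ind s \<tau> \<omega> f f' x = ind s \<tau> \<omega> g g' x"
proof -
  have xE: "x \<in> EF (dplus \<tau> \<omega>)" using x heart.YF_EF by blast
  have "conv \<tau> \<omega> f f' z = conv \<tau> \<omega> g g' z" if z: "z \<in> hF (dplus \<tau> \<omega>)" for z
  proof -
    have "z \<in> EF (dplus \<tau> \<omega>)" using z heart.YF_EF by blast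
    then show ?thesis using heart_blocks_F[OF _ d, of z] z f by (simp add: conv_def)
  qed
  then have "orb_sum (dplus \<tau> \<omega>) (conv \<tau> \<omega> f f') x = orb_sum (dplus \<tau> \<omega>) (conv \<tau> \<omega> g g') x"
    unfolding orb_sum_def using x heart.YF_act by (intro sum.cong) auto
  then show ?thesis by (simp add: ind_eq[OF xE])
qed

text \<open>
  If \<open>x\<close> lies outside the open part, then so does one of the blocks of each stable \<open>g x\<close>.
\<close>

lemma ind_heart_zero:
  assumes x: "x \<in> EF (dplus \<tau> \<omega>)" "x \<notin> hF (dplus \<tau> \<omega>)" and d: "\<tau> \<in> Dh" "\<omega> \<in> Dh"
    and f: "\<And>z. z \<in> EF \<tau> \<Longrightarrow> z \<notin> hF \<tau> \<Longrightarrow> f z = 0" "\<And>z. z \<in> EF \<omega> \<Longrightarrow> z \<notin> hF \<omega> \<Longrightarrow> f' z = 0"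
  shows "ind s \<tau> \<omega> f f' x = 0"
proof -
  have "conv \<tau> \<omega> f f' z = 0" if z: "z \<in> EF (dplus \<tau> \<omega>)" "z \<notin> hF (dplus \<tau> \<omega>)" for z
    using heart_blocks_F[OF _ d, of z] z f iTW_EF[of z \<tau> \<omega>] by (auto simp: conv_def)
  then have "orb_sum (dplus \<tau> \<omega>) (conv \<tau> \<omega> f f') x = 0"
    unfolding orb_sum_def using x heart.YF_act_iff[OF _ x(1)] by (intro sum.neutral) auto
  then show ?thesis by (simp add: ind_eq[OF x(1)])
qed

abbreviation HI where "HI s \<equiv> (hall_sub \<Gamma> ip im q s :: (complex, ('v, 'h, 'k) hall_elt) module)"
abbreviation Hc where "Hc s \<equiv> (hall_compl \<Gamma> ip im q s :: ('v, 'h, 'k) hall_elt set)"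
abbreviation Hh where "Hh s \<equiv> (hall_heart \<Gamma> ip im q s :: (complex, ('v, 'h, 'k) hall_elt) module)"
abbreviation jr where "jr \<equiv> (j_restrict \<Gamma> ip im q :: ('v, 'h, 'k) hall_elt \<Rightarrow> _)"
abbreviation je where "je \<equiv> (j_extend \<Gamma> ip im q :: ('v, 'h, 'k) hall_elt \<Rightarrow> _)"

lemma HI_carrier: "carrier (HI s) = {f \<in> HS s. \<forall>\<nu>\<in>D. \<forall>x\<in>EF \<nu>. f \<nu> x \<noteq> 0 \<longrightarrow> \<nu> \<in> Dh}"
  unfolding hall_sub_def using full.extend_zero_image[OF Dh_D, of s] by (simp add: fixed_EF)

lemma Hc_eq: "Hc s = {f \<in> HS s. \<forall>\<nu>\<in>D. \<forall>x\<in>EF \<nu>. f \<nu> x \<noteq> 0 \<longrightarrow> \<nu> \<in> Dh \<and> x \<notin> hF \<nu>}"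
  unfolding hall_compl_def compl.extend_zero_image[OF Dh_D] compl_F by auto

lemma HI_simps [simp]:
  "monoid.mult (HI s) = monoid.mult (HA s)" "add (HI s) = add (HA s)" "module.smult (HI s) = module.smult (HA s)"
  "one (HI s) = one (HA s)" "zero (HI s) = zero (HA s)"
  by (simp_all add: hall_sub_def)

lemma HI_eq: "HI s = (HA s)\<lparr>carrier := carrier (HI s)\<rparr>"
  by (simp add: hall_sub_def)

lemma HA_app:
  assumes "\<nu> \<in> D" "x \<in> EF \<nu>"
  shows "(a \<oplus>\<^bsub>HA s\<^esub> b) \<nu> x = a \<nu> x + b \<nu> x" "(c \<odot>\<^bsub>HA s\<^esub> a) \<nu> x = c * a \<nu> x" "\<zero>\<^bsub>HA s\<^esub> \<nu> x = 0"
  using assms by (simp_all add: HA_simps)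

lemma HA_closed:
  assumes "a \<in> HS s" "b \<in> HS s" "c \<in> Kc s"
  shows "a \<oplus>\<^bsub>HA s\<^esub> b \<in> HS s" "c \<odot>\<^bsub>HA s\<^esub> a \<in> HS s" "\<zero>\<^bsub>HA s\<^esub> \<in> HS s"
  unfolding HA_simps using HS_closed[OF assms] HS_consts by blast+

text \<open>The supports of the factors leave only the decompositions within \<open>Dh\<close>.\<close>

lemma HI_mult_apply:
  assumes f: "f \<in> carrier (HI s)" "f' \<in> carrier (HI s)" and x: "\<nu> \<in> D" "x \<in> EF \<nu>"
  shows "(f \<otimes>\<^bsub>HA s\<^esub> f') \<nu> x =
    (\<Sum>d\<in>{d \<in> dec \<nu>. fst d \<in> Dh \<and> snd d \<in> Dh}. ind s (fst d) (snd d) (f (fst d)) (f' (snd d)) x)"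
  unfolding HA_mult_apply[OF x]
proof (rule sum.mono_neutral_right[OF finite_dec])
  show "\<forall>d\<in>dec \<nu> - {d \<in> dec \<nu>. fst d \<in> Dh \<and> snd d \<in> Dh}. ind s (fst d) (snd d) (f (fst d)) (f' (snd d)) x = 0"
  proof
    fix d assume d: "d \<in> dec \<nu> - {d \<in> dec \<nu>. fst d \<in> Dh \<and> snd d \<in> Dh}"
    then have dd: "fst d \<in> D" "snd d \<in> D" "dplus (fst d) (snd d) = \<nu>" using decD[of d \<nu>] by blast+
    show "ind s (fst d) (snd d) (f (fst d)) (f' (snd d)) x = 0"
      by (rule ind_zero) (use d dd x f in \<open>auto simp: HI_carrier\<close>)
  qed
qed auto

lemma HI_mult_in:
  assumes f: "f \<in> carrier (HI s)" "f' \<in> carrier (HI s)"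
  shows "f \<otimes>\<^bsub>HA s\<^esub> f' \<in> carrier (HI s)"
proof -
  have "f \<otimes>\<^bsub>HA s\<^esub> f' \<in> HS s" using f HA_mult_in by (simp add: HI_carrier)
  moreover have "\<nu> \<in> Dh" if \<nu>: "\<nu> \<in> D" "x \<in> EF \<nu>" and nz: "(f \<otimes>\<^bsub>HA s\<^esub> f') \<nu> x \<noteq> 0" for \<nu> x
  proof -
    obtain d where "d \<in> {d \<in> dec \<nu>. fst d \<in> Dh \<and> snd d \<in> Dh}"
      by (rule sum.not_neutral_contains_not_neutral[OF nz[unfolded HI_mult_apply[OF f \<nu>]]])
    then have d: "d \<in> dec \<nu>" "fst d \<in> Dh" "snd d \<in> Dh" by simp_all
    show ?thesis by (subst decD(3)[OF d(1), symmetric]) (rule Dh_dplus[OF d(2,3)])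
  qed
  ultimately show ?thesis unfolding HI_carrier by blast
qed

lemma HI_subalgebra: "subalgebra_of (coeff_field s) (carrier (HI s)) (HA s)"
proof -
  interpret H: assoc_algebra "coeff_field s" "HA s" by (rule hall_assoc_algebra)
  show ?thesis
  proof (rule subalgebra_ofI[OF hall_assoc_algebra])
    show "carrier (HI s) \<subseteq> carrier (HA s)" by (auto simp: HI_carrier HA_simps)
    show "\<one>\<^bsub>HA s\<^esub> \<in> carrier (HI s)"
      using HA_one_in Dh_zero by (auto simp: HI_carrier HA_one_apply split: if_splits)
    show "f \<oplus>\<^bsub>HA s\<^esub> g \<in> carrier (HI s)" if "f \<in> carrier (HI s)" "g \<in> carrier (HI s)" for f g
      using that HA_closed(1)[of f s g 0] unfolding HI_carrier by (auto simp: HA_app) (metis add_0)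
    show "c \<odot>\<^bsub>HA s\<^esub> f \<in> carrier (HI s)" if "c \<in> Kc s" "f \<in> carrier (HI s)" for c f
      using that HA_closed(2)[of f s f c] unfolding HI_carrier by (auto simp: HA_app)
  qed (rule HI_mult_in)
qed

lemma HI_algebra: "assoc_algebra (coeff_field s) (HI s)"
  by (subst HI_eq) (rule subalgebra_is_algebra[OF HI_subalgebra])

lemma Hc_HI: "Hc s \<subseteq> carrier (HI s)"
  unfolding HI_carrier Hc_eq by blast

lemma Hc_iff: "f \<in> Hc s \<longleftrightarrow> f \<in> carrier (HI s) \<and> (\<forall>\<nu>\<in>Dh. \<forall>x\<in>hF \<nu>. f \<nu> x = 0)"
  unfolding HI_carrier Hc_eq using Dh_D heart.YF_EF by fast

text \<open>
  On the open part a product only sees the values of its factors on open parts, and there one of them is zero.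
\<close>

lemma Hc_ideal: "algebra_ideal (coeff_field s) (Hc s) (HI s)"
proof -
  interpret H: assoc_algebra "coeff_field s" "HI s" by (rule HI_algebra)
  have hx: "\<nu> \<in> D \<and> x \<in> EF \<nu>" if "\<nu> \<in> Dh" "x \<in> hF \<nu>" for \<nu> x
    using that Dh_D heart.YF_EF by blast
  have m: "(f \<otimes>\<^bsub>HA s\<^esub> f') \<nu> x = 0" if f: "f \<in> carrier (HI s)" "f' \<in> carrier (HI s)" "f \<in> Hc s \<or> f' \<in> Hc s"
    and x: "\<nu> \<in> Dh" "x \<in> hF \<nu>" for f f' \<nu> x
  proof -
    note x' = conjunct1[OF hx[OF x]] conjunct2[OF hx[OF x]]
    have "ind s (fst d) (snd d) (f (fst d)) (f' (snd d)) x = 0"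
      if d: "d \<in> dec \<nu>" "fst d \<in> Dh" "snd d \<in> Dh" for d
    proof -
      have dd: "dplus (fst d) (snd d) = \<nu>" using decD d by blast
      have "ind s (fst d) (snd d) (f (fst d)) (f' (snd d)) x =
          ind s (fst d) (snd d) (if f \<in> Hc s then (\<lambda>z. 0) else f (fst d)) (if f \<in> Hc s then f' (snd d) else (\<lambda>z. 0)) x"
        by (rule ind_heart_cong) (use x dd d f(3) in \<open>auto simp: Hc_iff\<close>)
      also have "\<dots> = 0" by (rule ind_zero) (use x' dd in auto)
      finally show ?thesis .
    qed
    then show ?thesis unfolding HI_mult_apply[OF f(1,2) x'] by (intro sum.neutral) auto
  qed
  show ?thesis
  proof (rule algebra_idealI[OF HI_algebra])
    show "Hc s \<subseteq> carrier (HI s)" by (rule Hc_HI)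
    show "\<zero>\<^bsub>HI s\<^esub> \<in> Hc s"
      unfolding Hc_iff using H.M.zero_closed hx by (auto simp: HA_app)
    show "f \<oplus>\<^bsub>HI s\<^esub> f' \<in> Hc s" if "f \<in> Hc s" "f' \<in> Hc s" for f f'
      using that H.M.a_closed[of f f'] hx unfolding Hc_iff by (auto simp: HA_app)
    show "c \<odot>\<^bsub>HI s\<^esub> f \<in> Hc s" if "c \<in> carrier (coeff_field s)" "f \<in> Hc s" for c f
      using that H.smult_closed[of c f] hx unfolding Hc_iff by (auto simp: HA_app)
    show "f \<otimes>\<^bsub>HI s\<^esub> f' \<in> Hc s" "f' \<otimes>\<^bsub>HI s\<^esub> f \<in> Hc s" if "f \<in> Hc s" "f' \<in> carrier (HI s)" for f f'
    proof -
      have f: "f \<in> carrier (HI s)" using that(1) Hc_HI by blast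
      have *: "a \<otimes>\<^bsub>HA s\<^esub> b \<in> Hc s"
        if ab: "a \<in> carrier (HI s)" "b \<in> carrier (HI s)" "a \<in> Hc s \<or> b \<in> Hc s" for a b
        unfolding Hc_iff using HI_mult_in[OF ab(1,2)] m[OF ab] by blast
      show "f \<otimes>\<^bsub>HI s\<^esub> f' \<in> Hc s" "f' \<otimes>\<^bsub>HI s\<^esub> f \<in> Hc s"
        using *[OF f that(2)] *[OF that(2) f] that(1) by simp_all
    qed
  qed
qed

lemma Hh_simps:
  "carrier (Hh s) = hall_space \<Gamma> q s Dh Yh"
  "f \<oplus>\<^bsub>Hh s\<^esub> f' = hall_tab \<Gamma> q Dh Yh (\<lambda>\<nu> x. f \<nu> x + f' \<nu> x)"
  "c \<odot>\<^bsub>Hh s\<^esub> f = hall_tab \<Gamma> q Dh Yh (\<lambda>\<nu> x. c * f \<nu> x)"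
  "\<zero>\<^bsub>Hh s\<^esub> = hall_tab \<Gamma> q Dh Yh (\<lambda>\<nu> x. 0)"
  "\<one>\<^bsub>Hh s\<^esub> = hall_tab \<Gamma> q Dh Yh (\<lambda>\<nu> x. if \<nu> = (\<lambda>i. 0) then 1 else 0)"
  unfolding hall_heart_def by (rule heart.hall_algebra_simps)+

lemma Hh_mult: "f \<otimes>\<^bsub>Hh s\<^esub> f' = hall_tab \<Gamma> q Dh Yh (\<lambda>\<nu> x.
    \<Sum>d\<in>{d \<in> dec \<nu>. fst d \<in> Dh \<and> snd d \<in> Dh}. ind s (fst d) (snd d) (f (fst d)) (f' (snd d)) x)"
proof -
  have s: "{d. fst d \<in> Dh \<and> snd d \<in> Dh \<and> dplus (fst d) (snd d) = \<nu>} = {d \<in> dec \<nu>. fst d \<in> Dh \<and> snd d \<in> Dh}" for \<nu>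
    using Dh_D by (auto simp: dec_def)
  have "(\<Sum>d\<in>{d \<in> dec \<nu>. fst d \<in> Dh \<and> snd d \<in> Dh}. Ind \<Gamma> q s (rep_heart \<Gamma> ip im) (fst d) (snd d) (f (fst d)) (f' (snd d)) x) =
      (\<Sum>d\<in>{d \<in> dec \<nu>. fst d \<in> Dh \<and> snd d \<in> Dh}. ind s (fst d) (snd d) (f (fst d)) (f' (snd d)) x)"
    if "x \<in> hF \<nu>" for \<nu> x
    by (rule sum.cong[OF refl]) (use that decD(3) in \<open>auto intro!: Ind_heart\<close>)
  then show ?thesis
    by (simp add: hall_heart_def hall_algebra_def case_prod_unfold s)
      (auto simp: hall_tab_def intro!: restrict_ext)
qed

lemma jr_apply: "\<nu> \<in> Dh \<Longrightarrow> x \<in> hF \<nu> \<Longrightarrow> jr f \<nu> x = f \<nu> x"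
  by (simp add: j_restrict_def)

lemma jr_in: "f \<in> HS s \<Longrightarrow> jr f \<in> carrier (Hh s)"
  unfolding j_restrict_def Hh_simps by (rule heart.hall_restrict_in[OF _ Dh_D])

lemma je_apply: "\<nu> \<in> D \<Longrightarrow> x \<in> EF \<nu> \<Longrightarrow> je f \<nu> x = (if \<nu> \<in> Dh \<and> x \<in> hF \<nu> then f \<nu> x else 0)"
  unfolding j_extend_def by (rule heart.extend_zero_apply)

lemma je_in: "f \<in> carrier (Hh s) \<Longrightarrow> je f \<in> carrier (HI s)"
  unfolding HI_carrier using heart.extend_zero_in[of f s Dh] je_apply[of _ _ f]
  by (auto simp: Hh_simps j_extend_def split: if_splits)

lemma jr_je: "f \<in> carrier (Hh s) \<Longrightarrow> jr (je f) = f"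
  unfolding j_restrict_def j_extend_def Hh_simps by (rule heart.restrict_extend[OF _ Dh_D])

lemma hF_D: "\<nu> \<in> Dh \<Longrightarrow> x \<in> hF \<nu> \<Longrightarrow> \<nu> \<in> D \<and> x \<in> EF \<nu>"
  using Dh_D heart.YF_EF by blast

lemma tab_cong:
  assumes "\<And>\<nu> x. \<nu> \<in> Dh \<Longrightarrow> x \<in> hF \<nu> \<Longrightarrow> F \<nu> x = F' \<nu> x"
  shows "hall_tab \<Gamma> q Dh Yh F = hall_tab \<Gamma> q Dh Yh F'"
  using assms by (auto simp: hall_tab_def intro!: restrict_ext)

lemma jr_mult:
  assumes f: "f \<in> carrier (HI s)" "f' \<in> carrier (HI s)"
  shows "jr (f \<otimes>\<^bsub>HA s\<^esub> f') = jr f \<otimes>\<^bsub>Hh s\<^esub> jr f'"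
  unfolding Hh_mult unfolding j_restrict_def[of _ _ _ _ "f \<otimes>\<^bsub>HA s\<^esub> f'"]
proof (rule tab_cong)
  fix \<nu> x assume x: "\<nu> \<in> Dh" "x \<in> hF \<nu>"
  note x' = hF_D[OF x]
  show "(f \<otimes>\<^bsub>HA s\<^esub> f') \<nu> x = (\<Sum>d\<in>{d \<in> dec \<nu>. fst d \<in> Dh \<and> snd d \<in> Dh}.
      ind s (fst d) (snd d) (jr f (fst d)) (jr f' (snd d)) x)"
    unfolding HI_mult_apply[OF f conjunct1[OF x'] conjunct2[OF x']]
  proof (rule sum.cong[OF refl])
    fix d assume d: "d \<in> {d \<in> dec \<nu>. fst d \<in> Dh \<and> snd d \<in> Dh}"
    show "ind s (fst d) (snd d) (f (fst d)) (f' (snd d)) x = ind s (fst d) (snd d) (jr f (fst d)) (jr f' (snd d)) x"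
      by (rule ind_heart_cong) (use d x decD(3) in \<open>auto simp: jr_apply\<close>)
  qed
qed

lemma jr_linear:
  "jr (f \<oplus>\<^bsub>HA s\<^esub> f') = jr f \<oplus>\<^bsub>Hh s\<^esub> jr f'" "jr (c \<odot>\<^bsub>HA s\<^esub> f) = c \<odot>\<^bsub>Hh s\<^esub> jr f"
  "jr \<zero>\<^bsub>HA s\<^esub> = \<zero>\<^bsub>Hh s\<^esub>" "jr \<one>\<^bsub>HA s\<^esub> = \<one>\<^bsub>Hh s\<^esub>"
  unfolding Hh_simps unfolding j_restrict_def[of _ _ _ _ "f \<oplus>\<^bsub>HA s\<^esub> f'"] j_restrict_def[of _ _ _ _ "c \<odot>\<^bsub>HA s\<^esub> f"]
    j_restrict_def[of _ _ _ _ "\<zero>\<^bsub>HA s\<^esub>"] j_restrict_def[of _ _ _ _ "\<one>\<^bsub>HA s\<^esub>"]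
  by (rule tab_cong, insert hF_D, simp add: HA_app HA_one_apply jr_apply)+

lemma jr_image: "jr ` carrier (HI s) = carrier (Hh s)"
proof (intro equalityI subsetI)
  fix f assume "f \<in> carrier (Hh s)"
  then show "f \<in> jr ` carrier (HI s)" using jr_je je_in by (intro image_eqI[of _ _ "je f"]) auto
qed (use jr_in in \<open>auto simp: HI_carrier\<close>)

text \<open>
  The algebra of the open part is the image of \<open>HI\<close> under restriction, which already is multiplicative.
\<close>

lemma Hh_algebra: "assoc_algebra (coeff_field s) (Hh s)"
  by (rule assoc_algebra_image[OF HI_algebra jr_image]) (simp_all add: jr_mult jr_linear)

lemma jr_hom: "jr \<in> algebra_hom (coeff_field s) (HI s) (Hh s)"
  unfolding algebra_hom_def Ring.ring_hom_def using jr_image by (auto simp: jr_mult jr_linear)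

lemma jr_kernel: "a_kernel (HI s) (Hh s) jr = Hc s"
proof -
  have "jr f = \<zero>\<^bsub>Hh s\<^esub> \<longleftrightarrow> (\<forall>\<nu>\<in>Dh. \<forall>x\<in>hF \<nu>. f \<nu> x = 0)" for f
  proof
    assume z: "jr f = \<zero>\<^bsub>Hh s\<^esub>"
    show "\<forall>\<nu>\<in>Dh. \<forall>x\<in>hF \<nu>. f \<nu> x = 0"
    proof safe
      fix \<nu> x assume x: "\<nu> \<in> Dh" "x \<in> hF \<nu>"
      show "f \<nu> x = 0" using jr_apply[OF x, of f] x unfolding z Hh_simps by simp
    qed
  next
    assume "\<forall>\<nu>\<in>Dh. \<forall>x\<in>hF \<nu>. f \<nu> x = 0"
    then show "jr f = \<zero>\<^bsub>Hh s\<^esub>" unfolding Hh_simps j_restrict_def by (intro tab_cong) auto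
  qed
  then show ?thesis by (intro Set.set_eqI) (simp add: a_kernel_def' Hc_iff)
qed

text \<open>An extension by zero is recognised by its restriction and its vanishing elsewhere.\<close>

lemma je_eqI:
  assumes F: "F \<in> HS s" and jr: "jr F = f" and z: "\<And>\<nu> x. \<nu> \<in> D \<Longrightarrow> x \<in> EF \<nu> \<Longrightarrow> \<not> (\<nu> \<in> Dh \<and> x \<in> hF \<nu>) \<Longrightarrow> F \<nu> x = 0"
  shows "je f = F"
  unfolding jr[symmetric] j_restrict_def j_extend_def
  by (rule heart.extend_restrict[OF F Dh_D]) (use z in blast)

lemma je_hom: "je \<in> algebra_hom (coeff_field s) (Hh s) (HI s)"
proof -
  have je_HS: "je f \<in> HS s" if "f \<in> carrier (Hh s)" for f using je_in[OF that] by (simp add: HI_carrier)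
  have m: "je (f \<otimes>\<^bsub>Hh s\<^esub> f') = je f \<otimes>\<^bsub>HA s\<^esub> je f'"
    if f: "f \<in> carrier (Hh s)" "f' \<in> carrier (Hh s)" for f f'
  proof (rule je_eqI[OF HA_mult_in])
    show "jr (je f \<otimes>\<^bsub>HA s\<^esub> je f') = f \<otimes>\<^bsub>Hh s\<^esub> f'" using f by (simp add: jr_mult je_in jr_je)
    fix \<nu> x assume x: "\<nu> \<in> D" "x \<in> EF \<nu>" "\<not> (\<nu> \<in> Dh \<and> x \<in> hF \<nu>)"
    have "ind s (fst d) (snd d) (je f (fst d)) (je f' (snd d)) x = 0"
      if d: "d \<in> dec \<nu>" "fst d \<in> Dh" "snd d \<in> Dh" for d
      by (rule ind_heart_zero) (use d decD(3)[OF d(1)] x Dh_D Dh_dplus[OF d(2,3)] in \<open>auto simp: je_apply subset_iff\<close>)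
    then show "(je f \<otimes>\<^bsub>HA s\<^esub> je f') \<nu> x = 0"
      unfolding HI_mult_apply[OF je_in[OF f(1)] je_in[OF f(2)] x(1,2)] by (intro sum.neutral) auto
  qed (use f je_HS in auto)
  have a: "je (f \<oplus>\<^bsub>Hh s\<^esub> f') = je f \<oplus>\<^bsub>HA s\<^esub> je f'"
    if f: "f \<in> carrier (Hh s)" "f' \<in> carrier (Hh s)" for f f'
    by (rule je_eqI[OF HA_closed(1)[OF _ _ Kc_closed(1)]]) (use f je_HS in \<open>auto simp: jr_linear jr_je je_apply HA_app\<close>)
  have sm: "je (c \<odot>\<^bsub>Hh s\<^esub> f) = c \<odot>\<^bsub>HA s\<^esub> je f"
    if f: "f \<in> carrier (Hh s)" "c \<in> Kc s" for f c
    by (rule je_eqI[OF HA_closed(2)[where c = c]]) (use f je_HS in \<open>auto simp: jr_linear jr_je je_apply HA_app\<close>)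
  have "x \<in> hF (\<lambda>i. 0)" if "x \<in> EF (\<lambda>i. 0)" for x
    using that repD(1)[of x "\<lambda>i. 0"] by (auto simp: fixed_pts_def EF_iff heart_iff det_dim_zero)
  then have "je \<one>\<^bsub>Hh s\<^esub> = \<one>\<^bsub>HA s\<^esub>"
    by (intro je_eqI[OF HA_one_in]) (auto simp: jr_linear HA_one_apply Dh_zero)
  then show ?thesis unfolding algebra_hom_def Ring.ring_hom_def using je_in m a sm by auto
qed

lemma graded:
  "graded_map Dh ((HI s)\<lparr>carrier := Hc s\<rparr>) (HI s) (\<lambda>f. f)"
  "graded_map Dh (HI s) (Hh s) jr"
  "graded_map Dh (Hh s) (HI s) je"
proof -
  show "graded_map Dh ((HI s)\<lparr>carrier := Hc s\<rparr>) (HI s) (\<lambda>f. f)"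
    using Hc_HI by (auto simp: graded_map_def homogeneous_def)
  have "jr f \<mu> = \<zero>\<^bsub>Hh s\<^esub> \<mu>" if f: "f \<mu> = \<zero>\<^bsub>HA s\<^esub> \<mu>" for f \<mu>
  proof (cases "\<mu> \<in> Dh")
    case True
    have "f \<mu> x = 0" if "x \<in> hF \<mu>" for x using f that hF_D[OF True that] by (simp add: HA_app)
    then show ?thesis using True unfolding Hh_simps by (auto simp: j_restrict_def hall_tab_def intro!: restrict_ext)
  qed (simp add: Hh_simps j_restrict_def hall_tab_def)
  then show "graded_map Dh (HI s) (Hh s) jr"
    using jr_image unfolding graded_map_def homogeneous_def HI_simps by blast
  have "je f \<mu> = \<zero>\<^bsub>HA s\<^esub> \<mu>" if f: "f \<mu> = \<zero>\<^bsub>Hh s\<^esub> \<mu>" for f \<mu>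
  proof (cases "\<mu> \<in> D")
    case True
    have "f \<mu> x = 0" if "\<mu> \<in> Dh" "x \<in> hF \<mu>" for x using f that by (simp add: Hh_simps)
    then show ?thesis using True unfolding HA_simps
      by (auto simp: j_extend_def extend_zero_def hall_tab_def intro!: restrict_ext)
  qed (simp add: HA_simps j_extend_def extend_zero_def hall_tab_def)
  then show "graded_map Dh (Hh s) (HI s) je"
    using je_in unfolding graded_map_def homogeneous_def HI_simps by blast
qed

end

section \<open>The edge contraction\<close>

context contraction_data
begin

abbreviation \<Gamma>c where "\<Gamma>c \<equiv> contraction \<Gamma> ip im"
abbreviation Ac :: "'h contr_arc set" where "Ac \<equiv> arcs \<Gamma>c"

definition bridge_to :: "'v \<Rightarrow> 'h" where
  "bridge_to w = (THE h. h \<in> Br \<and> head \<Gamma> h = w)"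

lemma bridge_to: "w \<in> im \<Longrightarrow> bridge_to w \<in> Br" "w \<in> im \<Longrightarrow> head \<Gamma> (bridge_to w) = w"
  and bridge_to_head: "h \<in> Br \<Longrightarrow> bridge_to (head \<Gamma> h) = h"
proof -
  have inj: "h = h'" if "h \<in> Br" "h' \<in> Br" "head \<Gamma> h = head \<Gamma> h'" for h h'
    by (rule inj_onD[OF bij_betw_imp_inj_on[OF head_bij] that(3,1,2)])
  show *: "bridge_to (head \<Gamma> h) = h" if "h \<in> Br" for h
    unfolding bridge_to_def by (rule the_equality) (use that inj in auto)
  have "bridge_to w \<in> Br \<and> head \<Gamma> (bridge_to w) = w" if w: "w \<in> im" for w
  proof -
    have "w \<in> head \<Gamma> ` Br" using w bij_betw_imp_surj_on[OF head_bij] by simp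
    then obtain h where h: "w = head \<Gamma> h" "h \<in> Br" by (rule imageE)
    show ?thesis using *[OF h(2)] h by simp
  qed
  then show "w \<in> im \<Longrightarrow> bridge_to w \<in> Br" "w \<in> im \<Longrightarrow> head \<Gamma> (bridge_to w) = w" by simp_all
qed

lemma vaut_im: "w \<in> im \<Longrightarrow> vaut \<Gamma> w \<in> im" and vaut_ip: "w \<in> ip \<Longrightarrow> vaut \<Gamma> w \<in> ip"
  using orbitsD(4)[OF ip_orb] orbitsD(4)[OF im_orb] by auto

lemma vaut_im_iff: "v \<in> V \<Longrightarrow> vaut \<Gamma> v \<in> im \<longleftrightarrow> v \<in> im" and vaut_ip_iff: "v \<in> V \<Longrightarrow> vaut \<Gamma> v \<in> ip \<longleftrightarrow> v \<in> ip"
proof -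
  assume v: "v \<in> V"
  have "v \<in> O'" if O': "O' \<in> vorbits \<Gamma>" "vaut \<Gamma> v \<in> O'" for O'
    using orbitsD(3)[OF that] orbit_of_bij_betw(1)[OF fin_V vaut_bij v] self_in_orbit_of_bij_betw[OF fin_V vaut_bij v]
    by simp
  then show "vaut \<Gamma> v \<in> im \<longleftrightarrow> v \<in> im" "vaut \<Gamma> v \<in> ip \<longleftrightarrow> v \<in> ip"
    using vaut_im vaut_ip im_orb ip_orb by blast+
qed

lemma bridge_to_vaut: "w \<in> im \<Longrightarrow> bridge_to (vaut \<Gamma> w) = aaut \<Gamma> (bridge_to w)"
  using bridge_to_head[of "aaut \<Gamma> (bridge_to w)"] bridge_to[of w] by simp

lemma tail_in_im: "h \<in> A \<Longrightarrow> tail \<Gamma> h \<in> im \<Longrightarrow> head \<Gamma> h \<notin> im \<and> head \<Gamma> h \<notin> ip"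
  using no_arrow[of h] BrD(2)[of h] ip_im_disjoint by blast

lemma head_in_im: "h \<in> A \<Longrightarrow> head \<Gamma> h \<in> im \<Longrightarrow> h \<notin> Br \<Longrightarrow> tail \<Gamma> h \<notin> im \<and> tail \<Gamma> h \<notin> ip"
  using no_arrow[of h] by blast

lemma Br_tail [simp]: "h \<in> Br \<Longrightarrow> tail \<Gamma> h \<notin> im" "h \<in> Br \<Longrightarrow> tail \<Gamma> h \<in> V" "h \<in> Br \<Longrightarrow> head \<Gamma> h \<in> V"
  using BrD(1,2)[of h] ip_im_disjoint by (blast, simp, simp)

lemma Br_iff: "h \<in> Br \<longleftrightarrow> h \<in> A \<and> tail \<Gamma> h \<in> ip \<and> head \<Gamma> h \<in> im"
  unfolding bridges_def by blast

text \<open>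
  An arrow other than a bridge gives one arrow of the contraction: a detour over the bridge at the end of the
  arrow which lies in \<open>im\<close>, if there is one. Both ends cannot lie in \<open>im\<close>.
\<close>

definition contr :: "'h \<Rightarrow> 'h contr_arc" where
  "contr h = (if tail \<Gamma> h \<in> im then Comp h (bridge_to (tail \<Gamma> h))
     else if head \<Gamma> h \<in> im then CompBar (bridge_to (head \<Gamma> h)) h else Old h)"

lemma Ac_iff:
  "Old h \<in> Ac \<longleftrightarrow> h \<in> A \<and> tail \<Gamma> h \<notin> im \<and> head \<Gamma> h \<notin> im"
  "Comp h2 h1 \<in> Ac \<longleftrightarrow> h1 \<in> Br \<and> h2 \<in> A \<and> tail \<Gamma> h2 = head \<Gamma> h1"
  "CompBar h1 h2 \<in> Ac \<longleftrightarrow> h1 \<in> Br \<and> h2 \<in> A \<and> head \<Gamma> h2 = head \<Gamma> h1 \<and> tail \<Gamma> h2 \<notin> ip"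
  unfolding contraction_def pre_digraph.simps by blast+

lemma contr_simps [simp]:
  "verts \<Gamma>c = V - im" "vaut \<Gamma>c = vaut \<Gamma>" "aaut \<Gamma>c = map_contr_arc (aaut \<Gamma>)"
  "tail \<Gamma>c (Old h) = tail \<Gamma> h" "tail \<Gamma>c (Comp h2 h1) = tail \<Gamma> h1" "tail \<Gamma>c (CompBar h1 h2) = tail \<Gamma> h2"
  "head \<Gamma>c (Old h) = head \<Gamma> h" "head \<Gamma>c (Comp h2 h1) = head \<Gamma> h2" "head \<Gamma>c (CompBar h1 h2) = tail \<Gamma> h1"
  by (simp_all add: contraction_def)

text \<open>
  The constraints on the ends of \<open>h\<close> come from the assumption that bridges are the only arrows between vertices
  of \<open>ip\<close> and \<open>im\<close>.
\<close>

lemma Ac_cases: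
  assumes "c \<in> Ac"
  obtains (old) h where "c = Old h" "h \<in> A" "h \<notin> Br" "tail \<Gamma> h \<notin> im" "head \<Gamma> h \<notin> im" "contr h = c"
  | (comp) h k where "c = Comp h k" "h \<in> A" "h \<notin> Br" "k \<in> Br" "tail \<Gamma> h = head \<Gamma> k"
      "tail \<Gamma> h \<in> im" "head \<Gamma> h \<notin> im" "head \<Gamma> h \<notin> ip" "contr h = c"
  | (bar) h k where "c = CompBar k h" "h \<in> A" "h \<notin> Br" "k \<in> Br" "head \<Gamma> h = head \<Gamma> k"
      "head \<Gamma> h \<in> im" "tail \<Gamma> h \<notin> im" "tail \<Gamma> h \<notin> ip" "contr h = c"
proof (cases c)
  case (Old h)
  then have h: "h \<in> A" "tail \<Gamma> h \<notin> im" "head \<Gamma> h \<notin> im" using assms Ac_iff by auto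
  have nB: "h \<notin> Br" using h(3) Br_iff by blast
  show ?thesis by (rule old[OF Old h(1) nB h(2,3)]) (simp add: contr_def h Old)
next
  case (Comp h k)
  then have h: "k \<in> Br" "h \<in> A" "tail \<Gamma> h = head \<Gamma> k" using assms Ac_iff by auto
  then have t: "tail \<Gamma> h \<in> im" using BrD(3) by simp
  then have n: "head \<Gamma> h \<notin> im" "head \<Gamma> h \<notin> ip" using tail_in_im h(2) by blast+
  have nB: "h \<notin> Br" using n Br_iff by blast
  have c: "contr h = c" using t Comp bridge_to_head[OF h(1)] h(3) by (simp add: contr_def)
  show ?thesis by (rule comp[OF Comp h(2) nB h(1,3) t n c])
next
  case (CompBar k h)
  then have h: "k \<in> Br" "h \<in> A" "head \<Gamma> h = head \<Gamma> k" "tail \<Gamma> h \<notin> ip" using assms Ac_iff by auto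
  then have t: "head \<Gamma> h \<in> im" using BrD(3) by simp
  have nB: "h \<notin> Br" using h(4) Br_iff by blast
  have n: "tail \<Gamma> h \<notin> im" using head_in_im[OF h(2) t nB] by blast
  have c: "contr h = c" using t n CompBar bridge_to_head[OF h(1)] h(3) by (simp add: contr_def)
  show ?thesis by (rule bar[OF CompBar h(2) nB h(1,3) t n h(4) c])
qed

lemma contr_in: "h \<in> A \<Longrightarrow> h \<notin> Br \<Longrightarrow> contr h \<in> Ac"
  using bridge_to[of "tail \<Gamma> h"] bridge_to[of "head \<Gamma> h"] head_in_im[of h]
  by (cases "tail \<Gamma> h \<in> im"; cases "head \<Gamma> h \<in> im") (simp_all add: contr_def Ac_iff)

lemma contr_bij: "bij_betw contr (A - Br) Ac"
  unfolding bij_betw_def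
proof
  show "inj_on contr (A - Br)" by (rule inj_onI) (auto simp: contr_def split: if_splits)
  show "contr ` (A - Br) = Ac"
  proof (intro equalityI subsetI)
    fix c assume "c \<in> Ac"
    then have "\<exists>h. h \<in> A - Br \<and> contr h = c" by (cases rule: Ac_cases) (metis DiffI)+
    then show "c \<in> contr ` (A - Br)" by blast
  qed (use contr_in in auto)
qed

lemma contr_aaut:
  assumes "h \<in> A"
  shows "contr (aaut \<Gamma> h) = map_contr_arc (aaut \<Gamma>) (contr h)"
  using assms by (auto simp: contr_def vaut_im_iff bridge_to_vaut)

lemma aaut_Br_iff: "h \<in> A \<Longrightarrow> aaut \<Gamma> h \<in> Br \<longleftrightarrow> h \<in> Br"
  unfolding Br_iff by (simp add: vaut_im_iff vaut_ip_iff)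

lemma aaut_Ac: "c \<in> Ac \<Longrightarrow> map_contr_arc (aaut \<Gamma>) c \<in> Ac"
proof -
  assume "c \<in> Ac"
  then obtain h where h: "h \<in> A" "h \<notin> Br" "contr h = c" by (cases rule: Ac_cases) auto
  then show ?thesis using contr_in[of "aaut \<Gamma> h"] contr_aaut[of h] aaut_Br_iff[of h] by simp
qed

lemma ends_Ac:
  assumes "c \<in> Ac"
  shows "tail \<Gamma>c c \<in> V - im" "head \<Gamma>c c \<in> V - im"
    "orbit (vaut \<Gamma>) (tail \<Gamma>c c) \<noteq> orbit (vaut \<Gamma>) (head \<Gamma>c c)"
    "tail \<Gamma>c (map_contr_arc (aaut \<Gamma>) c) = vaut \<Gamma> (tail \<Gamma>c c)"
    "head \<Gamma>c (map_contr_arc (aaut \<Gamma>) c) = vaut \<Gamma> (head \<Gamma>c c)"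
proof -
  have ipim: "v \<notin> im" if "v \<in> ip" for v using ip_im_disjoint that by blast
  have neq: "orbit (vaut \<Gamma>) v \<noteq> orbit (vaut \<Gamma>) w" if "v \<in> ip" "w \<in> V" "w \<notin> ip" for v w
    using that orbitsD(3)[OF ip_orb that(1)] self_in_orbit_of_bij_betw[OF fin_V vaut_bij that(2)] by auto
  have "(tail \<Gamma>c c \<in> V - im) \<and> (head \<Gamma>c c \<in> V - im) \<and>
      orbit (vaut \<Gamma>) (tail \<Gamma>c c) \<noteq> orbit (vaut \<Gamma>) (head \<Gamma>c c) \<and>
      tail \<Gamma>c (map_contr_arc (aaut \<Gamma>) c) = vaut \<Gamma> (tail \<Gamma>c c) \<and>
      head \<Gamma>c (map_contr_arc (aaut \<Gamma>) c) = vaut \<Gamma> (head \<Gamma>c c)"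
    using assms
  proof (cases rule: Ac_cases)
    case (old h)
    then show ?thesis
      using orbit_tail_head[OF old(2)] by simp
  next
    case (comp h k)
    then show ?thesis
      using neq[OF BrD(2)[OF comp(4)] _ comp(8)] ipim[OF BrD(2)[OF comp(4)]] BrD(1)[OF comp(4)] by simp
  next
    case (bar h k)
    then show ?thesis
      using neq[OF BrD(2)[OF bar(4)] _ bar(8), symmetric] ipim[OF BrD(2)[OF bar(4)]] BrD(1)[OF bar(4)] by simp
  qed
  then show "tail \<Gamma>c c \<in> V - im" "head \<Gamma>c c \<in> V - im"
    "orbit (vaut \<Gamma>) (tail \<Gamma>c c) \<noteq> orbit (vaut \<Gamma>) (head \<Gamma>c c)"
    "tail \<Gamma>c (map_contr_arc (aaut \<Gamma>) c) = vaut \<Gamma> (tail \<Gamma>c c)"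
    "head \<Gamma>c (map_contr_arc (aaut \<Gamma>) c) = vaut \<Gamma> (head \<Gamma>c c)" by blast+
qed

lemma contraction_admissible: "admissible \<Gamma>c"
proof -
  have finAc: "finite Ac" using bij_betw_finite[OF contr_bij] by simp
  have fd: "fin_digraph (pre_digraph.truncate \<Gamma>c)"
    by unfold_locales (use finAc ends_Ac in \<open>auto simp: pre_digraph.defs\<close>)
  have lf: "loopfree_digraph (pre_digraph.truncate \<Gamma>c)"
  proof -
    interpret fin_digraph "pre_digraph.truncate \<Gamma>c" by (rule fd)
    have "tail \<Gamma>c c \<noteq> head \<Gamma>c c" if "c \<in> Ac" for c using ends_Ac(3)[OF that] by metis
    then show ?thesis by unfold_locales (auto simp: pre_digraph.defs)
  qed
  have bv: "bij_betw (vaut \<Gamma>) (V - im) (V - im)"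
  proof -
    have "vaut \<Gamma> ` (V - im) \<subseteq> V - im" using vaut_im_iff by auto
    moreover have "inj_on (vaut \<Gamma>) (V - im)"
      using vaut_bij by (meson Diff_subset bij_betw_imp_inj_on inj_on_subset)
    ultimately show ?thesis using endo_inj_surj[of "V - im"] by (simp add: bij_betw_def)
  qed
  have ba: "bij_betw (map_contr_arc (aaut \<Gamma>)) Ac Ac"
  proof -
    have inj: "h = h'" if "aaut \<Gamma> h = aaut \<Gamma> h'" "h \<in> A" "h' \<in> A" for h h'
      using aaut_bij that by (meson bij_betw_imp_inj_on inj_onD)
    have "inj_on (map_contr_arc (aaut \<Gamma>)) Ac"
    proof (rule inj_onI)
      fix c c' assume c: "c \<in> Ac" "c' \<in> Ac" "map_contr_arc (aaut \<Gamma>) c = map_contr_arc (aaut \<Gamma>) c'"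
      show "c = c'" using c Ac_iff inj BrD(1) by (cases c; cases c') auto
    qed
    then show ?thesis using endo_inj_surj[OF finAc] aaut_Ac by (auto simp: bij_betw_def image_subset_iff)
  qed
  show ?thesis unfolding admissible_def using fd lf bv ba ends_Ac by simp
qed

sublocale C: hall_data p e q K "contraction \<Gamma> ip im"
  by unfold_locales (rule contraction_admissible)

subsection \<open>Dimension vectors\<close>

text \<open>
  On the dimension vectors whose values at \<open>ip\<close> and \<open>im\<close> agree, \<open>red\<close> is a bijection onto the dimension vectors of
  the contraction, with inverse \<open>ext\<close>.
\<close>

definition red :: "('v set \<Rightarrow> nat) \<Rightarrow> 'v set \<Rightarrow> nat" where "red \<nu> = \<nu>(im := 0)"
definition ext :: "('v set \<Rightarrow> nat) \<Rightarrow> 'v set \<Rightarrow> nat" where "ext \<nu> = \<nu>(im := \<nu> ip)"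

lemma ip_neq_im: "ip \<noteq> im" using ip_im_disjoint orbitsD(2)[OF ip_orb] by auto

lemma vorbits_c: "vorbits \<Gamma>c = vorbits \<Gamma> - {im}"
proof -
  have "orbit (vaut \<Gamma>) v = im \<longleftrightarrow> v \<in> im" if "v \<in> V" for v
    using orbitsD(3)[OF im_orb, of v] self_in_orbit_of_bij_betw[OF fin_V vaut_bij that] by auto
  then show ?thesis by (auto simp: vorbits_def)
qed

lemma red_in: "\<nu> \<in> D \<Longrightarrow> red \<nu> \<in> C.D"
  by (auto simp: dim_vectors_def red_def vorbits_c)

lemma ext_in: "\<nu> \<in> C.D \<Longrightarrow> ext \<nu> \<in> Dh"
  using ip_neq_im im_orb by (auto simp: dim_vectors_hat_def dim_vectors_def ext_def vorbits_c)

lemma red_ext: "\<nu> \<in> C.D \<Longrightarrow> red (ext \<nu>) = \<nu>"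
  by (auto simp: dim_vectors_def red_def ext_def vorbits_c fun_eq_iff)

lemma ext_red: "\<nu> \<in> Dh \<Longrightarrow> ext (red \<nu>) = \<nu>"
  using ip_neq_im by (auto simp: Dh_iff red_def ext_def fun_eq_iff)

lemma red_dplus: "red (dplus \<tau> \<omega>) = dplus (red \<tau>) (red \<omega>)"
  and ext_dplus: "ext (dplus \<tau> \<omega>) = dplus (ext \<tau>) (ext \<omega>)"
  by (auto simp: red_def ext_def dplus_def fun_eq_iff)

lemma red_ip [simp]: "red \<nu> ip = \<nu> ip" and ext_ip [simp]: "ext \<nu> ip = \<nu> ip"
  using ip_neq_im by (simp_all add: red_def ext_def)

lemma dm_red [simp]: "v \<in> V \<Longrightarrow> v \<notin> im \<Longrightarrow> C.dm (red \<nu>) v = dm \<nu> v"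
  using self_in_orbit_of_bij_betw[OF fin_V vaut_bij, of v] by (auto simp: vdim_def red_def)

lemma dm_ends:
  "h \<in> Br \<Longrightarrow> dm \<nu> (tail \<Gamma> h) = \<nu> ip" "h \<in> Br \<Longrightarrow> dm \<nu> (head \<Gamma> h) = \<nu> im"
  by (simp_all add: dm_ip dm_im)

lemma DhD: "\<nu> \<in> Dh \<Longrightarrow> \<nu> im = \<nu> ip" by (simp add: Dh_iff)

subsection \<open>Contracting representations\<close>

text \<open>
  The representation on the spaces away from \<open>im\<close> which results from identifying the two ends of each bridge
  \<open>k\<close> by the isomorphism \<open>x k\<close>.
\<close>

definition contr_rep :: "('v set \<Rightarrow> nat) \<Rightarrow> ('h \<Rightarrow> 'k mat) \<Rightarrow> 'h contr_arc \<Rightarrow> 'k mat" where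
  "contr_rep \<nu> x = (\<lambda>c\<in>Ac. case c of Old h \<Rightarrow> x h | Comp h k \<Rightarrow> x h * x k
     | CompBar k h \<Rightarrow> inv\<^bsub>mat_alg (\<nu> ip)\<^esub> (x k) * x h)"

definition contr_gauge :: "('v \<Rightarrow> 'k mat) \<Rightarrow> 'v \<Rightarrow> 'k mat" where
  "contr_gauge g = restrict g (V - im)"

lemma contr_rep_simps:
  "Old h \<in> Ac \<Longrightarrow> contr_rep \<nu> x (Old h) = x h"
  "Comp h k \<in> Ac \<Longrightarrow> contr_rep \<nu> x (Comp h k) = x h * x k"
  "CompBar k h \<in> Ac \<Longrightarrow> contr_rep \<nu> x (CompBar k h) = inv\<^bsub>mat_alg (\<nu> ip)\<^esub> (x k) * x h"
  by (simp_all add: contr_rep_def)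

lemma bridge_mat:
  assumes "x \<in> Yh \<nu>" "\<nu> \<in> Dh" "k \<in> Br"
  shows "x k \<in> carrier_mat (\<nu> ip) (\<nu> ip)" "det (x k) \<noteq> 0"
    "inv\<^bsub>mat_alg (\<nu> ip)\<^esub> (x k) \<in> carrier_mat (\<nu> ip) (\<nu> ip)"
proof -
  show *: "x k \<in> carrier_mat (\<nu> ip) (\<nu> ip)" "det (x k) \<noteq> 0"
    using assms heart_iff repD(1)[of x \<nu> k] by (auto simp: dm_ends DhD)
  show "inv\<^bsub>mat_alg (\<nu> ip)\<^esub> (x k) \<in> carrier_mat (\<nu> ip) (\<nu> ip)" by (rule inv_mat_alg[OF *])
qed

lemma heart_E: "x \<in> Yh \<nu> \<Longrightarrow> x \<in> E \<nu>" using heart_iff by blast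

lemma contr_rep_in:
  assumes x: "x \<in> Yh \<nu>" and \<nu>: "\<nu> \<in> Dh"
  shows "contr_rep \<nu> x \<in> C.E (red \<nu>)"
proof -
  note xc = repD(1)[OF heart_E[OF x]] and b = bridge_mat[OF x \<nu>]
  have "contr_rep \<nu> x c \<in> carrier_mat (C.dm (red \<nu>) (head \<Gamma>c c)) (C.dm (red \<nu>) (tail \<Gamma>c c))" if c: "c \<in> Ac" for c
    using c
  proof (cases rule: Ac_cases)
    case (old h)
    then show ?thesis using xc[of h] c by (simp add: contr_rep_simps)
  next
    case (comp h k)
    have "C.dm (red \<nu>) (tail \<Gamma>c c) = \<nu> ip" "dm \<nu> (tail \<Gamma> h) = \<nu> ip"
      using comp \<nu> by (simp_all add: dm_ends dm_im DhD)
    then show ?thesis using xc[of h] b(1)[of k] comp c by (auto simp: contr_rep_simps)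
  next
    case (bar h k)
    have "C.dm (red \<nu>) (head \<Gamma>c c) = \<nu> ip" "dm \<nu> (head \<Gamma> h) = \<nu> ip"
      using bar \<nu> by (simp_all add: dm_ends dm_im DhD)
    then show ?thesis using xc[of h] b(3)[of k] bar c by (auto simp: contr_rep_simps)
  qed
  then show ?thesis by (auto simp: rep_space_def contr_rep_def)
qed

lemma contr_gauge_in: "g \<in> G \<nu> \<Longrightarrow> contr_gauge g \<in> C.G (red \<nu>)"
  unfolding C.gauge_iff by (auto simp: contr_gauge_def dest: gaugeD)

lemma contr_gauge_GF: "g \<in> GF \<nu> \<Longrightarrow> contr_gauge g \<in> C.GF (red \<nu>)"
proof -
  assume g: "g \<in> GF \<nu>"
  have "\<forall>v\<in>V. g (vaut \<Gamma> v) = fr (g v)" using frob_gauge_iff[OF GF_G[OF g]] g by (simp add: GF_iff)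
  then show ?thesis
    using C.frob_gauge_iff[OF contr_gauge_in[OF GF_G[OF g]]] contr_gauge_in[OF GF_G[OF g]]
    by (auto simp: C.GF_iff contr_gauge_def vaut_im_iff)
qed

lemma contr_gi:
  assumes "v \<in> V" "v \<notin> im"
  shows "C.gi (red \<nu>) (contr_gauge g) v = gi \<nu> g v"
  using assms by (simp add: gauge_inv_def contr_gauge_def)

text \<open>
  A change of basis at a vertex of \<open>im\<close> cancels between the two factors of a new arrow, by \<open>comp_conj\<close> and
  \<open>bar_conj\<close>; a change of basis at the other end of the bridge becomes one at the end of the new arrow.
\<close>

lemma contr_rep_act:
  assumes g: "g \<in> G \<nu>" and x: "x \<in> Yh \<nu>" and \<nu>: "\<nu> \<in> Dh"
  shows "contr_rep \<nu> (act \<nu> g x) = C.act (red \<nu>) (contr_gauge g) (contr_rep \<nu> x)"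
proof (rule extensionalityI[of _ Ac])
  let ?g = "contr_gauge g"
  fix c assume c: "c \<in> Ac"
  note xc = repD(1)[OF heart_E[OF x]] and b = bridge_mat[OF x \<nu>]
  have cg: "?g v = g v" if "v \<in> V" "v \<notin> im" for v using that by (simp add: contr_gauge_def)
  have kv: "tail \<Gamma> k \<in> V \<and> tail \<Gamma> k \<notin> im \<and> head \<Gamma> k \<in> V \<and> k \<in> A" if "k \<in> Br" for k
    using that by simp
  have gv: "g v \<in> carrier_mat (dm \<nu> v) (dm \<nu> v)" "det (g v) \<noteq> 0" "gi \<nu> g v \<in> carrier_mat (dm \<nu> v) (dm \<nu> v)"
    if "v \<in> V" for v using gaugeD(1,2)[OF g that] gi_at(1)[OF g that] by auto
  have gk: "g (tail \<Gamma> k) \<in> carrier_mat (\<nu> ip) (\<nu> ip)" "g (head \<Gamma> k) \<in> carrier_mat (\<nu> ip) (\<nu> ip)"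
    "gi \<nu> g (tail \<Gamma> k) \<in> carrier_mat (\<nu> ip) (\<nu> ip)" "gi \<nu> g (head \<Gamma> k) \<in> carrier_mat (\<nu> ip) (\<nu> ip)"
    if "k \<in> Br" for k
    using gv(1,3)[of "tail \<Gamma> k"] gv(1,3)[of "head \<Gamma> k"] kv[OF that] that \<nu> by (auto simp: dm_ends DhD)
  show "contr_rep \<nu> (act \<nu> g x) c = C.act (red \<nu>) ?g (contr_rep \<nu> x) c"
    using c
  proof (cases rule: Ac_cases)
    case (old h)
    then show ?thesis using c by (simp add: gauge_act_def contr_rep_simps cg contr_gi)
  next
    case (comp h k)
    note k = kv[OF comp(4)] gk[OF comp(4)]
    have xh: "x h \<in> carrier_mat (dm \<nu> (head \<Gamma> h)) (\<nu> ip)" using xc[of h] comp \<nu> by (simp add: dm_im DhD)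
    have "gi \<nu> g (head \<Gamma> k) = inv\<^bsub>mat_alg (\<nu> ip)\<^esub> (g (head \<Gamma> k))"
      using k comp(4) \<nu> by (simp add: gauge_inv_def dm_ends DhD)
    moreover have "contr_rep \<nu> (act \<nu> g x) c =
        (g (head \<Gamma> h) * x h * gi \<nu> g (head \<Gamma> k)) * (g (head \<Gamma> k) * x k * gi \<nu> g (tail \<Gamma> k))"
      using comp c k by (simp add: gauge_act_def contr_rep_simps)
    moreover have "C.act (red \<nu>) ?g (contr_rep \<nu> x) c = g (head \<Gamma> h) * (x h * x k) * gi \<nu> g (tail \<Gamma> k)"
      using comp c k by (simp add: gauge_act_def contr_rep_simps cg contr_gi)
    ultimately show ?thesis
      using comp_conj[OF gv(1)[of "head \<Gamma> h"] xh k(3) gv(2)[of "head \<Gamma> k"] b(1)[OF comp(4)] k(4)] comp(2) k by simp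
  next
    case (bar h k)
    note k = kv[OF bar(4)] gk[OF bar(4)]
    have xh: "x h \<in> carrier_mat (\<nu> ip) (dm \<nu> (tail \<Gamma> h))" using xc[of h] bar \<nu> by (simp add: dm_im DhD)
    have "gi \<nu> g (tail \<Gamma> k) = inv\<^bsub>mat_alg (\<nu> ip)\<^esub> (g (tail \<Gamma> k))"
      using k bar(4) \<nu> by (simp add: gauge_inv_def dm_ends DhD)
    moreover have "contr_rep \<nu> (act \<nu> g x) c = inv\<^bsub>mat_alg (\<nu> ip)\<^esub> (g (head \<Gamma> k) * x k * gi \<nu> g (tail \<Gamma> k)) *
        (g (head \<Gamma> k) * x h * gi \<nu> g (tail \<Gamma> h))"
      using bar c k by (simp add: gauge_act_def contr_rep_simps)
    moreover have "C.act (red \<nu>) ?g (contr_rep \<nu> x) c =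
        g (tail \<Gamma> k) * (inv\<^bsub>mat_alg (\<nu> ip)\<^esub> (x k) * x h) * gi \<nu> g (tail \<Gamma> h)"
      using bar c k by (simp add: gauge_act_def contr_rep_simps cg contr_gi)
    ultimately show ?thesis
      using bar_conj[OF k(3) gv(2)[of "head \<Gamma> k"] b(1,2)[OF bar(4)] k(2) gv(2)[of "tail \<Gamma> k"] xh gv(3)[of "tail \<Gamma> h"]]
        bar(2) k by simp
  qed
qed (auto simp: contr_rep_def gauge_act_def)

lemma hF_iff: "x \<in> hF \<nu> \<longleftrightarrow> x \<in> Yh \<nu> \<and> (\<forall>h\<in>A. x (aaut \<Gamma> h) = fr (x h))"
  using frob_rep_iff[OF heart_E] by (auto simp: fixed_pts_def)

lemma hF_heart: "x \<in> hF \<nu> \<Longrightarrow> x \<in> Yh \<nu>" by (simp add: fixed_pts_def)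

lemma contr_rep_EF:
  assumes x: "x \<in> hF \<nu>" and \<nu>: "\<nu> \<in> Dh"
  shows "contr_rep \<nu> x \<in> C.EF (red \<nu>)"
proof -
  note xh = hF_heart[OF x] and b = bridge_mat[OF hF_heart[OF x] \<nu>]
  note xc = repD(1)[OF heart_E[OF xh]]
  have xf: "x (aaut \<Gamma> h) = fr (x h)" if "h \<in> A" for h using x that hF_iff by blast
  have "contr_rep \<nu> x (map_contr_arc (aaut \<Gamma>) c) = fr (contr_rep \<nu> x c)" if c: "c \<in> Ac" for c
    using c
  proof (cases rule: Ac_cases)
    case (old h)
    then show ?thesis using c aaut_Ac[OF c] xf by (simp add: contr_rep_simps)
  next
    case (comp h k)
    have "x h \<in> carrier_mat (dm \<nu> (head \<Gamma> h)) (\<nu> ip)" using xc[of h] comp \<nu> by (simp add: dm_im DhD)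
    then show ?thesis using comp c aaut_Ac[OF c] xf fr_mult[OF _ b(1)[OF comp(4)]] by (simp add: contr_rep_simps)
  next
    case (bar h k)
    have "x h \<in> carrier_mat (\<nu> ip) (dm \<nu> (tail \<Gamma> h))" using xc[of h] bar \<nu> by (simp add: dm_im DhD)
    then show ?thesis using bar c aaut_Ac[OF c] xf fr_mult[OF b(3)[OF bar(4)]] fr_inv[OF b(1,2)[OF bar(4)]]
      by (simp add: contr_rep_simps)
  qed
  then show ?thesis using contr_rep_in[OF xh \<nu>] C.frob_rep_iff[OF contr_rep_in[OF xh \<nu>]]
    by (simp add: C.EF_iff)
qed

lemma contr_cases:
  assumes "h \<in> A" "h \<notin> Br"
  obtains (old) "contr h = Old h" "tail \<Gamma> h \<notin> im" "head \<Gamma> h \<notin> im"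
  | (comp) k where "contr h = Comp h k" "k \<in> Br" "tail \<Gamma> h = head \<Gamma> k"
      "tail \<Gamma> h \<in> im" "head \<Gamma> h \<notin> im" "head \<Gamma> h \<notin> ip"
  | (bar) k where "contr h = CompBar k h" "k \<in> Br" "head \<Gamma> h = head \<Gamma> k"
      "head \<Gamma> h \<in> im" "tail \<Gamma> h \<notin> im" "tail \<Gamma> h \<notin> ip"
proof (cases "tail \<Gamma> h \<in> im")
  case True
  have n: "head \<Gamma> h \<notin> im" "head \<Gamma> h \<notin> ip" using tail_in_im[OF assms(1) True] by blast+
  have c: "contr h = Comp h (bridge_to (tail \<Gamma> h))" using True by (simp add: contr_def)
  show ?thesis by (rule comp[OF c bridge_to(1)[OF True] bridge_to(2)[OF True, symmetric] True n])
next
  case F: False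
  show ?thesis
  proof (cases "head \<Gamma> h \<in> im")
    case True
    have n: "tail \<Gamma> h \<notin> im" "tail \<Gamma> h \<notin> ip" using head_in_im[OF assms(1) True assms(2)] by blast+
    have c: "contr h = CompBar (bridge_to (head \<Gamma> h)) h" using True F by (simp add: contr_def)
    show ?thesis by (rule bar[OF c bridge_to(1)[OF True] bridge_to(2)[OF True, symmetric] True n])
  next
    case False
    then show ?thesis using old F by (simp add: contr_def)
  qed
qed

lemma contr_dims:
  assumes \<nu>: "\<nu> \<in> Dh" and h: "h \<in> A" "h \<notin> Br"
  shows "C.dm (red \<nu>) (tail \<Gamma>c (contr h)) = dm \<nu> (tail \<Gamma> h)" "C.dm (red \<nu>) (head \<Gamma>c (contr h)) = dm \<nu> (head \<Gamma> h)"
proof (atomize(full), use h in \<open>cases rule: contr_cases\<close>)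
  case old
  then show "C.dm (red \<nu>) (tail \<Gamma>c (contr h)) = dm \<nu> (tail \<Gamma> h) \<and> C.dm (red \<nu>) (head \<Gamma>c (contr h)) = dm \<nu> (head \<Gamma> h)"
    using h by simp
next
  case (comp k)
  then show "C.dm (red \<nu>) (tail \<Gamma>c (contr h)) = dm \<nu> (tail \<Gamma> h) \<and> C.dm (red \<nu>) (head \<Gamma>c (contr h)) = dm \<nu> (head \<Gamma> h)"
    using h \<nu> by (simp add: dm_ends DhD)
next
  case (bar k)
  then show "C.dm (red \<nu>) (tail \<Gamma>c (contr h)) = dm \<nu> (tail \<Gamma> h) \<and> C.dm (red \<nu>) (head \<Gamma>c (contr h)) = dm \<nu> (head \<Gamma> h)"
    using h \<nu> by (simp add: dm_ends DhD)
qed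

text \<open>
  The vertices of \<open>im\<close> and the bridges contribute the same amount each. A remaining arrow has ends of the same
  dimensions as its contraction.
\<close>

lemma m_form_contraction:
  assumes \<tau>: "\<tau> \<in> Dh" and \<omega>: "\<omega> \<in> Dh"
  shows "m_form \<Gamma> \<tau> \<omega> = m_form \<Gamma>c (red \<tau>) (red \<omega>) + 2 * (card ip * (\<tau> ip * \<omega> ip))"
proof -
  have "(\<Sum>v\<in>V. dm \<tau> v * dm \<omega> v) = (\<Sum>v\<in>V - im. dm \<tau> v * dm \<omega> v) + (\<Sum>v\<in>im. dm \<tau> v * dm \<omega> v)"
    by (rule sum.subset_diff[OF im_V fin_V])
  moreover have "(\<Sum>v\<in>im. dm \<tau> v * dm \<omega> v) = card ip * (\<tau> ip * \<omega> ip)"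
    using \<tau> \<omega> by (simp add: dm_im DhD card_ip_im)
  moreover have "(\<Sum>v\<in>V - im. dm \<tau> v * dm \<omega> v) = (\<Sum>v\<in>V - im. C.dm (red \<tau>) v * C.dm (red \<omega>) v)"
    by (rule sum.cong) auto
  moreover have "(\<Sum>h\<in>A. dm \<tau> (tail \<Gamma> h) * dm \<omega> (head \<Gamma> h)) =
      (\<Sum>h\<in>A - Br. dm \<tau> (tail \<Gamma> h) * dm \<omega> (head \<Gamma> h)) + (\<Sum>h\<in>Br. dm \<tau> (tail \<Gamma> h) * dm \<omega> (head \<Gamma> h))"
    by (rule sum.subset_diff[OF _ fin_A]) (use BrD(1) in blast)
  moreover have "(\<Sum>h\<in>Br. dm \<tau> (tail \<Gamma> h) * dm \<omega> (head \<Gamma> h)) = card ip * (\<tau> ip * \<omega> ip)"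
    using \<omega> by (simp add: dm_ends DhD card_Br card_ip_im)
  moreover have "(\<Sum>h\<in>A - Br. dm \<tau> (tail \<Gamma> h) * dm \<omega> (head \<Gamma> h)) =
      (\<Sum>c\<in>Ac. C.dm (red \<tau>) (tail \<Gamma>c c) * C.dm (red \<omega>) (head \<Gamma>c c))"
    unfolding sum.reindex_bij_betw[OF contr_bij, symmetric] by (rule sum.cong) (simp_all add: contr_dims \<tau> \<omega>)
  ultimately show ?thesis unfolding m_form_def contr_simps(1) by linarith
qed

subsection \<open>The gauge group of the contraction\<close>

text \<open>
  The Frobenius-fixed points of the general linear groups at the vertices of \<open>im\<close>.
\<close>

definition GLim :: "nat \<Rightarrow> ('v \<Rightarrow> 'k mat) set" where
  "GLim n = {M \<in> mfam im (vaut \<Gamma>) (\<lambda>w. n) (\<lambda>w. n). \<forall>w\<in>im. det (M w) \<noteq> 0}"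

lemma GLim_iff: "M \<in> GLim n \<longleftrightarrow> M \<in> extensional im \<and>
    (\<forall>w\<in>im. M w \<in> carrier_mat n n \<and> det (M w) \<noteq> 0 \<and> M (vaut \<Gamma> w) = fr (M w))"
  by (auto simp: GLim_def mfam_def PiE_iff)

lemma GLimD:
  assumes "M \<in> GLim n" "w \<in> im"
  shows "M w \<in> carrier_mat n n" "det (M w) \<noteq> 0" "M (vaut \<Gamma> w) = fr (M w)"
  using assms GLim_iff by auto

lemma finite_GLim: "finite (GLim n)"
proof -
  have "bij_betw (vaut \<Gamma>) im im"
  proof -
    have "inj_on (vaut \<Gamma>) im" by (rule inj_on_subset[OF bij_betw_imp_inj_on[OF vaut_bij] im_V])
    then show ?thesis using endo_inj_surj[OF fin_im, of "vaut \<Gamma>"] vaut_im by (simp add: bij_betw_def image_subset_iff)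
  qed
  from finite_mfam[OF fin_im this] show ?thesis unfolding GLim_def by simp
qed

lemma GLim_mult:
  assumes M: "M \<in> GLim n" and c: "c \<in> GLim n"
  shows "(\<lambda>w\<in>im. M w * c w) \<in> GLim n" "(\<lambda>w\<in>im. inv\<^bsub>mat_alg n\<^esub> (c w)) \<in> GLim n"
proof -
  have "M w * c w \<in> carrier_mat n n \<and> det (M w * c w) \<noteq> 0 \<and> M (vaut \<Gamma> w) * c (vaut \<Gamma> w) = fr (M w * c w)"
    if w: "w \<in> im" for w
    using det_mult[OF GLimD(1)[OF M w] GLimD(1)[OF c w]] GLimD[OF M w] GLimD[OF c w]
      fr_mult[OF GLimD(1)[OF M w] GLimD(1)[OF c w]] by simp
  then show "(\<lambda>w\<in>im. M w * c w) \<in> GLim n" unfolding GLim_iff by (simp add: vaut_im)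
  have "inv\<^bsub>mat_alg n\<^esub> (c w) \<in> carrier_mat n n \<and> det (inv\<^bsub>mat_alg n\<^esub> (c w)) \<noteq> 0 \<and>
      inv\<^bsub>mat_alg n\<^esub> (c (vaut \<Gamma> w)) = fr (inv\<^bsub>mat_alg n\<^esub> (c w))" if w: "w \<in> im" for w
    using inv_mat_alg[OF GLimD(1,2)[OF c w]] fr_inv[OF GLimD(1,2)[OF c w]] GLimD(3)[OF c w] by simp
  then show "(\<lambda>w\<in>im. inv\<^bsub>mat_alg n\<^esub> (c w)) \<in> GLim n" unfolding GLim_iff by (simp add: vaut_im)
qed

lemma GLim_translate:
  assumes c: "c \<in> GLim n"
  shows "bij_betw (\<lambda>M. \<lambda>w\<in>im. M w * c w) (GLim n) (GLim n)"
proof (rule bij_betw_byWitness[where f' = "\<lambda>M. \<lambda>w\<in>im. M w * inv\<^bsub>mat_alg n\<^esub> (c w)"])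
  let ?c = "\<lambda>w\<in>im. inv\<^bsub>mat_alg n\<^esub> (c w)"
  note cc = GLimD(1,2)[OF c]
  show "\<forall>M\<in>GLim n. (\<lambda>w\<in>im. (\<lambda>w\<in>im. M w * c w) w * inv\<^bsub>mat_alg n\<^esub> (c w)) = M"
  proof (intro ballI extensionalityI[of _ im])
    fix M w assume M: "M \<in> GLim n" and w: "w \<in> im"
    show "(\<lambda>w\<in>im. (\<lambda>w\<in>im. M w * c w) w * inv\<^bsub>mat_alg n\<^esub> (c w)) w = M w"
      using mat_cancel_right(1)[OF cc(1)[OF w] cc(2)[OF w] GLimD(1)[OF M w]] w by simp
  qed (simp_all add: GLim_iff)
  show "\<forall>M\<in>GLim n. (\<lambda>w\<in>im. (\<lambda>w\<in>im. M w * inv\<^bsub>mat_alg n\<^esub> (c w)) w * c w) = M"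
  proof (intro ballI extensionalityI[of _ im])
    fix M w assume M: "M \<in> GLim n" and w: "w \<in> im"
    show "(\<lambda>w\<in>im. (\<lambda>w\<in>im. M w * inv\<^bsub>mat_alg n\<^esub> (c w)) w * c w) w = M w"
      using mat_cancel_right(2)[OF cc(1)[OF w] cc(2)[OF w] GLimD(1)[OF M w]] w by simp
  qed (simp_all add: GLim_iff)
  show "(\<lambda>M. \<lambda>w\<in>im. M w * c w) ` GLim n \<subseteq> GLim n" using GLim_mult(1)[OF _ c] by blast
  have "(\<lambda>w\<in>im. M w * inv\<^bsub>mat_alg n\<^esub> (c w)) = (\<lambda>w\<in>im. M w * ?c w)" for M :: "'v \<Rightarrow> 'k mat" by auto
  then show "(\<lambda>M. \<lambda>w\<in>im. M w * inv\<^bsub>mat_alg n\<^esub> (c w)) ` GLim n \<subseteq> GLim n"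
    using GLim_mult(1)[OF _ GLim_mult(2)[OF c c]] by auto
qed

text \<open>
  A point of the gauge group of the graph consists of one for the contraction and one of \<open>GLim\<close>.
\<close>

definition glue :: "('v \<Rightarrow> 'k mat) \<Rightarrow> ('v \<Rightarrow> 'k mat) \<Rightarrow> 'v \<Rightarrow> 'k mat" where
  "glue g M = (\<lambda>v\<in>V. if v \<in> im then M v else g v)"

lemma glue_simps [simp]:
  "w \<in> im \<Longrightarrow> glue g M w = M w" "v \<in> V \<Longrightarrow> v \<notin> im \<Longrightarrow> glue g M v = g v"
  using im_V by (auto simp: glue_def)

lemma GF_iff_at: "g \<in> GF \<nu> \<longleftrightarrow> g \<in> extensional V \<and>
    (\<forall>v\<in>V. g v \<in> carrier_mat (dm \<nu> v) (dm \<nu> v) \<and> det (g v) \<noteq> 0 \<and> g (vaut \<Gamma> v) = fr (g v))"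
  unfolding GF_iff_mfam by (auto simp: mfam_def PiE_iff)

lemma CGF_iff_at: "g \<in> C.GF (red \<nu>) \<longleftrightarrow> g \<in> extensional (V - im) \<and>
    (\<forall>v\<in>V - im. g v \<in> carrier_mat (dm \<nu> v) (dm \<nu> v) \<and> det (g v) \<noteq> 0 \<and> g (vaut \<Gamma> v) = fr (g v))"
  unfolding C.GF_iff_mfam by (auto simp: mfam_def PiE_iff)

lemma GFD:
  assumes "g \<in> GF \<nu>" "v \<in> V"
  shows "g v \<in> carrier_mat (dm \<nu> v) (dm \<nu> v)" "det (g v) \<noteq> 0" "g (vaut \<Gamma> v) = fr (g v)"
  using assms unfolding GF_iff_at by blast+

lemma CGFD:
  assumes "g \<in> C.GF (red \<nu>)" "v \<in> V" "v \<notin> im"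
  shows "g v \<in> carrier_mat (dm \<nu> v) (dm \<nu> v)" "det (g v) \<noteq> 0" "g (vaut \<Gamma> v) = fr (g v)"
  using assms unfolding CGF_iff_at by blast+

lemma glue_GF:
  assumes \<nu>: "\<nu> \<in> Dh" and g: "g \<in> C.GF (red \<nu>)" and M: "M \<in> GLim (\<nu> ip)"
  shows "glue g M \<in> GF \<nu>"
proof -
  have "glue g M v \<in> carrier_mat (dm \<nu> v) (dm \<nu> v) \<and> det (glue g M v) \<noteq> 0 \<and> glue g M (vaut \<Gamma> v) = fr (glue g M v)"
    if v: "v \<in> V" for v
  proof (cases "v \<in> im")
    case True
    then show ?thesis using GLimD[OF M True] vaut_im[OF True] \<nu> by (simp add: dm_im DhD)
  next
    case False
    then show ?thesis using g v vaut_im_iff[OF v] unfolding CGF_iff_at by simp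
  qed
  then show ?thesis unfolding GF_iff_at by (simp add: glue_def)
qed

lemma contr_gauge_glue: "g \<in> C.GF (red \<nu>) \<Longrightarrow> contr_gauge (glue g M) = g"
  unfolding CGF_iff_at by (auto simp: contr_gauge_def intro!: extensionalityI[of _ "V - im"])

lemma restrict_GLim:
  assumes \<nu>: "\<nu> \<in> Dh" and g: "g \<in> GF \<nu>"
  shows "restrict g im \<in> GLim (\<nu> ip)"
proof -
  have "g w \<in> carrier_mat (\<nu> ip) (\<nu> ip) \<and> det (g w) \<noteq> 0 \<and> g (vaut \<Gamma> w) = fr (g w)" if w: "w \<in> im" for w
    using GFD[OF g, of w] w im_V \<nu> by (auto simp: dm_im DhD)
  then show ?thesis unfolding GLim_iff by (simp add: vaut_im)
qed

lemma glue_bij: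
  assumes \<nu>: "\<nu> \<in> Dh"
  shows "bij_betw (\<lambda>(g, M). glue g M) (C.GF (red \<nu>) \<times> GLim (\<nu> ip)) (GF \<nu>)"
proof (rule bij_betw_byWitness[where f' = "\<lambda>g. (contr_gauge g, restrict g im)"])
  show "\<forall>t\<in>C.GF (red \<nu>) \<times> GLim (\<nu> ip). (\<lambda>g. (contr_gauge g, restrict g im)) (case t of (g, M) \<Rightarrow> glue g M) = t"
  proof
    fix t assume "t \<in> C.GF (red \<nu>) \<times> GLim (\<nu> ip)"
    then obtain g M where t: "t = (g, M)" "g \<in> C.GF (red \<nu>)" "M \<in> GLim (\<nu> ip)" by (metis mem_Sigma_iff surj_pair)
    have "restrict (glue g M) im = M" using t(3) by (auto simp: GLim_iff intro!: extensionalityI[of _ im])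
    then show "(\<lambda>g. (contr_gauge g, restrict g im)) (case t of (g, M) \<Rightarrow> glue g M) = t"
      using t contr_gauge_glue by simp
  qed
  show "\<forall>g\<in>GF \<nu>. (case (contr_gauge g, restrict g im) of (g, M) \<Rightarrow> glue g M) = g"
    by (auto simp: GF_iff_at glue_def contr_gauge_def intro!: extensionalityI[of _ V])
  show "(\<lambda>(g, M). glue g M) ` (C.GF (red \<nu>) \<times> GLim (\<nu> ip)) \<subseteq> GF \<nu>" using glue_GF[OF \<nu>] by auto
  show "(\<lambda>g. (contr_gauge g, restrict g im)) ` GF \<nu> \<subseteq> C.GF (red \<nu>) \<times> GLim (\<nu> ip)"
    using contr_gauge_GF restrict_GLim[OF \<nu>] by auto
qed

subsection \<open>The fibres of the contraction\<close>

definition bridge_fam :: "('h \<Rightarrow> 'k mat) \<Rightarrow> 'v \<Rightarrow> 'k mat" where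
  "bridge_fam x = (\<lambda>w\<in>im. x (bridge_to w))"

lemma bridge_fam_in: "\<nu> \<in> Dh \<Longrightarrow> x \<in> hF \<nu> \<Longrightarrow> bridge_fam x \<in> GLim (\<nu> ip)"
  using bridge_mat[of x \<nu>] hF_heart[of x \<nu>] bridge_to vaut_im bridge_to_vaut
  unfolding GLim_iff bridge_fam_def by (auto simp: hF_iff)

text \<open>
  The bridge \<open>y\<close> with head \<open>w\<close> becomes \<open>M w * y * g\<inverse>\<close>, with \<open>g\<close> taken at its tail: for fixed \<open>g\<close> this is a
  right translation of \<open>M\<close>.
\<close>

lemma bridge_fam_act:
  assumes \<nu>: "\<nu> \<in> Dh" and g: "g \<in> C.GF (red \<nu>)" and x: "x \<in> hF \<nu>"
  shows "\<exists>c\<in>GLim (\<nu> ip). \<forall>M\<in>GLim (\<nu> ip). bridge_fam (act \<nu> (glue g M) x) = (\<lambda>w\<in>im. M w * c w)"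
proof -
  let ?n = "\<nu> ip"
  let ?t = "\<lambda>w. tail \<Gamma> (bridge_to w)"
  let ?c = "\<lambda>w\<in>im. x (bridge_to w) * inv\<^bsub>mat_alg ?n\<^esub> (g (?t w))"
  have gt: "g (?t w) \<in> carrier_mat ?n ?n" "det (g (?t w)) \<noteq> 0" "g (vaut \<Gamma> (?t w)) = fr (g (?t w))"
    if "w \<in> im" for w
    using CGFD[OF g, of "?t w"] bridge_to(1)[OF that] by (simp_all add: dm_ends)
  have "(\<lambda>w\<in>im. g (?t w)) \<in> GLim ?n"
    unfolding GLim_iff using gt vaut_im bridge_to_vaut bridge_to(1) by auto
  from GLim_mult(1)[OF bridge_fam_in[OF \<nu> x] GLim_mult(2)[OF this this]]
  have "?c \<in> GLim ?n" by (simp add: bridge_fam_def cong: restrict_cong)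
  moreover have "bridge_fam (act \<nu> (glue g M) x) = (\<lambda>w\<in>im. M w * ?c w)" if M: "M \<in> GLim ?n" for M
  proof -
    have "act \<nu> (glue g M) x (bridge_to w) = M w * (x (bridge_to w) * inv\<^bsub>mat_alg ?n\<^esub> (g (?t w)))" if w: "w \<in> im" for w
    proof -
      note k = bridge_to[OF w]
      have "act \<nu> (glue g M) x (bridge_to w) = M w * x (bridge_to w) * inv\<^bsub>mat_alg ?n\<^esub> (g (?t w))"
        using k w by (simp add: gauge_act_def gauge_inv_def dm_ends)
      then show ?thesis
        using assoc_mult_mat[OF GLimD(1)[OF M w] bridge_mat(1)[OF hF_heart[OF x] \<nu> k(1)] inv_mat_alg(1)[OF gt(1,2)[OF w]]] by simp
    qed
    then show ?thesis by (auto simp: bridge_fam_def)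
  qed
  ultimately show ?thesis by blast
qed

text \<open>The bridges are invertible, so they can be cancelled from the new arrows.\<close>

lemma contr_rep_inj:
  assumes \<nu>: "\<nu> \<in> Dh" and x: "x \<in> Yh \<nu>" "x' \<in> Yh \<nu>"
    and eq: "contr_rep \<nu> x = contr_rep \<nu> x'" "bridge_fam x = bridge_fam x'"
  shows "x = x'"
proof (rule extensionalityI[OF repD(2)[OF heart_E[OF x(1)]] repD(2)[OF heart_E[OF x(2)]]])
  fix h assume h: "h \<in> A"
  have b: "x k = x' k" if k: "k \<in> Br" for k
    using fun_cong[OF eq(2), of "head \<Gamma> k"] k by (simp add: bridge_fam_def bridge_to_head)
  note xc = repD(1)[OF heart_E[OF x(1)] h] repD(1)[OF heart_E[OF x(2)] h]
  show "x h = x' h"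
  proof (cases "h \<in> Br")
    case False
    note e = fun_cong[OF eq(1), of "contr h"] and c = contr_in[OF h False]
    show ?thesis using h False
    proof (cases rule: contr_cases)
      case old
      then show ?thesis using e c by (simp add: contr_rep_simps)
    next
      case (comp k)
      note bk = bridge_mat(1,2)[OF x(1) \<nu> comp(2)]
      have "x h * x k = x' h * x k" using e c comp b by (simp add: contr_rep_simps)
      moreover have "x h * x k * inv\<^bsub>mat_alg (\<nu> ip)\<^esub> (x k) = x h" "x' h * x k * inv\<^bsub>mat_alg (\<nu> ip)\<^esub> (x k) = x' h"
        by (rule mat_cancel_right(1)[OF bk], use xc comp \<nu> in \<open>simp add: dm_im DhD\<close>)+
      ultimately show ?thesis by metis
    next
      case (bar k)
      note bk = bridge_mat[OF x(1) \<nu> bar(2)]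
      have "inv\<^bsub>mat_alg (\<nu> ip)\<^esub> (x k) * x h = inv\<^bsub>mat_alg (\<nu> ip)\<^esub> (x k) * x' h" using e c bar b by (simp add: contr_rep_simps)
      moreover have "x k * (inv\<^bsub>mat_alg (\<nu> ip)\<^esub> (x k) * x h) = x h" "x k * (inv\<^bsub>mat_alg (\<nu> ip)\<^esub> (x k) * x' h) = x' h"
        by (rule mat_cancel(2)[OF bk(1,2)], use xc bar \<nu> in \<open>simp add: dm_im DhD\<close>)+
      ultimately show ?thesis by metis
    qed
  qed (rule b)
qed

text \<open>
  The general linear groups at the vertices of \<open>im\<close> act simply transitively on the invertible bridges. So the
  element of the gauge group of the contraction can be lifted in such a way that the bridges come out right too.
\<close>

lemma conj_lift:
  assumes \<nu>: "\<nu> \<in> Dh" and x: "x \<in> hF \<nu>" "x' \<in> hF \<nu>" and g: "g \<in> C.GF (red \<nu>)"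
    and eq: "contr_rep \<nu> x' = C.act (red \<nu>) g (contr_rep \<nu> x)"
  shows "\<exists>k\<in>GF \<nu>. x' = act \<nu> k x"
proof -
  obtain c where c: "c \<in> GLim (\<nu> ip)"
    "\<forall>M\<in>GLim (\<nu> ip). bridge_fam (act \<nu> (glue g M) x) = (\<lambda>w\<in>im. M w * c w)"
    using bridge_fam_act[OF \<nu> g x(1)] by blast
  have "bridge_fam x' \<in> (\<lambda>M. \<lambda>w\<in>im. M w * c w) ` GLim (\<nu> ip)"
    using bij_betw_imp_surj_on[OF GLim_translate[OF c(1)]] bridge_fam_in[OF \<nu> x(2)] by simp
  then obtain M where M: "M \<in> GLim (\<nu> ip)" "bridge_fam x' = (\<lambda>w\<in>im. M w * c w)" by blast
  let ?k = "glue g M"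
  have k: "?k \<in> GF \<nu>" by (rule glue_GF[OF \<nu> g M(1)])
  have "act \<nu> ?k x = x'"
  proof (rule contr_rep_inj[OF \<nu>])
    show "act \<nu> ?k x \<in> Yh \<nu>" using heart.YF_act[OF k x(1)] hF_heart by blast
    show "contr_rep \<nu> (act \<nu> ?k x) = contr_rep \<nu> x'"
      using contr_rep_act[OF GF_G[OF k] hF_heart[OF x(1)] \<nu>] contr_gauge_glue[OF g] eq by simp
    show "bridge_fam (act \<nu> ?k x) = bridge_fam x'" using c(2) M by simp
  qed (rule hF_heart[OF x(2)])
  then show ?thesis using k by blast
qed

text \<open>The representative of a fibre of the contraction whose bridges are all identities.\<close>

definition sect :: "('v set \<Rightarrow> nat) \<Rightarrow> ('h contr_arc \<Rightarrow> 'k mat) \<Rightarrow> 'h \<Rightarrow> 'k mat" where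
  "sect \<nu> x = (\<lambda>h\<in>A. if h \<in> Br then 1\<^sub>m (\<nu> ip) else x (contr h))"

lemma sect_hF:
  assumes \<nu>: "\<nu> \<in> Dh" and x: "x \<in> C.EF (red \<nu>)"
  shows "sect \<nu> x \<in> hF \<nu>"
proof -
  note xE = C.EF_E[OF x]
  have c: "sect \<nu> x h \<in> carrier_mat (dm \<nu> (head \<Gamma> h)) (dm \<nu> (tail \<Gamma> h))" if h: "h \<in> A" for h
  proof (cases "h \<in> Br")
    case True
    then show ?thesis using \<nu> by (simp add: sect_def dm_ends DhD)
  next
    case False
    then show ?thesis using C.repD(1)[OF xE contr_in[OF h False]] h \<nu> by (simp add: sect_def contr_dims)
  qed
  then have "sect \<nu> x \<in> E \<nu>" by (auto simp: rep_space_def sect_def)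
  then have h: "sect \<nu> x \<in> Yh \<nu>" using \<nu> by (simp add: heart_iff sect_def DhD)
  have xf: "x (map_contr_arc (aaut \<Gamma>) k) = fr (x k)" if "k \<in> Ac" for k
    using C.frob_rep_iff[OF xE] x that by (simp add: C.EF_iff)
  have "sect \<nu> x (aaut \<Gamma> h) = fr (sect \<nu> x h)" if h: "h \<in> A" for h
    using h aaut_Br_iff[OF h] contr_aaut[OF h] xf[OF contr_in[OF h]] q_gt_1
    by (auto simp: sect_def intro!: eq_matI)
  then show ?thesis using h hF_iff by blast
qed

lemma contr_rep_sect:
  assumes \<nu>: "\<nu> \<in> Dh" and x: "x \<in> C.EF (red \<nu>)"
  shows "contr_rep \<nu> (sect \<nu> x) = x"
proof (rule extensionalityI[OF _ C.repD(2)[OF C.EF_E[OF x]]])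
  fix c assume c: "c \<in> Ac"
  note xc = C.repD(1)[OF C.EF_E[OF x] c]
  show "contr_rep \<nu> (sect \<nu> x) c = x c" using c
  proof (cases rule: Ac_cases)
    case (old h)
    then show ?thesis using c by (simp add: contr_rep_simps sect_def)
  next
    case (comp h k)
    have "C.dm (red \<nu>) (tail \<Gamma>c c) = \<nu> ip" using comp by (simp add: dm_ends)
    then show ?thesis using c comp xc right_mult_one_mat[of "x c" _ "\<nu> ip"] by (simp add: contr_rep_simps sect_def)
  next
    case (bar h k)
    have "C.dm (red \<nu>) (head \<Gamma>c c) = \<nu> ip" using bar by (simp add: dm_ends)
    then show ?thesis using c bar xc left_mult_one_mat[of "x c" "\<nu> ip"] by (simp add: contr_rep_simps sect_def)
  qed
qed (simp add: contr_rep_def)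

subsection \<open>Stable representations of the contraction\<close>

text \<open>Forming blocks commutes with products and inverses of block triangular matrices.\<close>

lemma contr_blocks_arrow:
  assumes x: "x \<in> Yh (dplus \<tau> \<omega>)" and \<tau>: "\<tau> \<in> Dh" and \<omega>: "\<omega> \<in> Dh"
    and b: "\<And>k. k \<in> Br \<Longrightarrow> blk_lower (\<tau> ip) (\<tau> ip) (x k)" and h: "h \<in> A" "h \<notin> Br"
  shows "blk_lower (dm \<tau> (head \<Gamma> h)) (dm \<tau> (tail \<Gamma> h)) (contr_rep (dplus \<tau> \<omega>) x (contr h)) \<longleftrightarrow>
      blk_lower (dm \<tau> (head \<Gamma> h)) (dm \<tau> (tail \<Gamma> h)) (x h)" (is "?l1 \<longleftrightarrow> ?l")
    and "blk_lower (dm \<tau> (head \<Gamma> h)) (dm \<tau> (tail \<Gamma> h)) (x h) \<Longrightarrow>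
      contr_rep \<tau> (iT \<tau> x) (contr h) =
        blk_T (dm \<tau> (head \<Gamma> h)) (dm \<tau> (tail \<Gamma> h)) (contr_rep (dplus \<tau> \<omega>) x (contr h)) \<and>
      contr_rep \<omega> (iW \<tau> \<omega> x) (contr h) =
        blk_W (dm \<tau> (head \<Gamma> h)) (dm \<tau> (tail \<Gamma> h)) (dm \<omega> (head \<Gamma> h)) (dm \<omega> (tail \<Gamma> h))
          (contr_rep (dplus \<tau> \<omega>) x (contr h))" (is "?l \<Longrightarrow> ?r")
proof -
  note N = Dh_dplus[OF \<tau> \<omega>]
  have n: "dplus \<tau> \<omega> ip = \<tau> ip + \<omega> ip" by (simp add: dplus_def)
  have xh: "x h \<in> carrier_mat (dm \<tau> (head \<Gamma> h) + dm \<omega> (head \<Gamma> h)) (dm \<tau> (tail \<Gamma> h) + dm \<omega> (tail \<Gamma> h))"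
    using repD(1)[OF heart_E[OF x] h(1)] by simp
  note c = contr_in[OF h]
  note bm = bridge_mat(1,2)[OF x N, unfolded n]
  have "(?l1 \<longleftrightarrow> ?l) \<and> (?l \<longrightarrow> ?r)" using h
  proof (cases rule: contr_cases)
    case old
    then show ?thesis using c h by (simp add: contr_rep_simps iT_eq iW_eq)
  next
    case (comp k)
    note k = bm[OF comp(2)] b[OF comp(2)]
    have t: "dm \<tau> (tail \<Gamma> h) = \<tau> ip" "dm \<omega> (tail \<Gamma> h) = \<omega> ip"
      "dm \<tau> (tail \<Gamma> k) = \<tau> ip" "dm \<omega> (tail \<Gamma> k) = \<omega> ip" "dm \<tau> (head \<Gamma> k) = \<tau> ip" "dm \<omega> (head \<Gamma> k) = \<omega> ip"
      using comp \<tau> \<omega> by (simp_all add: dm_ends dm_im DhD)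
    have xh': "x h \<in> carrier_mat (dm \<tau> (head \<Gamma> h) + dm \<omega> (head \<Gamma> h)) (\<tau> ip + \<omega> ip)" using xh by (simp add: t)
    have cr: "contr_rep (dplus \<tau> \<omega>) x (contr h) = x h * x k"
      "contr_rep \<tau> (iT \<tau> x) (contr h) = iT \<tau> x h * iT \<tau> x k"
      "contr_rep \<omega> (iW \<tau> \<omega> x) (contr h) = iW \<tau> \<omega> x h * iW \<tau> \<omega> x k"
      using c comp(1) by (simp_all add: contr_rep_simps)
    show ?thesis
      unfolding cr using blk_lower_mult_right_iff[OF xh' k] blk_mult(2,3)[OF xh' _ k(1,3)] h comp(2)
      by (simp add: t iT_eq iW_eq)
  next
    case (bar k)
    note k = bm[OF bar(2)] b[OF bar(2)]
    have t: "dm \<tau> (head \<Gamma> h) = \<tau> ip" "dm \<omega> (head \<Gamma> h) = \<omega> ip"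
      "dm \<tau> (tail \<Gamma> k) = \<tau> ip" "dm \<omega> (tail \<Gamma> k) = \<omega> ip" "dm \<tau> (head \<Gamma> k) = \<tau> ip" "dm \<omega> (head \<Gamma> k) = \<omega> ip"
      using bar \<tau> \<omega> by (simp_all add: dm_ends dm_im DhD)
    have xh': "x h \<in> carrier_mat (\<tau> ip + \<omega> ip) (dm \<tau> (tail \<Gamma> h) + dm \<omega> (tail \<Gamma> h))" using xh by (simp add: t)
    have cr: "contr_rep (dplus \<tau> \<omega>) x (contr h) = inv\<^bsub>mat_alg (\<tau> ip + \<omega> ip)\<^esub> (x k) * x h"
      "contr_rep \<tau> (iT \<tau> x) (contr h) = inv\<^bsub>mat_alg (\<tau> ip)\<^esub> (iT \<tau> x k) * iT \<tau> x h"
      "contr_rep \<omega> (iW \<tau> \<omega> x) (contr h) = inv\<^bsub>mat_alg (\<omega> ip)\<^esub> (iW \<tau> \<omega> x k) * iW \<tau> \<omega> x h"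
      using c bar(1) n by (simp_all add: contr_rep_simps)
    show ?thesis
      unfolding cr
      using blk_lower_mult_left_iff[OF xh' k] blk_mult(2,3)[OF inv_mat_alg(1)[OF k(1,2)] blk_inv(1)[OF k] xh']
        blk_inv(2,3)[OF k] h bar(2)
      by (simp add: t iT_eq iW_eq)
  qed
  then show "?l1 \<longleftrightarrow> ?l" "?l \<Longrightarrow> ?r" by blast+
qed

lemma ball_Ac: "(\<forall>c\<in>Ac. P c) \<longleftrightarrow> (\<forall>h\<in>A - Br. P (contr h))"
  unfolding bij_betw_imp_surj_on[OF contr_bij, symmetric] by simp

lemma contr_S_iff:
  assumes x: "x \<in> Yh (dplus \<tau> \<omega>)" and \<tau>: "\<tau> \<in> Dh" and \<omega>: "\<omega> \<in> Dh"
  shows "x \<in> S \<tau> \<omega> \<longleftrightarrow> (\<forall>k\<in>Br. blk_lower (\<tau> ip) (\<tau> ip) (x k)) \<and>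
    contr_rep (dplus \<tau> \<omega>) x \<in> C.S (red \<tau>) (red \<omega>)"
proof -
  have E: "contr_rep (dplus \<tau> \<omega>) x \<in> C.E (dplus (red \<tau>) (red \<omega>))"
    using contr_rep_in[OF x Dh_dplus[OF \<tau> \<omega>]] by (simp add: red_dplus)
  have 1: "x \<in> S \<tau> \<omega> \<longleftrightarrow> (\<forall>k\<in>Br. blk_lower (\<tau> ip) (\<tau> ip) (x k)) \<and>
      (\<forall>h\<in>A - Br. blk_lower (dm \<tau> (head \<Gamma> h)) (dm \<tau> (tail \<Gamma> h)) (x h))"
  proof -
    have "blk_lower (dm \<tau> (head \<Gamma> k)) (dm \<tau> (tail \<Gamma> k)) (x k) \<longleftrightarrow> blk_lower (\<tau> ip) (\<tau> ip) (x k)" if "k \<in> Br" for k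
      using that \<tau> by (simp add: dm_ends DhD)
    then show ?thesis unfolding S_def using heart_E[OF x] BrD(1) by blast
  qed
  have 2: "contr_rep (dplus \<tau> \<omega>) x \<in> C.S (red \<tau>) (red \<omega>) \<longleftrightarrow>
      (\<forall>h\<in>A - Br. blk_lower (dm \<tau> (head \<Gamma> h)) (dm \<tau> (tail \<Gamma> h)) (contr_rep (dplus \<tau> \<omega>) x (contr h)))"
    unfolding C.S_def ball_Ac using E contr_dims[OF \<tau>] by simp
  show ?thesis unfolding 1 2 using contr_blocks_arrow(1)[OF x \<tau> \<omega>] by blast
qed

lemma contr_S_blocks:
  assumes x: "x \<in> Yh (dplus \<tau> \<omega>)" and \<tau>: "\<tau> \<in> Dh" and \<omega>: "\<omega> \<in> Dh" and S: "x \<in> S \<tau> \<omega>"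
  shows "contr_rep \<tau> (iT \<tau> x) = C.iT (red \<tau>) (contr_rep (dplus \<tau> \<omega>) x)"
    "contr_rep \<omega> (iW \<tau> \<omega> x) = C.iW (red \<tau>) (red \<omega>) (contr_rep (dplus \<tau> \<omega>) x)"
proof -
  have b: "blk_lower (\<tau> ip) (\<tau> ip) (x k)" if "k \<in> Br" for k using S contr_S_iff[OF x \<tau> \<omega>] that by blast
  have l: "blk_lower (dm \<tau> (head \<Gamma> h)) (dm \<tau> (tail \<Gamma> h)) (x h)" if "h \<in> A" for h using SD(2)[OF S that] .
  have "contr_rep \<tau> (iT \<tau> x) (contr h) = C.iT (red \<tau>) (contr_rep (dplus \<tau> \<omega>) x) (contr h) \<and>
      contr_rep \<omega> (iW \<tau> \<omega> x) (contr h) = C.iW (red \<tau>) (red \<omega>) (contr_rep (dplus \<tau> \<omega>) x) (contr h)"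
    if h: "h \<in> A" "h \<notin> Br" for h
    using contr_blocks_arrow(2)[OF x \<tau> \<omega> b h l[OF h(1)]] contr_in[OF h] contr_dims[OF \<tau> h] contr_dims[OF \<omega> h]
    by (simp add: C.iT_eq C.iW_eq)
  then have "\<forall>c\<in>Ac. contr_rep \<tau> (iT \<tau> x) c = C.iT (red \<tau>) (contr_rep (dplus \<tau> \<omega>) x) c \<and>
      contr_rep \<omega> (iW \<tau> \<omega> x) c = C.iW (red \<tau>) (red \<omega>) (contr_rep (dplus \<tau> \<omega>) x) c"
    unfolding ball_Ac by blast
  note eq = this
  have ext: "contr_rep \<nu> z \<in> extensional Ac" for \<nu> z by (simp add: contr_rep_def)
  show "contr_rep \<tau> (iT \<tau> x) = C.iT (red \<tau>) (contr_rep (dplus \<tau> \<omega>) x)"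
    by (rule extensionalityI[OF ext C.repD(2)[OF C.iT_in]]) (use eq in blast)
  show "contr_rep \<omega> (iW \<tau> \<omega> x) = C.iW (red \<tau>) (red \<omega>) (contr_rep (dplus \<tau> \<omega>) x)"
    by (rule extensionalityI[OF ext C.repD(2)[OF C.iW_in]]) (use eq in blast)
qed

subsection \<open>Induction commutes with contraction\<close>

definition lower_im :: "nat \<Rightarrow> ('v \<Rightarrow> 'k mat) \<Rightarrow> bool" where
  "lower_im n M \<longleftrightarrow> (\<forall>w\<in>im. blk_lower n n (M w))"

text \<open>
  The summand of \<open>ind\<close> depends on the contraction, apart from the condition that the bridges are block
  triangular.
\<close>

lemma conv_contr:
  assumes x: "x \<in> Yh (dplus \<tau> \<omega>)" and \<tau>: "\<tau> \<in> Dh" and \<omega>: "\<omega> \<in> Dh"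
  shows "conv \<tau> \<omega> (\<lambda>z. f (contr_rep \<tau> z)) (\<lambda>z. f' (contr_rep \<omega> z)) x =
    (if lower_im (\<tau> ip) (bridge_fam x) then C.conv (red \<tau>) (red \<omega>) f f' (contr_rep (dplus \<tau> \<omega>) x) else 0)"
proof -
  have "lower_im (\<tau> ip) (bridge_fam x) \<longleftrightarrow> (\<forall>k\<in>Br. blk_lower (\<tau> ip) (\<tau> ip) (x k))"
  proof -
    have "(\<forall>w\<in>head \<Gamma> ` Br. blk_lower (\<tau> ip) (\<tau> ip) (x (bridge_to w))) \<longleftrightarrow>
        (\<forall>k\<in>Br. blk_lower (\<tau> ip) (\<tau> ip) (x (bridge_to (head \<Gamma> k))))" by simp
    then have "(\<forall>w\<in>im. blk_lower (\<tau> ip) (\<tau> ip) (x (bridge_to w))) \<longleftrightarrow>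
        (\<forall>k\<in>Br. blk_lower (\<tau> ip) (\<tau> ip) (x (bridge_to (head \<Gamma> k))))"
      by (simp only: bij_betw_imp_surj_on[OF head_bij])
    then show ?thesis by (simp add: lower_im_def bridge_fam_def bridge_to_head)
  qed
  then show ?thesis using contr_S_iff[OF x \<tau> \<omega>] contr_S_blocks[OF x \<tau> \<omega>] by (simp add: conv_def C.conv_def)
qed

text \<open>
  The fixed points of a parabolic subgroup of the general linear groups at \<open>im\<close>.
\<close>

definition Pim :: "nat \<Rightarrow> nat \<Rightarrow> ('v \<Rightarrow> 'k mat) set" where
  "Pim n m = {M \<in> GLim (n + m). lower_im n M}"

lemma Pim_pos: "card (Pim n m) > 0"
proof -
  have "(\<lambda>w\<in>im. 1\<^sub>m (n + m)) \<in> GLim (n + m)"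
    unfolding GLim_iff using q_gt_1 by (auto simp: vaut_im intro!: eq_matI)
  then have "(\<lambda>w\<in>im. 1\<^sub>m (n + m)) \<in> Pim n m" by (simp add: Pim_def lower_im_def)
  then show ?thesis using finite_GLim[of "n + m"] by (auto simp: card_gt_0_iff Pim_def)
qed

text \<open>
  Write an element of the gauge group as a pair \<open>(g, M)\<close>. By \<open>bridge_fam_act\<close> the bridges of the transformed
  representation run over \<open>GLim\<close> with \<open>M\<close>, while its contraction depends on \<open>g\<close> only; so for each \<open>g\<close> the
  summand is repeated once for each element of \<open>Pim\<close>.
\<close>

lemma orb_sum_contr:
  assumes y: "y \<in> hF (dplus \<tau> \<omega>)" and \<tau>: "\<tau> \<in> Dh" and \<omega>: "\<omega> \<in> Dh"
  shows "orb_sum (dplus \<tau> \<omega>) (conv \<tau> \<omega> (\<lambda>z. f (contr_rep \<tau> z)) (\<lambda>z. f' (contr_rep \<omega> z))) y =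
    of_nat (card (Pim (\<tau> ip) (\<omega> ip))) *
      C.orb_sum (dplus (red \<tau>) (red \<omega>)) (C.conv (red \<tau>) (red \<omega>) f f') (contr_rep (dplus \<tau> \<omega>) y)"
proof -
  let ?N = "dplus \<tau> \<omega>"
  let ?C = "C.conv (red \<tau>) (red \<omega>) f f'"
  let ?F = "conv \<tau> \<omega> (\<lambda>z. f (contr_rep \<tau> z)) (\<lambda>z. f' (contr_rep \<omega> z))"
  note N = Dh_dplus[OF \<tau> \<omega>]
  have n: "?N ip = \<tau> ip + \<omega> ip" by (simp add: dplus_def)
  have inner: "(\<Sum>M\<in>GLim (?N ip). ?F (act ?N (glue g M) y)) =
      of_nat (card (Pim (\<tau> ip) (\<omega> ip))) * ?C (C.act (red ?N) g (contr_rep ?N y))" if g: "g \<in> C.GF (red ?N)" for g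
  proof -
    let ?K = "?C (C.act (red ?N) g (contr_rep ?N y))"
    obtain c where c: "c \<in> GLim (?N ip)"
      "\<forall>M\<in>GLim (?N ip). bridge_fam (act ?N (glue g M) y) = (\<lambda>w\<in>im. M w * c w)"
      using bridge_fam_act[OF N g y] by blast
    have "?F (act ?N (glue g M) y) = (if lower_im (\<tau> ip) (\<lambda>w\<in>im. M w * c w) then ?K else 0)" if M: "M \<in> GLim (?N ip)" for M
    proof -
      note k = glue_GF[OF N g M]
      have "act ?N (glue g M) y \<in> Yh ?N" using heart.YF_act[OF k y] hF_heart by blast
      moreover have "contr_rep ?N (act ?N (glue g M) y) = C.act (red ?N) g (contr_rep ?N y)"
        using contr_rep_act[OF GF_G[OF k] hF_heart[OF y] N] contr_gauge_glue[OF g] by simp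
      ultimately show ?thesis using conv_contr[of "act ?N (glue g M) y" \<tau> \<omega> f f'] \<tau> \<omega> c(2) M by simp
    qed
    then have "(\<Sum>M\<in>GLim (?N ip). ?F (act ?N (glue g M) y)) =
        (\<Sum>M\<in>GLim (?N ip). if lower_im (\<tau> ip) (\<lambda>w\<in>im. M w * c w) then ?K else 0)" by simp
    also have "\<dots> = (\<Sum>M\<in>GLim (?N ip). if lower_im (\<tau> ip) M then ?K else 0)"
      by (rule sum.reindex_bij_betw[OF GLim_translate[OF c(1)]])
    also have "\<dots> = of_nat (card (Pim (\<tau> ip) (\<omega> ip))) * ?K"
      by (subst sum.inter_filter[OF finite_GLim, symmetric]) (simp add: Pim_def n)
    finally show ?thesis .
  qed
  have "orb_sum ?N ?F y = (\<Sum>t\<in>C.GF (red ?N) \<times> GLim (?N ip). ?F (act ?N (case t of (g, M) \<Rightarrow> glue g M) y))"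
    unfolding orb_sum_def by (rule sum.reindex_bij_betw[OF glue_bij[OF N], symmetric])
  also have "\<dots> = (\<Sum>g\<in>C.GF (red ?N). \<Sum>M\<in>GLim (?N ip). ?F (act ?N (glue g M) y))"
    by (subst sum.cartesian_product) (simp add: case_prod_unfold)
  also have "\<dots> = (\<Sum>g\<in>C.GF (red ?N). of_nat (card (Pim (\<tau> ip) (\<omega> ip))) * ?C (C.act (red ?N) g (contr_rep ?N y)))"
    by (rule sum.cong[OF refl]) (rule inner)
  finally show ?thesis by (simp add: C.orb_sum_def sum_distrib_left red_dplus)
qed

lemma card_Q_contr:
  assumes \<tau>: "\<tau> \<in> Dh" and \<omega>: "\<omega> \<in> Dh"
  shows "card {g \<in> GF (dplus \<tau> \<omega>). g \<in> Q \<tau> \<omega>} =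
    card {g \<in> C.GF (dplus (red \<tau>) (red \<omega>)). g \<in> C.Q (red \<tau>) (red \<omega>)} * card (Pim (\<tau> ip) (\<omega> ip))"
proof -
  let ?N = "dplus \<tau> \<omega>"
  let ?P = "{g \<in> C.GF (red ?N). g \<in> C.Q (red \<tau>) (red \<omega>)}"
  note N = Dh_dplus[OF \<tau> \<omega>]
  have n: "?N ip = \<tau> ip + \<omega> ip" by (simp add: dplus_def)
  have iff: "glue g M \<in> Q \<tau> \<omega> \<longleftrightarrow> g \<in> C.Q (red \<tau>) (red \<omega>) \<and> lower_im (\<tau> ip) M"
    if g: "g \<in> C.GF (red ?N)" and M: "M \<in> GLim (?N ip)" for g M
  proof -
    have "glue g M \<in> G ?N" "g \<in> C.G (dplus (red \<tau>) (red \<omega>))"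
      using GF_G[OF glue_GF[OF N g M]] C.GF_G[OF g] by (simp_all add: red_dplus)
    then have "glue g M \<in> Q \<tau> \<omega> \<longleftrightarrow> (\<forall>v\<in>V. blk_lower (dm \<tau> v) (dm \<tau> v) (glue g M v))"
      "g \<in> C.Q (red \<tau>) (red \<omega>) \<longleftrightarrow> (\<forall>v\<in>V - im. blk_lower (dm \<tau> v) (dm \<tau> v) (g v))"
      unfolding parab_iff C.parab_iff by simp_all
    moreover have "(\<forall>v\<in>V. blk_lower (dm \<tau> v) (dm \<tau> v) (glue g M v)) \<longleftrightarrow>
        (\<forall>v\<in>V - im. blk_lower (dm \<tau> v) (dm \<tau> v) (glue g M v)) \<and> (\<forall>v\<in>im. blk_lower (dm \<tau> v) (dm \<tau> v) (glue g M v))"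
      using im_V by blast
    ultimately show ?thesis using \<tau> by (simp add: lower_im_def dm_im DhD)
  qed
  have "bij_betw (\<lambda>(g, M). glue g M) (?P \<times> Pim (\<tau> ip) (\<omega> ip)) {g \<in> GF ?N. g \<in> Q \<tau> \<omega>}"
  proof (rule bij_betw_subset[OF glue_bij[OF N]])
    show "?P \<times> Pim (\<tau> ip) (\<omega> ip) \<subseteq> C.GF (red ?N) \<times> GLim (?N ip)" by (auto simp: Pim_def n)
    show "(\<lambda>(g, M). glue g M) ` (?P \<times> Pim (\<tau> ip) (\<omega> ip)) = {g \<in> GF ?N. g \<in> Q \<tau> \<omega>}"
    proof (intro equalityI subsetI)
      fix k assume "k \<in> {g \<in> GF ?N. g \<in> Q \<tau> \<omega>}"
      then have k: "k \<in> (\<lambda>(g, M). glue g M) ` (C.GF (red ?N) \<times> GLim (?N ip))" "k \<in> Q \<tau> \<omega>"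
        using bij_betw_imp_surj_on[OF glue_bij[OF N]] by auto
      then obtain g M where gM: "g \<in> C.GF (red ?N)" "M \<in> GLim (?N ip)" "k = glue g M" by auto
      then have "(g, M) \<in> ?P \<times> Pim (\<tau> ip) (\<omega> ip)" using iff[OF gM(1,2)] k(2) by (simp add: Pim_def n)
      then show "k \<in> (\<lambda>(g, M). glue g M) ` (?P \<times> Pim (\<tau> ip) (\<omega> ip))"
        by (rule rev_image_eqI) (simp add: gM(3))
    next
      fix k assume "k \<in> (\<lambda>(g, M). glue g M) ` (?P \<times> Pim (\<tau> ip) (\<omega> ip))"
      then obtain g M where gM: "g \<in> C.GF (red ?N)" "g \<in> C.Q (red \<tau>) (red \<omega>)" "M \<in> GLim (?N ip)"
        "lower_im (\<tau> ip) M" "k = glue g M" by (auto simp: Pim_def n)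
      then show "k \<in> {g \<in> GF ?N. g \<in> Q \<tau> \<omega>}" using iff[OF gM(1,3)] glue_GF[OF N gM(1,3)] by simp
    qed
  qed
  from bij_betw_same_card[OF this] show ?thesis by (simp add: card_cartesian_product red_dplus)
qed

text \<open>
  The exponent is the quadratic form whose polarisation is the difference of the two forms \<open>m_form\<close> in
  \<open>m_form_contraction\<close>.
\<close>

definition twist :: "complex \<Rightarrow> ('v set \<Rightarrow> nat) \<Rightarrow> complex" where
  "twist s \<nu> = inverse s ^ (card ip * (\<nu> ip)\<^sup>2)"

text \<open>
  The number of elements of \<open>Pim\<close> cancels between the sum and its constant, and \<open>twist\<close> accounts for the powers of \<open>s\<close>.
\<close>

lemma ind_contr:
  assumes y: "y \<in> hF (dplus \<tau> \<omega>)" and \<tau>: "\<tau> \<in> Dh" and \<omega>: "\<omega> \<in> Dh"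
  shows "ind s \<tau> \<omega> (\<lambda>z. twist s \<tau> * f (contr_rep \<tau> z)) (\<lambda>z. twist s \<omega> * f' (contr_rep \<omega> z)) y =
    twist s (dplus \<tau> \<omega>) * C.ind s (red \<tau>) (red \<omega>) f f' (contr_rep (dplus \<tau> \<omega>) y)"
proof -
  let ?N = "dplus \<tau> \<omega>"
  let ?f = "\<lambda>z. f (contr_rep \<tau> z)" and ?f' = "\<lambda>z. f' (contr_rep \<omega> z)"
  let ?Q = "of_nat (card {g \<in> C.GF (dplus (red \<tau>) (red \<omega>)). g \<in> C.Q (red \<tau>) (red \<omega>)}) :: complex"
  let ?B = "of_nat (card (Pim (\<tau> ip) (\<omega> ip))) :: complex"
  let ?o = "C.orb_sum (dplus (red \<tau>) (red \<omega>)) (C.conv (red \<tau>) (red \<omega>) f f') (contr_rep ?N y)"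
  have yE: "y \<in> EF ?N" using y heart.YF_EF by blast
  have yC: "contr_rep ?N y \<in> C.EF (dplus (red \<tau>) (red \<omega>))"
    using contr_rep_EF[OF y Dh_dplus[OF \<tau> \<omega>]] by (simp add: red_dplus)
  have B: "?B \<noteq> 0" using Pim_pos[of "\<tau> ip" "\<omega> ip"] by simp
  \<comment> \<open>The binomial formula: the mixed term is the difference of the two forms \<open>m_form\<close>.\<close>
  have e: "card ip * (?N ip)\<^sup>2 = card ip * (\<tau> ip)\<^sup>2 + card ip * (\<omega> ip)\<^sup>2 + 2 * (card ip * (\<tau> ip * \<omega> ip))"
    by (simp add: dplus_def power2_eq_square algebra_simps)
  have "ind s \<tau> \<omega> (\<lambda>z. twist s \<tau> * ?f z) (\<lambda>z. twist s \<omega> * ?f' z) y = twist s \<tau> * (twist s \<omega> * ind s \<tau> \<omega> ?f ?f' y)"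
    by (simp add: ind_smult[OF yE])
  also have "ind s \<tau> \<omega> ?f ?f' y = inverse s ^ m_form \<Gamma> \<tau> \<omega> * (1 / (?Q * ?B)) * (?B * ?o)"
    unfolding ind_eq[OF yE] ind_const_eq orb_sum_contr[OF y \<tau> \<omega>] card_Q_contr[OF \<tau> \<omega>] by simp
  also have "\<dots> = inverse s ^ m_form \<Gamma> \<tau> \<omega> * (1 / ?Q) * ?o" using B by simp
  also have "twist s \<tau> * (twist s \<omega> * \<dots>) = twist s ?N * (inverse s ^ m_form \<Gamma>c (red \<tau>) (red \<omega>) * (1 / ?Q) * ?o)"
    unfolding twist_def e m_form_contraction[OF \<tau> \<omega>] power_add by (simp only: ac_simps)
  also have "inverse s ^ m_form \<Gamma>c (red \<tau>) (red \<omega>) * (1 / ?Q) * ?o = C.ind s (red \<tau>) (red \<omega>) f f' (contr_rep ?N y)"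
    unfolding C.ind_eq[OF yC] C.ind_const_eq by simp
  finally show ?thesis .
qed

subsection \<open>The isomorphism with the Hall algebra of the contraction\<close>

text \<open>Pull-back of functions along the contraction, normalised so as to be multiplicative.\<close>

definition pull :: "complex \<Rightarrow> ('v, 'h contr_arc, 'k) hall_elt \<Rightarrow> ('v, 'h, 'k) hall_elt" where
  "pull s f = hall_tab \<Gamma> q Dh Yh (\<lambda>\<nu> x. twist s \<nu> * f (red \<nu>) (contr_rep \<nu> x))"

lemma pull_apply: "\<nu> \<in> Dh \<Longrightarrow> x \<in> hF \<nu> \<Longrightarrow> pull s f \<nu> x = twist s \<nu> * f (red \<nu>) (contr_rep \<nu> x)"
  by (simp add: pull_def)

lemma red_Dh: "\<nu> \<in> Dh \<Longrightarrow> red \<nu> \<in> C.D" using red_in Dh_D by blast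

lemma pull_in:
  assumes f: "f \<in> C.HS s"
  shows "pull s f \<in> carrier (Hh s)"
  unfolding pull_def Hh_simps
proof (rule heart.hall_tab_in[where C = "ext ` {\<nu> \<in> C.D. \<exists>x\<in>C.EF \<nu>. f \<nu> x \<noteq> 0}"])
  fix \<nu> x assume \<nu>: "\<nu> \<in> Dh" and x: "x \<in> hF \<nu>"
  note xc = contr_rep_EF[OF x \<nu>]
  show "twist s \<nu> * f (red \<nu>) (contr_rep \<nu> x) \<in> Kc s" using C.HS_D(1)[OF f red_Dh[OF \<nu>] xc] by (simp add: twist_def)
  show "\<nu> \<in> ext ` {\<nu> \<in> C.D. \<exists>x\<in>C.EF \<nu>. f \<nu> x \<noteq> 0}" if "twist s \<nu> * f (red \<nu>) (contr_rep \<nu> x) \<noteq> 0"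
    by (rule image_eqI[where x = "red \<nu>"]) (use that xc red_Dh[OF \<nu>] ext_red[OF \<nu>] in auto)
  fix g assume g: "g \<in> GF \<nu>"
  show "twist s \<nu> * f (red \<nu>) (contr_rep \<nu> (act \<nu> g x)) = twist s \<nu> * f (red \<nu>) (contr_rep \<nu> x)"
    unfolding contr_rep_act[OF GF_G[OF g] hF_heart[OF x] \<nu>] C.HS_D(2)[OF f red_Dh[OF \<nu>] contr_gauge_GF[OF g] xc] ..
qed (use C.HS_D(3)[OF f] in simp)

lemma pull_mult:
  assumes f: "f \<in> C.HS s" "f' \<in> C.HS s"
  shows "pull s (f \<otimes>\<^bsub>C.HA s\<^esub> f') = pull s f \<otimes>\<^bsub>Hh s\<^esub> pull s f'"
  unfolding Hh_mult unfolding pull_def[of s "f \<otimes>\<^bsub>C.HA s\<^esub> f'"]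
proof (rule tab_cong)
  fix \<nu> x assume \<nu>: "\<nu> \<in> Dh" and x: "x \<in> hF \<nu>"
  let ?I = "{d \<in> dec \<nu>. fst d \<in> Dh \<and> snd d \<in> Dh}"
  have "(\<Sum>d\<in>?I. ind s (fst d) (snd d) (pull s f (fst d)) (pull s f' (snd d)) x) =
      (\<Sum>d\<in>C.dec (red \<nu>). twist s \<nu> * C.ind s (fst d) (snd d) (f (fst d)) (f' (snd d)) (contr_rep \<nu> x))"
  proof (rule sum.reindex_bij_witness[of _ "map_prod ext ext" "map_prod red red"])
    fix d assume d: "d \<in> ?I"
    then have d': "fst d \<in> Dh" "snd d \<in> Dh" "dplus (fst d) (snd d) = \<nu>" using decD(3)[of d \<nu>] by auto
    show "map_prod ext ext (map_prod red red d) = d" using d' by (cases d) (simp add: ext_red)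
    show "map_prod red red d \<in> C.dec (red \<nu>)"
      using red_Dh[OF d'(1)] red_Dh[OF d'(2)] red_dplus[of "fst d" "snd d"] d'(3) by (cases d) (simp add: C.dec_def)
    have xd: "x \<in> hF (dplus (fst d) (snd d))" using x d'(3) by simp
    have "ind s (fst d) (snd d) (pull s f (fst d)) (pull s f' (snd d)) x =
        ind s (fst d) (snd d) (\<lambda>z. twist s (fst d) * f (red (fst d)) (contr_rep (fst d) z))
          (\<lambda>z. twist s (snd d) * f' (red (snd d)) (contr_rep (snd d) z)) x"
      by (rule ind_heart_cong[OF xd d'(1,2)]) (simp_all add: pull_apply d')
    also have "\<dots> = twist s \<nu> * C.ind s (red (fst d)) (red (snd d)) (f (red (fst d))) (f' (red (snd d))) (contr_rep \<nu> x)"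
      using ind_contr[OF xd d'(1,2)] d'(3) by simp
    finally show "twist s \<nu> * C.ind s (fst (map_prod red red d)) (snd (map_prod red red d))
        (f (fst (map_prod red red d))) (f' (snd (map_prod red red d))) (contr_rep \<nu> x) =
        ind s (fst d) (snd d) (pull s f (fst d)) (pull s f' (snd d)) x" by simp
  next
    fix d assume "d \<in> C.dec (red \<nu>)"
    note d = C.decD[OF this]
    show "map_prod red red (map_prod ext ext d) = d" using d by (cases d) (simp add: red_ext)
    have e: "ext (fst d) \<in> Dh" "ext (snd d) \<in> Dh" using d ext_in by auto
    have "dplus (ext (fst d)) (ext (snd d)) = \<nu>" using ext_dplus[of "fst d" "snd d"] d(3) ext_red[OF \<nu>] by simp
    then show "map_prod ext ext d \<in> ?I" using e Dh_D by (cases d) (auto simp: dec_def)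
  qed
  then show "twist s \<nu> * (f \<otimes>\<^bsub>C.HA s\<^esub> f') (red \<nu>) (contr_rep \<nu> x) =
      (\<Sum>d\<in>?I. ind s (fst d) (snd d) (pull s f (fst d)) (pull s f' (snd d)) x)"
    unfolding C.HA_mult_apply[OF red_Dh[OF \<nu>] contr_rep_EF[OF x \<nu>]] by (simp add: sum_distrib_left)
qed

lemma red_zero_iff: "\<nu> \<in> Dh \<Longrightarrow> red \<nu> = (\<lambda>i. 0) \<longleftrightarrow> \<nu> = (\<lambda>i. 0)"
  using DhD[of \<nu>] red_ip[of \<nu>] by (auto simp: red_def fun_eq_iff) (metis ip_neq_im)

lemma pull_linear:
  "pull s (f \<oplus>\<^bsub>C.HA s\<^esub> f') = pull s f \<oplus>\<^bsub>Hh s\<^esub> pull s f'"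
  "pull s (c \<odot>\<^bsub>C.HA s\<^esub> f) = c \<odot>\<^bsub>Hh s\<^esub> pull s f"
  "pull s \<one>\<^bsub>C.HA s\<^esub> = \<one>\<^bsub>Hh s\<^esub>"
proof -
  have c: "red \<nu> \<in> C.D \<and> contr_rep \<nu> x \<in> C.EF (red \<nu>)" if "\<nu> \<in> Dh" "x \<in> hF \<nu>" for \<nu> x
    using red_Dh contr_rep_EF that by blast
  show "pull s (f \<oplus>\<^bsub>C.HA s\<^esub> f') = pull s f \<oplus>\<^bsub>Hh s\<^esub> pull s f'"
    unfolding Hh_simps unfolding pull_def[of s "f \<oplus>\<^bsub>C.HA s\<^esub> f'"]
    by (rule tab_cong) (use c in \<open>simp add: C.HA_simps pull_apply algebra_simps\<close>)
  show "pull s (c \<odot>\<^bsub>C.HA s\<^esub> f) = c \<odot>\<^bsub>Hh s\<^esub> pull s f"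
    unfolding Hh_simps unfolding pull_def[of s "c \<odot>\<^bsub>C.HA s\<^esub> f"]
    by (rule tab_cong) (use c in \<open>simp add: C.HA_simps pull_apply algebra_simps\<close>)
  show "pull s \<one>\<^bsub>C.HA s\<^esub> = \<one>\<^bsub>Hh s\<^esub>"
    unfolding Hh_simps unfolding pull_def
    by (rule tab_cong) (use c in \<open>simp add: C.HA_one_apply red_zero_iff twist_def\<close>)
qed

lemma pull_hom: "pull s \<in> algebra_hom (coeff_field s) (C.HA s) (Hh s)"
  unfolding algebra_hom_def Ring.ring_hom_def using pull_in pull_mult pull_linear by (auto simp: C.HA_simps(1))

text \<open>
  By \<open>contr_rep_sect\<close> the contraction is onto, and by \<open>conj_lift\<close> an invariant function is constant on its fibres
  and determines an invariant function on the contraction.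
\<close>

lemma pull_bij:
  assumes s: "s \<noteq> 0"
  shows "bij_betw (pull s) (carrier (C.HA s)) (carrier (Hh s))"
proof -
  have nz: "twist s \<nu> \<noteq> 0" for \<nu> using s by (simp add: twist_def)
  have sx: "ext \<nu> \<in> Dh \<and> red (ext \<nu>) = \<nu> \<and> sect (ext \<nu>) x \<in> hF (ext \<nu>) \<and> contr_rep (ext \<nu>) (sect (ext \<nu>) x) = x"
    if "\<nu> \<in> C.D" "x \<in> C.EF \<nu>" for \<nu> x
    using ext_in[OF that(1)] red_ext[OF that(1)] sect_hF[of "ext \<nu>" x] contr_rep_sect[of "ext \<nu>" x] that(2) by simp
  have "inj_on (pull s) (C.HS s)"
  proof (rule inj_onI)
    fix f f' assume f: "f \<in> C.HS s" "f' \<in> C.HS s" and eq: "pull s f = pull s f'"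
    show "f = f'"
    proof (rule C.HS_eqI[OF f])
      fix \<nu> x assume x: "\<nu> \<in> C.D" "x \<in> C.EF \<nu>"
      note e = sx[OF x]
      have "pull s f (ext \<nu>) (sect (ext \<nu>) x) = pull s f' (ext \<nu>) (sect (ext \<nu>) x)" using eq by simp
      then show "f \<nu> x = f' \<nu> x" using e nz[of "ext \<nu>"] by (simp add: pull_apply)
    qed
  qed
  moreover have "pull s ` C.HS s = carrier (Hh s)"
  proof (intro equalityI subsetI)
    fix F assume "F \<in> carrier (Hh s)"
    then have F: "F \<in> hall_space \<Gamma> q s Dh Yh" by (simp add: Hh_simps)
    let ?f = "C.tab (\<lambda>\<nu> x. inverse (twist s (ext \<nu>)) * F (ext \<nu>) (sect (ext \<nu>) x))"
    have f: "?f \<in> C.HS s"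
    proof (rule C.tab_in[where C = "red ` {\<nu> \<in> Dh. \<exists>x\<in>hF \<nu>. F \<nu> x \<noteq> 0}"])
      fix \<nu> x assume x: "\<nu> \<in> C.D" "x \<in> C.EF \<nu>"
      note e = sx[OF x]
      have "F (ext \<nu>) (sect (ext \<nu>) x) \<in> Kc s" using heart.hall_spaceD(1)[OF F] e by blast
      then show "inverse (twist s (ext \<nu>)) * F (ext \<nu>) (sect (ext \<nu>) x) \<in> Kc s" by (simp add: twist_def)
      show "\<nu> \<in> red ` {\<nu> \<in> Dh. \<exists>x\<in>hF \<nu>. F \<nu> x \<noteq> 0}"
        if "inverse (twist s (ext \<nu>)) * F (ext \<nu>) (sect (ext \<nu>) x) \<noteq> 0"
        by (rule image_eqI[of _ _ "ext \<nu>"]) (use e that in auto)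
      fix g assume g: "g \<in> C.GF \<nu>"
      note e' = sx[OF x(1) C.act_EF[OF g x(2)]]
      have "\<exists>k\<in>GF (ext \<nu>). sect (ext \<nu>) (C.act \<nu> g x) = act (ext \<nu>) k (sect (ext \<nu>) x)"
        by (rule conj_lift[where g = g]) (use e e' g in auto)
      then obtain k where "k \<in> GF (ext \<nu>)" "sect (ext \<nu>) (C.act \<nu> g x) = act (ext \<nu>) k (sect (ext \<nu>) x)" by blast
      then show "inverse (twist s (ext \<nu>)) * F (ext \<nu>) (sect (ext \<nu>) (C.act \<nu> g x)) =
          inverse (twist s (ext \<nu>)) * F (ext \<nu>) (sect (ext \<nu>) x)"
        using heart.hall_spaceD(2)[OF F] e by simp
    qed (use heart.hall_spaceD(3)[OF F] in simp)
    have "pull s ?f = F"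
    proof (rule heart.hall_space_eqI[OF pull_in[OF f, unfolded Hh_simps(1)] F])
      fix \<nu> x assume \<nu>: "\<nu> \<in> Dh" and x: "x \<in> hF \<nu>"
      note xc = contr_rep_EF[OF x \<nu>]
      note e = sx[OF red_Dh[OF \<nu>] xc, unfolded ext_red[OF \<nu>]]
      have "\<exists>k\<in>GF \<nu>. sect \<nu> (contr_rep \<nu> x) = act \<nu> k x"
        by (rule conj_lift[where g = "C.gunit (red \<nu>)"]) (use e \<nu> x xc C.EF_E[OF xc] in auto)
      then obtain k where "k \<in> GF \<nu>" "sect \<nu> (contr_rep \<nu> x) = act \<nu> k x" by blast
      then have "F \<nu> (sect \<nu> (contr_rep \<nu> x)) = F \<nu> x" using heart.hall_spaceD(2)[OF F \<nu> _ x] by simp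
      then show "pull s ?f \<nu> x = F \<nu> x"
        using nz[of \<nu>] xc red_Dh[OF \<nu>] by (simp add: pull_apply[OF \<nu> x] ext_red[OF \<nu>])
    qed
    then show "F \<in> pull s ` C.HS s" using f by (intro image_eqI[of _ _ ?f]) auto
  qed (use pull_in in auto)
  ultimately show ?thesis by (simp add: bij_betw_def C.HA_simps(1))
qed

end

section \<open>The quotient by the functions supported off the open part\<close>

context contraction_data
begin

text \<open>
  Composing restriction to the open part with the isomorphism of the latter with the Hall algebra of
  the contraction gives the quotient map; extension by zero gives its section.
\<close>

lemma quotient_iso:
  assumes s: "s \<noteq> 0"
  shows "\<exists>\<phi>\<in>algebra_iso (coeff_field s) (quotient_algebra (HI s) (Hc s)) (C.HA s).
    \<exists>\<sigma>\<in>algebra_hom (coeff_field s) (C.HA s) (HI s). \<forall>f\<in>carrier (C.HA s). \<phi> (Hc s +>\<^bsub>HI s\<^esub> \<sigma> f) = f"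
proof -
  let ?K = "coeff_field s"
  let ?i = "inv_into (carrier (C.HA s)) (pull s)"
  note A = C.hall_assoc_algebra[of s] and bij = pull_bij[OF s]
  interpret A: assoc_algebra ?K "C.HA s" by (rule A)
  interpret B: assoc_algebra ?K "Hh s" by (rule Hh_algebra)
  note ih = algebra_hom_inverse[OF A pull_hom bij]
  have Lc: "pull s f \<in> carrier (Hh s)" if "f \<in> carrier (C.HA s)" for f
    using bij_betw_apply[OF bij that] .
  have il: "?i (pull s f) = f" if "f \<in> carrier (C.HA s)" for f
    by (rule bij_betw_inv_into_left[OF bij that])
  have ib: "bij_betw ?i (carrier (Hh s)) (carrier (C.HA s))" by (rule bij_betw_inv_into[OF bij])
  have z: "pull s \<zero>\<^bsub>C.HA s\<^esub> = \<zero>\<^bsub>Hh s\<^esub>"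
  proof -
    have "pull s \<in> Ring.ring_hom (C.HA s) (Hh s)" using pull_hom[of s] by (simp add: algebra_hom_def)
    then interpret r: ring_hom_ring "C.HA s" "Hh s" "pull s"
      by (rule ring_hom_ringI2[OF A.ring_axioms B.ring_axioms])
    show ?thesis by (rule r.hom_zero)
  qed
  have i0: "?i y = \<zero>\<^bsub>C.HA s\<^esub> \<longleftrightarrow> y = \<zero>\<^bsub>Hh s\<^esub>" if y: "y \<in> carrier (Hh s)" for y
  proof
    assume "?i y = \<zero>\<^bsub>C.HA s\<^esub>"
    then show "y = \<zero>\<^bsub>Hh s\<^esub>" using bij_betw_inv_into_right[OF bij y] z by simp
  next
    assume "y = \<zero>\<^bsub>Hh s\<^esub>"
    then show "?i y = \<zero>\<^bsub>C.HA s\<^esub>" using il[OF A.M.zero_closed] z by simp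
  qed
  have jr: "jr f \<in> carrier (Hh s)" if "f \<in> carrier (HI s)" for f using jr_image that by blast
  have ker: "Hc s = a_kernel (HI s) (C.HA s) (\<lambda>f. ?i (jr f))"
    unfolding jr_kernel[symmetric] a_kernel_def' using i0[OF jr] by blast
  have onto: "(\<lambda>f. ?i (jr f)) ` carrier (HI s) = carrier (C.HA s)"
  proof -
    have "(\<lambda>f. ?i (jr f)) ` carrier (HI s) = ?i ` (jr ` carrier (HI s))" by (simp only: image_image)
    also have "\<dots> = carrier (C.HA s)" unfolding jr_image by (rule bij_betw_imp_surj_on[OF ib])
    finally show ?thesis .
  qed
  obtain \<phi> where \<phi>: "\<phi> \<in> algebra_iso ?K (quotient_algebra (HI s) (Hc s)) (C.HA s)"
    "\<forall>f\<in>carrier (HI s). \<phi> (Hc s +>\<^bsub>HI s\<^esub> f) = ?i (jr f)"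
    using quotient_algebra_iso[OF HI_algebra A algebra_hom_comp[OF jr_hom ih] onto ker] by (elim bexE) (rule that)
  have "\<phi> (Hc s +>\<^bsub>HI s\<^esub> je (pull s f)) = f" if f: "f \<in> carrier (C.HA s)" for f
    using \<phi>(2) je_in[OF Lc[OF f]] jr_je[OF Lc[OF f]] il[OF f] by simp
  then show ?thesis by (intro bexI[OF _ \<phi>(1)] bexI[OF _ algebra_hom_comp[OF pull_hom je_hom]] ballI)
qed

end

text \<open>Adding 1 to every element of the field does not change the sum of all elements.\<close>

lemma CHAR_prime_card:
  assumes "prime p" "CARD('f::field) = p"
  shows "CHAR('f) = p"
proof -
  have fin: "finite (UNIV :: 'f set)" using assms prime_gt_0_nat[of p] by (intro card_ge_0_finite) simp
  have "bij (\<lambda>x :: 'f. x + 1)" by (rule bij_betw_byWitness[where f' = "\<lambda>x. x - 1"]) auto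
  from sum.reindex_bij_betw[OF this, of "\<lambda>x. x"]
  have "(\<Sum>x\<in>UNIV. x + (1 :: 'f)) = (\<Sum>x\<in>UNIV. x)" .
  then have "of_nat CARD('f) = (0 :: 'f)" by (simp add: sum.distrib)
  then have "CHAR('f) dvd p" using assms(2) by (simp add: of_nat_eq_0_iff_char_dvd)
  then show ?thesis using assms(1) CHAR_not_1'[where 'a = 'f] by (auto simp: prime_nat_iff)
qed

theorem proposition2p4p1:
  fixes \<Gamma> :: "('v, 'h) aut_digraph" and ip im :: "'v set"
    and p e q :: nat and s :: complex
    and K :: "complex ring"
    and H HI Hheart :: "(complex, ('v, 'h, 'f::field alg_closure) hall_elt) module"
    and Hc :: "('v, 'h, 'f alg_closure) hall_elt set"
    and Hhat :: "(complex, ('v, 'h contr_arc, 'f alg_closure) hall_elt) module"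
    and j_star j_shriek :: "('v, 'h, 'f alg_closure) hall_elt \<Rightarrow> ('v, 'h, 'f alg_closure) hall_elt"
  assumes "prime p" and "CARD('f) = p" and "e \<ge> 1" and "q = p ^ e" and "s ^ 2 = of_nat q"
    and "admissible \<Gamma>" and "contractible \<Gamma> ip im"
  defines "K \<equiv> coeff_field s"
    and "H \<equiv> hall \<Gamma> q s"
    and "HI \<equiv> hall_sub \<Gamma> ip im q s"
    and "Hc \<equiv> hall_compl \<Gamma> ip im q s"
    and "Hheart \<equiv> hall_heart \<Gamma> ip im q s"
    and "Hhat \<equiv> hall (contraction \<Gamma> ip im) q s"
    and "j_star \<equiv> j_restrict \<Gamma> ip im q"
    and "j_shriek \<equiv> j_extend \<Gamma> ip im q"
  shows
    "(algebra_ideal K Hc HI \<and>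
      assoc_algebra K Hheart \<and>
      j_star \<in> algebra_hom K HI Hheart \<and>
      a_kernel HI Hheart j_star = Hc \<and>
      j_star ` carrier HI = carrier Hheart \<and>
      j_shriek \<in> algebra_hom K Hheart HI \<and>
      (\<forall>f\<in>carrier Hheart. j_star (j_shriek f) = f) \<and>
      graded_map (dim_vectors_hat \<Gamma> ip im) (HI\<lparr>carrier := Hc\<rparr>) HI (\<lambda>f. f) \<and>
      graded_map (dim_vectors_hat \<Gamma> ip im) HI Hheart j_star \<and>
      graded_map (dim_vectors_hat \<Gamma> ip im) Hheart HI j_shriek) \<and>
     (subalgebra_of K (carrier HI) H \<and>
      algebra_ideal K Hc HI \<and>
      assoc_algebra K Hhat \<and>
      (\<exists>\<phi> \<in> algebra_iso K (quotient_algebra HI Hc) Hhat.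
       \<exists>\<sigma> \<in> algebra_hom K Hhat HI.
         \<forall>f\<in>carrier Hhat. \<phi> (Hc +>\<^bsub>HI\<^esub> \<sigma> f) = f))"
proof -
  have ch: "CHAR('f alg_closure) = p" using CHAR_prime_card[OF assms(1,2)] by simp
  interpret L: contraction_data p e q "TYPE('f alg_closure)" \<Gamma> ip im
    by unfold_locales (use assms(1,3-4,6-7) ch in auto)
  have s: "s \<noteq> 0" using assms(1,4,5) prime_gt_0_nat[of p] by auto
  show ?thesis
    unfolding K_def H_def HI_def Hc_def Hheart_def Hhat_def j_star_def j_shriek_def
    by (intro conjI L.Hc_ideal L.Hh_algebra L.jr_hom L.jr_kernel L.jr_image L.je_hom ballI L.jr_je L.graded
        L.HI_subalgebra L.C.hall_assoc_algebra L.quotient_iso[OF s])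
qed

end
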